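(* The character of $\mathcal{H}(3)^{S_3}$ has the following modular invariance property: there exist, for each $i\in\{1,2,3\}$, a family of $\mathcal{H}(3)^{S_3}$-modules $M_{\lambda_i}$ parametrized by $\lambda_i\in\mathbb{R}^i$ and complex coefficients $S_{\lambda_i}\in\mathbb{C}$, such that for all $\tau$ in the upper half-plane $$\mathrm{ch}[\mathcal{H}(3)^{S_3}]\left(-\frac1\tau\right)=\sum_{i=1}^{3}\int_{\mathbb{R}^i}S_{\lambda_i}\,\mathrm{ch}[M_{\lambda_i}](\tau)\,d\lambda_i .$$
   Context: $\mathcal{H}$ is the rank one Heisenberg vertex operator algebra over $\mathbb{C}$, generated by $\alpha(-1)\mathbf{1}$ with $[\alpha(m),\alpha(n)]=m\delta_{m+n,0}$, with conformal vector $\frac12\alpha(-1)^2\mathbf{1}$ (central charge $1$); $\mathcal{H}(3)=\mathcal{H}^{\otimes3}$ (central charge $3$), on which $S_3$ acts by permuting tensor factors, and $\mathcal{H}(3)^{S_3}$ is the fixed-point vertex operator subalgebra (with the same conformal vector). For an $\mathcal{H}(3)^{S_3}$-module $M$ (graded by $L(0)$-eigenvalues with finite-dimensional eigenspaces), its character is $\mathrm{ch}[M](\tau)=\mathrm{tr}_M\,q^{L(0)-3/24}$, $q=e^{2\pi i\tau}$, $\tau$ in the upper half-plane. Modules here are untwisted $\mathcal{H}(3)^{S_3}$-modules; these include restrictions to $\mathcal{H}(3)^{S_3}$ of ordinary and $g$-twisted $\mathcal{H}(3)$-modules, $g\in S_3$. *)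

theory Defs
  imports "HOL-Analysis.Analysis" "HOL-Library.Poly_Mapping" "HOL-Library.Multiset"
begin

section \<open>Complex vector spaces with a basis\<close>

text \<open>
  Complex vector spaces are represented as subspaces of the free space
  \<open>'b \<Rightarrow>\<^sub>0 complex\<close> on a basis type \<open>'b\<close>.
\<close>

definition cscale :: "complex \<Rightarrow> ('b \<Rightarrow>\<^sub>0 complex) \<Rightarrow> ('b \<Rightarrow>\<^sub>0 complex)" where
  "cscale c v = Poly_Mapping.map (\<lambda>x. c * x) v"

lemma lookup_cscale [simp]: "Poly_Mapping.lookup (cscale c v) b = c * Poly_Mapping.lookup v b"
  by (simp add: cscale_def Poly_Mapping.map.rep_eq when_def)

global_interpretation cvec: vector_space cscale
  by unfold_locales (auto intro!: poly_mapping_eqI simp: lookup_add algebra_simps)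

definition lin_ext :: "('b \<Rightarrow> ('c \<Rightarrow>\<^sub>0 complex)) \<Rightarrow> ('b \<Rightarrow>\<^sub>0 complex) \<Rightarrow> ('c \<Rightarrow>\<^sub>0 complex)" where
  "lin_ext f v = (\<Sum>b\<in>Poly_Mapping.keys v. cscale (Poly_Mapping.lookup v b) (f b))"


section \<open>Vertex operator algebras and their modules\<close>

text \<open>
  \<open>mode V v n w\<close> is \<open>v\<^sub>n w\<close>, where \<open>Y(v,z) = (\<Sum>n. v\<^sub>n z^(-n-1))\<close>.
\<close>

record 'b voa =
  vcarrier :: "('b \<Rightarrow>\<^sub>0 complex) set"
  mode :: "('b \<Rightarrow>\<^sub>0 complex) \<Rightarrow> int \<Rightarrow> ('b \<Rightarrow>\<^sub>0 complex) \<Rightarrow> ('b \<Rightarrow>\<^sub>0 complex)"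
  vacuum :: "'b \<Rightarrow>\<^sub>0 complex"
  conformal :: "'b \<Rightarrow>\<^sub>0 complex"
  central_charge :: complex

record ('b, 'm) voa_mod =
  mcarrier :: "('m \<Rightarrow>\<^sub>0 complex) set"
  act :: "('b \<Rightarrow>\<^sub>0 complex) \<Rightarrow> int \<Rightarrow> ('m \<Rightarrow>\<^sub>0 complex) \<Rightarrow> ('m \<Rightarrow>\<^sub>0 complex)"

definition adjoint_module :: "'b voa \<Rightarrow> ('b, 'b) voa_mod" where
  "adjoint_module V = \<lparr>mcarrier = vcarrier V, act = mode V\<rparr>"

text \<open>\<open>L(0)\<close> is the mode with index 1 of the conformal vector, as \<open>Y(\<omega>,z) = (\<Sum>n. L(n) z^(-n-2))\<close>.\<close>

definition L0 :: "'b voa \<Rightarrow> ('b, 'm) voa_mod \<Rightarrow> ('m \<Rightarrow>\<^sub>0 complex) \<Rightarrow> ('m \<Rightarrow>\<^sub>0 complex)" where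
  "L0 V M w = act M (conformal V) 1 w"

definition eigenspace :: "'b voa \<Rightarrow> ('b, 'm) voa_mod \<Rightarrow> complex \<Rightarrow> ('m \<Rightarrow>\<^sub>0 complex) set" where
  "eigenspace V M h = {w \<in> mcarrier M. L0 V M w = cscale h w}"

text \<open>
  The Jacobi identity is stated by components (Borcherds identity).  By truncation, the sums over
  \<open>i\<close> have finite support, so that \<^const>\<open>Sum_any\<close> is the actual sum.  The Virasoro relations
  on the module and the \<open>L(-1)\<close>-derivative property follow from the listed axioms.
\<close>

definition weak_module :: "'b voa \<Rightarrow> ('b, 'm) voa_mod \<Rightarrow> bool" where
  "weak_module V M \<longleftrightarrow>
     cvec.subspace (mcarrier M) \<and>
     (\<forall>v\<in>vcarrier V. \<forall>n. \<forall>w\<in>mcarrier M. act M v n w \<in> mcarrier M) \<and>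
     (\<forall>u\<in>vcarrier V. \<forall>v\<in>vcarrier V. \<forall>n. \<forall>w\<in>mcarrier M.
        act M (u + v) n w = act M u n w + act M v n w) \<and>
     (\<forall>c. \<forall>v\<in>vcarrier V. \<forall>n. \<forall>w\<in>mcarrier M.
        act M (cscale c v) n w = cscale c (act M v n w)) \<and>
     (\<forall>v\<in>vcarrier V. \<forall>n. \<forall>w\<in>mcarrier M. \<forall>x\<in>mcarrier M.
        act M v n (w + x) = act M v n w + act M v n x) \<and>
     (\<forall>c. \<forall>v\<in>vcarrier V. \<forall>n. \<forall>w\<in>mcarrier M.
        act M v n (cscale c w) = cscale c (act M v n w)) \<and>
     (\<forall>v\<in>vcarrier V. \<forall>w\<in>mcarrier M. \<exists>N. \<forall>n\<ge>N. act M v n w = 0) \<and>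
     (\<forall>n. \<forall>w\<in>mcarrier M. act M (vacuum V) n w = (if n = -1 then w else 0)) \<and>
     (\<forall>u\<in>vcarrier V. \<forall>v\<in>vcarrier V. \<forall>w\<in>mcarrier M. \<forall>l m n :: int.
        Sum_any (\<lambda>i::nat. cscale (of_int m gchoose i)
          (act M (mode V u (l + int i) v) (m + n - int i) w)) =
        Sum_any (\<lambda>i::nat. cscale ((-1) ^ i * (of_int l gchoose i))
          (act M u (l + m - int i) (act M v (n + int i) w) -
           cscale ((-1) powi l) (act M v (l + n - int i) (act M u (m + int i) w)))))"

text \<open>
  Ordinary modules: \<open>L(0)\<close>-eigenvectors span (the sum of eigenspaces is automatically direct),
  eigenspaces are finite-dimensional, and on each coset \<open>h + \<int>\<close> the weights are bounded below.
\<close>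

definition voa_module :: "'b voa \<Rightarrow> ('b, 'm) voa_mod \<Rightarrow> bool" where
  "voa_module V M \<longleftrightarrow>
     weak_module V M \<and>
     mcarrier M \<subseteq> cvec.span (\<Union>h. eigenspace V M h) \<and>
     (\<forall>h. \<exists>B. finite B \<and> eigenspace V M h \<subseteq> cvec.span B) \<and>
     (\<forall>h. \<exists>N. \<forall>n\<ge>N. eigenspace V M (h - of_nat n) = {0})"

text \<open>
  By choosing bases of the eigenspaces, every ordinary module is isomorphic to one carried by the
  free space on pairs of an eigenvalue and a natural number.
\<close>

type_synonym 'b weight_mod = "('b, complex \<times> nat) voa_mod"

text \<open>
  The trace of \<open>q^(L(0) - c/24)\<close> is the sum over \<open>h\<close> of its value \<open>q^(h - c/24)\<close> times the
  dimension of the \<open>h\<close>-eigenspace.  As \<^const>\<open>infsum\<close> takes the value 0 on families that are not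
  summable, convergence is a separate predicate.
\<close>

definition char_term :: "'b voa \<Rightarrow> ('b, 'm) voa_mod \<Rightarrow> complex \<Rightarrow> complex \<Rightarrow> complex" where
  "char_term V M \<tau> h = of_nat (cvec.dim (eigenspace V M h)) *
     exp (2 * of_real pi * \<i> * \<tau> * (h - central_charge V / 24))"

definition char_converges :: "'b voa \<Rightarrow> ('b, 'm) voa_mod \<Rightarrow> complex \<Rightarrow> bool" where
  "char_converges V M \<tau> \<longleftrightarrow> char_term V M \<tau> summable_on UNIV"

definition ch :: "'b voa \<Rightarrow> ('b, 'm) voa_mod \<Rightarrow> complex \<Rightarrow> complex" where
  "ch V M \<tau> = (\<Sum>\<^sub>\<infinity>h. char_term V M \<tau> h)"


section \<open>The rank one Heisenberg vertex operator algebra\<close>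

text \<open>
  The basis vector indexed by the multiset \<open>{#k\<^sub>1, \<dots>, k\<^sub>r#}\<close> of natural numbers is
  \<open>\<alpha>(-k\<^sub>1-1) \<dots> \<alpha>(-k\<^sub>r-1) 1\<close>; note the shift by one.
\<close>

definition heis_alpha :: "int \<Rightarrow> (nat multiset \<Rightarrow>\<^sub>0 complex) \<Rightarrow> (nat multiset \<Rightarrow>\<^sub>0 complex)" where
  "heis_alpha n = lin_ext (\<lambda>\<mu>.
     if n < 0 then Poly_Mapping.single (add_mset (nat (- n - 1)) \<mu>) 1
     else if n = 0 then 0
     else Poly_Mapping.single (\<mu> - {#nat (n - 1)#}) (of_int n * of_nat (count \<mu> (nat (n - 1)))))"

text \<open>
  \<open>heis_field [k\<^sub>1, \<dots>, k\<^sub>r] n\<close> is the coefficient of \<open>z^(-n-1)\<close> in the normally ordered product of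
  the fields \<open>\<partial>^k \<alpha>(z) / k! = (\<Sum>m. (-m-1 choose k) \<alpha>(m) z^(-m-k-1))\<close> for \<open>k = k\<^sub>1, \<dots>, k\<^sub>r\<close>:
  modes \<open>\<alpha>(m)\<close> with \<open>m < 0\<close> go to the left and modes with \<open>m \<ge> 0\<close> to the right.
  The sum over \<open>m\<close> has finite support.
\<close>

primrec heis_field ::
    "nat list \<Rightarrow> int \<Rightarrow> (nat multiset \<Rightarrow>\<^sub>0 complex) \<Rightarrow> (nat multiset \<Rightarrow>\<^sub>0 complex)" where
  "heis_field [] n w = (if n = -1 then w else 0)"
| "heis_field (k # ks) n w =
     Sum_any (\<lambda>m::int. cscale (of_int (- m - 1) gchoose k)
       (if m < 0 then heis_alpha m (heis_field ks (n - m - int k - 1) w)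
        else heis_field ks (n - m - int k - 1) (heis_alpha m w)))"

definition heis_mode ::
    "(nat multiset \<Rightarrow>\<^sub>0 complex) \<Rightarrow> int \<Rightarrow> (nat multiset \<Rightarrow>\<^sub>0 complex) \<Rightarrow> (nat multiset \<Rightarrow>\<^sub>0 complex)" where
  "heis_mode v n w = lin_ext (\<lambda>\<mu>. heis_field (sorted_list_of_multiset \<mu>) n w) v"

definition heisenberg :: "nat multiset voa" where
  "heisenberg = \<lparr>vcarrier = UNIV, mode = heis_mode, vacuum = Poly_Mapping.single {#} 1,
     conformal = Poly_Mapping.single {#0, 0#} (1/2), central_charge = 1\<rparr>"

lemma lin_ext_superset:
  assumes "finite A" "Poly_Mapping.keys v \<subseteq> A"
  shows "lin_ext f v = (\<Sum>b\<in>A. cscale (Poly_Mapping.lookup v b) (f b))"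
  unfolding lin_ext_def
  by (rule sum.mono_neutral_left) (use assms in \<open>auto simp: in_keys_iff\<close>)

lemma lin_ext_single [simp]: "lin_ext f (Poly_Mapping.single b c) = cscale c (f b)"
  by (cases "c = 0") (simp_all add: lin_ext_def)

lemma lin_ext_add: "lin_ext f (v + w) = lin_ext f v + lin_ext f w"
proof -
  let ?A = "Poly_Mapping.keys v \<union> Poly_Mapping.keys w"
  have "Poly_Mapping.keys (v + w) \<subseteq> ?A" by (rule keys_add)
  then show ?thesis
    by (simp add: lin_ext_superset[of ?A] lookup_add cvec.scale_left_distrib sum.distrib)
qed

lemma lin_ext_cscale: "lin_ext f (cscale c v) = cscale c (lin_ext f v)"
proof -
  have "Poly_Mapping.keys (cscale c v) \<subseteq> Poly_Mapping.keys v" by (auto simp: in_keys_iff)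
  then show ?thesis
    by (simp add: lin_ext_superset[of "Poly_Mapping.keys v"] cvec.scale_sum_right)
qed

lemma lin_ext_linear: "Vector_Spaces.linear cscale cscale (lin_ext f)"
  by unfold_locales (simp_all add: lin_ext_add lin_ext_cscale)

lemma linear_eq_on_basis:
  assumes f: "Vector_Spaces.linear cscale cscale f" and g: "Vector_Spaces.linear cscale cscale g"
    and eq: "\<And>b. f (Poly_Mapping.single b 1) = g (Poly_Mapping.single b 1)"
  shows "f v = g v"
proof -
  interpret f: Vector_Spaces.linear cscale cscale f by (fact f)
  interpret g: Vector_Spaces.linear cscale cscale g by (fact g)
  have *: "f (Poly_Mapping.single b c) = g (Poly_Mapping.single b c)" for b c
  proof -
    have "Poly_Mapping.single b c = cscale c (Poly_Mapping.single b 1)"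
      by (rule poly_mapping_eqI) (simp add: lookup_single when_def)
    then show ?thesis by (simp add: f.scale g.scale eq)
  qed
  have v: "(\<Sum>b\<in>Poly_Mapping.keys v. Poly_Mapping.single b (Poly_Mapping.lookup v b)) = v"
    by (rule poly_mapping_eqI) (simp add: lookup_sum lookup_single when_def in_keys_iff)
  have "f (\<Sum>b\<in>Poly_Mapping.keys v. Poly_Mapping.single b (Poly_Mapping.lookup v b)) =
      g (\<Sum>b\<in>Poly_Mapping.keys v. Poly_Mapping.single b (Poly_Mapping.lookup v b))"
    by (simp add: f.sum g.sum *)
  then show ?thesis
    by (simp only: v)
qed

text \<open>Two checks of the construction: the commutation relations, and \<open>Y(\<alpha>(-1)1, z) = \<alpha>(z)\<close>.\<close>

lemma heis_alpha_linear: "Vector_Spaces.linear cscale cscale (heis_alpha n)"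
  unfolding heis_alpha_def by (rule lin_ext_linear)

lemma cscale_single: "cscale c (Poly_Mapping.single b d) = Poly_Mapping.single b (c * d)"
  by (rule poly_mapping_eqI) (simp add: lookup_single when_def)

lemma heis_alpha_neg:
  "n < 0 \<Longrightarrow> heis_alpha n (Poly_Mapping.single \<mu> c) = Poly_Mapping.single (add_mset (nat (- n - 1)) \<mu>) c"
  by (simp add: heis_alpha_def cscale_single)

lemma heis_alpha_0: "heis_alpha 0 w = 0"
  by (simp add: heis_alpha_def lin_ext_def)

lemma heis_alpha_pos:
  "n > 0 \<Longrightarrow> heis_alpha n (Poly_Mapping.single \<mu> c) =
     Poly_Mapping.single (\<mu> - {#nat (n - 1)#}) (c * (of_int n * of_nat (count \<mu> (nat (n - 1)))))"
  by (simp add: heis_alpha_def cscale_single)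

lemma heis_alpha_commutator:
  "heis_alpha m (heis_alpha n w) - heis_alpha n (heis_alpha m w) =
     cscale (if m + n = 0 then of_int m else 0) w"
proof (rule linear_eq_on_basis [where
      f = "\<lambda>w. heis_alpha m (heis_alpha n w) - heis_alpha n (heis_alpha m w)" and
      g = "cscale (if m + n = 0 then of_int m else 0)"])
  interpret a: Vector_Spaces.linear cscale cscale "heis_alpha k" for k
    by (rule heis_alpha_linear)
  show "Vector_Spaces.linear cscale cscale
      (\<lambda>w. heis_alpha m (heis_alpha n w) - heis_alpha n (heis_alpha m w))"
    by unfold_locales
      (simp_all add: a.add a.scale cvec.scale_right_diff_distrib)
  show "Vector_Spaces.linear cscale cscale (cscale (if m + n = 0 then of_int m else 0))"
    by unfold_locales (simp_all add: cvec.scale_right_distrib mult.commute)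
  fix \<mu> :: "nat multiset"
  have pm: "heis_alpha p (heis_alpha q (Poly_Mapping.single \<mu> 1)) -
      heis_alpha q (heis_alpha p (Poly_Mapping.single \<mu> 1)) =
      cscale (if p + q = 0 then of_int p else 0) (Poly_Mapping.single \<mu> 1)"
    if "p > 0" "q < 0" for p q :: int
  proof (cases "p + q = 0")
    case True
    then have q: "q = - p" by simp
    show ?thesis
    proof (cases "nat (p - 1) \<in># \<mu>")
      case True
      then show ?thesis using that
        by (simp add: q heis_alpha_neg heis_alpha_pos cscale_single single_diff [symmetric] algebra_simps)
    next
      case False
      then show ?thesis using that
        by (simp add: q heis_alpha_neg heis_alpha_pos cscale_single not_in_iff a.zero)
    qed
  next
    case False
    then have ne: "nat (p - 1) \<noteq> nat (- q - 1)" using that by auto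
    show ?thesis
    proof (cases "nat (p - 1) \<in># \<mu>")
      case True
      then show ?thesis using that False ne
        by (simp add: heis_alpha_neg heis_alpha_pos)
    next
      case False
      then show ?thesis using that \<open>p + q \<noteq> 0\<close> ne
        by (simp add: heis_alpha_neg heis_alpha_pos not_in_iff)
    qed
  qed
  consider "m = 0 \<or> n = 0" | "m > 0" "n < 0" | "m < 0" "n > 0" | "m < 0" "n < 0" | "m > 0" "n > 0"
    by linarith
  then show "heis_alpha m (heis_alpha n (Poly_Mapping.single \<mu> 1)) -
      heis_alpha n (heis_alpha m (Poly_Mapping.single \<mu> 1)) =
      cscale (if m + n = 0 then of_int m else 0) (Poly_Mapping.single \<mu> 1)"
  proof cases
    case 1
    then show ?thesis by (auto simp: heis_alpha_0 a.zero)
  next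
    case 2
    then show ?thesis by (rule pm)
  next
    case 3
    then have "heis_alpha n (heis_alpha m (Poly_Mapping.single \<mu> 1)) -
      heis_alpha m (heis_alpha n (Poly_Mapping.single \<mu> 1)) =
      cscale (if n + m = 0 then of_int n else 0) (Poly_Mapping.single \<mu> 1)"
      by (intro pm)
    moreover have "cscale (if m + n = 0 then of_int m else 0) (Poly_Mapping.single \<mu> 1) =
        - cscale (if n + m = 0 then of_int n else 0) (Poly_Mapping.single \<mu> 1)"
    proof (cases "m + n = 0")
      case True
      then have "m = - n" by simp
      then show ?thesis by (simp flip: cvec.scale_minus_left)
    qed (simp add: add.commute)
    ultimately show ?thesis
      by (metis minus_diff_eq)
  next
    case 4
    then show ?thesis by (simp add: heis_alpha_neg add_mset_commute)
  next
    case 5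
    then show ?thesis
      by (cases "m = n")
        (auto simp: heis_alpha_pos diff_diff_add_mset add_mset_commute nat_eq_iff mult_ac)
  qed
qed

lemma heis_mode_alpha: "heis_mode (Poly_Mapping.single {#0#} 1) n w = heis_alpha n w"
proof -
  interpret a: Vector_Spaces.linear cscale cscale "heis_alpha k" for k
    by (rule heis_alpha_linear)
  have "(\<lambda>m::int. cscale (of_int (- m - 1) gchoose 0)
       (if m < 0 then heis_alpha m (heis_field [] (n - m - int 0 - 1) w)
        else heis_field [] (n - m - int 0 - 1) (heis_alpha m w))) =
      (\<lambda>m. if m = n then heis_alpha n w else 0)"
    by (auto simp: fun_eq_iff a.zero)
  moreover have "Sum_any (\<lambda>m. if m = n then heis_alpha n w else 0) = heis_alpha n w"
    by (subst Sum_any.expand_superset[of "{n}"]) auto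
  ultimately have A: "heis_field [0] n w = heis_alpha n w"
    by (simp only: heis_field.simps(2) [of 0 "[]"])
  have B: "sorted_list_of_multiset {#0 :: nat#} = [0]"
    by simp
  show ?thesis
    unfolding heis_mode_def lin_ext_single cvec.scale_one B by (rule A)
qed


section \<open>Tensor powers and permutation orbifolds\<close>

definition pure_tensor :: "('n::finite \<Rightarrow> ('b \<Rightarrow>\<^sub>0 complex)) \<Rightarrow> (('n \<Rightarrow> 'b) \<Rightarrow>\<^sub>0 complex)" where
  "pure_tensor v =
     (\<Sum>b | \<forall>i. b i \<in> Poly_Mapping.keys (v i).
        Poly_Mapping.single b (\<Prod>i\<in>UNIV. Poly_Mapping.lookup (v i) (b i)))"

text \<open>
  The tensor power of the Heisenberg algebra has as basis the families of basis vectors.  Since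
  \<open>Y(\<Otimes>\<^sub>i u\<^sub>i, z) = \<Otimes>\<^sub>i Y(u\<^sub>i, z)\<close>, the mode \<open>n\<close> of a tensor is the sum of the tensors of the modes
  \<open>p i\<close> over all \<open>p\<close> with \<open>(\<Sum>i. p i + 1) = n + 1\<close>; only finitely many terms are nonzero.
\<close>

definition heis_tensor_mode ::
    "(('n::finite \<Rightarrow> nat multiset) \<Rightarrow>\<^sub>0 complex) \<Rightarrow> int \<Rightarrow>
     (('n \<Rightarrow> nat multiset) \<Rightarrow>\<^sub>0 complex) \<Rightarrow> (('n \<Rightarrow> nat multiset) \<Rightarrow>\<^sub>0 complex)" where
  "heis_tensor_mode v n w =
     lin_ext (\<lambda>a. lin_ext (\<lambda>b. Sum_any (\<lambda>p :: 'n \<Rightarrow> int.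
       if (\<Sum>i\<in>UNIV. p i + 1) = n + 1
       then pure_tensor (\<lambda>i.
         mode heisenberg (Poly_Mapping.single (a i) 1) (p i) (Poly_Mapping.single (b i) 1))
       else 0)) w) v"

definition heisenberg_tensor :: "('n::finite \<Rightarrow> nat multiset) voa" where
  "heisenberg_tensor = \<lparr>vcarrier = UNIV, mode = heis_tensor_mode,
     vacuum = pure_tensor (\<lambda>_. vacuum heisenberg),
     conformal = (\<Sum>j\<in>UNIV. pure_tensor (\<lambda>i. if i = j then conformal heisenberg else vacuum heisenberg)),
     central_charge = of_nat CARD('n) * central_charge heisenberg\<rparr>"

definition tensor_perm :: "('n \<Rightarrow> 'n) \<Rightarrow> (('n \<Rightarrow> 'b) \<Rightarrow>\<^sub>0 complex) \<Rightarrow> (('n \<Rightarrow> 'b) \<Rightarrow>\<^sub>0 complex)" where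
  "tensor_perm \<sigma> = lin_ext (\<lambda>b. Poly_Mapping.single (b \<circ> inv \<sigma>) 1)"

definition fixed_subalgebra :: "(('b \<Rightarrow>\<^sub>0 complex) \<Rightarrow> ('b \<Rightarrow>\<^sub>0 complex)) set \<Rightarrow> 'b voa \<Rightarrow> 'b voa" where
  "fixed_subalgebra G V = V\<lparr>vcarrier := {v \<in> vcarrier V. \<forall>g\<in>G. g v = v}\<rparr>"

definition H3S3 :: "(3 \<Rightarrow> nat multiset) voa" where
  "H3S3 = fixed_subalgebra {tensor_perm \<sigma> | \<sigma>. bij \<sigma>} heisenberg_tensor"

end

theory Submission
  imports Defs "HOL-Complex_Analysis.Complex_Analysis"
begin

text \<open>
  A normally ordered product is obtained from the vacuum by repeatedly wrapping a derivative of a free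
  field around a field.  The triples of expansions of one expression in \<open>z\<close>, \<open>w\<close> and \<open>z - w\<close>
  satisfy the Borcherds identity, and they are closed under wrapping and under division by \<open>z - w\<close>;
  this makes every Fock space of \<open>H(3)\<close>, with an arbitrary complex momentum, a module.

  By Burnside's lemma the character of the orbifold is
  \<open>(\<eta>(\<tau>)^-3 + 3 \<eta>(2\<tau>)^-1 \<eta>(\<tau>)^-1 + 2 \<eta>(3\<tau>)^-1) / 6\<close>, while the Fock module with
  \<open>L(0)\<close>-weight \<open>t\<close> of its lowest vector has the character \<open>q^t \<eta>(\<tau>)^-3\<close>.  After
  \<open>\<tau> \<mapsto> -1/\<tau>\<close>, inversion of \<open>\<eta>\<close> turns the three terms into \<open>\<eta>(\<tau>)^-3\<close> times a power
  \<open>(-2\<pi>\<i>\<tau>)^-p\<close> with \<open>p = 3/2, 1, 1/2\<close> and a power series in \<open>q\<close>, \<open>q^(1/2)\<close> or \<open>q^(1/3)\<close>.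
  As \<open>(-2\<pi>\<i>\<tau>)^-p\<close> is the Laplace transform of \<open>t^(p-1) / \<Gamma>(p)\<close>, so that multiplication by \<open>q^a\<close>
  shifts the density by \<open>a\<close>, each of them is a superposition of \<open>q^t \<eta>(\<tau>)^-3\<close> over real \<open>t\<close>.  A single
  one-parameter family of Fock modules carries everything, and the other two families are zero.

  The inversion of \<open>\<eta>\<close> is proved on the imaginary axis, where the partial fractions of the cotangent
  make \<open>ln \<eta>\<close> a double sum that is symmetric up to a Riemann sum for \<open>\<integral> arctan u / u du\<close>.
\<close>

text \<open>One real parameter is enough because a Fock character depends on the momentum only
  through half its square: a Gaussian integral over i momenta collapses to its radial part, and p =
  i/2 is the origin of 3/2, 1 and 1/2. The series in q^(1/m) begin at q^(m/24 - 1/(24 m)), that is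
  at the exponents 1/16 and 1/9, the lowest weights of the sectors twisted by a transposition and by
  a 3-cycle; the densities constructed here therefore live on t >= 0. The obstacle on the algebraic
  side is that the modes of H(3) are given as sums over all distributions of a mode index among the
  tensor factors, which is no convenient form for the Borcherds identity. They are translated into a
  single recursion that wraps one free field at a time. The momentum enters only through the central
  zero modes, so one argument covers the algebra (momentum 0) and all its Fock modules. Formal
  series are avoided: the weight filtration makes each sum over modes finite on a given vector, and
  identities are stated with cut-offs.\<close>

type_synonym 'n fock = "('n \<Rightarrow> nat multiset) \<Rightarrow>\<^sub>0 complex"

section \<open>Linear maps between free spaces, and sums of finite support\<close>

abbreviation clinear :: "(('b \<Rightarrow>\<^sub>0 complex) \<Rightarrow> ('c \<Rightarrow>\<^sub>0 complex)) \<Rightarrow> bool" where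
  "clinear \<equiv> Vector_Spaces.linear cscale cscale"

lemma clinearI:
  assumes "\<And>v w. f (v + w) = f v + f w" "\<And>c v. f (cscale c v) = cscale c (f v)"
  shows "clinear f"
  using assms by unfold_locales auto

lemma clinear_add: "clinear f \<Longrightarrow> f (v + w) = f v + f w"
  and clinear_cscale: "clinear f \<Longrightarrow> f (cscale c v) = cscale c (f v)"
  and clinear_sum: "clinear f \<Longrightarrow> f (sum g A) = (\<Sum>x\<in>A. f (g x))"
  and clinear_diff: "clinear f \<Longrightarrow> f (v - w) = f v - f w"
  by (simp_all add: linear_iff_module_hom module_hom.add module_hom.scale module_hom.sum module_hom.diff)

lemma clinear_0: "clinear f \<Longrightarrow> f 0 = 0"
  using clinear_cscale[of f 0 0] by simp

lemma clinear_Sum_any: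
  assumes "clinear f" "finite {x. g x \<noteq> 0}"
  shows "f (Sum_any g) = Sum_any (\<lambda>x. f (g x))"
proof -
  have "{x. f (g x) \<noteq> 0} \<subseteq> {x. g x \<noteq> 0}"
    using clinear_0[OF assms(1)] by auto
  then show ?thesis
    using assms by (simp add: Sum_any.expand_superset[of "{x. g x \<noteq> 0}"] clinear_sum)
qed

lemma cscale_0 [simp]: "cscale 0 v = 0" "cscale c 0 = 0"
  by (simp_all)

lemma Sum_any_eq_sum_int:
  assumes "\<And>q::int. q < lo \<or> q > hi \<Longrightarrow> f q = 0"
  shows "Sum_any f = sum f {lo..hi}"
  by (rule Sum_any.expand_superset) (use assms in \<open>force simp: not_less\<close>)+

lemma Sum_any_eq_sum_nat:
  assumes "\<And>i::nat. i \<ge> K \<Longrightarrow> f i = 0"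
  shows "Sum_any f = sum f {..<K}"
  by (rule Sum_any.expand_superset) (use assms not_le in \<open>blast | simp\<close>)+

section \<open>The weight filtration and operators of bounded degree\<close>

definition weight :: "('n::finite \<Rightarrow> nat multiset) \<Rightarrow> nat" where
  "weight b = (\<Sum>i\<in>UNIV. \<Sum>k\<in>#b i. k + 1)"

text \<open>A filtration and not a grading: an upper bound for the weight survives linear
  combinations, and a negative bound already forces the vector to vanish. Truncation of fields on
  Fock space rests on that.\<close>

definition deg_le :: "int \<Rightarrow> 'n::finite fock \<Rightarrow> bool" where
  "deg_le d w \<longleftrightarrow> (\<forall>b\<in>Poly_Mapping.keys w. int (weight b) \<le> d)"

definition shifts :: "int \<Rightarrow> ('n::finite fock \<Rightarrow> 'n fock) \<Rightarrow> bool" where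
  "shifts e T \<longleftrightarrow> clinear T \<and> (\<forall>d w. deg_le d w \<longrightarrow> deg_le (d + e) (T w))"

lemma deg_le_0 [simp]: "deg_le d 0"
  by (simp add: deg_le_def)

lemma deg_le_neg: assumes "deg_le d w" "d < 0" shows "w = 0"
proof -
  have "b \<notin> Poly_Mapping.keys w" for b
    using assms unfolding deg_le_def by (metis not_le of_nat_0_le_iff order_trans)
  then show ?thesis by (intro poly_mapping_eqI) (simp add: in_keys_iff)
qed

lemma deg_le_mono: "deg_le d w \<Longrightarrow> d \<le> d' \<Longrightarrow> deg_le d' w"
  unfolding deg_le_def by (meson order.trans)

lemma deg_le_add: "deg_le d v \<Longrightarrow> deg_le d w \<Longrightarrow> deg_le d (v + w)"
  unfolding deg_le_def using keys_add[of v w] by (meson UnE subsetD)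

lemma deg_le_cscale: "deg_le d w \<Longrightarrow> deg_le d (cscale c w)"
  unfolding deg_le_def by (auto simp: in_keys_iff)

lemma deg_le_sum: "(\<And>x. x \<in> A \<Longrightarrow> deg_le d (f x)) \<Longrightarrow> deg_le d (sum f A)"
  by (induction A rule: infinite_finite_induct) (auto intro: deg_le_add)

lemma deg_le_ex: "\<exists>d\<ge>0. deg_le d w"
proof -
  let ?d = "\<Sum>b\<in>Poly_Mapping.keys w. int (weight b)"
  have "deg_le ?d w"
    unfolding deg_le_def
  proof
    fix b assume "b \<in> Poly_Mapping.keys w"
    then show "int (weight b) \<le> ?d" by (intro member_le_sum) simp_all
  qed
  moreover have "?d \<ge> 0" by (intro sum_nonneg) simp
  ultimately show ?thesis by blast
qed

lemma shifts_linear: "shifts e T \<Longrightarrow> clinear T"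
  by (simp add: shifts_def)

lemma shifts_deg: "shifts e T \<Longrightarrow> deg_le d w \<Longrightarrow> d + e \<le> d' \<Longrightarrow> deg_le d' (T w)"
  unfolding shifts_def using deg_le_mono by blast

lemma shifts_eq_0: "shifts e T \<Longrightarrow> deg_le d w \<Longrightarrow> d + e < 0 \<Longrightarrow> T w = 0"
  unfolding shifts_def using deg_le_neg by blast

lemma shifts_mono: "shifts e T \<Longrightarrow> e \<le> e' \<Longrightarrow> shifts e' T"
  unfolding shifts_def using deg_le_mono by (metis add_left_mono)

lemma shifts_zero: "shifts e (\<lambda>w. 0)"
  unfolding shifts_def by (intro conjI clinearI) simp_all

lemma clinear_plus: "clinear S \<Longrightarrow> clinear T \<Longrightarrow> clinear (\<lambda>w. S w + T w)"
  by (rule clinearI) (simp_all add: clinear_add clinear_cscale cvec.scale_right_distrib add_ac)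

lemma clinear_scale: "clinear S \<Longrightarrow> clinear (\<lambda>w. cscale c (S w))"
  by (rule clinearI) (simp_all add: clinear_add clinear_cscale cvec.scale_right_distrib mult.commute)

lemma shifts_add: "shifts e S \<Longrightarrow> shifts e T \<Longrightarrow> shifts e (\<lambda>w. S w + T w)"
  unfolding shifts_def by (blast intro: clinear_plus deg_le_add)

lemma shifts_cscale: "shifts e S \<Longrightarrow> shifts e (\<lambda>w. cscale c (S w))"
  unfolding shifts_def by (blast intro: clinear_scale deg_le_cscale)

lemma shifts_sum: "(\<And>x. x \<in> A \<Longrightarrow> shifts e (S x)) \<Longrightarrow> shifts e (\<lambda>w. \<Sum>x\<in>A. S x w)"
  by (induction A rule: infinite_finite_induct) (auto intro: shifts_add shifts_zero)

lemma shifts_comp: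
  fixes S T :: "'n::finite fock \<Rightarrow> 'n fock"
  assumes S: "shifts e S" and T: "shifts e' T" and e: "e + e' = e''"
  shows "shifts e'' (\<lambda>w. S (T w))"
  unfolding shifts_def
proof (intro conjI clinearI allI impI)
  fix d and w :: "'n fock" assume "deg_le d w"
  then show "deg_le (d + e'') (S (T w))"
    by (intro shifts_deg[OF S shifts_deg[OF T]]) (use e in auto)
qed (simp_all add: shifts_linear[OF S] shifts_linear[OF T] clinear_add clinear_cscale)

text \<open>The sum need not be uniformly finite: only its restriction to each degree is.\<close>

lemma shifts_Sum_any:
  fixes S :: "'a \<Rightarrow> 'n::finite fock \<Rightarrow> 'n fock"
  assumes S: "\<And>x. shifts e (S x)" and fin: "\<And>d. \<exists>A. finite A \<and> (\<forall>x w. x \<notin> A \<longrightarrow> deg_le d w \<longrightarrow> S x w = 0)"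
  shows "shifts e (\<lambda>w. Sum_any (\<lambda>x. S x w))"
proof -
  \<comment> \<open>On vectors of bounded degree the sum agrees with one fixed finite sum. Linearity
    is inherited from there after putting two vectors under a common bound.\<close>
  have *: "\<exists>A. finite A \<and> (\<forall>w. deg_le d w \<longrightarrow> Sum_any (\<lambda>x. S x w) = (\<Sum>x\<in>A. S x w))" for d
  proof -
    obtain A where A: "finite A" "\<And>x w. x \<notin> A \<Longrightarrow> deg_le d w \<Longrightarrow> S x w = 0" using fin[of d] by blast
    then show ?thesis by (intro exI[of _ A]) (auto intro!: Sum_any.expand_superset)
  qed
  have T: "shifts e (\<lambda>w. \<Sum>x\<in>A. S x w)" for A by (intro shifts_sum S)
  show ?thesis unfolding shifts_def
  proof (intro conjI clinearI allI impI)
    fix v w :: "'n fock"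
    obtain d1 d2 where "deg_le d1 v" "deg_le d2 w" using deg_le_ex by meson
    then have d: "deg_le (max d1 d2) v" "deg_le (max d1 d2) w" by (auto intro: deg_le_mono)
    then show "Sum_any (\<lambda>x. S x (v + w)) = Sum_any (\<lambda>x. S x v) + Sum_any (\<lambda>x. S x w)"
      using *[of "max d1 d2"] deg_le_add[OF d] clinear_add[OF shifts_linear[OF T]] by metis
  next
    fix c and v :: "'n fock"
    obtain d where d: "deg_le d v" using deg_le_ex by meson
    then show "Sum_any (\<lambda>x. S x (cscale c v)) = cscale c (Sum_any (\<lambda>x. S x v))"
      using *[of d] deg_le_cscale[OF d, of c] clinear_cscale[OF shifts_linear[OF T]] by metis
  next
    fix d and w :: "'n fock" assume d: "deg_le d w"
    then show "deg_le (d + e) (Sum_any (\<lambda>x. S x w))"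
      using *[of d] shifts_deg[OF T d order_refl] by metis
  qed
qed

subsection \<open>Normally ordered products with a free field\<close>

text \<open>Normal ordering of one mode against an operator. The zero mode counts as an annihilation
  operator, as in \<open>heis_field\<close>.\<close>

definition app :: "(int \<Rightarrow> 'n fock \<Rightarrow> 'n fock) \<Rightarrow> int \<Rightarrow> ('n fock \<Rightarrow> 'n fock) \<Rightarrow> 'n fock \<Rightarrow> 'n fock" where
  "app a q F w = (if q < 0 then a q (F w) else F (a q w))"

text \<open>The normally ordered product of the k-th divided derivative of the field
  \<open>a\<close> with the field \<open>F\<close>; it repeats the recursion of
  \<open>heis_field\<close> on an arbitrary Fock space.\<close>

definition wrap :: "(int \<Rightarrow> 'n fock \<Rightarrow> 'n fock) \<Rightarrow> nat \<Rightarrow> (int \<Rightarrow> 'n fock \<Rightarrow> 'n fock) \<Rightarrow>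
    int \<Rightarrow> 'n fock \<Rightarrow> 'n fock" where
  "wrap a k F n w =
     Sum_any (\<lambda>q. cscale (of_int (- q - 1) gchoose k) (app a q (F (n - q - int k - 1)) w))"

definition modes :: "(int \<Rightarrow> 'n::finite fock \<Rightarrow> 'n fock) \<Rightarrow> bool" where
  "modes a \<longleftrightarrow> (\<forall>n. shifts (- n) (a n))"

text \<open>The exact degree of the mode n of a field of conformal weight h is h - n - 1. The bound
  is one unit larger, which is harmless since only upper bounds are used.\<close>

definition weight_field :: "int \<Rightarrow> (int \<Rightarrow> 'n::finite fock \<Rightarrow> 'n fock) \<Rightarrow> bool" where
  "weight_field h F \<longleftrightarrow> (\<forall>n. shifts (h - n) (F n))"

lemma modes_linear: "modes a \<Longrightarrow> clinear (a n)"
  and modes_shifts: "modes a \<Longrightarrow> shifts (- n) (a n)"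
  by (auto simp: modes_def shifts_def)

lemma app_shifts:
  assumes "modes a" "shifts e F" shows "shifts (e - q) (app a q F)"
  using shifts_comp[OF modes_shifts[OF assms(1)] assms(2), of q "e - q"]
    shifts_comp[OF assms(2) modes_shifts[OF assms(1)], of q "e - q"]
  by (cases "q < 0") (simp_all add: app_def [abs_def])

lemma app_eq_0:
  assumes a: "modes a" and F: "shifts e F" and w: "deg_le d w"
    and q: "d + e < 0 \<and> q < 0 \<or> q \<ge> 0 \<and> q > d"
  shows "app a q F w = 0"
  using q
proof
  assume *: "d + e < 0 \<and> q < 0"
  then have "F w = 0" using shifts_eq_0[OF F w] by simp
  then show ?thesis using * by (simp add: app_def clinear_0 modes_linear[OF a])
next
  assume *: "q \<ge> 0 \<and> q > d"
  then have "a q w = 0" using shifts_eq_0[OF modes_shifts[OF a] w] by simp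
  then show ?thesis using * by (simp add: app_def clinear_0 shifts_linear[OF F])
qed

text \<open>Beyond the window either \<open>a q\<close> annihilates \<open>w\<close> (large q) or
  the mode of \<open>F\<close> does (very negative q). Every \<open>M\<close> above the three bounds
  will do, which lets several sums share one window.\<close>

lemma wrap_eq_sum:
  assumes a: "modes a" and F: "\<And>n. shifts (h - n) (F n)" and w: "deg_le d w"
    and M: "M \<ge> d" "M \<ge> 0" "M \<ge> d + h - n + int k"
  shows "wrap a k F n w = (\<Sum>q\<in>{-M-1..M}. cscale (of_int (- q - 1) gchoose k) (app a q (F (n - q - int k - 1)) w))"
  unfolding wrap_def
proof (rule Sum_any_eq_sum_int)
  fix q assume q: "q < - M - 1 \<or> q > M"
  have "app a q (F (n - q - int k - 1)) w = 0"
    by (rule app_eq_0[OF a F w]) (use M q in auto)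
  then show "cscale (of_int (- q - 1) gchoose k) (app a q (F (n - q - int k - 1)) w) = 0" by simp
qed

lemma wrap_shifts:
  fixes a :: "int \<Rightarrow> 'n::finite fock \<Rightarrow> 'n fock"
  assumes a: "modes a" and F: "\<And>n. shifts (h - n) (F n)"
  shows "shifts (h + int k + 1 - n) (wrap a k F n)"
  unfolding wrap_def [abs_def]
proof (rule shifts_Sum_any)
  show "shifts (h + int k + 1 - n) (\<lambda>w. cscale (of_int (- q - 1) gchoose k) (app a q (F (n - q - int k - 1)) w))" for q
    by (rule shifts_cscale) (use app_shifts[OF a F, of "n - q - int k - 1" q] in \<open>simp add: algebra_simps\<close>)
  fix d
  let ?M = "max 0 (max d (d + h - n + int k))"
  show "\<exists>A. finite A \<and> (\<forall>q w. q \<notin> A \<longrightarrow> deg_le d w \<longrightarrow>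
          cscale (of_int (- q - 1) gchoose k) (app a q (F (n - q - int k - 1)) w) = 0)"
  proof (intro exI[of _ "{-?M-1..?M}"] conjI allI impI)
    fix q and w :: "'n fock" assume q: "q \<notin> {-?M-1..?M}" and w: "deg_le d w"
    have "app a q (F (n - q - int k - 1)) w = 0"
      by (rule app_eq_0[OF a F w]) (use q in auto)
    then show "cscale (of_int (- q - 1) gchoose k) (app a q (F (n - q - int k - 1)) w) = 0" by simp
  qed simp
qed

lemma wrap_weight_field:
  "modes a \<Longrightarrow> weight_field h F \<Longrightarrow> weight_field (h + int k + 1) (wrap a k F)"
  unfolding weight_field_def using wrap_shifts by blast

text \<open>Both sides become the same double sum. Modes on opposite sides of the normal ordering
  never meet, so commutation is needed only for indices of the same sign class; this makes normally
  ordered products of free fields symmetric although their modes do not commute.\<close>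

lemma wrap_commute:
  assumes a: "modes a" and b: "modes b" and F: "weight_field h F"
    and comm: "\<And>p q w. (p < 0 \<longleftrightarrow> q < 0) \<Longrightarrow> a p (b q w) = b q (a p w)"
  shows "wrap a k (wrap b l F) n w = wrap b l (wrap a k F) n w"
proof -
  obtain d where d: "d \<ge> 0" "deg_le d w" using deg_le_ex by blast
  define M where "M = d + \<bar>h\<bar> + \<bar>n\<bar> + int k + int l + 1"
  note F' = F[unfolded weight_field_def, rule_format]
  have *: "wrap a k (wrap b l F) n w = (\<Sum>p\<in>{-M-1..M}. \<Sum>q\<in>{-M-1..M}.
      cscale ((of_int (- p - 1) gchoose k) * (of_int (- q - 1) gchoose l))
        (app a p (app b q (F (n - p - int k - 1 - q - int l - 1))) w))"
    if a: "modes a" and b: "modes b" and kl: "M = d + \<bar>h\<bar> + \<bar>n\<bar> + int k + int l + 1" for a b k l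
  proof -
    have "wrap a k (wrap b l F) n w = (\<Sum>p\<in>{-M-1..M}. cscale (of_int (- p - 1) gchoose k)
       (app a p (wrap b l F (n - p - int k - 1)) w))"
      by (rule wrap_eq_sum[OF a wrap_shifts[OF b F'] d(2)]) (use d in \<open>auto simp: kl\<close>)
    also have "\<dots> = (\<Sum>p\<in>{-M-1..M}. \<Sum>q\<in>{-M-1..M}.
      cscale ((of_int (- p - 1) gchoose k) * (of_int (- q - 1) gchoose l))
        (app a p (app b q (F (n - p - int k - 1 - q - int l - 1))) w))"
    proof (intro sum.cong refl)
      fix p assume p: "p \<in> {-M-1..M}"
      show "cscale (of_int (- p - 1) gchoose k) (app a p (wrap b l F (n - p - int k - 1)) w) =
        (\<Sum>q\<in>{-M-1..M}. cscale ((of_int (- p - 1) gchoose k) * (of_int (- q - 1) gchoose l))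
        (app a p (app b q (F (n - p - int k - 1 - q - int l - 1))) w))"
      proof (cases "p < 0")
        case True
        then have "wrap b l F (n - p - int k - 1) w = (\<Sum>q\<in>{-M-1..M}. cscale (of_int (- q - 1) gchoose l)
            (app b q (F (n - p - int k - 1 - q - int l - 1)) w))"
          by (intro wrap_eq_sum[OF b F' d(2)]) (use d in \<open>auto simp: kl\<close>)
        then show ?thesis using True
          by (simp add: app_def[of a] clinear_sum[OF modes_linear[OF a]]
            clinear_cscale[OF modes_linear[OF a]] cvec.scale_sum_right)
      next
        case False
        \<comment> \<open>Applying \<open>a p\<close> lowers the degree by p, which balances the
          rise by p caused by the smaller index of \<open>F\<close>; hence the window does not
          depend on p.\<close>
        have "deg_le (d - p) (a p w)"
          by (rule shifts_deg[OF modes_shifts[OF a] d(2)]) simp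
        moreover have "deg_le d (a p w)"
          by (rule shifts_deg[OF modes_shifts[OF a] d(2)]) (use False in simp)
        ultimately have "wrap b l F (n - p - int k - 1) (a p w) = (\<Sum>q\<in>{-M-1..M}. cscale (of_int (- q - 1) gchoose l)
            (app b q (F (n - p - int k - 1 - q - int l - 1)) (a p w)))"
          by (intro wrap_eq_sum[OF b F', where d = "d - p"]) (use d False in \<open>auto simp: kl\<close>)
        then show ?thesis using False
          by (simp add: app_def[of a] cvec.scale_sum_right)
      qed
    qed
    finally show ?thesis .
  qed
  have "app a p (app b q G) w = app b q (app a p G) w" for p q G
    using comm[of p q] by (cases "p < 0"; cases "q < 0") (auto simp: app_def)
  note 2 = this
  have 1: "wrap b l (wrap a k F) n w = (\<Sum>p\<in>{-M-1..M}. \<Sum>q\<in>{-M-1..M}.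
      cscale ((of_int (- p - 1) gchoose l) * (of_int (- q - 1) gchoose k))
        (app b p (app a q (F (n - p - int l - 1 - q - int k - 1))) w))"
    by (rule *[OF b a]) (simp add: M_def)
  have 3: "cscale ((of_int (- p - 1) gchoose k) * (of_int (- q - 1) gchoose l))
        (app a p (app b q (F (n - p - int k - 1 - q - int l - 1))) w) =
      cscale ((of_int (- q - 1) gchoose l) * (of_int (- p - 1) gchoose k))
        (app b q (app a p (F (n - q - int l - 1 - p - int k - 1))) w)" for p q
  proof -
    have "n - p - int k - 1 - q - int l - 1 = n - q - int l - 1 - p - int k - 1" by simp
    then show ?thesis by (simp only: 2 mult.commute)
  qed
  show ?thesis
    unfolding *[OF a b M_def] 1 by (subst sum.swap) (simp only: 3)
qed

section \<open>Products of truncated binomial expansions\<close>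

text \<open>The square of indices may be cut down to the triangle because \<open>h\<close> vanishes
  from \<open>K\<close> on. Products of binomial expansions thus turn into Vandermonde sums without
  leaving finite sums.\<close>

lemma sum_sum_convolution:
  fixes h :: "nat \<Rightarrow> ('b \<Rightarrow>\<^sub>0 complex)"
  assumes "\<And>t. t \<ge> K \<Longrightarrow> h t = 0"
  shows "(\<Sum>i<K. \<Sum>j<K. cscale (f i * g j) (h (i + j))) = (\<Sum>t<K. cscale (\<Sum>i\<le>t. f i * g (t - i)) (h t))"
proof -
  have "(\<Sum>i<K. \<Sum>j<K. cscale (f i * g j) (h (i + j))) =
      (\<Sum>i<K. \<Sum>j<K-i. cscale (f i * g j) (h (i + j)))"
    by (intro sum.cong refl sum.mono_neutral_right) (auto simp: assms)
  also have "\<dots> = (\<Sum>(i,j)\<in>{(i,j). i + j < K}. cscale (f i * g j) (h (i + j)))"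
    by (subst sum.Sigma) (auto intro!: sum.cong)
  also have "\<dots> = (\<Sum>t<K. \<Sum>i\<le>t. cscale (f i * g (t - i)) (h (i + (t - i))))"
    by (rule sum.triangle_reindex)
  also have "\<dots> = (\<Sum>t<K. \<Sum>i\<le>t. cscale (f i * g (t - i)) (h t))"
    by (intro sum.cong refl) simp
  finally show ?thesis by (simp add: cvec.scale_sum_left)
qed

lemma gbinomial_convolution:
  fixes a b :: complex
  shows "(\<Sum>i\<le>t. (a gchoose i) * (b gchoose (t - i))) = (a + b) gchoose t"
  using gbinomial_Vandermonde[of a b t] by (simp add: atMost_atLeast0)

lemma gbinomial_convolution_signed:
  fixes a b :: complex
  shows "(\<Sum>i\<le>t. ((-1) ^ i * (a gchoose i)) * ((-1) ^ (t - i) * (b gchoose (t - i)))) = (-1) ^ t * ((a + b) gchoose t)"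
proof -
  have "(\<Sum>i\<le>t. ((-1) ^ i * (a gchoose i)) * ((-1) ^ (t - i) * (b gchoose (t - i)))) =
      (\<Sum>i\<le>t. (-1) ^ t * ((a gchoose i) * (b gchoose (t - i))))"
  proof (intro sum.cong refl)
    fix i assume "i \<in> {..t}"
    then have "(-1) ^ i * (-1) ^ (t - i) = ((-1) ^ t :: complex)"
      by (simp flip: power_add)
    then show "((-1) ^ i * (a gchoose i)) * ((-1) ^ (t - i) * (b gchoose (t - i))) =
        (-1) ^ t * ((a gchoose i) * (b gchoose (t - i)))"
      by (metis (no_types, opaque_lifting) mult.assoc mult.left_commute)
  qed
  then show ?thesis by (simp add: gbinomial_convolution flip: sum_distrib_left)
qed

subsection \<open>The Borcherds identity for triples of two-variable fields\<close>

text \<open>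
  \<open>P\<close>, \<open>Q\<close> and \<open>R\<close> play the roles of \<open>Y(u,z)Y(v,w)\<close>, \<open>Y(v,w)Y(u,z)\<close> and \<open>Y(Y(u,z-w)v,w)\<close>.  A triple
  satisfies the identity when its members are the three expansions of one expression in
  \<open>z\<close>, \<open>w\<close> and \<open>z - w\<close>.
\<close>

definition borcherds_at :: "nat \<Rightarrow> (int \<Rightarrow> int \<Rightarrow> 'n fock \<Rightarrow> 'n fock) \<Rightarrow> (int \<Rightarrow> int \<Rightarrow> 'n fock \<Rightarrow> 'n fock) \<Rightarrow>
    (int \<Rightarrow> int \<Rightarrow> 'n fock \<Rightarrow> 'n fock) \<Rightarrow> int \<Rightarrow> int \<Rightarrow> int \<Rightarrow> 'n fock \<Rightarrow> bool" where
  "borcherds_at K P Q R l m n w \<longleftrightarrow>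
     (\<Sum>i<K. cscale (of_int m gchoose i) (R (l + int i) (m + n - int i) w)) =
     (\<Sum>i<K. cscale ((-1) ^ i * (of_int l gchoose i)) (P (l + m - int i) (n + int i) w)) -
     cscale ((-1) powi l) (\<Sum>i<K. cscale ((-1) ^ i * (of_int l gchoose i)) (Q (m + int i) (l + n - int i) w))"

definition two_weight :: "int \<Rightarrow> (int \<Rightarrow> int \<Rightarrow> 'n::finite fock \<Rightarrow> 'n fock) \<Rightarrow> bool" where
  "two_weight h P \<longleftrightarrow> (\<forall>r s. shifts (h - r - s) (P r s))"

text \<open>The truncated index belongs to the field that acts first: v in P, u in Q. In R it
  belongs to the inner product of u and v, which vanishes for large l. The bound is uniform in the
  other index.\<close>

definition trunc_left :: "int \<Rightarrow> (int \<Rightarrow> int \<Rightarrow> 'n::finite fock \<Rightarrow> 'n fock) \<Rightarrow> bool" where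
  "trunc_left c P \<longleftrightarrow> (\<forall>d w r s. deg_le d w \<longrightarrow> r > d + c \<longrightarrow> P r s w = 0)"

definition trunc_right :: "int \<Rightarrow> (int \<Rightarrow> int \<Rightarrow> 'n::finite fock \<Rightarrow> 'n fock) \<Rightarrow> bool" where
  "trunc_right c P \<longleftrightarrow> (\<forall>d w r s. deg_le d w \<longrightarrow> s > d + c \<longrightarrow> P r s w = 0)"

text \<open>\<open>h\<close> and \<open>c\<close> bound degrees and truncations, so that the next
  operation again leads to finite sums. The identity is asked for all large cut-offs, where by
  truncation its three sums no longer depend on \<open>K\<close>.\<close>

definition borcherds :: "int \<Rightarrow> int \<Rightarrow> (int \<Rightarrow> int \<Rightarrow> 'n::finite fock \<Rightarrow> 'n fock) \<Rightarrow>
    (int \<Rightarrow> int \<Rightarrow> 'n fock \<Rightarrow> 'n fock) \<Rightarrow> (int \<Rightarrow> int \<Rightarrow> 'n fock \<Rightarrow> 'n fock) \<Rightarrow> bool" where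
  "borcherds h c P Q R \<longleftrightarrow> two_weight h P \<and> two_weight h Q \<and> two_weight h R \<and>
     trunc_right c P \<and> trunc_left c Q \<and> trunc_left c R \<and>
     (\<forall>l m n w. \<forall>\<^sub>F K in sequentially. borcherds_at K P Q R l m n w)"

lemma two_weight_mono: "two_weight h P \<Longrightarrow> h \<le> h' \<Longrightarrow> two_weight h' P"
  unfolding two_weight_def by (meson diff_right_mono shifts_mono)

lemma trunc_left_mono: "trunc_left c P \<Longrightarrow> c \<le> c' \<Longrightarrow> trunc_left c' P"
  unfolding trunc_left_def by (meson add_left_mono order.strict_trans1)

lemma trunc_right_mono: "trunc_right c P \<Longrightarrow> c \<le> c' \<Longrightarrow> trunc_right c' P"
  unfolding trunc_right_def by (meson add_left_mono order.strict_trans1)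

lemma borcherds_mono: "borcherds h c P Q R \<Longrightarrow> h \<le> h' \<Longrightarrow> c \<le> c' \<Longrightarrow> borcherds h' c' P Q R"
  unfolding borcherds_def using two_weight_mono trunc_left_mono trunc_right_mono by blast

lemma borcherds_add:
  assumes "borcherds h c P Q R" "borcherds h c P' Q' R'"
  shows "borcherds h c (\<lambda>r s w. P r s w + P' r s w) (\<lambda>r s w. Q r s w + Q' r s w) (\<lambda>r s w. R r s w + R' r s w)"
  unfolding borcherds_def
proof (intro conjI allI)
  fix l m n w
  have "\<forall>\<^sub>F K in sequentially. borcherds_at K P Q R l m n w"
    "\<forall>\<^sub>F K in sequentially. borcherds_at K P' Q' R' l m n w"
    using assms by (auto simp: borcherds_def)
  then show "\<forall>\<^sub>F K in sequentially. borcherds_at K (\<lambda>r s w. P r s w + P' r s w)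
      (\<lambda>r s w. Q r s w + Q' r s w) (\<lambda>r s w. R r s w + R' r s w) l m n w"
    by eventually_elim (simp add: borcherds_at_def cvec.scale_right_distrib sum.distrib)
qed (use assms in \<open>auto simp: borcherds_def two_weight_def trunc_left_def trunc_right_def intro: shifts_add\<close>)

lemma borcherds_cscale:
  assumes "borcherds h c P Q R"
  shows "borcherds h c (\<lambda>r s w. cscale a (P r s w)) (\<lambda>r s w. cscale a (Q r s w)) (\<lambda>r s w. cscale a (R r s w))"
  unfolding borcherds_def
proof (intro conjI allI)
  fix l m n w
  have *: "cscale c (cscale a v) = cscale a (cscale c v)" for c and v :: "'a fock" by (simp add: mult.commute)
  have "\<forall>\<^sub>F K in sequentially. borcherds_at K P Q R l m n w"
    using assms by (auto simp: borcherds_def)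
  then show "\<forall>\<^sub>F K in sequentially. borcherds_at K (\<lambda>r s w. cscale a (P r s w))
      (\<lambda>r s w. cscale a (Q r s w)) (\<lambda>r s w. cscale a (R r s w)) l m n w"
    by eventually_elim
      (simp only: borcherds_at_def * cvec.scale_sum_right [symmetric] cvec.scale_right_diff_distrib [symmetric])
qed (use assms in \<open>auto simp: borcherds_def two_weight_def trunc_left_def trunc_right_def intro: shifts_cscale\<close>)

lemma borcherds_zero: "borcherds h c (\<lambda>r s w. 0) (\<lambda>r s w. 0) (\<lambda>r s w. 0)"
  by (simp add: borcherds_def two_weight_def trunc_left_def trunc_right_def borcherds_at_def shifts_zero)

text \<open>Multiplication by \<open>(z - w) ^ -N\<close>, expanded in the three domains.\<close>

definition dp :: "nat \<Rightarrow> (int \<Rightarrow> int \<Rightarrow> 'n fock \<Rightarrow> 'n fock) \<Rightarrow> int \<Rightarrow> int \<Rightarrow> 'n fock \<Rightarrow> 'n fock" where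
  "dp N P r s w = Sum_any (\<lambda>i::nat. cscale ((-1) ^ i * (of_int (- int N) gchoose i)) (P (r - int N - int i) (s + int i) w))"

definition dq :: "nat \<Rightarrow> (int \<Rightarrow> int \<Rightarrow> 'n fock \<Rightarrow> 'n fock) \<Rightarrow> int \<Rightarrow> int \<Rightarrow> 'n fock \<Rightarrow> 'n fock" where
  "dq N Q r s w = cscale ((-1) ^ N) (Sum_any (\<lambda>i::nat. cscale ((-1) ^ i * (of_int (- int N) gchoose i)) (Q (r + int i) (s - int N - int i) w)))"

lemma dp_eq_sum:
  assumes "trunc_right c P" "deg_le d w" "int K > d + c - s"
  shows "dp N P r s w = (\<Sum>i<K. cscale ((-1) ^ i * (of_int (- int N) gchoose i)) (P (r - int N - int i) (s + int i) w))"
  unfolding dp_def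
proof (rule Sum_any_eq_sum_nat)
  fix i assume "K \<le> i"
  then have "s + int i > d + c" using assms(3) by simp
  then show "cscale ((-1) ^ i * (of_int (- int N) gchoose i)) (P (r - int N - int i) (s + int i) w) = 0"
    using assms(1,2) by (auto simp: trunc_right_def)
qed

lemma dq_eq_sum:
  assumes "trunc_left c Q" "deg_le d w" "int K > d + c - r"
  shows "dq N Q r s w = cscale ((-1) ^ N) (\<Sum>i<K. cscale ((-1) ^ i * (of_int (- int N) gchoose i)) (Q (r + int i) (s - int N - int i) w))"
  unfolding dq_def
proof (rule arg_cong[of _ _ "cscale _"], rule Sum_any_eq_sum_nat)
  fix i assume "K \<le> i"
  then have "r + int i > d + c" using assms(3) by simp
  then show "cscale ((-1) ^ i * (of_int (- int N) gchoose i)) (Q (r + int i) (s - int N - int i) w) = 0"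
    using assms(1,2) by (auto simp: trunc_left_def)
qed

text \<open>The identity at l is the old one at l - N: by Vandermonde the coefficients of (z - w)^l
  convolved with those of (z - w)^(-N) are those of (z - w)^(l - N), for |z| > |w| as well as for
  |z| < |w|, and in R the division is a plain shift of the first index.\<close>

lemma borcherds_div:
  fixes P Q R :: "int \<Rightarrow> int \<Rightarrow> 'n::finite fock \<Rightarrow> 'n fock"
  assumes B: "borcherds h c P Q R"
  shows "borcherds (h + int N) (c + int N) (dp N P) (dq N Q) (\<lambda>r s. R (r - int N) s)"
  unfolding borcherds_def
proof (intro conjI allI)
  have P: "two_weight h P" "trunc_right c P" and Q: "two_weight h Q" "trunc_left c Q"
    and R: "two_weight h R" "trunc_left c R"
    using B by (auto simp: borcherds_def)
  show "two_weight (h + int N) (dp N P)"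
    unfolding two_weight_def dp_def
  proof (intro allI shifts_Sum_any shifts_cscale)
    fix r s i
    show "shifts (h + int N - r - s) (P (r - int N - int i) (s + int i))"
      using P(1)[unfolded two_weight_def, rule_format, of "r - int N - int i" "s + int i"]
      by (simp add: algebra_simps)
  next
    fix r s d
    show "\<exists>A. finite A \<and> (\<forall>i w. i \<notin> A \<longrightarrow> deg_le d w \<longrightarrow>
        cscale ((-1) ^ i * (of_int (- int N) gchoose i)) (P (r - int N - int i) (s + int i) w) = 0)"
      by (rule exI[of _ "{..nat (d + c - s)}"])
        (use P(2) in \<open>auto simp: trunc_right_def not_le nat_less_iff\<close>)
  qed
  show "two_weight (h + int N) (dq N Q)"
    unfolding two_weight_def dq_def
  proof (intro allI shifts_cscale shifts_Sum_any)
    fix r s i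
    show "shifts (h + int N - r - s) (Q (r + int i) (s - int N - int i))"
      using Q(1)[unfolded two_weight_def, rule_format, of "r + int i" "s - int N - int i"]
      by (simp add: algebra_simps)
  next
    fix r s d
    show "\<exists>A. finite A \<and> (\<forall>i w. i \<notin> A \<longrightarrow> deg_le d w \<longrightarrow>
        cscale ((-1) ^ i * (of_int (- int N) gchoose i)) (Q (r + int i) (s - int N - int i) w) = 0)"
      by (rule exI[of _ "{..nat (d + c - r)}"])
        (use Q(2) in \<open>auto simp: trunc_left_def not_le nat_less_iff\<close>)
  qed
  show "two_weight (h + int N) (\<lambda>r s. R (r - int N) s)"
    unfolding two_weight_def
  proof (intro allI)
    fix r s show "shifts (h + int N - r - s) (R (r - int N) s)"
      using R(1)[unfolded two_weight_def, rule_format, of "r - int N" s] by (simp add: algebra_simps)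
  qed
  show "trunc_right (c + int N) (dp N P)"
    using P(2) by (auto simp: trunc_right_def dp_def)
  show "trunc_left (c + int N) (dq N Q)"
    using Q(2) by (auto simp: trunc_left_def dq_def)
  show "trunc_left (c + int N) (\<lambda>r s. R (r - int N) s)"
    using R(2) by (auto simp: trunc_left_def)
  fix l m n :: int and w :: "'n fock"
  obtain d where d: "d \<ge> 0" "deg_le d w" using deg_le_ex by blast
  have "\<forall>\<^sub>F K in sequentially. borcherds_at K P Q R (l - int N) m n w"
    using B by (auto simp: borcherds_def)
  moreover have "\<forall>\<^sub>F K in sequentially. int K > \<bar>d\<bar> + \<bar>c\<bar> + \<bar>n\<bar> + \<bar>m\<bar>"
    using eventually_ge_at_top[of "nat (\<bar>d\<bar> + \<bar>c\<bar> + \<bar>n\<bar> + \<bar>m\<bar> + 1)"] by eventually_elim linarith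
  ultimately show "\<forall>\<^sub>F K in sequentially. borcherds_at K (dp N P) (dq N Q) (\<lambda>r s. R (r - int N) s) l m n w"
  proof eventually_elim
    case (elim K)
    let ?e = "\<lambda>j. (-1) ^ j * (of_int (- int N) gchoose j) :: complex"
    have 1: "dp N P (l + m - int i) (n + int i) w =
        (\<Sum>j<K. cscale (?e j) (P (l - int N + m - int (i + j)) (n + int (i + j)) w))" for i
      by (subst dp_eq_sum[OF P(2) d(2), where K = K]) (use elim(2) in \<open>auto simp: algebra_simps\<close>)
    have 2: "dq N Q (m + int i) (l + n - int i) w =
        cscale ((-1) ^ N) (\<Sum>j<K. cscale (?e j) (Q (m + int (i + j)) (l - int N + n - int (i + j)) w))" for i
      by (subst dq_eq_sum[OF Q(2) d(2), where K = K]) (use elim(2) in \<open>auto simp: algebra_simps\<close>)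
    have z: "P (l - int N + m - int t) (n + int t) w = 0" "Q (m + int t) (l - int N + n - int t) w = 0" if "t \<ge> K" for t
      using P(2) Q(2) d elim(2) that by (auto simp: trunc_left_def trunc_right_def)
    have c: "(\<Sum>i\<le>t. ((-1) ^ i * (of_int l gchoose i)) * ?e (t - i)) = (-1) ^ t * (of_int (l - int N) gchoose t :: complex)" for t
      unfolding gbinomial_convolution_signed by simp
    have A: "(\<Sum>i<K. cscale ((-1) ^ i * (of_int l gchoose i)) (dp N P (l + m - int i) (n + int i) w)) =
        (\<Sum>t<K. cscale ((-1) ^ t * (of_int (l - int N) gchoose t)) (P (l - int N + m - int t) (n + int t) w))"
      unfolding 1 cvec.scale_sum_right cvec.scale_scale
      by (subst sum_sum_convolution[where h = "\<lambda>t. P (l - int N + m - int t) (n + int t) w"]; (simp only: c | simp only: z))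
    have B: "(\<Sum>i<K. cscale ((-1) ^ i * (of_int l gchoose i))
          (\<Sum>j<K. cscale (?e j) (Q (m + int (i + j)) (l - int N + n - int (i + j)) w))) =
        (\<Sum>t<K. cscale ((-1) ^ t * (of_int (l - int N) gchoose t)) (Q (m + int t) (l - int N + n - int t) w))"
      unfolding cvec.scale_sum_right cvec.scale_scale
      by (subst sum_sum_convolution[where h = "\<lambda>t. Q (m + int t) (l - int N + n - int t) w"]; (simp only: c | simp only: z))
    have sg: "(-1) powi l * (-1) ^ N = ((-1) powi (l - int N) :: complex)"
      by (simp add: power_int_diff divide_simps flip: power_mult_distrib)
    have C: "cscale ((-1) powi l) (\<Sum>i<K. cscale ((-1) ^ i * (of_int l gchoose i)) (dq N Q (m + int i) (l + n - int i) w)) =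
        cscale ((-1) powi (l - int N)) (\<Sum>t<K. cscale ((-1) ^ t * (of_int (l - int N) gchoose t)) (Q (m + int t) (l - int N + n - int t) w))"
    proof -
      have "(\<Sum>i<K. cscale (E i) (cscale ((-1) ^ N) (X i))) = cscale ((-1) ^ N) (\<Sum>i<K. cscale (E i) (X i))"
        for E and X :: "nat \<Rightarrow> 'n fock" by (simp add: cvec.scale_sum_right mult.commute)
      then show ?thesis unfolding 2 by (simp only: B cvec.scale_scale sg)
    qed
    show ?case
      using elim(1) unfolding borcherds_at_def A C by (simp add: algebra_simps)
  qed
qed

text \<open>The residue theorem for z^m (z - w)^l, whose poles lie at 0, w and infinity at most: the
  residue at z = w is the coefficient of 1/z in the expansion for |z| > |w| minus the one for |z| <
  |w|. The cases record which of the three binomials vanish.\<close>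

lemma borcherds_base_coeff:
  fixes l m :: int
  shows "(if l < 0 then of_int m gchoose nat (- 1 - l) else 0) =
    (if l + m + 1 \<ge> 0 then (-1) ^ nat (l + m + 1) * (of_int l gchoose nat (l + m + 1)) else 0) -
    (-1) powi l * (if m < 0 then (-1) ^ nat (- 1 - m) * (of_int l gchoose nat (- 1 - m)) else (0::complex))"
proof -
  have gz: "(of_int x gchoose k :: complex) = 0" if "x \<ge> 0" "int k > x" for x k
  proof -
    have "(of_nat (nat x) gchoose k :: complex) = of_nat (nat x choose k)" by (rule binomial_gbinomial [symmetric])
    then show ?thesis using that by (simp add: binomial_eq_0)
  qed
  have gs: "(of_int x gchoose j :: complex) = of_int x gchoose k" if "x = int j + int k" for x j k
  proof -
    have "(of_nat (j + k) gchoose j :: complex) = of_nat (j + k) gchoose k"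
      by (metis add_diff_cancel_left' binomial_gbinomial binomial_symmetric le_add1)
    then show ?thesis using that by simp
  qed
  have gn: "(of_int x gchoose k :: complex) = (-1) ^ k * (of_int (int k - x - 1) gchoose k)" for x k
    by (subst gbinomial_negated_upper) simp
  have pw: "((-1::complex) powi l) = (if even l then 1 else -1)" for l by simp
  have pn: "((-1::complex) ^ n) = (if even n then 1 else -1)" for n by simp
  consider (1) "m \<ge> 0" "l \<ge> 0" | (2) "m \<ge> 0" "l < 0" "l + m + 1 < 0" | (3) "m \<ge> 0" "l < 0" "l + m + 1 \<ge> 0"
    | (4) "m < 0" "l \<ge> 0" "l + m + 1 < 0" | (5) "m < 0" "l \<ge> 0" "l + m + 1 \<ge> 0" | (6) "m < 0" "l < 0" by linarith
  then show ?thesis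
  proof cases
    case 1 then show ?thesis by (simp add: gz)
  next
    case 2 then show ?thesis by (simp add: gz)
  next
    case 3
    have "(of_int l gchoose nat (l + m + 1) :: complex) = (-1) ^ nat (l + m + 1) * (of_int m gchoose nat (l + m + 1))"
      using 3 by (subst gn) simp
    moreover have "(of_int m gchoose nat (l + m + 1) :: complex) = of_int m gchoose nat (- 1 - l)"
      by (rule gs) (use 3 in simp)
    ultimately show ?thesis using 3 by (simp flip: mult.assoc power_mult_distrib)
  next
    case 4 then show ?thesis by (simp add: gz)
  next
    case 5
    have "(of_int l gchoose nat (l + m + 1) :: complex) = of_int l gchoose nat (- 1 - m)"
      by (rule gs) (use 5 in simp)
    moreover have "(-1::complex) ^ nat (l + m + 1) = (-1) powi l * (-1) ^ nat (- 1 - m)"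
      using 5 by (simp add: pw pn even_nat_iff)
    ultimately show ?thesis using 5 by simp
  next
    case 6
    have 1: "(of_int m gchoose nat (- 1 - l) :: complex) = (-1) ^ nat (- 1 - l) * (of_int (- l - m - 2) gchoose nat (- 1 - l))"
      using 6 by (subst gn) (simp add: algebra_simps)
    have 2: "(of_int l gchoose nat (- 1 - m) :: complex) = (-1) ^ nat (- 1 - m) * (of_int (- l - m - 2) gchoose nat (- 1 - m))"
      using 6 by (subst gn) (simp add: algebra_simps)
    have 3: "(of_int (- l - m - 2) gchoose nat (- 1 - l) :: complex) = of_int (- l - m - 2) gchoose nat (- 1 - m)"
      by (rule gs) (use 6 in simp)
    have 4: "(-1::complex) ^ nat (- 1 - l) = - ((-1) powi l)"
      using 6 by (simp add: pw pn even_nat_iff)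
    have 5: "(-1::complex) ^ nat (- 1 - m) * ((-1) ^ nat (- 1 - m) * x) = x" for x
      by (simp flip: mult.assoc power_mult_distrib)
    show ?thesis using 6 by (simp only: 1 2 3 4 5 if_True if_False) simp
  qed
qed

lemma sum_delta_shift:
  fixes f :: "nat \<Rightarrow> 'b::comm_monoid_add"
  assumes "x < int K"
  shows "(\<Sum>i<K. if int i = x then f i else 0) = (if x \<ge> 0 then f (nat x) else 0)"
proof (cases "x \<ge> 0")
  case True
  then have "(\<Sum>i<K. if int i = x then f i else 0) = (\<Sum>i<K. if i = nat x then f i else 0)"
    by (intro sum.cong refl) auto
  then show ?thesis using True assms by (simp add: nat_less_iff)
next
  case False
  then have "(if int i = x then f i else 0) = 0" for i by auto
  then show ?thesis using False by simp
qed

text \<open>The case where u is the vacuum, of which only the mode -1 survives. The induction on u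
  starts here, with an arbitrary field in the second variable.\<close>

lemma borcherds_unit:
  fixes G :: "int \<Rightarrow> 'n::finite fock \<Rightarrow> 'n fock"
  assumes G: "weight_field h G"
  shows "borcherds (h + 1) \<bar>h\<bar> (\<lambda>r s w. if r = -1 then G s w else 0) (\<lambda>r s w. if r = -1 then G s w else 0)
    (\<lambda>r s w. if r = -1 then G s w else 0)"
proof -
  define P where "P = (\<lambda>(r::int) s w. if r = -1 then G s w else 0)"
  have "two_weight (h + 1) P"
    unfolding two_weight_def P_def
  proof (intro allI)
    fix r s show "shifts (h + 1 - r - s) (\<lambda>w. if r = - 1 then G s w else 0)"
      using shifts_mono[OF G[unfolded weight_field_def, rule_format, of s], of "h + 1 - r - s"]
      by (cases "r = -1") (auto intro: shifts_zero)
  qed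
  moreover have "trunc_right \<bar>h\<bar> P"
    unfolding trunc_right_def P_def using shifts_eq_0[OF G[unfolded weight_field_def, rule_format]] by fastforce
  moreover have "trunc_left \<bar>h\<bar> P"
    unfolding trunc_left_def P_def
  proof (intro allI impI)
    fix d r s and w :: "'n fock" assume "deg_le d w" "r > d + \<bar>h\<bar>"
    then show "(if r = - 1 then G s w else 0) = 0"
      using deg_le_neg[of d w] clinear_0[OF shifts_linear[OF G[unfolded weight_field_def, rule_format]]]
      by (cases "d < 0") auto
  qed
  moreover have "\<forall>\<^sub>F K in sequentially. borcherds_at K P P P l m n w" for l m n w
  proof -
    have "\<forall>\<^sub>F K in sequentially. int K > \<bar>l\<bar> + \<bar>m\<bar> + 2"
      using eventually_ge_at_top[of "nat (\<bar>l\<bar> + \<bar>m\<bar> + 3)"] by eventually_elim linarith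
    then show ?thesis
    proof eventually_elim
      case (elim K)
      let ?G = "G (l + m + n + 1) w"
      have "(\<Sum>i<K. cscale (of_int m gchoose i) (P (l + int i) (m + n - int i) w)) =
          (\<Sum>i<K. if int i = - 1 - l then cscale (of_int m gchoose i) ?G else 0)"
        by (intro sum.cong refl) (auto simp: P_def intro!: arg_cong2[of _ _ _ _ G] arg_cong[of _ _ "\<lambda>n. G n w"])
      also have "\<dots> = cscale (if l < 0 then of_int m gchoose nat (- 1 - l) else 0) ?G"
        by (subst sum_delta_shift) (use elim in auto)
      finally have 1: "(\<Sum>i<K. cscale (of_int m gchoose i) (P (l + int i) (m + n - int i) w)) =
          cscale (if l < 0 then of_int m gchoose nat (- 1 - l) else 0) ?G" .
      have "(\<Sum>i<K. cscale ((-1) ^ i * (of_int l gchoose i)) (P (l + m - int i) (n + int i) w)) =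
          (\<Sum>i<K. if int i = l + m + 1 then cscale ((-1) ^ i * (of_int l gchoose i)) ?G else 0)"
        by (intro sum.cong refl) (auto simp: P_def algebra_simps)
      also have "\<dots> = cscale (if l + m + 1 \<ge> 0 then (-1) ^ nat (l + m + 1) * (of_int l gchoose nat (l + m + 1)) else 0) ?G"
        by (subst sum_delta_shift) (use elim in auto)
      finally have 2: "(\<Sum>i<K. cscale ((-1) ^ i * (of_int l gchoose i)) (P (l + m - int i) (n + int i) w)) =
          cscale (if l + m + 1 \<ge> 0 then (-1) ^ nat (l + m + 1) * (of_int l gchoose nat (l + m + 1)) else 0) ?G" .
      have "(\<Sum>i<K. cscale ((-1) ^ i * (of_int l gchoose i)) (P (m + int i) (l + n - int i) w)) =
          (\<Sum>i<K. if int i = - 1 - m then cscale ((-1) ^ i * (of_int l gchoose i)) ?G else 0)"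
        by (intro sum.cong refl) (auto simp: P_def intro!: arg_cong[of _ _ "\<lambda>n. G n w"])
      also have "\<dots> = cscale (if m < 0 then (-1) ^ nat (- 1 - m) * (of_int l gchoose nat (- 1 - m)) else 0) ?G"
        by (subst sum_delta_shift) (use elim in auto)
      finally have 3: "(\<Sum>i<K. cscale ((-1) ^ i * (of_int l gchoose i)) (P (m + int i) (l + n - int i) w)) =
          cscale (if m < 0 then (-1) ^ nat (- 1 - m) * (of_int l gchoose nat (- 1 - m)) else 0) ?G" .
      show ?case unfolding borcherds_at_def 1 2 3 borcherds_base_coeff[of l m]
        by (simp only: cvec.scale_scale cvec.scale_left_diff_distrib)
    qed
  qed
  ultimately show ?thesis unfolding borcherds_def P_def by blast
qed

subsection \<open>Wrapping in the first variable\<close>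

definition wrap_left :: "(int \<Rightarrow> 'n fock \<Rightarrow> 'n fock) \<Rightarrow> nat \<Rightarrow> (int \<Rightarrow> int \<Rightarrow> 'n fock \<Rightarrow> 'n fock) \<Rightarrow>
    int \<Rightarrow> int \<Rightarrow> 'n fock \<Rightarrow> 'n fock" where
  "wrap_left a k P r s = wrap a k (\<lambda>r. P r s) r"

text \<open>The Taylor expansion of the wrapping field at \<open>w + (z - w)\<close>.\<close>

definition wrap_iter :: "(int \<Rightarrow> 'n fock \<Rightarrow> 'n fock) \<Rightarrow> nat \<Rightarrow> (int \<Rightarrow> int \<Rightarrow> 'n fock \<Rightarrow> 'n fock) \<Rightarrow>
    int \<Rightarrow> int \<Rightarrow> 'n fock \<Rightarrow> 'n fock" where
  "wrap_iter a k R l n w = Sum_any (\<lambda>j::nat. cscale (of_nat ((k + j) choose j)) (wrap a (k + j) (R (l + int j)) n w))"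

text \<open>The j-th Taylor coefficient of the k-th divided derivative is (k+j choose j) times the
  (k+j)-th divided derivative; on the level of modes this is trinomial revision.\<close>

lemma wrap_coeff:
  fixes q :: int
  shows "of_nat ((k + j) choose j) * (of_int (- q - 1) gchoose (k + j)) =
    (of_int (- q - 1) gchoose k) * (of_int (- q - 1 - int k) gchoose j :: complex)"
proof -
  have "(of_nat ((k + j) choose j) :: complex) = of_nat (k + j) gchoose k"
    by (metis add_diff_cancel_left' binomial_gbinomial binomial_symmetric le_add1)
  then show ?thesis
    using gbinomial_trinomial_revision[of k "k + j" "of_int (- q - 1) :: complex"] by (simp add: algebra_simps)
qed

text \<open>A creation mode is applied after the three sums and an annihilation mode before them, so
  the identity is used at \<open>w\<close> or at \<open>a q w\<close> respectively.\<close>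

lemma borcherds_at_app:
  assumes a: "modes a" and "q < 0 \<Longrightarrow> borcherds_at K P Q R l m n w" "\<not> q < 0 \<Longrightarrow> borcherds_at K P Q R l m n (a q w)"
  shows "borcherds_at K (\<lambda>r s. app a q (P r s)) (\<lambda>r s. app a q (Q r s)) (\<lambda>r s. app a q (R r s)) l m n w"
proof (cases "q < 0")
  case True
  note lin = clinear_sum[OF modes_linear[OF a]] clinear_cscale[OF modes_linear[OF a]] clinear_diff[OF modes_linear[OF a]]
  show ?thesis
    using arg_cong[OF assms(2)[OF True, unfolded borcherds_at_def], of "a q"] True
    by (simp add: borcherds_at_def app_def lin)
next
  case False
  then show ?thesis using assms(3) by (simp add: borcherds_at_def app_def)
qed

lemma wrap_left_eq_sum:
  assumes a: "modes a" and P: "two_weight h P" and w: "deg_le d w"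
    and M: "M \<ge> d" "M \<ge> 0" "M \<ge> d + h - r - s + int k"
  shows "wrap_left a k P r s w =
    (\<Sum>q\<in>{-M-1..M}. cscale (of_int (- q - 1) gchoose k) (app a q (P (r - q - int k - 1) s) w))"
  unfolding wrap_left_def
proof (rule wrap_eq_sum[OF a _ w M(1,2), where h = "h - s"])
  show "shifts (h - s - n) (P n s)" for n
    using P by (simp add: two_weight_def algebra_simps)
qed (use M in simp)

lemma wrap_iter_eq_sum:
  assumes a: "modes a" and R: "two_weight h R" "trunc_left c R" and w: "deg_le d w"
    and M: "M \<ge> d" "M \<ge> 0" "M \<ge> d + h - l - n + int k" and K: "int K > d + c - l"
  shows "wrap_iter a k R l n w = (\<Sum>q\<in>{-M-1..M}. \<Sum>j<K.
    cscale ((of_int (- q - 1) gchoose k) * (of_int (- q - 1 - int k) gchoose j))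
      (app a q (R (l + int j) (n - q - int k - 1 - int j)) w))"
proof -
  have W: "wrap a (k + j) (R (l + int j)) n w = (\<Sum>q\<in>{-M-1..M}. cscale (of_int (- q - 1) gchoose (k + j))
      (app a q (R (l + int j) (n - q - int k - 1 - int j)) w))" for j
    by (subst wrap_eq_sum[OF a R(1)[unfolded two_weight_def, rule_format] w M(1,2)])
      (use M(3) in \<open>simp_all add: diff_diff_eq add_ac\<close>)
  have "wrap_iter a k R l n w = (\<Sum>j<K. cscale (of_nat ((k + j) choose j)) (wrap a (k + j) (R (l + int j)) n w))"
    unfolding wrap_iter_def
  proof (rule Sum_any_eq_sum_nat)
    fix j assume j: "K \<le> j"
    have z: "R (l + int j) n' v = 0" if "deg_le d v" for n' v
      using R(2) that j K unfolding trunc_left_def by (smt (verit, best) of_nat_mono)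
    have "app a q (R (l + int j) (n - q - int k - 1 - int j)) w = 0" for q
    proof (cases "q < 0")
      case True
      then show ?thesis using z[OF w] clinear_0[OF modes_linear[OF a]] by (simp add: app_def)
    next
      case False
      then have "deg_le d (a q w)" by (intro shifts_deg[OF modes_shifts[OF a] w]) simp
      then show ?thesis using False z by (simp add: app_def)
    qed
    then show "cscale (of_nat ((k + j) choose j)) (wrap a (k + j) (R (l + int j)) n w) = 0"
      unfolding W by simp
  qed
  also have "\<dots> = (\<Sum>q\<in>{-M-1..M}. \<Sum>j<K. cscale ((of_int (- q - 1) gchoose k) * (of_int (- q - 1 - int k) gchoose j))
      (app a q (R (l + int j) (n - q - int k - 1 - int j)) w))"
    unfolding W cvec.scale_sum_right cvec.scale_scale wrap_coeff by (rule sum.swap)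
  finally show ?thesis .
qed

text \<open>Mode by mode, wrapping multiplies by z^p with p = -q - 1 - k and places
  \<open>a q\<close> on the far left or the far right, so the identity at m + p gives the wrapped
  one at m. In R the power z^p is expanded in w and z - w, and Vandermonde merges the exponents m
  and p.\<close>

lemma borcherds_wrap:
  fixes P Q R :: "int \<Rightarrow> int \<Rightarrow> 'n::finite fock \<Rightarrow> 'n fock"
  assumes a: "modes a" and B: "borcherds h c P Q R"
  shows "borcherds (h + int k + 1) (c + int k + 1) (wrap_left a k P) (wrap_left a k Q) (wrap_iter a k R)"
  unfolding borcherds_def
proof (intro conjI allI)
  have P: "two_weight h P" "trunc_right c P" and Q: "two_weight h Q" "trunc_left c Q"
    and R: "two_weight h R" "trunc_left c R"
    using B by (auto simp: borcherds_def)
  have ad: "deg_le (d - q) (a q w)" if "deg_le d w" for d q w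
    by (rule shifts_deg[OF modes_shifts[OF a] that]) simp
  have a0: "a q 0 = 0" for q by (rule clinear_0[OF modes_linear[OF a]])
  have wl: "two_weight (h + int k + 1) (wrap_left a k X)" if "two_weight h X" for X
    unfolding two_weight_def wrap_left_def
  proof (intro allI)
    fix r s
    have "shifts (h - s + int k + 1 - r) (wrap a k (\<lambda>r. X r s) r)"
      by (rule wrap_shifts[OF a]) (use that in \<open>simp add: two_weight_def algebra_simps\<close>)
    then show "shifts (h + int k + 1 - r - s) (wrap a k (\<lambda>r. X r s) r)" by (simp add: algebra_simps)
  qed
  show "two_weight (h + int k + 1) (wrap_left a k P)" "two_weight (h + int k + 1) (wrap_left a k Q)"
    by (rule wl, fact)+
  have iter: "wrap a (k + j) (R (l + int j)) n w = 0" if "deg_le d w" "l + int j > d + c" for j l n d w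
  proof -
    have "app a q (R (l + int j) n') w = 0" for q n'
      using R(2) that ad[OF that(1), of q] unfolding trunc_left_def
      by (cases "q < 0") (auto simp: app_def a0)
    then show ?thesis by (simp add: wrap_def)
  qed
  show "two_weight (h + int k + 1) (wrap_iter a k R)"
    unfolding two_weight_def wrap_iter_def
  proof (intro allI shifts_Sum_any shifts_cscale)
    fix r s j
    have "shifts (h - (r + int j) + int (k + j) + 1 - s) (wrap a (k + j) (R (r + int j)) s)"
      by (rule wrap_shifts[OF a]) (use R(1) in \<open>simp add: two_weight_def\<close>)
    then show "shifts (h + int k + 1 - r - s) (wrap a (k + j) (R (r + int j)) s)" by (simp add: algebra_simps)
  next
    fix r s d
    show "\<exists>A. finite A \<and> (\<forall>j w. j \<notin> A \<longrightarrow> deg_le d w \<longrightarrow>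
        cscale (of_nat ((k + j) choose j)) (wrap a (k + j) (R (r + int j)) s w) = 0)"
      by (rule exI[of _ "{..nat (d + c - r)}"]) (use iter in \<open>auto simp: not_le nat_less_iff\<close>)
  qed
  show "trunc_right (c + int k + 1) (wrap_left a k P)"
    unfolding trunc_right_def
  proof (intro allI impI)
    fix d r s and w :: "'n fock" assume w: "deg_le d w" and s: "d + (c + int k + 1) < s"
    have "app a q (P r' s) w = 0" for q r'
      using P(2) w ad[OF w, of q] s unfolding trunc_right_def
      by (cases "q < 0") (auto simp: app_def a0)
    then show "wrap_left a k P r s w = 0" by (simp add: wrap_left_def wrap_def)
  qed
  show "trunc_left (c + int k + 1) (wrap_left a k Q)"
    unfolding trunc_left_def
  proof (intro allI impI)
    fix d r s and w :: "'n fock" assume w: "deg_le d w" and r: "d + (c + int k + 1) < r"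
    have "app a q (Q (r - q - int k - 1) s) w = 0" for q
      using Q(2) w ad[OF w, of q] r unfolding trunc_left_def
      by (cases "q < 0") (auto simp: app_def a0)
    then show "wrap_left a k Q r s w = 0" by (simp add: wrap_left_def wrap_def)
  qed
  show "trunc_left (c + int k + 1) (wrap_iter a k R)"
    unfolding trunc_left_def
  proof (intro allI impI)
    fix d r s and w :: "'n fock" assume w: "deg_le d w" and r: "d + (c + int k + 1) < r"
    show "wrap_iter a k R r s w = 0"
      unfolding wrap_iter_def using iter[OF w] r by simp
  qed
  fix l m n :: int and w :: "'n fock"
  obtain d where d: "d \<ge> 0" "deg_le d w" using deg_le_ex by blast
  \<comment> \<open>A window of modes that serves all three wrapped operators. As it is finite, a
    single cut-off \<open>K\<close> can be chosen for all modes in it.\<close>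
  define M where "M = d + \<bar>h\<bar> + \<bar>l\<bar> + \<bar>m\<bar> + \<bar>n\<bar> + int k"
  have M0: "M \<ge> d" "M \<ge> 0" using d by (auto simp: M_def)
  have "\<forall>\<^sub>F K in sequentially. \<forall>q\<in>{-M-1..M}.
      borcherds_at K P Q R l (m - q - int k - 1) n w \<and> borcherds_at K P Q R l (m - q - int k - 1) n (a q w)"
    using B by (intro eventually_ball_finite ballI eventually_conj) (auto simp: borcherds_def)
  moreover have "\<forall>\<^sub>F K in sequentially. int K > \<bar>d\<bar> + \<bar>c\<bar> + \<bar>l\<bar>"
    using eventually_ge_at_top[of "nat (\<bar>d\<bar> + \<bar>c\<bar> + \<bar>l\<bar> + 1)"] by eventually_elim linarith
  ultimately show "\<forall>\<^sub>F K in sequentially. borcherds_at K (wrap_left a k P) (wrap_left a k Q) (wrap_iter a k R) l m n w"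
  proof eventually_elim
    case (elim K)
    define C :: "int \<Rightarrow> complex" where "C = (\<lambda>q. of_int (- q - 1) gchoose k)"
    \<comment> \<open>The exponent of z that accompanies the mode \<open>a q\<close> in the k-th
      divided derivative.\<close>
    define p where "p = (\<lambda>q. - q - 1 - int k)"
    have bq: "borcherds_at K (\<lambda>r s. app a q (P r s)) (\<lambda>r s. app a q (Q r s)) (\<lambda>r s. app a q (R r s)) l (m + p q) n w"
      if "q \<in> {-M-1..M}" for q
    proof -
      have "m - q - int k - 1 = m + p q" by (simp add: p_def)
      then show ?thesis using elim(1) that by (intro borcherds_at_app[OF a]) metis+
    qed
    have sw: "(\<Sum>i<K. cscale (E i) (\<Sum>q\<in>{-M-1..M}. cscale (C q) (X i q))) =
        (\<Sum>q\<in>{-M-1..M}. cscale (C q) (\<Sum>i<K. cscale (E i) (X i q)))" for E and X :: "nat \<Rightarrow> int \<Rightarrow> 'n fock"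
      unfolding cvec.scale_sum_right by (subst sum.swap) (simp add: mult.commute)
    have "wrap_left a k P (l + m - int i) (n + int i) w =
        (\<Sum>q\<in>{-M-1..M}. cscale (C q) (app a q (P (l + (m + p q) - int i) (n + int i)) w))" for i
      unfolding C_def by (subst wrap_left_eq_sum[OF a P(1) d(2) M0])
        (use d in \<open>auto simp: M_def p_def algebra_simps\<close>)
    note 1 = this
    have "wrap_left a k Q (m + int i) (l + n - int i) w =
        (\<Sum>q\<in>{-M-1..M}. cscale (C q) (app a q (Q (m + p q + int i) (l + n - int i)) w))" for i
      unfolding C_def by (subst wrap_left_eq_sum[OF a Q(1) d(2) M0])
        (use d in \<open>auto simp: M_def p_def algebra_simps\<close>)
    note 2 = this
    have 3: "wrap_iter a k R (l + int i) (m + n - int i) w =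
        (\<Sum>q\<in>{-M-1..M}. cscale (C q) (\<Sum>j<K. cscale (of_int (p q) gchoose j)
          (app a q (R (l + int (i + j)) (m + p q + n - int (i + j))) w)))" for i
    proof -
      have "wrap_iter a k R (l + int i) (m + n - int i) w = (\<Sum>q\<in>{-M-1..M}. \<Sum>j<K.
        cscale (C q * (of_int (- q - 1 - int k) gchoose j))
          (app a q (R (l + int i + int j) (m + n - int i - q - int k - 1 - int j)) w))"
        unfolding C_def
        by (rule wrap_iter_eq_sum[OF a R d(2) M0]) (use elim(2) d in \<open>auto simp: M_def\<close>)
      moreover have "m + n - int i - q - int k - 1 - int j = m + p q + n - int (i + j)" "l + int i + int j = l + int (i + j)" for q j
        by (auto simp: p_def)
      ultimately show ?thesis by (simp only: cvec.scale_sum_right cvec.scale_scale p_def)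
    qed
    have z: "app a q (R (l + int t) n') w = 0" if "t \<ge> K" for t q n'
      using R(2) d(2) ad[OF d(2), of q] elim(2) that unfolding trunc_left_def
      by (cases "q < 0") (auto simp: app_def a0)
    have 4: "(\<Sum>i<K. cscale (of_int m gchoose i) (\<Sum>j<K. cscale (of_int (p q) gchoose j)
          (app a q (R (l + int (i + j)) (m + p q + n - int (i + j))) w))) =
        (\<Sum>i<K. cscale (of_int (m + p q) gchoose i) (app a q (R (l + int i) (m + p q + n - int i)) w))" for q
    proof -
      have c: "(\<Sum>i\<le>t. (of_int m gchoose i) * (of_int (p q) gchoose (t - i))) = (of_int (m + p q) gchoose t :: complex)" for t
        by (simp add: gbinomial_convolution)
      show ?thesis
        unfolding cvec.scale_sum_right cvec.scale_scale
        by (subst sum_sum_convolution[where h = "\<lambda>t. app a q (R (l + int t) (m + p q + n - int t)) w"]; (simp only: c | simp only: z))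
    qed
    have dist: "(\<Sum>q\<in>{-M-1..M}. cscale (C q) (A q)) - cscale x (\<Sum>q\<in>{-M-1..M}. cscale (C q) (D q)) =
        (\<Sum>q\<in>{-M-1..M}. cscale (C q) (A q - cscale x (D q)))" for A D :: "int \<Rightarrow> 'n fock" and x
      by (simp add: cvec.scale_right_diff_distrib sum_subtractf cvec.scale_sum_right mult.commute)
    show ?case
      unfolding borcherds_at_def 1 2 3 sw 4 dist
      by (rule sum.cong[OF refl], rule arg_cong[of _ _ "cscale _"]) (use bq in \<open>simp only: borcherds_at_def\<close>)
  qed
qed

section \<open>Oscillators on a Fock space with given momentum\<close>

text \<open>The momentum enters only through the zero mode, a scalar, so the commutators are the
  same for every \<open>l\<close>; momentum 0 gives back \<open>heis_alpha\<close> on the i-th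
  tensor factor.\<close>

definition osc :: "('n \<Rightarrow> complex) \<Rightarrow> 'n \<Rightarrow> int \<Rightarrow> 'n::finite fock \<Rightarrow> 'n fock" where
  "osc l i n = lin_ext (\<lambda>b.
     if n < 0 then Poly_Mapping.single (b(i := add_mset (nat (- n - 1)) (b i))) 1
     else if n = 0 then Poly_Mapping.single b (l i)
     else Poly_Mapping.single (b(i := b i - {#nat (n - 1)#})) (of_int n * of_nat (count (b i) (nat (n - 1)))))"

lemma osc_linear: "clinear (osc l i n)"
  unfolding osc_def by (rule lin_ext_linear)

lemma osc_neg: "n < 0 \<Longrightarrow> osc l i n (Poly_Mapping.single b c) =
    Poly_Mapping.single (b(i := add_mset (nat (- n - 1)) (b i))) c"
  by (simp add: osc_def cscale_single)

lemma osc_zero: "osc l i 0 (Poly_Mapping.single b c) = Poly_Mapping.single b (c * l i)"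
  by (simp add: osc_def cscale_single)

lemma osc_pos: "n > 0 \<Longrightarrow> osc l i n (Poly_Mapping.single b c) =
    Poly_Mapping.single (b(i := b i - {#nat (n - 1)#})) (c * (of_int n * of_nat (count (b i) (nat (n - 1)))))"
  by (simp add: osc_def cscale_single)

lemma weight_upd: "weight (b(i := M)) + (\<Sum>k\<in>#b i. k + 1) = weight b + (\<Sum>k\<in>#M. k + 1)"
proof -
  have *: "weight f = (\<Sum>k\<in>#f i. k + 1) + (\<Sum>j\<in>UNIV - {i}. \<Sum>k\<in>#f j. k + 1)" for f :: "'a \<Rightarrow> nat multiset"
    unfolding weight_def by (subst sum.remove[of UNIV i]) auto
  have "(\<Sum>j\<in>UNIV - {i}. \<Sum>k\<in>#(b(i := M)) j. k + 1) = (\<Sum>j\<in>UNIV - {i}. \<Sum>k\<in>#b j. k + 1)"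
    by (rule sum.cong) auto
  then show ?thesis using *[of b] *[of "b(i := M)"] by simp
qed

lemma weight_add: "weight (b(i := add_mset k (b i))) = weight b + k + 1"
  using weight_upd[of b i "add_mset k (b i)"] by simp

lemma weight_remove: "k \<in># b i \<Longrightarrow> weight (b(i := b i - {#k#})) + k + 1 = weight b"
  using weight_add[of "b(i := b i - {#k#})" i k] by simp

lemma deg_le_single: "(c \<noteq> 0 \<Longrightarrow> int (weight b) \<le> d) \<Longrightarrow> deg_le d (Poly_Mapping.single b c)"
  by (auto simp: deg_le_def)

lemma deg_le_lin_ext:
  assumes "\<And>b. b \<in> Poly_Mapping.keys w \<Longrightarrow> deg_le d (f b)"
  shows "deg_le d (lin_ext f w)"
  unfolding lin_ext_def by (intro deg_le_sum deg_le_cscale assms)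

lemma osc_modes: "modes (osc l i)"
  unfolding modes_def shifts_def
proof (intro allI conjI impI)
  fix n d and w :: "'a fock"
  assume w: "deg_le d w"
  show "deg_le (d + - n) (osc l i n w)"
    unfolding osc_def
  proof (rule deg_le_lin_ext)
    fix b assume "b \<in> Poly_Mapping.keys w"
    then have b: "int (weight b) \<le> d" using w by (auto simp: deg_le_def)
    consider "n < 0" | "n = 0" | "n > 0" "nat (n - 1) \<in># b i" | "n > 0" "nat (n - 1) \<notin># b i" by linarith
    then show "deg_le (d + - n) (if n < 0 then Poly_Mapping.single (b(i := add_mset (nat (- n - 1)) (b i))) 1
      else if n = 0 then Poly_Mapping.single b (l i)
      else Poly_Mapping.single (b(i := b i - {#nat (n - 1)#})) (of_int n * of_nat (count (b i) (nat (n - 1)))))"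
    proof cases
      case 1 then show ?thesis using b by (auto intro!: deg_le_single simp: weight_add)
    next
      case 2 then show ?thesis using b by (auto intro!: deg_le_single)
    next
      case 3 then show ?thesis using b weight_remove[of "nat (n - 1)" b i] by (auto intro!: deg_le_single)
    next
      case 4 then show ?thesis by (simp add: not_in_iff)
    qed
  qed
qed (rule osc_linear)

lemma clinear_id: "clinear (\<lambda>w. w)" by (rule clinearI) auto

lemma clinear_comp: "clinear S \<Longrightarrow> clinear T \<Longrightarrow> clinear (\<lambda>w. S (T w))"
  by (rule clinearI) (simp_all add: clinear_add clinear_cscale)

text \<open>The remaining index pairs, n <= 0 < m, follow by exchanging the two oscillators, because
  the commutator is antisymmetric.\<close>

lemma osc_commutator_aux:
  assumes "n > 0 \<or> n \<le> 0 \<and> m \<le> 0"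
  shows "osc l i n (osc l j m (Poly_Mapping.single b 1)) =
    osc l j m (osc l i n (Poly_Mapping.single b 1)) + cscale (if i = j \<and> n + m = 0 then of_int n else 0) (Poly_Mapping.single b 1)"
proof (cases "i = j")
  case False
  consider "n < 0" | "n = 0" | "n > 0" by linarith
  then show ?thesis
  proof cases
    case 1
    consider "m < 0" | "m = 0" | "m > 0" by linarith
    then show ?thesis by cases (use 1 False in \<open>simp_all add: osc_neg osc_zero osc_pos fun_upd_twist[of i j] mult_ac\<close>)
  next
    case 2
    consider "m < 0" | "m = 0" | "m > 0" by linarith
    then show ?thesis by cases (use 2 False in \<open>simp_all add: osc_neg osc_zero osc_pos fun_upd_twist[of i j] mult_ac\<close>)
  next
    case 3
    consider "m < 0" | "m = 0" | "m > 0" by linarith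
    then show ?thesis by cases (use 3 False in \<open>simp_all add: osc_neg osc_zero osc_pos fun_upd_twist[of i j] mult_ac\<close>)
  qed
next
  case True
  consider "m = 0" | "n = 0" | "n > 0" "m < 0" "n + m = 0" | "n > 0" "m < 0" "n + m \<noteq> 0" | "n < 0" "m < 0" | "n > 0" "m > 0" using assms by linarith
  then show ?thesis
  proof cases
    case 1
    consider "n < 0" | "n = 0" | "n > 0" by linarith
    then show ?thesis by cases (use 1 in \<open>auto simp: osc_neg osc_zero osc_pos mult_ac\<close>)
  next
    case 2
    consider "m < 0" | "m = 0" | "m > 0" by linarith
    then show ?thesis by cases (use 2 in \<open>auto simp: osc_neg osc_zero osc_pos mult_ac\<close>)
  next
    case 3
    then have m: "m = - n" by simp
    show ?thesis
    proof (cases "nat (n - 1) \<in># b i")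
      case t: True
      then show ?thesis using 3 True
        by (simp add: m osc_neg osc_pos cscale_single single_add [symmetric] algebra_simps)
    next
      case f: False
      then show ?thesis using 3 True
        by (simp add: m osc_neg osc_pos cscale_single not_in_iff clinear_0[OF osc_linear])
    qed
  next
    case 4
    then have ne: "nat (n - 1) \<noteq> nat (- m - 1)" by auto
    then show ?thesis using 4 True
      by (cases "nat (n - 1) \<in># b i") (simp_all add: osc_neg osc_pos not_in_iff clinear_0[OF osc_linear])
  next
    case 5
    then show ?thesis using True by (simp add: osc_neg add_mset_commute)
  next
    case 6
    then show ?thesis using True
      by (cases "m = n")
        (auto simp: osc_pos diff_diff_add_mset add_mset_commute nat_eq_iff mult_ac)
  qed
qed

lemma osc_commutator:
  "osc l i n (osc l j m w) = osc l j m (osc l i n w) + cscale (if i = j \<and> n + m = 0 then of_int n else 0) w"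
proof (rule linear_eq_on_basis [where f = "\<lambda>w. osc l i n (osc l j m w)" and
      g = "\<lambda>w. osc l j m (osc l i n w) + cscale (if i = j \<and> n + m = 0 then of_int n else 0) w"])
  show "clinear (\<lambda>w. osc l i n (osc l j m w))"
    by (rule clinear_comp[OF osc_linear osc_linear])
  show "clinear (\<lambda>w. osc l j m (osc l i n w) + cscale (if i = j \<and> n + m = 0 then of_int n else 0) w)"
    by (rule clinear_plus[OF clinear_comp[OF osc_linear osc_linear] clinear_scale[OF clinear_id]])
  fix b
  show "osc l i n (osc l j m (Poly_Mapping.single b 1)) =
    osc l j m (osc l i n (Poly_Mapping.single b 1)) + cscale (if i = j \<and> n + m = 0 then of_int n else 0) (Poly_Mapping.single b 1)"
  proof (cases "n > 0 \<or> n \<le> 0 \<and> m \<le> 0")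
    case True then show ?thesis by (rule osc_commutator_aux)
  next
    case False
    then have A: "osc l j m (osc l i n (Poly_Mapping.single b 1)) =
      osc l i n (osc l j m (Poly_Mapping.single b 1)) + cscale (if j = i \<and> m + n = 0 then of_int m else 0) (Poly_Mapping.single b 1)"
      by (intro osc_commutator_aux) auto
    have "(if j = i \<and> m + n = 0 then of_int m else 0) + (if i = j \<and> n + m = 0 then of_int n else 0) = (0 :: complex)"
      by (auto simp flip: of_int_add)
    then have B: "cscale (if j = i \<and> m + n = 0 then of_int m else 0) v +
        cscale (if i = j \<and> n + m = 0 then of_int n else 0) v = 0" for v :: "'a fock"
      by (simp only: cvec.scale_left_distrib [symmetric] cvec.scale_zero_left)
    show ?thesis unfolding A add.assoc B by simp
  qed
qed

subsection \<open>Fields of states\<close>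

primrec fields :: "('n \<Rightarrow> complex) \<Rightarrow> ('n::finite \<times> nat) list \<Rightarrow> int \<Rightarrow> 'n fock \<Rightarrow> 'n fock" where
  "fields l [] = (\<lambda>n w. if n = -1 then w else 0)"
| "fields l (x # A) = wrap (osc l (fst x)) (snd x) (fields l A)"

definition state_of :: "('n \<times> nat) list \<Rightarrow> 'n \<Rightarrow> nat multiset" where
  "state_of A i = mset (map snd (filter (\<lambda>x. fst x = i) A))"

text \<open>Within each factor the order is the sorted one, so that the sublists are literally the
  lists in \<open>heis_mode\<close>. How the factors interleave is left to choice, because
  \<open>fields\<close> does not depend on the order.\<close>

definition state_list :: "('n::finite \<Rightarrow> nat multiset) \<Rightarrow> ('n \<times> nat) list" where
  "state_list b = (SOME A. \<forall>i. map snd (filter (\<lambda>x. fst x = i) A) = sorted_list_of_multiset (b i))"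

definition fld :: "('n \<Rightarrow> complex) \<Rightarrow> ('n::finite \<Rightarrow> nat multiset) \<Rightarrow> int \<Rightarrow> 'n fock \<Rightarrow> 'n fock" where
  "fld l b = fields l (state_list b)"

lemma state_list: "map snd (filter (\<lambda>x. fst x = i) (state_list b)) = sorted_list_of_multiset (b i)"
proof -
  have "\<exists>A. \<forall>i. map snd (filter (\<lambda>x. fst x = i) A) = (if i \<in> S then f i else [])" if "finite S"
    for S :: "'a set" and f :: "'a \<Rightarrow> nat list"
    using that
  proof induction
    case empty
    show ?case by (rule exI[of _ "[]"]) simp
  next
    case (insert x S)
    then obtain A where A: "\<And>i. map snd (filter (\<lambda>x. fst x = i) A) = (if i \<in> S then f i else [])" by blast
    have "map snd (filter (\<lambda>x. fst x = i) (map (Pair x) (f x))) = (if i = x then f x else [])" for i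
      by (auto simp: filter_map o_def)
    then show ?case
      by (intro exI[of _ "map (Pair x) (f x) @ A"]) (use insert.hyps in \<open>auto simp: A\<close>)
  qed
  from this[of UNIV "\<lambda>i. sorted_list_of_multiset (b i)"]
  have "\<exists>A. \<forall>i. map snd (filter (\<lambda>x. fst x = i) A) = sorted_list_of_multiset (b i)" by simp
  then show ?thesis unfolding state_list_def by (rule someI2_ex) blast
qed

lemma state_of_state_list: "state_of (state_list b) = b"
  by (rule ext) (simp add: state_of_def state_list)

lemma state_of_Nil: "state_of [] = (\<lambda>_. {#})"
  by (rule ext) (simp add: state_of_def)

lemma state_of_Cons: "state_of (x # A) = (state_of A)(fst x := add_mset (snd x) (state_of A (fst x)))"
  by (rule ext) (simp add: state_of_def)

lemma state_of_inj: "state_of A = state_of B \<Longrightarrow> mset A = mset B"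
proof (rule multiset_eqI)
  fix x
  have *: "count (mset A) x = count (state_of A (fst x)) (snd x)" for A :: "('a \<times> nat) list"
    by (induction A) (auto simp: state_of_Nil state_of_Cons prod_eq_iff)
  assume "state_of A = state_of B"
  then show "count (mset A) x = count (mset B) x" by (simp add: *)
qed

lemma fields_weight:
  fixes A :: "('n::finite \<times> nat) list"
  shows "weight_field (int (\<Sum>x\<leftarrow>A. snd x + 1)) (fields l A)"
proof (induction A)
  case Nil
  have "shifts (0 - n) (\<lambda>w :: 'n fock. if n = - 1 then w else 0)" for n
  proof (cases "n = - 1")
    case True
    have "shifts 0 (\<lambda>w :: 'n fock. w)" by (auto simp: shifts_def intro: clinear_id)
    then show ?thesis using True shifts_mono[of 0 "\<lambda>w :: 'n fock. w" 1] by simp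
  qed (simp add: shifts_zero)
  then show ?case by (simp add: weight_field_def)
next
  case (Cons x A)
  show ?case using wrap_weight_field[OF osc_modes[of l "fst x"] Cons.IH, of "snd x"] by (simp add: add_ac)
qed

text \<open>Oscillators whose indices belong to the same sign class commute: their indices add up to
  0 only if both are 0, and then the commutator has coefficient 0.\<close>

lemma fields_perm: "mset A = mset B \<Longrightarrow> fields l A = fields l B"
proof (induction A arbitrary: B)
  case (Cons x A)
  then have "x \<in> set B" by (metis list.set_intros(1) set_mset_mset)
  then obtain C D where B: "B = C @ x # D" by (meson split_list)
  have *: "fields l (C @ x # D) = fields l (x # C @ D)" for C
  proof (induction C)
    case (Cons y C)
    have "wrap (osc l (fst y)) (snd y) (wrap (osc l (fst x)) (snd x) (fields l (C @ D))) =
        wrap (osc l (fst x)) (snd x) (wrap (osc l (fst y)) (snd y) (fields l (C @ D)))"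
    proof (intro ext wrap_commute[OF osc_modes osc_modes fields_weight])
      fix p q :: int and w :: "'a fock" assume "(p < 0) = (q < 0)"
      then have "\<not> (fst y = fst x \<and> p + q = 0) \<or> p = 0" by linarith
      then show "osc l (fst y) p (osc l (fst x) q w) = osc l (fst x) q (osc l (fst y) p w)"
        by (subst osc_commutator) auto
    qed
    then show ?case using Cons.IH by simp
  qed simp
  have "mset A = mset (C @ D)" using Cons.prems B by simp
  then show ?case using Cons.IH[of "C @ D"] by (simp add: B *)
qed simp

lemma fields_eq_fld: "fields l A = fld l (state_of A)"
  unfolding fld_def by (intro fields_perm state_of_inj) (simp add: state_of_state_list)

lemma fld_empty: "fld l (\<lambda>_. {#}) n w = (if n = -1 then w else 0)"
  by (simp add: state_of_Nil [symmetric] fields_eq_fld [symmetric])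

lemma fld_add: "fld l (b(i := add_mset k (b i))) = wrap (osc l i) k (fld l b)"
  using fields_eq_fld[of l "(i, k) # state_list b"]
  by (simp add: state_of_Cons state_of_state_list fld_def)

lemma state_induct [case_names empty add]:
  assumes "P (\<lambda>_. {#})" "\<And>b i k. P b \<Longrightarrow> P (b(i := add_mset k (b i)))"
  shows "P (b :: 'n::finite \<Rightarrow> nat multiset)"
proof -
  have "P (state_of A)" for A :: "('n \<times> nat) list"
  proof (induction A)
    case (Cons x A)
    then show ?case using assms(2)[of "state_of A" "fst x" "snd x"] by (simp only: state_of_Cons)
  qed (simp add: state_of_Nil assms(1))
  from this[of "state_list b"] show ?thesis by (simp add: state_of_state_list)
qed

lemma fld_weight_field:
  fixes b :: "'n::finite \<Rightarrow> nat multiset"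
  shows "weight_field (int (weight b)) (fld l b)"
proof (induction b rule: state_induct)
  case empty
  have "weight (\<lambda>_ :: 'n. {#}) = 0" by (simp add: weight_def)
  then show ?case using fields_weight[of "[]" l] by (simp add: fields_eq_fld state_of_Nil del: fields.simps)
next
  case (add b i k)
  then show ?case using wrap_weight_field[OF osc_modes[of l i] add, of k]
    by (simp only: fld_add weight_add of_nat_add of_nat_1)
qed

lemma fld_shifts: "shifts (int (weight b) - n) (fld l b n)"
  using fld_weight_field[of b l] by (simp add: weight_field_def)

lemma fld_linear: "clinear (fld l b n)"
  using fld_shifts shifts_linear by blast

lemma fields_linear: "clinear (fields l A n)"
  by (simp add: fields_eq_fld fld_linear)

lemma fld_eq_0: "deg_le d w \<Longrightarrow> n > d + int (weight b) \<Longrightarrow> fld l b n w = 0"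
  by (rule shifts_eq_0[OF fld_shifts]) (assumption, linarith)

definition is_field :: "(int \<Rightarrow> 'n::finite fock \<Rightarrow> 'n fock) \<Rightarrow> bool" where
  "is_field F \<longleftrightarrow> (\<exists>h. weight_field h F)"

lemma weight_field_mono: "weight_field h F \<Longrightarrow> h \<le> h' \<Longrightarrow> weight_field h' F"
  unfolding weight_field_def using shifts_mono by (meson diff_right_mono)

lemma is_field_zero: "is_field (\<lambda>n w. 0)"
  by (auto simp: is_field_def weight_field_def shifts_zero)

lemma is_field_add:
  assumes "is_field F" "is_field G" shows "is_field (\<lambda>n w. F n w + G n w)"
proof -
  obtain h h' where "weight_field h F" "weight_field h' G" using assms by (auto simp: is_field_def)
  then have "weight_field (max h h') F" "weight_field (max h h') G"
    by (auto intro: weight_field_mono)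
  then have "weight_field (max h h') (\<lambda>n w. F n w + G n w)"
    by (simp add: weight_field_def shifts_add)
  then show ?thesis by (auto simp: is_field_def)
qed

lemma is_field_cscale: "is_field F \<Longrightarrow> is_field (\<lambda>n w. cscale c (F n w))"
  by (auto simp: is_field_def weight_field_def intro: shifts_cscale)

lemma is_field_index:
  assumes "is_field F" shows "is_field (\<lambda>n. F (n + e))"
proof -
  obtain h where h: "\<And>n. shifts (h - n) (F n)" using assms by (auto simp: is_field_def weight_field_def)
  have "weight_field (h - e) (\<lambda>n. F (n + e))"
    unfolding weight_field_def
  proof
    fix n show "shifts (h - e - n) (F (n + e))" using h[of "n + e"] by (simp add: algebra_simps)
  qed
  then show ?thesis by (auto simp: is_field_def)
qed

lemma is_field_fld: "is_field (fld l b)"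
  using fld_weight_field by (auto simp: is_field_def)

lemma is_field_sum_mset:
  "(\<And>j. is_field (G j)) \<Longrightarrow> is_field (\<lambda>n w. \<Sum>j\<in>#M. cscale (c j) (G j n w))"
  by (induction M) (simp_all add: is_field_zero is_field_add[OF is_field_cscale])

lemma is_field_sum:
  "(\<And>j. is_field (G j)) \<Longrightarrow> is_field (\<lambda>n w. \<Sum>j\<in>A. cscale (c j) (G j n w))"
  by (induction A rule: infinite_finite_induct) (simp_all add: is_field_zero is_field_add[OF is_field_cscale])

lemma wrap_finite:
  assumes a: "modes a" and F: "is_field F"
  shows "finite {q. cscale (C q) (app a q (F (n - q - int k - 1)) w) \<noteq> 0}"
proof -
  obtain h where h: "\<And>n. shifts (h - n) (F n)" using F by (auto simp: is_field_def weight_field_def)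
  obtain d where d: "d \<ge> 0" "deg_le d w" using deg_le_ex by blast
  define M where "M = d + \<bar>h\<bar> + \<bar>n\<bar> + int k"
  have "{q. cscale (C q) (app a q (F (n - q - int k - 1)) w) \<noteq> 0} \<subseteq> {-M-1..M}"
  proof (rule subsetI, rule ccontr)
    fix q assume q: "q \<in> {q. cscale (C q) (app a q (F (n - q - int k - 1)) w) \<noteq> 0}" "q \<notin> {-M-1..M}"
    have "app a q (F (n - q - int k - 1)) w = 0"
      by (rule app_eq_0[OF a h d(2)]) (use q(2) d(1) in \<open>auto simp: M_def\<close>)
    then show False using q(1) by simp
  qed
  then show ?thesis by (rule finite_subset) simp
qed

lemma app_add: "modes a \<Longrightarrow> app a q (\<lambda>w. F w + G w) w = app a q F w + app a q G w"
  by (simp add: app_def clinear_add modes_linear)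

lemma app_cscale: "modes a \<Longrightarrow> app a q (\<lambda>w. cscale c (F w)) w = cscale c (app a q F w)"
  by (simp add: app_def clinear_cscale modes_linear)

lemma wrap_add:
  assumes a: "modes a" and F: "is_field F" and G: "is_field G"
  shows "wrap a k (\<lambda>n w. F n w + G n w) n w = wrap a k F n w + wrap a k G n w"
  unfolding wrap_def app_add[OF a] cvec.scale_right_distrib
  by (rule Sum_any.distrib) (rule wrap_finite[OF a F] wrap_finite[OF a G])+

lemma wrap_zero: assumes "modes a" shows "wrap a k (\<lambda>n w. 0) n w = 0"
proof -
  have "app a q (\<lambda>w. 0) w = 0" for q w using clinear_0[OF modes_linear[OF assms]] by (simp add: app_def)
  then show ?thesis by (simp add: wrap_def)
qed

lemma wrap_cscale:
  assumes a: "modes a" and F: "is_field F"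
  shows "wrap a k (\<lambda>n w. cscale c (F n w)) n w = cscale c (wrap a k F n w)"
proof -
  have "cscale c (wrap a k F n w) = Sum_any (\<lambda>q. cscale c (cscale (of_int (- q - 1) gchoose k) (app a q (F (n - q - int k - 1)) w)))"
    unfolding wrap_def
    by (rule clinear_Sum_any[OF clinear_scale[OF clinear_id] wrap_finite[OF a F]])
  then show ?thesis by (simp add: wrap_def app_cscale[OF a] mult.commute)
qed

lemma wrap_sum_mset:
  assumes a: "modes a" and G: "\<And>j. is_field (G j)"
  shows "wrap a k (\<lambda>n w. \<Sum>j\<in>#M. cscale (c j) (G j n w)) n w = (\<Sum>j\<in>#M. cscale (c j) (wrap a k (G j) n w))"
  by (induction M) (simp_all add: wrap_zero[OF a] wrap_add[OF a is_field_cscale[OF G] is_field_sum_mset[OF G]] wrap_cscale[OF a G])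

lemma wrap_index: "wrap a k (\<lambda>n. F (n + e)) n w = wrap a k F (n + e) w"
  by (simp add: wrap_def algebra_simps)

text \<open>Commutation with \<open>a q\<close> is a derivation: it either hits \<open>F\<close>,
  which gives \<open>D\<close>, or meets the single mode p = -q of the wrapping field. The scalar q
  (q-1 choose k) arising there is rewritten by absorption, which exhibits its vanishing for 0 <= q
  <= k. \<open>\<kappa>\<close> will be 1 or 0 according to whether the two oscillators belong to
  the same factor.\<close>

lemma wrap_commutator:
  assumes a: "modes a" and b: "modes b" and F: "is_field F" and D: "is_field D"
    and ab: "\<And>p w. a q (b p w) = b p (a q w) + cscale (if p + q = 0 then \<kappa> * of_int q else 0) w"
    and aF: "\<And>n w. a q (F n w) = F n (a q w) + D n w"
  shows "a q (wrap b k F n w) = wrap b k F n (a q w) + wrap b k D n w +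
    cscale (\<kappa> * (of_nat (k + 1) * (of_int q gchoose (k + 1)))) (F (n + q - int k - 1) w)"
proof -
  let ?C = "\<lambda>p::int. of_int (- p - 1) gchoose k :: complex"
  let ?F = "\<lambda>p. F (n - p - int k - 1)" and ?D = "\<lambda>p. D (n - p - int k - 1)"
  have FL: "clinear (F n)" for n using F by (auto simp: is_field_def weight_field_def dest: shifts_linear)
  have t: "a q (app b p (?F p) w) = app b p (?F p) (a q w) + app b p (?D p) w +
      cscale (if p + q = 0 then \<kappa> * of_int q else 0) (?F p w)" for p
    by (simp add: app_def ab aF clinear_add[OF FL] clinear_cscale[OF FL] clinear_add[OF modes_linear[OF b]] add_ac)
  have d: "cscale (?C p) (cscale (if p + q = 0 then \<kappa> * of_int q else 0) (?F p w)) =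
      (if p = - q then cscale (\<kappa> * (of_nat (k + 1) * (of_int q gchoose (k + 1)))) (F (n + q - int k - 1) w) else 0)" for p
  proof (cases "p = - q")
    case True
    have "of_int q * (of_int q - 1 gchoose k) = of_nat (k + 1) * (of_int q gchoose (k + 1) :: complex)"
      using gbinomial_absorption[of k "of_int q :: complex"] by (simp add: algebra_simps)
    then show ?thesis using True by (simp add: mult_ac)
  next
    case False
    then have "p + q \<noteq> 0" by simp
    then show ?thesis using False by simp
  qed
  have f3: "finite {p. cscale (?C p) (cscale (if p + q = 0 then \<kappa> * of_int q else 0) (?F p w)) \<noteq> 0}"
    unfolding d by (rule finite_subset[of _ "{-q}"]) auto
  have "a q (wrap b k F n w) = Sum_any (\<lambda>p. a q (cscale (?C p) (app b p (?F p) w)))"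
    unfolding wrap_def by (rule clinear_Sum_any[OF modes_linear[OF a] wrap_finite[OF b F]])
  also have "\<dots> = Sum_any (\<lambda>p. (cscale (?C p) (app b p (?F p) (a q w)) + cscale (?C p) (app b p (?D p) w)) +
      cscale (?C p) (cscale (if p + q = 0 then \<kappa> * of_int q else 0) (?F p w)))"
    by (simp add: clinear_cscale[OF modes_linear[OF a]] t cvec.scale_right_distrib)
  also have "\<dots> = Sum_any (\<lambda>p. cscale (?C p) (app b p (?F p) (a q w)) + cscale (?C p) (app b p (?D p) w)) +
      Sum_any (\<lambda>p. cscale (?C p) (cscale (if p + q = 0 then \<kappa> * of_int q else 0) (?F p w)))"
  proof (rule Sum_any.distrib[OF _ f3])
    have "finite ({p. cscale (?C p) (app b p (?F p) (a q w)) \<noteq> 0} \<union> {p. cscale (?C p) (app b p (?D p) w) \<noteq> 0})"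
      by (intro finite_UnI wrap_finite[OF b F] wrap_finite[OF b D])
    then show "finite {p. cscale (?C p) (app b p (?F p) (a q w)) + cscale (?C p) (app b p (?D p) w) \<noteq> 0}"
      by (rule rev_finite_subset) auto
  qed
  also have "Sum_any (\<lambda>p. cscale (?C p) (app b p (?F p) (a q w)) + cscale (?C p) (app b p (?D p) w)) =
      wrap b k F n (a q w) + wrap b k D n w"
    unfolding wrap_def by (rule Sum_any.distrib[OF wrap_finite[OF b F] wrap_finite[OF b D]])
  finally show ?thesis unfolding d by simp
qed

text \<open>Wick's theorem for a single free mode: each part j in the i-th factor can be contracted,
  which removes it. The coefficient is that of z^(q-j-1) in the j-th divided derivative of q
  z^(q-1).\<close>

lemma osc_fld:
  "osc l i q (fld l b s w) = fld l b s (osc l i q w) +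
    (\<Sum>j\<in>#b i. cscale (of_nat (j + 1) * (of_int q gchoose (j + 1))) (fld l (b(i := b i - {#j#})) (s + q - int j - 1) w))"
proof (induction b arbitrary: s w rule: state_induct)
  case empty
  show ?case by (simp add: fld_empty clinear_0[OF osc_linear])
next
  case (add b i' k)
  let ?c = "\<lambda>j. of_nat (j + 1) * (of_int q gchoose (j + 1)) :: complex"
  let ?\<kappa> = "if i = i' then 1 else 0 :: complex"
  let ?b = "b(i' := add_mset k (b i'))"
  let ?G = "\<lambda>j s. fld l (b(i := b i - {#j#})) (s + (q - int j - 1))"
  have GF: "is_field (?G j)" for j by (rule is_field_index[OF is_field_fld])
  have "osc l i q (fld l ?b s w) = fld l ?b s (osc l i q w) +
      wrap (osc l i') k (\<lambda>s w. \<Sum>j\<in>#b i. cscale (?c j) (?G j s w)) s w +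
      cscale (?\<kappa> * ?c k) (fld l b (s + q - int k - 1) w)"
    unfolding fld_add
  proof (rule wrap_commutator[OF osc_modes osc_modes is_field_fld is_field_sum_mset[OF GF]])
    show "osc l i q (osc l i' p w) = osc l i' p (osc l i q w) + cscale (if p + q = 0 then ?\<kappa> * of_int q else 0) w" for p w
      by (subst osc_commutator) (auto simp: add.commute)
    show "osc l i q (fld l b n w) = fld l b n (osc l i q w) + (\<Sum>j\<in>#b i. cscale (?c j) (?G j n w))" for n w
      unfolding add by (simp add: add_diff_eq)
  qed
  also have "wrap (osc l i') k (\<lambda>s w. \<Sum>j\<in>#b i. cscale (?c j) (?G j s w)) s w =
      (\<Sum>j\<in>#b i. cscale (?c j) (fld l (?b(i := ?b i - {#j#})) (s + q - int j - 1) w))"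
    unfolding wrap_sum_mset[OF osc_modes GF] wrap_index fld_add [symmetric]
  proof (intro arg_cong[of _ _ sum_mset] image_mset_cong)
    fix j assume j: "j \<in># b i"
    have "(b(i := b i - {#j#}))(i' := add_mset k ((b(i := b i - {#j#})) i')) = ?b(i := ?b i - {#j#})"
      using j by (cases "i = i'") (auto simp: fun_eq_iff)
    then show "cscale (?c j) (fld l ((b(i := b i - {#j#}))(i' := add_mset k ((b(i := b i - {#j#})) i'))) (s + (q - int j - 1)) w) =
        cscale (?c j) (fld l (?b(i := ?b i - {#j#})) (s + q - int j - 1) w)"
      by (simp add: add_diff_eq)
  qed
  finally have *: "osc l i q (fld l ?b s w) = fld l ?b s (osc l i q w) +
      (\<Sum>j\<in>#b i. cscale (?c j) (fld l (?b(i := ?b i - {#j#})) (s + q - int j - 1) w)) +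
      cscale (?\<kappa> * ?c k) (fld l b (s + q - int k - 1) w)" .
  show ?case
  proof (cases "i = i'")
    case True
    have "?b i = add_mset k (b i)" "?b(i := ?b i - {#k#}) = b" using True by (auto simp: fun_eq_iff)
    then show ?thesis unfolding * using True by (simp only: image_mset_add_mset sum_mset.add_mset simp_thms if_True mult_1_left add_ac)
  next
    case False
    have "?b i = b i" using False by simp
    then show ?thesis unfolding * using False by (simp only: if_False mult_zero_left cscale_0 add_0_right)
  qed
qed

section \<open>Contractions, and the recursions for products of fields\<close>

text \<open>Applying the k-th divided derivative in z and the j-th one in w to the two-point
  function (z - w)^(-2) gives this number times (z - w)^(-k-j-2). It equals (-1)^k (k+j+1)! / (k!
  j!).\<close>

definition contraction :: "nat \<Rightarrow> nat \<Rightarrow> complex" where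
  "contraction k j = (-1) ^ k * of_nat (j + 1) * of_nat ((k + j + 1) choose k)"

lemma gbinomial_neg_nat: "(- of_nat (a + 1) gchoose k :: complex) = (-1) ^ k * of_nat ((a + k) choose k)"
  by (subst gbinomial_minus) (simp add: binomial_gbinomial add_ac)

lemma binomial_exchange: "((t + j + 1 + k) choose k) * ((t + j + 1) choose (j + 1)) = ((k + j + 1) choose k) * ((k + j + 1 + t) choose t)"
proof -
  have "((t + j + 1 + k) choose (k + j + 1)) * ((k + j + 1) choose k) =
      ((t + j + 1 + k) choose k) * ((t + j + 1 + k - k) choose (k + j + 1 - k))"
    by (rule choose_mult) auto
  moreover have "(t + j + 1 + k) choose (k + j + 1) = (k + j + 1 + t) choose t"
    using binomial_symmetric[of t "k + j + 1 + t"] by (simp add: add_ac)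
  ultimately show ?thesis by (simp add: mult.commute)
qed

text \<open>The annihilation modes assemble the expansion of (z - w)^(-k-j-2) for |z| > |w|. The
  count starts at q = j + 1 because the coefficient vanishes for 0 <= q <= j.\<close>

lemma contraction_coeff_pos:
  fixes k j t :: nat
  defines "q \<equiv> int t + int j + 1"
  shows "(of_int (- q - 1) gchoose k) * (of_nat (j + 1) * (of_int q gchoose (j + 1))) =
    contraction k j * ((-1) ^ t * (of_int (- int (k + j + 2)) gchoose t) :: complex)"
proof -
  have 1: "(of_int (- q - 1) gchoose k :: complex) = (-1) ^ k * of_nat ((t + j + 1 + k) choose k)"
    using gbinomial_neg_nat[of "t + j + 1" k] by (simp add: q_def)
  have 2: "(of_int q gchoose (j + 1) :: complex) = of_nat ((t + j + 1) choose (j + 1))"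
    by (subst binomial_gbinomial) (simp add: q_def add_ac)
  have 3: "(-1) ^ t * (of_int (- int (k + j + 2)) gchoose t :: complex) = of_nat ((k + j + 1 + t) choose t)"
    using gbinomial_neg_nat[of "k + j + 1" t] by (simp flip: mult.assoc power_mult_distrib)
  have "of_nat (((t + j + 1 + k) choose k) * ((t + j + 1) choose (j + 1))) =
      (of_nat (((k + j + 1) choose k) * ((k + j + 1 + t) choose t)) :: complex)"
    by (simp only: binomial_exchange)
  then show ?thesis unfolding 1 2 3 contraction_def of_nat_mult by (simp only: mult_ac)
qed

text \<open>The creation modes give, up to sign, the expansion of the same function for |z| < |w|,
  whence the factor (-1)^(k+j+2). The count starts at q = -k-1 because the modes from -k to -1 have
  coefficient 0 in the k-th derivative.\<close>

lemma contraction_coeff_neg: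
  fixes k j t :: nat
  defines "q \<equiv> - int k - 1 - int t"
  shows "- ((of_int (- q - 1) gchoose k) * (of_nat (j + 1) * (of_int q gchoose (j + 1)))) =
    contraction k j * ((-1) ^ (k + j + 2) * ((-1) ^ t * (of_int (- int (k + j + 2)) gchoose t)) :: complex)"
proof -
  have 1: "(of_int (- q - 1) gchoose k :: complex) = of_nat ((k + t) choose k)"
    by (subst binomial_gbinomial) (simp add: q_def add_ac)
  have 2: "(of_int q gchoose (j + 1) :: complex) = (-1) ^ (j + 1) * of_nat ((k + t + (j + 1)) choose (j + 1))"
  proof -
    have "of_int q = (- of_nat (k + t + 1) :: complex)" by (simp add: q_def)
    then show ?thesis using gbinomial_neg_nat[of "k + t" "j + 1"] by (simp only:)
  qed
  have 3: "(-1) ^ t * (of_int (- int (k + j + 2)) gchoose t :: complex) = of_nat ((k + j + 1 + t) choose t)"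
    using gbinomial_neg_nat[of "k + j + 1" t] by (simp flip: mult.assoc power_mult_distrib)
  have "((k + j + 1 + t) choose (k + j + 1)) * ((k + j + 1) choose (j + 1)) =
      ((k + j + 1 + t) choose (j + 1)) * ((k + j + 1 + t - (j + 1)) choose (k + j + 1 - (j + 1)))"
    by (rule choose_mult) auto
  moreover have "(k + j + 1 + t) choose (k + j + 1) = (k + j + 1 + t) choose t"
    using binomial_symmetric[of t "k + j + 1 + t"] by (simp add: add_ac)
  moreover have "(k + j + 1) choose (j + 1) = (k + j + 1) choose k"
    using binomial_symmetric[of k "k + j + 1"] by simp
  ultimately have n: "((k + t) choose k) * ((k + t + (j + 1)) choose (j + 1)) = ((k + j + 1) choose k) * ((k + j + 1 + t) choose t)"
    by (simp add: add_ac mult.commute)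
  have "of_nat (((k + t) choose k) * ((k + t + (j + 1)) choose (j + 1))) =
      (of_nat (((k + j + 1) choose k) * ((k + j + 1 + t) choose t)) :: complex)"
    by (simp only: n)
  moreover have "(-1) ^ k * (-1) ^ (k + j + 2) = (- ((-1) ^ (j + 1)) :: complex)"
    by (simp flip: mult.assoc add: power_add power_mult_distrib [symmetric])
  moreover have "- (X * (J * (E * Y))) = A * J * N * (B * Z)" if "X * Y = N * Z" "A * B = - E"
    for X J E Y A N B Z :: complex
  proof -
    have "A * J * N * (B * Z) = (A * B) * J * (N * Z)" by (simp only: mult_ac)
    also have "\<dots> = (- E) * J * (X * Y)" using that by (simp only:)
    also have "\<dots> = - (X * (J * (E * Y)))" by (simp only: mult_ac mult_minus_left mult_minus_right)
    finally show ?thesis by (rule sym)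
  qed
  ultimately show ?thesis unfolding 1 2 3 contraction_def of_nat_mult by blast
qed

lemma dp_eq_mode_sum:
  assumes P: "trunc_right c P" and w: "deg_le d w" and M: "M \<ge> int j" "M > d + c - s + int j"
  shows "(\<Sum>q\<in>{-M-1..M}. if q < 0 then 0 else cscale ((of_int (- q - 1) gchoose k) * (of_nat (j + 1) * (of_int q gchoose (j + 1))))
      (P (r - q - int k - 1) (s + q - int j - 1) w)) = cscale (contraction k j) (dp (k + j + 2) P r s w)"
    (is "sum ?f _ = _")
proof -
  define K where "K = nat (M - int j)"
  let ?g = "\<lambda>t::nat. int t + int j + 1"
  have "sum ?f {-M-1..M} = sum ?f (?g ` {..<K})"
  proof (rule sum.mono_neutral_right)
    show "?g ` {..<K} \<subseteq> {-M-1..M}" using M by (auto simp: K_def)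
    show "\<forall>q\<in>{-M-1..M} - ?g ` {..<K}. ?f q = 0"
    proof
      fix q assume q: "q \<in> {-M-1..M} - ?g ` {..<K}"
      show "?f q = 0"
      proof (cases "q < 0")
        case False
        have "q \<le> int j"
        proof (rule ccontr)
          assume "\<not> q \<le> int j"
          then have "q = ?g (nat (q - int j - 1))" "nat (q - int j - 1) < K" using q by (auto simp: K_def)
          then show False using q by blast
        qed
        then have "(of_nat (nat q) gchoose (j + 1) :: complex) = 0"
          using False unfolding binomial_gbinomial [symmetric] by (simp add: binomial_eq_0 nat_less_iff)
        then show ?thesis using False by simp
      qed simp
    qed
  qed simp
  also have "\<dots> = (\<Sum>t<K. ?f (?g t))"
    by (rule sum.reindex_cong[of ?g]) (auto simp: inj_on_def)
  also have "\<dots> = (\<Sum>t<K. cscale (contraction k j) (cscale ((-1) ^ t * (of_int (- int (k + j + 2)) gchoose t))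
      (P (r - int (k + j + 2) - int t) (s + int t) w)))"
  proof (rule sum.cong[OF refl])
    fix t
    have "r - ?g t - int k - 1 = r - int (k + j + 2) - int t" "s + ?g t - int j - 1 = s + int t" "\<not> ?g t < 0" by auto
    then show "?f (?g t) = cscale (contraction k j) (cscale ((-1) ^ t * (of_int (- int (k + j + 2)) gchoose t))
      (P (r - int (k + j + 2) - int t) (s + int t) w))"
      by (simp only: if_False contraction_coeff_pos cvec.scale_scale)
  qed
  also have "\<dots> = cscale (contraction k j) (dp (k + j + 2) P r s w)"
    by (subst dp_eq_sum[OF P w, where K = K]) (use M in \<open>auto simp: K_def cvec.scale_sum_right\<close>)
  finally show ?thesis .
qed

lemma dq_eq_mode_sum:
  assumes Q: "trunc_left c Q" and w: "deg_le d w" and M: "M \<ge> int k" "M > d + c - r + int k"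
  shows "- (\<Sum>q\<in>{-M-1..M}. if q < 0 then cscale ((of_int (- q - 1) gchoose k) * (of_nat (j + 1) * (of_int q gchoose (j + 1))))
      (Q (r - q - int k - 1) (s + q - int j - 1) w) else 0) = cscale (contraction k j) (dq (k + j + 2) Q r s w)"
    (is "- sum ?f _ = _")
proof -
  define K where "K = nat (M - int k + 1)"
  let ?g = "\<lambda>t::nat. - int k - 1 - int t"
  have "sum ?f {-M-1..M} = sum ?f (?g ` {..<K})"
  proof (rule sum.mono_neutral_right)
    show "?g ` {..<K} \<subseteq> {-M-1..M}" using M by (auto simp: K_def)
    show "\<forall>q\<in>{-M-1..M} - ?g ` {..<K}. ?f q = 0"
    proof
      fix q assume q: "q \<in> {-M-1..M} - ?g ` {..<K}"
      show "?f q = 0"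
      proof (cases "q < 0")
        case True
        have "- q - 1 < int k"
        proof (rule ccontr)
          assume "\<not> - q - 1 < int k"
          then have "q = ?g (nat (- q - 1 - int k))" "nat (- q - 1 - int k) < K" using q by (auto simp: K_def)
          then show False using q by blast
        qed
        then have "(of_nat (nat (- q - 1)) gchoose k :: complex) = 0"
          using True unfolding binomial_gbinomial [symmetric] by (simp add: binomial_eq_0 nat_less_iff)
        then show ?thesis using True by simp
      qed simp
    qed
  qed simp
  also have "\<dots> = (\<Sum>t<K. ?f (?g t))"
    by (rule sum.reindex_cong[of ?g]) (auto simp: inj_on_def)
  finally have "- sum ?f {-M-1..M} = (\<Sum>t<K. - ?f (?g t))" by (simp only: sum_negf)
  also have "\<dots> = (\<Sum>t<K. cscale (contraction k j) (cscale ((-1) ^ (k + j + 2)) (cscale ((-1) ^ t * (of_int (- int (k + j + 2)) gchoose t))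
      (Q (r + int t) (s - int (k + j + 2) - int t) w))))"
  proof (rule sum.cong[OF refl])
    fix t
    have "r - ?g t - int k - 1 = r + int t" "s + ?g t - int j - 1 = s - int (k + j + 2) - int t" "?g t < 0" by auto
    then show "- ?f (?g t) = cscale (contraction k j) (cscale ((-1) ^ (k + j + 2)) (cscale ((-1) ^ t * (of_int (- int (k + j + 2)) gchoose t))
      (Q (r + int t) (s - int (k + j + 2) - int t) w)))"
      by (simp only: if_True contraction_coeff_neg cvec.scale_scale cvec.scale_minus_left [symmetric])
  qed
  also have "\<dots> = cscale (contraction k j) (dq (k + j + 2) Q r s w)"
    unfolding dq_eq_sum[OF Q w, where K = K, OF less_le_trans[OF _ order_refl[of "int K"]]]
    by (subst dq_eq_sum[OF Q w, where K = K]) (use M in \<open>auto simp: K_def cvec.scale_sum_right\<close>)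
  finally show ?thesis .
qed

lemma sum_sum_mset_swap: "(\<Sum>q\<in>A. \<Sum>j\<in>#M. f q j) = (\<Sum>j\<in>#M. \<Sum>q\<in>A. f q j)"
  by (induction M) (simp_all add: sum.distrib)

definition prodP :: "('n \<Rightarrow> complex) \<Rightarrow> ('n::finite \<times> nat) list \<Rightarrow> ('n \<Rightarrow> nat multiset) \<Rightarrow> int \<Rightarrow> int \<Rightarrow> 'n fock \<Rightarrow> 'n fock" where
  "prodP l A b r s w = fields l A r (fld l b s w)"

definition prodQ :: "('n \<Rightarrow> complex) \<Rightarrow> ('n::finite \<times> nat) list \<Rightarrow> ('n \<Rightarrow> nat multiset) \<Rightarrow> int \<Rightarrow> int \<Rightarrow> 'n fock \<Rightarrow> 'n fock" where
  "prodQ l A b r s w = fld l b s (fields l A r w)"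

lemma fields_shifts: "shifts (int (weight (state_of A)) - n) (fields l A n)"
  by (simp only: fields_eq_fld fld_shifts)

lemma prod_two_weight:
  "two_weight (int (weight (state_of A)) + int (weight b)) (prodP l A b)"
  "two_weight (int (weight (state_of A)) + int (weight b)) (prodQ l A b)"
  unfolding two_weight_def prodP_def [abs_def] prodQ_def [abs_def]
  by (auto intro!: shifts_comp[OF fields_shifts fld_shifts] shifts_comp[OF fld_shifts fields_shifts])

lemma prodP_trunc: "trunc_right (int (weight b)) (prodP l A b)"
  unfolding trunc_right_def prodP_def
proof (intro allI impI)
  fix d r s and w :: "'a fock" assume "deg_le d w" "d + int (weight b) < s"
  then have "fld l b s w = 0" by (intro fld_eq_0) auto
  then show "fields l A r (fld l b s w) = 0" by (simp add: clinear_0[OF fields_linear])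
qed

lemma prodQ_trunc: "trunc_left (int (weight (state_of A))) (prodQ l A b)"
  unfolding trunc_left_def prodQ_def
proof (intro allI impI)
  fix d r s and w :: "'a fock" assume "deg_le d w" "d + int (weight (state_of A)) < r"
  then have "fields l A r w = 0" unfolding fields_eq_fld by (intro fld_eq_0) auto
  then show "fld l b s (fields l A r w) = 0" by (simp add: clinear_0[OF fld_linear])
qed

lemma member_less_weight: "j \<in># b i \<Longrightarrow> j < weight b"
  using weight_remove[of j b i] by linarith

text \<open>The annihilation part of the outermost free field stands to the left of the field of b.
  Carrying it to the right by \<open>osc_fld\<close> costs one contraction per part of
  \<open>b i\<close>, and what remains is normally ordered around the whole product.\<close>

lemma prodP_rec:
  "prodP l ((i,k) # A) b r s w = wrap_left (osc l i) k (prodP l A b) r s w +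
    (\<Sum>j\<in>#b i. cscale (contraction k j) (dp (k + j + 2) (prodP l A (b(i := b i - {#j#}))) r s w))"
proof -
  let ?a = "osc l i" and ?C = "\<lambda>q::int. of_int (- q - 1) gchoose k :: complex"
  let ?b = "\<lambda>j. b(i := b i - {#j#})"
  obtain d where d: "d \<ge> 0" "deg_le d w" using deg_le_ex by blast
  obtain d2 where d2: "d2 \<ge> 0" "deg_le d2 (fld l b s w)" using deg_le_ex by blast
  \<comment> \<open>The window has to fit the vector \<open>fld l b s w\<close> before the
    commutation, which is why \<open>d2\<close> enters, and \<open>w\<close> after it.\<close>
  define M where "M = d + d2 + int (weight (state_of A)) + 2 * int (weight b) + \<bar>r\<bar> + \<bar>s\<bar> + int k"
  have "prodP l ((i,k) # A) b r s w = wrap ?a k (fields l A) r (fld l b s w)" by (simp add: prodP_def)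
  also have "\<dots> = (\<Sum>q\<in>{-M-1..M}. cscale (?C q) (app ?a q (fields l A (r - q - int k - 1)) (fld l b s w)))"
    by (rule wrap_eq_sum[OF osc_modes fields_shifts d2(2)]) (use d d2 in \<open>auto simp: M_def\<close>)
  also have "\<dots> = (\<Sum>q\<in>{-M-1..M}. cscale (?C q) (app ?a q (prodP l A b (r - q - int k - 1) s) w) +
      (\<Sum>j\<in>#b i. if q < 0 then 0 else cscale (?C q * (of_nat (j + 1) * (of_int q gchoose (j + 1))))
        (prodP l A (?b j) (r - q - int k - 1) (s + q - int j - 1) w)))"
  proof (rule sum.cong[OF refl])
    fix q
    have ms: "fields l A n (\<Sum>j\<in>#N. cscale (c j) (f j)) = (\<Sum>j\<in>#N. cscale (c j) (fields l A n (f j)))" for n c and N :: "nat multiset" and f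
      by (induction N) (simp_all add: clinear_0[OF fields_linear] clinear_add[OF fields_linear] clinear_cscale[OF fields_linear])
    have ms': "cscale x (\<Sum>j\<in>#N. cscale (c j) (f j)) = (\<Sum>j\<in>#N. cscale (x * c j) (f j))" for x N c and f :: "nat \<Rightarrow> 'a fock"
      by (induction N) (simp_all add: cvec.scale_right_distrib)
    show "cscale (?C q) (app ?a q (fields l A (r - q - int k - 1)) (fld l b s w)) =
      cscale (?C q) (app ?a q (prodP l A b (r - q - int k - 1) s) w) +
      (\<Sum>j\<in>#b i. if q < 0 then 0 else cscale (?C q * (of_nat (j + 1) * (of_int q gchoose (j + 1))))
        (prodP l A (?b j) (r - q - int k - 1) (s + q - int j - 1) w))"
    proof (cases "q < 0")
      case True then show ?thesis by (simp add: app_def prodP_def)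
    next
      case False
      have "app ?a q (fields l A (r - q - int k - 1)) (fld l b s w) = fields l A (r - q - int k - 1) (osc l i q (fld l b s w))"
        using False by (simp add: app_def)
      then show ?thesis using False
        unfolding osc_fld by (simp only: clinear_add[OF fields_linear] ms cvec.scale_right_distrib ms' app_def prodP_def if_False)
    qed
  qed
  also have "\<dots> = (\<Sum>q\<in>{-M-1..M}. cscale (?C q) (app ?a q (prodP l A b (r - q - int k - 1) s) w)) +
      (\<Sum>j\<in>#b i. \<Sum>q\<in>{-M-1..M}. if q < 0 then 0 else cscale (?C q * (of_nat (j + 1) * (of_int q gchoose (j + 1))))
        (prodP l A (?b j) (r - q - int k - 1) (s + q - int j - 1) w))"
    by (simp only: sum.distrib sum_sum_mset_swap)
  also have "(\<Sum>q\<in>{-M-1..M}. cscale (?C q) (app ?a q (prodP l A b (r - q - int k - 1) s) w)) = wrap_left ?a k (prodP l A b) r s w"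
    by (rule wrap_left_eq_sum[OF osc_modes prod_two_weight(1) d(2), symmetric]) (use d d2 in \<open>auto simp: M_def\<close>)
  also have "(\<Sum>j\<in>#b i. \<Sum>q\<in>{-M-1..M}. if q < 0 then 0 else cscale (?C q * (of_nat (j + 1) * (of_int q gchoose (j + 1))))
        (prodP l A (?b j) (r - q - int k - 1) (s + q - int j - 1) w)) =
      (\<Sum>j\<in>#b i. cscale (contraction k j) (dp (k + j + 2) (prodP l A (?b j)) r s w))"
  proof (intro arg_cong[of _ _ sum_mset] image_mset_cong)
    fix j assume "j \<in># b i"
    then show "(\<Sum>q\<in>{-M-1..M}. if q < 0 then 0 else cscale (?C q * (of_nat (j + 1) * (of_int q gchoose (j + 1))))
        (prodP l A (?b j) (r - q - int k - 1) (s + q - int j - 1) w)) =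
      cscale (contraction k j) (dp (k + j + 2) (prodP l A (?b j)) r s w)"
      using member_less_weight[of j b i] weight_remove[of j b i]
      by (intro dp_eq_mode_sum[OF prodP_trunc d(2)]) (use d d2 in \<open>auto simp: M_def\<close>)
  qed
  finally show ?thesis .
qed

text \<open>The mirror image: now the creation part stands to the right of the field of b and has to
  travel to the left, so the commutator enters with the opposite sign, in agreement with the
  expansion for |z| < |w|.\<close>

lemma prodQ_rec:
  "prodQ l ((i,k) # A) b r s w = wrap_left (osc l i) k (prodQ l A b) r s w +
    (\<Sum>j\<in>#b i. cscale (contraction k j) (dq (k + j + 2) (prodQ l A (b(i := b i - {#j#}))) r s w))"
proof -
  let ?a = "osc l i" and ?C = "\<lambda>q::int. of_int (- q - 1) gchoose k :: complex"
  let ?b = "\<lambda>j. b(i := b i - {#j#})"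
  obtain d where d: "d \<ge> 0" "deg_le d w" using deg_le_ex by blast
  define M where "M = d + int (weight (state_of A)) + int (weight b) + \<bar>r\<bar> + \<bar>s\<bar> + int k + 1"
  have "prodQ l ((i,k) # A) b r s w = fld l b s (wrap ?a k (fields l A) r w)" by (simp add: prodQ_def)
  also have "wrap ?a k (fields l A) r w = (\<Sum>q\<in>{-M-1..M}. cscale (?C q) (app ?a q (fields l A (r - q - int k - 1)) w))"
    by (rule wrap_eq_sum[OF osc_modes fields_shifts d(2)]) (use d in \<open>auto simp: M_def\<close>)
  also have "fld l b s \<dots> = (\<Sum>q\<in>{-M-1..M}. cscale (?C q) (fld l b s (app ?a q (fields l A (r - q - int k - 1)) w)))"
    by (simp only: clinear_sum[OF fld_linear] clinear_cscale[OF fld_linear])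
  also have "\<dots> = (\<Sum>q\<in>{-M-1..M}. cscale (?C q) (app ?a q (prodQ l A b (r - q - int k - 1) s) w) -
      (\<Sum>j\<in>#b i. if q < 0 then cscale (?C q * (of_nat (j + 1) * (of_int q gchoose (j + 1))))
        (prodQ l A (?b j) (r - q - int k - 1) (s + q - int j - 1) w) else 0))"
  proof (rule sum.cong[OF refl])
    fix q
    have ms': "cscale x (\<Sum>j\<in>#N. cscale (c j) (f j)) = (\<Sum>j\<in>#N. cscale (x * c j) (f j))" for x N c and f :: "nat \<Rightarrow> 'a fock"
      by (induction N) (simp_all add: cvec.scale_right_distrib)
    show "cscale (?C q) (fld l b s (app ?a q (fields l A (r - q - int k - 1)) w)) =
      cscale (?C q) (app ?a q (prodQ l A b (r - q - int k - 1) s) w) -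
      (\<Sum>j\<in>#b i. if q < 0 then cscale (?C q * (of_nat (j + 1) * (of_int q gchoose (j + 1))))
        (prodQ l A (?b j) (r - q - int k - 1) (s + q - int j - 1) w) else 0)"
    proof (cases "q < 0")
      case False then show ?thesis by (simp add: app_def prodQ_def)
    next
      case True
      let ?X = "fields l A (r - q - int k - 1) w"
      have e: "fld l b s (osc l i q ?X) = osc l i q (fld l b s ?X) -
          (\<Sum>j\<in>#b i. cscale (of_nat (j + 1) * (of_int q gchoose (j + 1))) (fld l (?b j) (s + q - int j - 1) ?X))"
        by (simp only: osc_fld add_diff_cancel_right')
      show ?thesis using True
        by (simp only: app_def if_True e prodQ_def cvec.scale_right_diff_distrib ms')
    qed
  qed
  also have "\<dots> = (\<Sum>q\<in>{-M-1..M}. cscale (?C q) (app ?a q (prodQ l A b (r - q - int k - 1) s) w)) +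
      (\<Sum>j\<in>#b i. - (\<Sum>q\<in>{-M-1..M}. if q < 0 then cscale (?C q * (of_nat (j + 1) * (of_int q gchoose (j + 1))))
        (prodQ l A (?b j) (r - q - int k - 1) (s + q - int j - 1) w) else 0))"
  proof -
    have neg: "(\<Sum>j\<in>#N. - f j) = - (\<Sum>j\<in>#N. f j)" for N and f :: "nat \<Rightarrow> 'a fock"
      by (induction N) simp_all
    show ?thesis by (simp only: sum_subtractf sum_sum_mset_swap neg) (simp only: diff_conv_add_uminus)
  qed
  also have "(\<Sum>q\<in>{-M-1..M}. cscale (?C q) (app ?a q (prodQ l A b (r - q - int k - 1) s) w)) = wrap_left ?a k (prodQ l A b) r s w"
    by (rule wrap_left_eq_sum[OF osc_modes prod_two_weight(2) d(2), symmetric]) (use d in \<open>auto simp: M_def\<close>)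
  also have "(\<Sum>j\<in>#b i. - (\<Sum>q\<in>{-M-1..M}. if q < 0 then cscale (?C q * (of_nat (j + 1) * (of_int q gchoose (j + 1))))
        (prodQ l A (?b j) (r - q - int k - 1) (s + q - int j - 1) w) else 0)) =
      (\<Sum>j\<in>#b i. cscale (contraction k j) (dq (k + j + 2) (prodQ l A (?b j)) r s w))"
    by (intro arg_cong[of _ _ sum_mset] image_mset_cong dq_eq_mode_sum[OF prodQ_trunc d(2)])
      (use d in \<open>auto simp: M_def\<close>)
  finally show ?thesis .
qed

section \<open>Vertex operators of arbitrary states\<close>

definition vertex :: "('n \<Rightarrow> complex) \<Rightarrow> 'n::finite fock \<Rightarrow> int \<Rightarrow> 'n fock \<Rightarrow> 'n fock" where
  "vertex l v n w = lin_ext (\<lambda>b. fld l b n w) v"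

lemma vertex_single: "vertex l (Poly_Mapping.single b c) n w = cscale c (fld l b n w)"
  by (simp add: vertex_def)

lemma vertex_linear_left: "clinear (\<lambda>v. vertex l v n w)"
  unfolding vertex_def by (rule lin_ext_linear)

lemma vertex_eq_sum: "vertex l v n w = (\<Sum>b\<in>Poly_Mapping.keys v. cscale (Poly_Mapping.lookup v b) (fld l b n w))"
  by (simp add: vertex_def lin_ext_def)

lemma is_field_vertex: "is_field (vertex l v)"
proof -
  have "is_field (\<lambda>n w. \<Sum>b\<in>Poly_Mapping.keys v. cscale (Poly_Mapping.lookup v b) (fld l b n w))"
    by (rule is_field_sum) (rule is_field_fld)
  then show ?thesis by (simp add: vertex_eq_sum [abs_def])
qed

lemma is_field_linear: "is_field F \<Longrightarrow> clinear (F n)"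
  by (auto simp: is_field_def weight_field_def dest: shifts_linear)

lemmas vertex_linear_right = is_field_linear[OF is_field_vertex]

lemma vertex_osc_neg:
  assumes "q < 0"
  shows "vertex l (osc m i q v) n w = wrap (osc l i) (nat (- q - 1)) (vertex l v) n w"
proof (rule linear_eq_on_basis [where f = "\<lambda>v. vertex l (osc m i q v) n w" and
      g = "\<lambda>v. wrap (osc l i) (nat (- q - 1)) (vertex l v) n w"])
  show "clinear (\<lambda>v. vertex l (osc m i q v) n w)"
    by (rule clinear_comp[OF vertex_linear_left osc_linear])
  show "clinear (\<lambda>v. wrap (osc l i) (nat (- q - 1)) (vertex l v) n w)"
  proof (rule clinearI)
    fix v v' :: "'a fock"
    have "vertex l (v + v') = (\<lambda>n w. vertex l v n w + vertex l v' n w)"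
      by (intro ext clinear_add[OF vertex_linear_left])
    then show "wrap (osc l i) (nat (- q - 1)) (vertex l (v + v')) n w =
        wrap (osc l i) (nat (- q - 1)) (vertex l v) n w + wrap (osc l i) (nat (- q - 1)) (vertex l v') n w"
      by (simp only: wrap_add[OF osc_modes is_field_vertex is_field_vertex])
  next
    fix c and v :: "'a fock"
    have "vertex l (cscale c v) = (\<lambda>n w. cscale c (vertex l v n w))"
      by (intro ext clinear_cscale[OF vertex_linear_left])
    then show "wrap (osc l i) (nat (- q - 1)) (vertex l (cscale c v)) n w =
        cscale c (wrap (osc l i) (nat (- q - 1)) (vertex l v) n w)"
      by (simp only: wrap_cscale[OF osc_modes is_field_vertex])
  qed
  fix b
  have "vertex l (Poly_Mapping.single b 1) = fld l b" for b :: "'a \<Rightarrow> nat multiset"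
    by (intro ext) (simp add: vertex_single)
  then show "vertex l (osc m i q (Poly_Mapping.single b 1)) n w =
      wrap (osc l i) (nat (- q - 1)) (vertex l (Poly_Mapping.single b 1)) n w"
    by (simp only: osc_neg[OF assms] fld_add)
qed

text \<open>The inner product is taken in the algebra, hence with momentum 0, while the resulting
  state acts on the module with momentum \<open>l\<close>.\<close>

definition iterR :: "('n \<Rightarrow> complex) \<Rightarrow> ('n::finite \<times> nat) list \<Rightarrow> ('n \<Rightarrow> nat multiset) \<Rightarrow> int \<Rightarrow> int \<Rightarrow> 'n fock \<Rightarrow> 'n fock" where
  "iterR l A b m = vertex l (fields (\<lambda>_. 0) A m (Poly_Mapping.single b 1))"

lemma sum_count_eq_sum_mset:
  fixes f :: "'x \<Rightarrow> ('b \<Rightarrow>\<^sub>0 complex)"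
  assumes "finite S" "set_mset N \<subseteq> S"
  shows "(\<Sum>j\<in>S. cscale (of_nat (count N j)) (f j)) = (\<Sum>j\<in>#N. f j)"
  using assms(2)
proof (induction N)
  case (add x N)
  have "(\<Sum>j\<in>S. cscale (of_nat (count (add_mset x N) j)) (f j)) =
      (\<Sum>j\<in>S. cscale (of_nat (count N j)) (f j) + (if j = x then f x else 0))"
    by (rule sum.cong) (auto simp: cvec.scale_left_distrib)
  then show ?case using add assms(1) by (simp add: sum.distrib add.commute)
qed simp

lemma fields_single_eq_0:
  "m > int (weight b) + int (weight (state_of A)) \<Longrightarrow> fields l A m (Poly_Mapping.single b 1) = 0"
  unfolding fields_eq_fld by (rule fld_eq_0[of "int (weight b)"]) (auto intro: deg_le_single)

text \<open>Inside the state the free field meets b directly. Its creation modes add a part, that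
  is, they wrap a higher derivative around the field of the state, which yields the Taylor series of
  \<open>wrap_iter\<close>. Its annihilation modes remove a part and give the contraction, here a
  mere shift of m. Its zero mode vanishes at momentum 0.\<close>

lemma iterR_rec:
  "iterR l ((i,k) # A) b m n w = wrap_iter (osc l i) k (iterR l A b) m n w +
    (\<Sum>j\<in>#b i. cscale (contraction k j) (iterR l A (b(i := b i - {#j#})) (m - int (k + j + 2)) n w))"
proof -
  let ?a = "osc (\<lambda>_. 0) i" and ?C = "\<lambda>q::int. of_int (- q - 1) gchoose k :: complex"
  let ?b = "\<lambda>j. b(i := b i - {#j#})" and ?v = "Poly_Mapping.single b 1"
  let ?F = "fields (\<lambda>_. 0) A"
  have d: "deg_le (int (weight b)) ?v" by (rule deg_le_single) simp
  define M where "M = int (weight (state_of A)) + int (weight b) + \<bar>m\<bar> + int k"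
  have "fields (\<lambda>_. 0) ((i,k) # A) m ?v = wrap ?a k ?F m ?v" by simp
  also have "\<dots> = (\<Sum>q\<in>{-M-1..M}. cscale (?C q) (app ?a q (?F (m - q - int k - 1)) ?v))"
    by (rule wrap_eq_sum[OF osc_modes fields_shifts d]) (auto simp: M_def)
  finally have "iterR l ((i,k) # A) b m n w = (\<Sum>q\<in>{-M-1..M}. cscale (?C q) (vertex l (app ?a q (?F (m - q - int k - 1)) ?v) n w))"
    unfolding iterR_def by (simp only: clinear_sum[OF vertex_linear_left] clinear_cscale[OF vertex_linear_left])
  also have "\<dots> = (\<Sum>q\<in>{-M-1..M}. (if q < 0 then cscale (?C q) (wrap (osc l i) (nat (- q - 1)) (vertex l (?F (m - q - int k - 1) ?v)) n w) else 0) +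
      (if q > 0 then cscale (?C q) (cscale (of_int q * of_nat (count (b i) (nat (q - 1)))) (iterR l A (?b (nat (q - 1))) (m - q - int k - 1) n w)) else 0))"
  proof (rule sum.cong[OF refl])
    fix q :: int
    consider "q < 0" | "q = 0" | "q > 0" by linarith
    then show "cscale (?C q) (vertex l (app ?a q (?F (m - q - int k - 1)) ?v) n w) =
      (if q < 0 then cscale (?C q) (wrap (osc l i) (nat (- q - 1)) (vertex l (?F (m - q - int k - 1) ?v)) n w) else 0) +
      (if q > 0 then cscale (?C q) (cscale (of_int q * of_nat (count (b i) (nat (q - 1)))) (iterR l A (?b (nat (q - 1))) (m - q - int k - 1) n w)) else 0)"
    proof cases
      case 1 then show ?thesis by (simp add: app_def vertex_osc_neg)
    next
      case 2 then show ?thesis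
        by (simp add: app_def osc_zero clinear_0[OF fields_linear] clinear_0[OF vertex_linear_left])
    next
      case 3
      have "?a q ?v = cscale (of_int q * of_nat (count (b i) (nat (q - 1)))) (Poly_Mapping.single (?b (nat (q - 1))) 1)"
        using 3 by (simp add: osc_pos cscale_single)
      then show ?thesis using 3
        by (simp add: app_def iterR_def clinear_cscale[OF fields_linear] clinear_cscale[OF vertex_linear_left])
    qed
  qed
  also have "\<dots> = (\<Sum>q\<in>{-M-1..M}. if q < 0 then cscale (?C q) (wrap (osc l i) (nat (- q - 1)) (vertex l (?F (m - q - int k - 1) ?v)) n w) else 0) +
      (\<Sum>q\<in>{-M-1..M}. if q > 0 then cscale (?C q) (cscale (of_int q * of_nat (count (b i) (nat (q - 1)))) (iterR l A (?b (nat (q - 1))) (m - q - int k - 1) n w)) else 0)"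
    by (rule sum.distrib)
  also have "(\<Sum>q\<in>{-M-1..M}. if q < 0 then cscale (?C q) (wrap (osc l i) (nat (- q - 1)) (vertex l (?F (m - q - int k - 1) ?v)) n w) else 0) =
      wrap_iter (osc l i) k (iterR l A b) m n w" (is "sum ?f _ = _")
  proof -
    \<comment> \<open>The creation mode -k-1-t corresponds to the Taylor index t: it adds the part k
      + t with coefficient (k+t choose t).\<close>
    define K where "K = nat (M - int k + 1)"
    let ?g = "\<lambda>t::nat. - int k - 1 - int t"
    have "sum ?f {-M-1..M} = sum ?f (?g ` {..<K})"
    proof (rule sum.mono_neutral_right)
      show "?g ` {..<K} \<subseteq> {-M-1..M}" by (auto simp: K_def M_def)
      show "\<forall>q\<in>{-M-1..M} - ?g ` {..<K}. ?f q = 0"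
      proof
        fix q assume q: "q \<in> {-M-1..M} - ?g ` {..<K}"
        show "?f q = 0"
        proof (cases "q < 0")
          case True
          have "- q - 1 < int k"
          proof (rule ccontr)
            assume "\<not> - q - 1 < int k"
            then have "q = ?g (nat (- q - 1 - int k))" "nat (- q - 1 - int k) < K" using q by (auto simp: K_def)
            then show False using q by blast
          qed
          then have "(of_nat (nat (- q - 1)) gchoose k :: complex) = 0"
            using True unfolding binomial_gbinomial [symmetric] by (simp add: binomial_eq_0 nat_less_iff)
          then show ?thesis using True by simp
        qed simp
      qed
    qed simp
    also have "\<dots> = (\<Sum>t<K. ?f (?g t))"
      by (rule sum.reindex_cong[of ?g]) (auto simp: inj_on_def)
    also have "\<dots> = (\<Sum>t<K. cscale (of_nat ((k + t) choose t)) (wrap (osc l i) (k + t) (iterR l A b (m + int t)) n w))"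
    proof (rule sum.cong[OF refl])
      fix t
      have 1: "m - ?g t - int k - 1 = m + int t" "?g t < 0" "nat (- ?g t - 1) = k + t" by auto
      have 2: "?C (?g t) = of_nat ((k + t) choose t)"
      proof -
        have "of_int (- ?g t - 1) = (of_nat (k + t) :: complex)" by simp
        then show ?thesis using binomial_symmetric[of t "k + t"] by (simp only: binomial_gbinomial [symmetric]) simp
      qed
      show "?f (?g t) = cscale (of_nat ((k + t) choose t)) (wrap (osc l i) (k + t) (iterR l A b (m + int t)) n w)"
        by (simp only: 1 2 iterR_def if_True)
    qed
    also have "\<dots> = wrap_iter (osc l i) k (iterR l A b) m n w"
      unfolding wrap_iter_def
    proof (rule Sum_any_eq_sum_nat [symmetric])
      fix t assume "K \<le> t"
      then have "?F (m + int t) ?v = 0" by (intro fields_single_eq_0) (auto simp: K_def M_def)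
      then have "iterR l A b (m + int t) = (\<lambda>n w. 0)"
        by (intro ext) (simp add: iterR_def clinear_0[OF vertex_linear_left])
      then show "cscale (of_nat ((k + t) choose t)) (wrap (osc l i) (k + t) (iterR l A b (m + int t)) n w) = 0"
        by (simp add: wrap_zero[OF osc_modes])
    qed
    finally show ?thesis .
  qed
  also have "(\<Sum>q\<in>{-M-1..M}. if q > 0 then cscale (?C q) (cscale (of_int q * of_nat (count (b i) (nat (q - 1)))) (iterR l A (?b (nat (q - 1))) (m - q - int k - 1) n w)) else 0) =
      (\<Sum>j\<in>#b i. cscale (contraction k j) (iterR l A (?b j) (m - int (k + j + 2)) n w))" (is "sum ?f _ = _")
  proof -
    \<comment> \<open>The mode j + 1 removes a part with index j. Its multiplicity turns the sum
      over modes into a sum over the multiset \<open>b i\<close>.\<close>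
    let ?g = "\<lambda>j::nat. int j + 1"
    have "sum ?f {-M-1..M} = sum ?f (?g ` {..<nat M})"
    proof (rule sum.mono_neutral_right)
      show "?g ` {..<nat M} \<subseteq> {-M-1..M}" by (auto simp: M_def)
      show "\<forall>q\<in>{-M-1..M} - ?g ` {..<nat M}. ?f q = 0"
      proof
        fix q assume q: "q \<in> {-M-1..M} - ?g ` {..<nat M}"
        have "\<not> q > 0"
        proof
          assume "q > 0"
          then have "q = ?g (nat (q - 1))" "nat (q - 1) < nat M" using q by auto
          then show False using q by blast
        qed
        then show "?f q = 0" by simp
      qed
    qed simp
    also have "\<dots> = (\<Sum>j<nat M. ?f (?g j))"
      by (rule sum.reindex_cong[of ?g]) (auto simp: inj_on_def)
    also have "\<dots> = (\<Sum>j<nat M. cscale (of_nat (count (b i) j)) (cscale (contraction k j) (iterR l A (?b j) (m - int (k + j + 2)) n w)))"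
    proof (rule sum.cong[OF refl])
      fix j
      have 1: "m - ?g j - int k - 1 = m - int (k + j + 2)" "?g j > 0" "nat (?g j - 1) = j" by auto
      have "?C (?g j) = (-1) ^ k * of_nat ((j + 1 + k) choose k)"
        using gbinomial_neg_nat[of "j + 1" k] by simp
      then have 2: "?C (?g j) * (of_int (?g j) * of_nat (count (b i) j)) = of_nat (count (b i) j) * contraction k j"
        by (simp add: contraction_def add_ac mult_ac)
      show "?f (?g j) = cscale (of_nat (count (b i) j)) (cscale (contraction k j) (iterR l A (?b j) (m - int (k + j + 2)) n w))"
        by (simp only: 1 2 if_True cvec.scale_scale)
    qed
    also have "\<dots> = (\<Sum>j\<in>#b i. cscale (contraction k j) (iterR l A (?b j) (m - int (k + j + 2)) n w))"
    proof (rule sum_count_eq_sum_mset)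
      show "set_mset (b i) \<subseteq> {..<nat M}"
        using member_less_weight[of _ b i] by (force simp: M_def)
    qed simp
    finally show ?thesis .
  qed
  finally show ?thesis .
qed

definition is_borcherds where "is_borcherds P Q R \<longleftrightarrow> (\<exists>h c. borcherds h c P Q R)"

lemma is_borcherds_add:
  assumes "is_borcherds P Q R" "is_borcherds P' Q' R'"
  shows "is_borcherds (\<lambda>r s w. P r s w + P' r s w) (\<lambda>r s w. Q r s w + Q' r s w) (\<lambda>r s w. R r s w + R' r s w)"
proof -
  obtain h c h' c' where "borcherds h c P Q R" "borcherds h' c' P' Q' R'"
    using assms by (auto simp: is_borcherds_def)
  then have "borcherds (max h h') (max c c') P Q R" "borcherds (max h h') (max c c') P' Q' R'"
    by (auto elim!: borcherds_mono)
  then show ?thesis unfolding is_borcherds_def using borcherds_add by blast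
qed

lemma is_borcherds_cscale:
  "is_borcherds P Q R \<Longrightarrow> is_borcherds (\<lambda>r s w. cscale a (P r s w)) (\<lambda>r s w. cscale a (Q r s w)) (\<lambda>r s w. cscale a (R r s w))"
  unfolding is_borcherds_def using borcherds_cscale by blast

lemma is_borcherds_zero: "is_borcherds (\<lambda>r s w. 0) (\<lambda>r s w. 0) (\<lambda>r s w. 0)"
  unfolding is_borcherds_def using borcherds_zero by blast

lemma is_borcherds_sum_mset:
  assumes "\<And>j. is_borcherds (P j) (Q j) (R j)"
  shows "is_borcherds (\<lambda>r s w. \<Sum>j\<in>#N. cscale (c j) (P j r s w)) (\<lambda>r s w. \<Sum>j\<in>#N. cscale (c j) (Q j r s w))
    (\<lambda>r s w. \<Sum>j\<in>#N. cscale (c j) (R j r s w))"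
  by (induction N) (simp_all add: is_borcherds_zero is_borcherds_add[OF is_borcherds_cscale[OF assms]])

lemma is_borcherds_sum:
  assumes "\<And>j. is_borcherds (P j) (Q j) (R j)"
  shows "is_borcherds (\<lambda>r s w. \<Sum>j\<in>N. cscale (c j) (P j r s w)) (\<lambda>r s w. \<Sum>j\<in>N. cscale (c j) (Q j r s w))
    (\<lambda>r s w. \<Sum>j\<in>N. cscale (c j) (R j r s w))"
  by (induction N rule: infinite_finite_induct)
    (simp_all add: is_borcherds_zero is_borcherds_add[OF is_borcherds_cscale[OF assms]])

text \<open>The three recursions have the same shape: the wrapped triple for A and b, plus triples
  for A and a smaller b divided by powers of z - w. Hence b has to be arbitrary in the induction on
  A.\<close>

theorem borcherds_fields: "is_borcherds (prodP l A b) (prodQ l A b) (iterR l A b)"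
proof (induction A arbitrary: b)
  case Nil
  have "prodP l [] b = (\<lambda>r s w. if r = -1 then fld l b s w else 0)"
    "prodQ l [] b = (\<lambda>r s w. if r = -1 then fld l b s w else 0)"
    "iterR l [] b = (\<lambda>r s w. if r = -1 then fld l b s w else 0)"
    by (auto simp: fun_eq_iff prodP_def prodQ_def iterR_def vertex_single clinear_0[OF fld_linear]
        clinear_0[OF vertex_linear_left])
  then show ?case using borcherds_unit[OF fld_weight_field, of b l] unfolding is_borcherds_def by metis
next
  case (Cons x A)
  obtain i k where x: "x = (i, k)" by fastforce
  have W: "is_borcherds (wrap_left (osc l i) k (prodP l A b)) (wrap_left (osc l i) k (prodQ l A b)) (wrap_iter (osc l i) k (iterR l A b))"
    using Cons borcherds_wrap[OF osc_modes] unfolding is_borcherds_def by blast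
  have D: "is_borcherds (dp (k + j + 2) (prodP l A (b(i := b i - {#j#})))) (dq (k + j + 2) (prodQ l A (b(i := b i - {#j#}))))
      (\<lambda>m n. iterR l A (b(i := b i - {#j#})) (m - int (k + j + 2)) n)" for j
    using Cons[of "b(i := b i - {#j#})"] borcherds_div[where N = "k + j + 2"] unfolding is_borcherds_def by blast
  show ?case
    unfolding x prodP_rec [abs_def] prodQ_rec [abs_def] iterR_rec [abs_def]
    by (rule is_borcherds_add[OF W is_borcherds_sum_mset[OF D]])
qed

corollary borcherds_vertex:
  "is_borcherds (\<lambda>r s w. vertex l u r (vertex l v s w)) (\<lambda>r s w. vertex l v s (vertex l u r w))
    (\<lambda>m n w. vertex l (vertex (\<lambda>_. 0) u m v) n w)"
proof -
  have B: "is_borcherds (\<lambda>r s w. fld l a r (fld l b s w)) (\<lambda>r s w. fld l b s (fld l a r w))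
      (\<lambda>m n w. vertex l (fld (\<lambda>_. 0) a m (Poly_Mapping.single b 1)) n w)" for a b
    using borcherds_fields[of l "state_list a" b]
    by (simp add: prodP_def [abs_def] prodQ_def [abs_def] iterR_def [abs_def] fields_eq_fld state_of_state_list)
  let ?u = "Poly_Mapping.keys u" and ?v = "Poly_Mapping.keys v"
  let ?c = "Poly_Mapping.lookup u" and ?d = "Poly_Mapping.lookup v"
  have v: "v = (\<Sum>b\<in>?v. cscale (?d b) (Poly_Mapping.single b 1))"
    by (rule poly_mapping_eqI) (simp add: lookup_sum cscale_single lookup_single when_def in_keys_iff del: lookup_cscale)
  have 1: "vertex l u r (vertex l v s w) = (\<Sum>a\<in>?u. cscale (?c a) (\<Sum>b\<in>?v. cscale (?d b) (fld l a r (fld l b s w))))" for r s w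
    by (simp add: vertex_eq_sum clinear_sum[OF fld_linear] clinear_cscale[OF fld_linear])
  have 2: "vertex l v s (vertex l u r w) = (\<Sum>a\<in>?u. cscale (?c a) (\<Sum>b\<in>?v. cscale (?d b) (fld l b s (fld l a r w))))" for r s w
    unfolding vertex_eq_sum clinear_sum[OF fld_linear] clinear_cscale[OF fld_linear] cvec.scale_sum_right
    by (subst sum.swap) (simp add: mult.commute)
  have 3: "vertex l (vertex (\<lambda>_. 0) u m v) n w =
      (\<Sum>a\<in>?u. cscale (?c a) (\<Sum>b\<in>?v. cscale (?d b) (vertex l (fld (\<lambda>_. 0) a m (Poly_Mapping.single b 1)) n w)))" for m n w
    unfolding vertex_eq_sum[of "\<lambda>_. 0"]
    by (subst v) (simp only: clinear_sum[OF fld_linear] clinear_cscale[OF fld_linear]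
        clinear_sum[OF vertex_linear_left] clinear_cscale[OF vertex_linear_left])
  show ?thesis unfolding 1 2 3 by (rule is_borcherds_sum[OF is_borcherds_sum[OF B]])
qed

section \<open>Comparison with the modes of the tensor power\<close>

lemma finite_pointwise: "(\<And>i::'n::finite. finite (K i)) \<Longrightarrow> finite {b. \<forall>i. b i \<in> K i}"
  using finite_PiE[of "UNIV :: 'n set" K] by (simp add: PiE_UNIV_domain Pi_def)

lemma lookup_pure_tensor: "Poly_Mapping.lookup (pure_tensor v) b = (\<Prod>i\<in>UNIV. Poly_Mapping.lookup (v i) (b i))"
proof -
  let ?S = "{b. \<forall>i. b i \<in> Poly_Mapping.keys (v i)}"
  have fin: "finite ?S" by (rule finite_pointwise) simp
  have "Poly_Mapping.lookup (pure_tensor v) b = (\<Sum>c\<in>?S. if c = b then (\<Prod>i\<in>UNIV. Poly_Mapping.lookup (v i) (b i)) else 0)"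
    unfolding pure_tensor_def lookup_sum by (rule sum.cong) (auto simp: lookup_single when_def)
  also have "\<dots> = (if b \<in> ?S then (\<Prod>i\<in>UNIV. Poly_Mapping.lookup (v i) (b i)) else 0)"
    using fin by simp
  also have "\<dots> = (\<Prod>i\<in>UNIV. Poly_Mapping.lookup (v i) (b i))"
    by (auto simp: in_keys_iff)
  finally show ?thesis .
qed

lemma pure_tensor_single: "pure_tensor (\<lambda>i. Poly_Mapping.single (b i) 1) = Poly_Mapping.single b 1"
proof (rule poly_mapping_eqI)
  fix c
  have "(\<Prod>i\<in>UNIV. if b i = c i then 1 else 0 :: complex) = (if \<forall>i. b i = c i then 1 else 0)" by auto
  then show "Poly_Mapping.lookup (pure_tensor (\<lambda>i. Poly_Mapping.single (b i) 1)) c = Poly_Mapping.lookup (Poly_Mapping.single b 1) c"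
    by (simp add: lookup_pure_tensor lookup_single when_def fun_eq_iff)
qed

lemma pure_tensor_linear: "clinear (\<lambda>x. pure_tensor (v(i := x)))"
proof -
  have *: "Poly_Mapping.lookup (pure_tensor (v(i := x))) b =
      Poly_Mapping.lookup x (b i) * (\<Prod>j\<in>UNIV - {i}. Poly_Mapping.lookup (v j) (b j))" for x b
    unfolding lookup_pure_tensor by (subst prod.remove[of UNIV i]) auto
  show ?thesis
    by (rule clinearI; rule poly_mapping_eqI) (simp_all only: * lookup_add lookup_cscale distrib_right mult.assoc)
qed

lemma pure_tensor_zero: "v i = 0 \<Longrightarrow> pure_tensor v = 0"
  using clinear_0[OF pure_tensor_linear[of v i]] by (metis fun_upd_triv)

text \<open>The arguments are replaced by basis vectors one coordinate at a time; the induction runs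
  over the set of coordinates that are still arbitrary.\<close>

lemma multilinear_eqI:
  fixes F G :: "('n::finite \<Rightarrow> ('b \<Rightarrow>\<^sub>0 complex)) \<Rightarrow> ('c \<Rightarrow>\<^sub>0 complex)"
  assumes F: "\<And>v i. clinear (\<lambda>x. F (v(i := x)))" and G: "\<And>v i. clinear (\<lambda>x. G (v(i := x)))"
    and eq: "\<And>b. F (\<lambda>i. Poly_Mapping.single (b i) 1) = G (\<lambda>i. Poly_Mapping.single (b i) 1)"
  shows "F v = G v"
proof -
  have "F v = G v" if "finite S" "\<forall>i. i \<notin> S \<longrightarrow> (\<exists>b. v i = Poly_Mapping.single b 1)" for S v
    using that
  proof (induction arbitrary: v rule: finite_induct)
    case empty
    then obtain b where "\<And>i. v i = Poly_Mapping.single (b i) 1" by (metis empty_iff)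
    then have "v = (\<lambda>i. Poly_Mapping.single (b i) 1)" by auto
    then show ?case using eq by simp
  next
    case (insert i S)
    have "F (v(i := v i)) = G (v(i := v i))"
    proof (rule linear_eq_on_basis[OF F G])
      fix b show "F (v(i := Poly_Mapping.single b 1)) = G (v(i := Poly_Mapping.single b 1))"
        by (rule insert.IH) (use insert.prems in auto)
    qed
    then show ?case by simp
  qed
  from this[of UNIV v] show ?thesis by simp
qed

lemma osc_pure_tensor:
  "osc (\<lambda>_. 0) i q (pure_tensor v) = pure_tensor (v(i := heis_alpha q (v i)))"
proof (rule multilinear_eqI[where F = "\<lambda>v. osc (\<lambda>_. 0) i q (pure_tensor v)" and
      G = "\<lambda>v. pure_tensor (v(i := heis_alpha q (v i)))"])
  fix v :: "'a \<Rightarrow> (nat multiset \<Rightarrow>\<^sub>0 complex)" and j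
  show "clinear (\<lambda>x. osc (\<lambda>_. 0) i q (pure_tensor (v(j := x))))"
    by (rule clinear_comp[OF osc_linear pure_tensor_linear])
  show "clinear (\<lambda>x. pure_tensor ((v(j := x))(i := heis_alpha q ((v(j := x)) i))))"
  proof (cases "i = j")
    case True
    then show ?thesis using clinear_comp[OF pure_tensor_linear[of v i] heis_alpha_linear] by simp
  next
    case False
    then have "(v(j := x))(i := heis_alpha q ((v(j := x)) i)) = (v(i := heis_alpha q (v i)))(j := x)" for x
      by (auto simp: fun_eq_iff)
    then show ?thesis by (simp only: pure_tensor_linear)
  qed
next
  fix b :: "'a \<Rightarrow> nat multiset"
  let ?v = "\<lambda>j. Poly_Mapping.single (b j) (1::complex)"
  have upd: "pure_tensor (?v(i := Poly_Mapping.single m c)) = Poly_Mapping.single (b(i := m)) c" for m c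
  proof -
    have "pure_tensor (?v(i := cscale c (Poly_Mapping.single m 1))) = cscale c (pure_tensor (?v(i := Poly_Mapping.single m 1)))"
      by (rule clinear_cscale[OF pure_tensor_linear])
    moreover have "?v(i := Poly_Mapping.single m 1) = (\<lambda>j. Poly_Mapping.single ((b(i := m)) j) 1)" by auto
    ultimately show ?thesis by (simp add: cscale_single pure_tensor_single del: fun_upd_apply)
  qed
  consider "q < 0" | "q = 0" | "q > 0" by linarith
  then show "osc (\<lambda>_. 0) i q (pure_tensor ?v) = pure_tensor (?v(i := heis_alpha q (?v i)))"
  proof cases
    case 1 then show ?thesis by (simp add: pure_tensor_single osc_neg heis_alpha_neg upd del: fun_upd_apply)
  next
    case 2 then show ?thesis
      by (simp add: pure_tensor_single osc_zero heis_alpha_0 pure_tensor_zero[of _ i])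
  next
    case 3 then show ?thesis by (simp add: pure_tensor_single osc_pos heis_alpha_pos upd del: fun_upd_apply)
  qed
qed

lemma heis_alpha_eventually_0: "\<exists>M. \<forall>m>M. heis_alpha m x = 0"
proof -
  have "\<exists>M. \<forall>m>M. heis_alpha m (Poly_Mapping.single \<mu> 1) = 0" for \<mu>
  proof (intro exI[of _ "int (Max (insert 0 (set_mset \<mu>))) + 1"] allI impI)
    fix m assume m: "m > int (Max (insert 0 (set_mset \<mu>))) + 1"
    have "nat (m - 1) \<notin># \<mu>"
    proof
      assume "nat (m - 1) \<in># \<mu>"
      then have "nat (m - 1) \<le> Max (insert 0 (set_mset \<mu>))" by simp
      then show False using m by linarith
    qed
    then show "heis_alpha m (Poly_Mapping.single \<mu> 1) = 0"
      using m by (simp add: heis_alpha_pos not_in_iff)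
  qed
  then obtain M where M: "\<And>\<mu> m. m > M \<mu> \<Longrightarrow> heis_alpha m (Poly_Mapping.single \<mu> 1) = 0" by metis
  have fin: "finite (Poly_Mapping.keys x)" by simp
  have x: "heis_alpha m x = (\<Sum>\<mu>\<in>Poly_Mapping.keys x. cscale (Poly_Mapping.lookup x \<mu>) (heis_alpha m (Poly_Mapping.single \<mu> 1)))" for m
    by (simp add: heis_alpha_def) (simp only: lin_ext_def)
  have "\<forall>m>Max (insert 0 (M ` Poly_Mapping.keys x)). heis_alpha m x = 0"
  proof (intro allI impI)
    fix m assume m: "m > Max (insert 0 (M ` Poly_Mapping.keys x))"
    have "m > M \<mu>" if "\<mu> \<in> Poly_Mapping.keys x" for \<mu>
      by (rule le_less_trans[OF Max_ge m]) (use that in auto)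
    then show "heis_alpha m x = 0" unfolding x by (intro sum.neutral ballI) (simp add: M)
  qed
  then show ?thesis by blast
qed

text \<open>Uniformity in m comes for free because only finitely many of the \<open>g m\<close> with
  m >= 0 are nonzero.\<close>

lemma eventually_0_uniform:
  assumes "\<And>x. \<exists>B::int. \<forall>p>B. F p x = (0 :: 'a::zero)"
    and z: "\<And>p. F p 0 = 0" and g: "\<exists>M::int. \<forall>m>M. g m = (0::'b::zero)"
  shows "\<exists>B. \<forall>m\<ge>0. \<forall>p>B. F p (g m) = 0"
proof -
  obtain M where M: "\<And>m. m > M \<Longrightarrow> g m = 0" using g by blast
  obtain B where B: "\<And>x p. p > B x \<Longrightarrow> F p x = 0" using assms(1) by metis
  have "F p (g m) = 0" if "m \<ge> 0" "p > Max (insert 0 ((\<lambda>m. B (g m)) ` {0..M}))" for m p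
  proof (cases "m \<le> M")
    case True
    have "p > B (g m)" by (rule le_less_trans[OF Max_ge that(2)]) (use True that(1) in auto)
    then show ?thesis by (rule B)
  next
    case False then show ?thesis using M z by simp
  qed
  then show ?thesis by blast
qed

definition heis_term where
  "heis_term k ks p x m = (if m < 0 then heis_alpha m (heis_field ks (p - m - int k - 1) x)
        else heis_field ks (p - m - int k - 1) (heis_alpha m x))"

lemma heis_field_Cons: "heis_field (k # ks) p x = Sum_any (\<lambda>m. cscale (of_int (- m - 1) gchoose k) (heis_term k ks p x m))"
  by (simp add: heis_term_def)

lemma heis_field_zero: "heis_field ks p 0 = 0"
proof (induction ks arbitrary: p)
  case (Cons k ks)
  have "heis_term k ks p 0 m = 0" for m
    using Cons clinear_0[OF heis_alpha_linear] by (simp add: heis_term_def)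
  then show ?case by (simp only: heis_field_Cons) simp
qed simp

text \<open>Creation modes only raise the index of the inner field, whereas nonnegative modes
  produce finitely many nonzero vectors, for which one bound \<open>B2\<close> serves.\<close>

lemma heis_field_eventually_0: "\<exists>B. \<forall>p>B. heis_field ks p x = 0"
proof (induction ks arbitrary: x)
  case Nil
  show ?case by (intro exI[of _ 0]) simp
next
  case (Cons k ks)
  obtain B1 where B1: "\<And>p. p > B1 \<Longrightarrow> heis_field ks p x = 0" using Cons by blast
  obtain B2 where B2: "\<And>m p. m \<ge> 0 \<Longrightarrow> p > B2 \<Longrightarrow> heis_field ks p (heis_alpha m x) = 0"
    using eventually_0_uniform[of "heis_field ks" "\<lambda>m. heis_alpha m x"] Cons heis_field_zero heis_alpha_eventually_0 by blast
  obtain M where M: "\<And>m. m > M \<Longrightarrow> heis_alpha m x = 0" using heis_alpha_eventually_0 by blast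
  have "heis_field (k # ks) p x = 0" if p: "p > max B1 (B2 + \<bar>M\<bar> + 1) + int k" for p
  proof -
    have "heis_term k ks p x m = 0" for m
    proof (cases "m < 0")
      case True
      then have "heis_field ks (p - m - int k - 1) x = 0" using p by (intro B1) auto
      then show ?thesis using True by (simp add: heis_term_def clinear_0[OF heis_alpha_linear])
    next
      case m: False
      show ?thesis
      proof (cases "m > M")
        case True then show ?thesis using m by (simp add: heis_term_def M heis_field_zero)
      next
        case False then show ?thesis using m p by (simp add: heis_term_def B2)
      qed
    qed
    then show ?thesis by (simp only: heis_field_Cons) simp
  qed
  then show ?case by blast
qed

lemma heis_term_finite: "finite {m. cscale (C m) (heis_term k ks p x m) \<noteq> 0}"
proof -
  obtain B1 where B1: "\<And>p. p > B1 \<Longrightarrow> heis_field ks p x = 0" using heis_field_eventually_0 by blast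
  obtain M where M: "\<And>m. m > M \<Longrightarrow> heis_alpha m x = 0" using heis_alpha_eventually_0 by blast
  have "{m. cscale (C m) (heis_term k ks p x m) \<noteq> 0} \<subseteq> {- \<bar>p - int k - 1 - B1\<bar> - 1..\<bar>M\<bar>} \<union> {p - int k - 1 - B1..\<bar>M\<bar>}"
  proof (rule subsetI, rule ccontr)
    fix m assume m: "m \<in> {m. cscale (C m) (heis_term k ks p x m) \<noteq> 0}" "m \<notin> {- \<bar>p - int k - 1 - B1\<bar> - 1..\<bar>M\<bar>} \<union> {p - int k - 1 - B1..\<bar>M\<bar>}"
    have "heis_term k ks p x m = 0"
    proof (cases "m < 0")
      case True
      then have "heis_field ks (p - m - int k - 1) x = 0" using m(2) by (intro B1) auto
      then show ?thesis using True by (simp add: heis_term_def clinear_0[OF heis_alpha_linear])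
    next
      case False
      then have "m > M" using m(2) by auto
      then show ?thesis using False by (simp add: heis_term_def M heis_field_zero)
    qed
    then show False using m(1) by simp
  qed
  then show ?thesis by (rule finite_subset) simp
qed

text \<open>An upper bound on every index and a prescribed total force a lower bound on each of
  them.\<close>

lemma finite_bounded_sum:
  "finite {p :: 'n::finite \<Rightarrow> int. (\<forall>j. p j \<le> B) \<and> (\<Sum>j\<in>UNIV. p j + 1) = c}"
proof (rule finite_subset)
  show "{p :: 'n \<Rightarrow> int. (\<forall>j. p j \<le> B) \<and> (\<Sum>j\<in>UNIV. p j + 1) = c} \<subseteq>
      {p. \<forall>j. p j \<in> {c - 1 - of_nat (CARD('n)) * \<bar>B + 1\<bar>..B}}"
  proof (intro subsetI CollectI allI)
    fix p :: "'n \<Rightarrow> int" and j assume p: "p \<in> {p. (\<forall>j. p j \<le> B) \<and> (\<Sum>j\<in>UNIV. p j + 1) = c}"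
    have "(\<Sum>j\<in>UNIV - {j}. p j + 1) \<le> of_nat (card (UNIV - {j})) * \<bar>B + 1\<bar>"
      by (rule sum_bounded_above) (use p in \<open>auto intro: order_trans[of _ "B + 1"]\<close>)
    also have "\<dots> \<le> of_nat (CARD('n)) * \<bar>B + 1\<bar>"
      by (intro mult_right_mono) (auto intro: card_mono)
    finally have "(\<Sum>j\<in>UNIV - {j}. p j + 1) \<le> of_nat (CARD('n)) * \<bar>B + 1\<bar>" .
    moreover have "c = (p j + 1) + (\<Sum>j\<in>UNIV - {j}. p j + 1)"
      using p by (subst sum.remove[of UNIV j, symmetric]) auto
    ultimately show "p j \<in> {c - 1 - of_nat (CARD('n)) * \<bar>B + 1\<bar>..B}" using p by auto
  qed
qed (rule finite_pointwise, simp)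

text \<open>The inner sum of \<open>heis_tensor_mode\<close>, with arbitrary lists and arbitrary
  vectors in the factors, as needed for an induction on the lists.\<close>

definition tensor_field :: "('n::finite \<Rightarrow> nat list) \<Rightarrow> int \<Rightarrow> ('n \<Rightarrow> (nat multiset \<Rightarrow>\<^sub>0 complex)) \<Rightarrow> 'n fock" where
  "tensor_field L n v = Sum_any (\<lambda>p :: 'n \<Rightarrow> int.
       if (\<Sum>i\<in>UNIV. p i + 1) = n + 1 then pure_tensor (\<lambda>i. heis_field (L i) (p i) (v i)) else 0)"

lemma tensor_field_Nil: "tensor_field (\<lambda>_. []) n v = (if n = -1 then pure_tensor v else 0)"
proof -
  have "(if (\<Sum>i\<in>UNIV. p i + 1) = n + 1 then pure_tensor (\<lambda>i. heis_field [] (p i) (v i)) else 0) =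
      (if p = (\<lambda>_. -1) then if n = -1 then pure_tensor v else 0 else 0)" for p :: "'a \<Rightarrow> int"
  proof (cases "p = (\<lambda>_. -1)")
    case False
    then obtain i where "p i \<noteq> -1" by auto
    then have "pure_tensor (\<lambda>i. heis_field [] (p i) (v i)) = 0" by (intro pure_tensor_zero[of _ i]) simp
    then show ?thesis using False by simp
  qed auto
  then show ?thesis unfolding tensor_field_def by (simp only: Sum_any.delta)
qed

lemma tensor_field_finite:
  "finite {p :: 'n \<Rightarrow> int. (if (\<Sum>i\<in>UNIV. p i + 1) = n then pure_tensor (\<lambda>i. heis_field (L i) (p i) (v i)) else 0) \<noteq> (0 :: 'n::finite fock)}"
proof -
  have "\<forall>i. \<exists>B. \<forall>p>B. heis_field (L i) p (v i) = 0" using heis_field_eventually_0 by blast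
  from choice[OF this] obtain B where B: "\<And>i p. p > B i \<Longrightarrow> heis_field (L i) p (v i) = 0" by blast
  let ?B = "Max (range B)"
  have "{p :: 'n \<Rightarrow> int. (if (\<Sum>i\<in>UNIV. p i + 1) = n then pure_tensor (\<lambda>i. heis_field (L i) (p i) (v i)) else 0) \<noteq> 0} \<subseteq>
     {p. (\<forall>j. p j \<le> ?B) \<and> (\<Sum>j\<in>UNIV. p j + 1) = n}"
  proof (intro subsetI CollectI conjI allI)
    fix p :: "'n \<Rightarrow> int" and j assume p: "p \<in> {p. (if (\<Sum>i\<in>UNIV. p i + 1) = n then pure_tensor (\<lambda>i. heis_field (L i) (p i) (v i)) else 0) \<noteq> 0}"
    then show "(\<Sum>j\<in>UNIV. p j + 1) = n" by (auto split: if_splits)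
    show "p j \<le> ?B"
    proof (rule ccontr)
      assume "\<not> p j \<le> ?B"
      moreover have "B j \<le> ?B" by simp
      ultimately have "p j > B j" by linarith
      then have "pure_tensor (\<lambda>i. heis_field (L i) (p i) (v i)) = 0" by (intro pure_tensor_zero[of _ j]) (rule B)
      then show False using p by (simp split: if_splits)
    qed
  qed
  then show ?thesis by (rule finite_subset) (rule finite_bounded_sum)
qed

text \<open>A new free field in factor i splits the index p i into its own mode m and the rest. Once
  m is moved out of p i, the condition on the total becomes that of the mode n - m - k - 1, and the
  sums over p and m may be exchanged because their joint support is finite.\<close>

lemma tensor_field_Cons:
  fixes L :: "'n::finite \<Rightarrow> nat list"
  shows "tensor_field (L(i := k # L i)) n v = Sum_any (\<lambda>m. cscale (of_int (- m - 1) gchoose k)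
     (if m < 0 then osc (\<lambda>_. 0) i m (tensor_field L (n - m - int k - 1) v)
      else tensor_field L (n - m - int k - 1) (v(i := heis_alpha m (v i)))))"
proof -
  let ?C = "\<lambda>m::int. of_int (- m - 1) gchoose k :: complex"
  let ?up = "\<lambda>(p :: 'n \<Rightarrow> int) m. p(i := p i - m - int k - 1)"
  define T :: "int \<Rightarrow> ('n \<Rightarrow> int) \<Rightarrow> 'n fock" where
    "T = (\<lambda>m p. if m < 0 then osc (\<lambda>_. 0) i m (pure_tensor (\<lambda>j. heis_field (L j) (p j) (v j)))
      else pure_tensor (\<lambda>j. heis_field (L j) (p j) ((v(i := heis_alpha m (v i))) j)))"
  have S: "(\<Sum>j\<in>UNIV. ?up p m j + 1) = (\<Sum>j\<in>UNIV. p j + 1) - m - int k - 1" for p m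
  proof -
    have "(\<Sum>j\<in>UNIV. ?up p m j + 1) = (?up p m i + 1) + (\<Sum>j\<in>UNIV - {i}. ?up p m j + 1)"
      by (rule sum.remove) auto
    also have "(\<Sum>j\<in>UNIV - {i}. ?up p m j + 1) = (\<Sum>j\<in>UNIV - {i}. p j + 1)" by (rule sum.cong) auto
    finally show ?thesis by (subst sum.remove[of UNIV i "\<lambda>j. p j + 1"]) auto
  qed
  have 1: "(if (\<Sum>j\<in>UNIV. p j + 1) = n + 1 then pure_tensor (\<lambda>j. heis_field ((L(i := k # L i)) j) (p j) (v j)) else 0) =
      Sum_any (\<lambda>m. if (\<Sum>j\<in>UNIV. ?up p m j + 1) = n - m - int k then cscale (?C m) (T m (?up p m)) else 0)" for p
  proof (cases "(\<Sum>j\<in>UNIV. p j + 1) = n + 1")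
    case True
    let ?u = "\<lambda>j. heis_field (L j) (p j) (v j)"
    have "(\<lambda>j. heis_field ((L(i := k # L i)) j) (p j) (v j)) = ?u(i := heis_field (k # L i) (p i) (v i))"
      by auto
    then have "pure_tensor (\<lambda>j. heis_field ((L(i := k # L i)) j) (p j) (v j)) =
        pure_tensor (?u(i := Sum_any (\<lambda>m. cscale (?C m) (heis_term k (L i) (p i) (v i) m))))"
      by (simp only: heis_field_Cons)
    also have "\<dots> = Sum_any (\<lambda>m. pure_tensor (?u(i := cscale (?C m) (heis_term k (L i) (p i) (v i) m))))"
      by (rule clinear_Sum_any[OF pure_tensor_linear heis_term_finite])
    also have "\<dots> = Sum_any (\<lambda>m. cscale (?C m) (T m (?up p m)))"
    proof (rule arg_cong[of _ _ Sum_any], rule ext)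
      fix m
      have "pure_tensor (?u(i := heis_term k (L i) (p i) (v i) m)) = T m (?up p m)"
      proof (cases "m < 0")
        case True
        have "?u(i := heis_alpha m (heis_field (L i) (p i - m - int k - 1) (v i))) =
            (\<lambda>j. heis_field (L j) (?up p m j) (v j))(i := heis_alpha m (heis_field (L i) (?up p m i) (v i)))" by auto
        then show ?thesis using True by (simp only: heis_term_def T_def if_True osc_pure_tensor)
      next
        case False
        have "?u(i := heis_field (L i) (p i - m - int k - 1) (heis_alpha m (v i))) =
            (\<lambda>j. heis_field (L j) (?up p m j) ((v(i := heis_alpha m (v i))) j))" by auto
        then show ?thesis using False by (simp only: heis_term_def T_def if_False)
      qed
      then show "pure_tensor (?u(i := cscale (?C m) (heis_term k (L i) (p i) (v i) m))) = cscale (?C m) (T m (?up p m))"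
        by (simp only: clinear_cscale[OF pure_tensor_linear])
    qed
    finally have *: "pure_tensor (\<lambda>j. heis_field ((L(i := k # L i)) j) (p j) (v j)) = Sum_any (\<lambda>m. cscale (?C m) (T m (?up p m)))" .
    have "(\<Sum>j\<in>UNIV. ?up p m j + 1) = n - m - int k" for m unfolding S True by simp
    then show ?thesis by (simp only: True * simp_thms if_True)
  next
    case False
    have "((\<Sum>j\<in>UNIV. ?up p m j + 1) = n - m - int k) = False" for m unfolding S using False by auto
    then show ?thesis using False by (simp only: if_False Sum_any.neutral)
  qed
  have "\<forall>j. \<exists>B. \<forall>p>B. heis_field (L j) p (v j) = 0" using heis_field_eventually_0 by blast
  from choice[OF this] obtain B1 where B1: "\<And>j p. p > B1 j \<Longrightarrow> heis_field (L j) p (v j) = 0" by blast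
  obtain B2 where B2: "\<And>m p. m \<ge> 0 \<Longrightarrow> p > B2 \<Longrightarrow> heis_field (L i) p (heis_alpha m (v i)) = 0"
    using eventually_0_uniform[of "heis_field (L i)" "\<lambda>m. heis_alpha m (v i)"] heis_field_eventually_0 heis_field_zero heis_alpha_eventually_0 by blast
  obtain M where M: "\<And>m. m > M \<Longrightarrow> heis_alpha m (v i) = 0" using heis_alpha_eventually_0 by blast
  define B where "B = max 0 (max B2 (Max (range B1)))"
  have B: "B \<ge> 0" "B2 \<le> B" "\<And>j. B1 j \<le> B" by (auto simp: B_def le_max_iff_disj)
  have Tz: "T m p = 0" if large: "m > max M 0 \<or> (\<exists>j. p j > B)" for m p
  proof (cases "m < 0")
    case True
    then have "\<not> m > max M 0" by simp
    then obtain j where "p j > B" using large by blast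
    then have "heis_field (L j) (p j) (v j) = 0" using B(3)[of j] by (intro B1) linarith
    then have "pure_tensor (\<lambda>j. heis_field (L j) (p j) (v j)) = 0" by (intro pure_tensor_zero[of _ j])
    then show ?thesis using True by (simp add: T_def clinear_0[OF osc_linear])
  next
    case False
    have "\<exists>j. heis_field (L j) (p j) ((v(i := heis_alpha m (v i))) j) = 0"
      using large
    proof
      assume "m > max M 0"
      then show ?thesis by (intro exI[of _ i]) (simp add: M heis_field_zero)
    next
      assume "\<exists>j. p j > B"
      then obtain j where j: "p j > B" by blast
      show ?thesis
      proof (cases "j = i")
        case True
        have "heis_field (L i) (p i) (heis_alpha m (v i)) = 0" using j True B(2) False by (intro B2) auto
        then show ?thesis by (intro exI[of _ i]) simp
      next
        case False
        have "heis_field (L j) (p j) (v j) = 0" using j B(3)[of j] by (intro B1) linarith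
        then show ?thesis using False by (intro exI[of _ j]) simp
      qed
    qed
    then have "pure_tensor (\<lambda>j. heis_field (L j) (p j) ((v(i := heis_alpha m (v i))) j)) = 0"
      by (elim exE) (rule pure_tensor_zero)
    then show ?thesis using False by (simp add: T_def)
  qed
  \<comment> \<open>The joint summand in the shifted indices. On its support m is bounded above
    through annihilation, and below because the p j are at most \<open>B\<close> while their total
    is prescribed; \<open>R\<close> is the resulting range.\<close>
  define g where "g = (\<lambda>m p. if (\<Sum>j\<in>UNIV. p j + 1) = n - m - int k then cscale (?C m) (T m p) else 0)"
  define R where "R = {n - int k - of_nat (CARD('n)) * (B + 1)..max M 0}"
  have g0: "m \<in> R \<and> p \<in> {p. (\<forall>j. p j \<le> B) \<and> (\<Sum>j\<in>UNIV. p j + 1) = n - m - int k}" if "g m p \<noteq> 0" for m p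
  proof -
    have T: "T m p \<noteq> 0" "(\<Sum>j\<in>UNIV. p j + 1) = n - m - int k" using that by (auto simp: g_def split: if_splits)
    then have *: "m \<le> max M 0" "\<forall>j. p j \<le> B" using Tz[of m p] by (meson not_le)+
    have "(\<Sum>j\<in>UNIV. p j + 1) \<le> of_nat (CARD('n)) * (B + 1)"
      by (rule sum_bounded_above) (use * in auto)
    then show ?thesis using T * by (auto simp: R_def)
  qed
  let ?P = "\<Union>m\<in>R. {p :: 'n \<Rightarrow> int. (\<forall>j. p j \<le> B) \<and> (\<Sum>j\<in>UNIV. p j + 1) = n - m - int k}"
  let ?dn = "\<lambda>(p :: 'n \<Rightarrow> int) m. p(i := p i + m + int k + 1)"
  have finP: "finite ?P" by (rule finite_UN_I) (simp_all add: R_def finite_bounded_sum)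
  have "tensor_field (L(i := k # L i)) n v = Sum_any (\<lambda>p. Sum_any (\<lambda>m. g m (?up p m)))"
    unfolding tensor_field_def g_def by (simp only: 1)
  also have "\<dots> = Sum_any (\<lambda>m. Sum_any (\<lambda>p. g m (?up p m)))"
  proof (rule Sum_any.swap)
    show "finite ((\<Union>m\<in>R. (\<lambda>p. ?dn p m) ` ?P) \<times> R)"
      using finP by (auto simp: R_def)
    show "{p. \<exists>m. g m (?up p m) \<noteq> 0} \<times> {m. \<exists>p. g m (?up p m) \<noteq> 0} \<subseteq> (\<Union>m\<in>R. (\<lambda>p. ?dn p m) ` ?P) \<times> R"
    proof (rule Sigma_mono)
      show "{p. \<exists>m. g m (?up p m) \<noteq> 0} \<subseteq> (\<Union>m\<in>R. (\<lambda>p. ?dn p m) ` ?P)"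
      proof
        fix p assume "p \<in> {p. \<exists>m. g m (?up p m) \<noteq> 0}"
        then obtain m where m: "g m (?up p m) \<noteq> 0" by blast
        note mR = g0[OF m, THEN conjunct1] and pP = g0[OF m, THEN conjunct2]
        have "p = ?dn (?up p m) m" by auto
        moreover have "?up p m \<in> ?P" using mR pP by (rule UN_I)
        ultimately have "p \<in> (\<lambda>p. ?dn p m) ` ?P" by (rule image_eqI)
        with mR show "p \<in> (\<Union>m\<in>R. (\<lambda>p. ?dn p m) ` ?P)" by (rule UN_I)
      qed
      show "{m. \<exists>p. g m (?up p m) \<noteq> 0} \<subseteq> R" using g0 by blast
    qed
  qed
  also have "\<dots> = Sum_any (\<lambda>m. Sum_any (g m))"
  proof (rule arg_cong[of _ _ Sum_any], rule ext)
    fix m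
    have "bij (\<lambda>p. ?up p m)"
      by (rule o_bij[of "\<lambda>p. ?dn p m"]) (auto simp: fun_eq_iff)
    then show "Sum_any (\<lambda>p. g m (?up p m)) = Sum_any (g m)"
      by (intro Sum_any.reindex_cong[of "\<lambda>p. ?up p m", symmetric]) (auto simp: bij_def)
  qed
  also have "\<dots> = Sum_any (\<lambda>m. cscale (?C m)
     (if m < 0 then osc (\<lambda>_. 0) i m (tensor_field L (n - m - int k - 1) v)
      else tensor_field L (n - m - int k - 1) (v(i := heis_alpha m (v i)))))"
  proof (rule arg_cong[of _ _ Sum_any], rule ext)
    fix m
    let ?t = "\<lambda>v p. if (\<Sum>j\<in>UNIV. p j + 1) = n - m - int k then pure_tensor (\<lambda>j. heis_field (L j) (p j) (v j)) else 0"
    have tf: "tensor_field L (n - m - int k - 1) v = Sum_any (?t v)" for v by (simp add: tensor_field_def)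
    show "Sum_any (g m) = cscale (?C m)
     (if m < 0 then osc (\<lambda>_. 0) i m (tensor_field L (n - m - int k - 1) v)
      else tensor_field L (n - m - int k - 1) (v(i := heis_alpha m (v i))))"
    proof (cases "m < 0")
      case True
      have "cscale (?C m) (osc (\<lambda>_. 0) i m (Sum_any (?t v))) = Sum_any (\<lambda>p. cscale (?C m) (osc (\<lambda>_. 0) i m (?t v p)))"
        by (rule clinear_Sum_any[OF clinear_scale[OF osc_linear] tensor_field_finite])
      also have "(\<lambda>p. cscale (?C m) (osc (\<lambda>_. 0) i m (?t v p))) = g m"
        using True by (auto simp: g_def T_def fun_eq_iff clinear_0[OF osc_linear])
      finally show ?thesis using True by (simp only: if_True tf)
    next
      case False
      let ?w = "v(i := heis_alpha m (v i))"
      have "cscale (?C m) (Sum_any (?t ?w)) = Sum_any (\<lambda>p. cscale (?C m) (?t ?w p))"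
        by (rule clinear_Sum_any[OF clinear_scale[OF clinear_id] tensor_field_finite])
      also have "(\<lambda>p. cscale (?C m) (?t ?w p)) = g m"
        using False by (auto simp: g_def T_def fun_eq_iff simp del: fun_upd_apply)
      finally show ?thesis using False by (simp only: if_False tf)
    qed
  qed
  finally show ?thesis .
qed

theorem fields_pure_tensor:
  "fields (\<lambda>_. 0) A n (pure_tensor v) = tensor_field (\<lambda>i. map snd (filter (\<lambda>x. fst x = i) A)) n v"
proof (induction A arbitrary: n v)
  case Nil
  show ?case by (simp add: tensor_field_Nil)
next
  case (Cons x A)
  obtain i k where x: "x = (i, k)" by fastforce
  let ?L = "\<lambda>i. map snd (filter (\<lambda>x. fst x = i) A)"
  have L: "(\<lambda>j. map snd (filter (\<lambda>x. fst x = j) (x # A))) = ?L(i := k # ?L i)"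
    by (auto simp: x)
  show ?case
    unfolding L tensor_field_Cons[of ?L i k]
    by (simp only: x fields.simps fst_conv snd_conv wrap_def app_def Cons osc_pure_tensor)
qed

text \<open>For each factor the sublist of \<open>state_list a\<close> is the sorted list used by
  \<open>heis_mode\<close>, so the two descriptions agree on basis vectors.\<close>

lemma heis_tensor_mode_eq_vertex: "heis_tensor_mode v n w = vertex (\<lambda>_. 0) v n w"
proof -
  have *: "Sum_any (\<lambda>p :: 'a \<Rightarrow> int. if (\<Sum>i\<in>UNIV. p i + 1) = n + 1
       then pure_tensor (\<lambda>i. mode heisenberg (Poly_Mapping.single (a i) 1) (p i) (Poly_Mapping.single (b i) 1))
       else 0) = fld (\<lambda>_. 0) a n (Poly_Mapping.single b 1)" for a b :: "'a \<Rightarrow> nat multiset"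
  proof -
    have "fld (\<lambda>_. 0) a n (Poly_Mapping.single b 1) =
        fields (\<lambda>_. 0) (state_list a) n (pure_tensor (\<lambda>i. Poly_Mapping.single (b i) 1))"
      by (simp add: fld_def pure_tensor_single)
    also have "\<dots> = tensor_field (\<lambda>i. sorted_list_of_multiset (a i)) n (\<lambda>i. Poly_Mapping.single (b i) 1)"
      by (simp only: fields_pure_tensor state_list)
    moreover have "mode heisenberg (Poly_Mapping.single \<mu> 1) p x = heis_field (sorted_list_of_multiset \<mu>) p x" for \<mu> p x
      by (simp add: heisenberg_def heis_mode_def)
    ultimately show ?thesis by (simp only: tensor_field_def)
  qed
  have "lin_ext (\<lambda>b. fld (\<lambda>_. 0) a n (Poly_Mapping.single b 1)) w = fld (\<lambda>_. 0) a n w" for a :: "'a \<Rightarrow> nat multiset"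
    by (rule linear_eq_on_basis[OF lin_ext_linear fld_linear]) simp
  then show ?thesis unfolding heis_tensor_mode_def * vertex_def by simp
qed

section \<open>The conformal vector and L(0)\<close>

definition L0_shift :: "('n::finite \<Rightarrow> complex) \<Rightarrow> complex" where
  "L0_shift l = (\<Sum>i\<in>UNIV. (l i)\<^sup>2 / 2)"

lemma wrap_osc_unit: "wrap (osc l i) 0 (fld l (\<lambda>_. {#})) n w = osc l i n w"
proof -
  have "(\<lambda>q. cscale (of_int (- q - 1) gchoose 0) (app (osc l i) q (fld l (\<lambda>_. {#}) (n - q - int 0 - 1)) w)) =
      (\<lambda>q. if q = n then osc l i n w else 0)"
    by (auto simp: fun_eq_iff app_def fld_empty clinear_0[OF osc_linear])
  then show ?thesis unfolding wrap_def by (simp only: Sum_any.delta)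
qed

lemma sum_count_eq_sum_mset_mult:
  fixes f :: "'x \<Rightarrow> complex"
  assumes "finite S" "set_mset N \<subseteq> S"
  shows "(\<Sum>j\<in>S. f j * of_nat (count N j)) = (\<Sum>j\<in>#N. f j)"
  using assms(2)
proof (induction N)
  case (add x N)
  have "(\<Sum>j\<in>S. f j * of_nat (count (add_mset x N) j)) =
      (\<Sum>j\<in>S. f j * of_nat (count N j) + (if j = x then f x else 0))"
    by (rule sum.cong) (auto simp: algebra_simps)
  then show ?case using add assms(1) by (simp add: sum.distrib add.commute)
qed simp

text \<open>Twice L(0) of one factor: the mode 1 of the normally ordered square is alpha(0)^2 plus
  twice the sum of alpha(-q) alpha(q) over q > 0, and alpha(-q) alpha(q) counts the parts of size q
  with weight q.\<close>

lemma fld_omega: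
  "fld l ((\<lambda>_. {#})(i := {#0, 0#})) 1 (Poly_Mapping.single b 1) =
     cscale ((l i)\<^sup>2 + 2 * (\<Sum>k\<in>#b i. of_nat (k + 1))) (Poly_Mapping.single b 1)"
proof -
  let ?b = "(\<lambda>_. {#})(i := add_mset 0 ((\<lambda>_. {#}) i))"
  let ?a = "osc l i" and ?v = "Poly_Mapping.single b (1::complex)"
  have "fld l (?b(i := add_mset 0 (?b i))) = wrap ?a 0 (fld l ?b)" by (rule fld_add)
  moreover have "fld l ?b = wrap ?a 0 (fld l (\<lambda>_. {#}))" by (rule fld_add)
  moreover have "wrap ?a 0 (fld l (\<lambda>_. {#})) = osc l i" by (intro ext wrap_osc_unit)
  moreover have "?b(i := add_mset 0 (?b i)) = (\<lambda>_. {#})(i := {#0, 0#})" by auto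
  ultimately have 1: "fld l ((\<lambda>_. {#})(i := {#0, 0#})) = wrap ?a 0 (osc l i)" by simp
  define M where "M = int (weight b)"
  have d: "deg_le M ?v" unfolding M_def by (rule deg_le_single) simp
  \<comment> \<open>The eigenvalue of the q-th summand; normal ordering makes the summands q and -q
    equal.\<close>
  define c where "c = (\<lambda>q::int. if q = 0 then (l i)\<^sup>2 else of_int \<bar>q\<bar> * of_nat (count (b i) (nat (\<bar>q\<bar> - 1))))"
  have t: "app ?a q (?a (1 - q - int 0 - 1)) ?v = cscale (c q) ?v" for q
  proof -
    have pos: "?a (- p) (?a p ?v) = cscale (of_int p * of_nat (count (b i) (nat (p - 1)))) ?v" if "p > 0" for p
    proof (cases "nat (p - 1) \<in># b i")
      case True
      then show ?thesis using that by (simp add: osc_pos osc_neg cscale_single)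
    next
      case False
      then show ?thesis using that
        by (simp add: osc_pos cscale_single not_in_iff clinear_0[OF osc_linear])
    qed
    consider "q < 0" | "q = 0" | "q > 0" by linarith
    then show ?thesis
    proof cases
      case 1 then show ?thesis using pos[of "- q"] by (simp add: app_def c_def)
    next
      case 2 then show ?thesis by (simp add: app_def c_def osc_zero cscale_single power2_eq_square)
    next
      case 3 then show ?thesis using pos[of q] by (simp add: app_def c_def)
    qed
  qed
  have "wrap ?a 0 (osc l i) 1 ?v = (\<Sum>q\<in>{-M-1..M}. cscale (of_int (- q - 1) gchoose 0) (app ?a q (?a (1 - q - int 0 - 1)) ?v))"
    by (rule wrap_eq_sum[OF osc_modes _ d, where h = 0]) (auto simp: M_def modes_shifts[OF osc_modes])
  also have "\<dots> = cscale (\<Sum>q\<in>{-M-1..M}. c q) ?v"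
    by (simp only: t cvec.scale_sum_left gbinomial_0 cvec.scale_one)
  also have "(\<Sum>q\<in>{-M-1..M}. c q) = (l i)\<^sup>2 + 2 * (\<Sum>k\<in>#b i. of_nat (k + 1))"
  proof -
    \<comment> \<open>The window is longer by one on its negative side. Both halves still give the
      full sum over the parts, since the indices of parts stay below the weight.\<close>
    have s: "(\<Sum>k<n. of_nat (k + 1) * of_nat (count (b i) k)) = (\<Sum>k\<in>#b i. of_nat (k + 1) :: complex)"
      if "n \<ge> weight b" for n
    proof (rule sum_count_eq_sum_mset_mult)
      show "set_mset (b i) \<subseteq> {..<n}" using member_less_weight[of _ b i] that by fastforce
    qed simp
    have "{-M-1..M} = {-M-1..-1} \<union> ({0} \<union> {1..M})" by (auto simp: M_def)
    then have "(\<Sum>q\<in>{-M-1..M}. c q) = (\<Sum>q\<in>{-M-1..-1}. c q) + (c 0 + (\<Sum>q\<in>{1..M}. c q))"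
      by (simp add: sum.union_disjoint)
    also have "(\<Sum>q\<in>{-M-1..-1}. c q) = (\<Sum>k<weight b + 1. of_nat (k + 1) * of_nat (count (b i) k))"
      by (rule sum.reindex_bij_witness[of _ "\<lambda>k. - int k - 1" "\<lambda>q. nat (- q - 1)"]) (auto simp: c_def M_def)
    also have "(\<Sum>q\<in>{1..M}. c q) = (\<Sum>k<weight b. of_nat (k + 1) * of_nat (count (b i) k))"
      by (rule sum.reindex_bij_witness[of _ "\<lambda>k. int k + 1" "\<lambda>q. nat (q - 1)"]) (auto simp: c_def M_def)
    finally have "(\<Sum>q\<in>{-M-1..M}. c q) = (\<Sum>k\<in>#b i. of_nat (k + 1)) + (c 0 + (\<Sum>k\<in>#b i. of_nat (k + 1)))"
      using s[of "weight b"] s[of "weight b + 1"] by (simp only: le_add1 order_refl)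
    then show ?thesis by (simp add: c_def)
  qed
  finally show ?thesis by (simp only: 1)
qed

definition omega :: "'n::finite fock" where
  "omega = (\<Sum>j\<in>UNIV. pure_tensor (\<lambda>i. if i = j then conformal heisenberg else vacuum heisenberg))"

lemma omega_eq: "omega = (\<Sum>j\<in>UNIV. cscale (1/2) (Poly_Mapping.single ((\<lambda>_. {#})(j := {#0, 0#})) 1))"
  unfolding omega_def
proof (rule sum.cong[OF refl])
  fix j :: 'a
  define v where "v = (\<lambda>i. Poly_Mapping.single (((\<lambda>_. {#})(j := {#0, 0 :: nat#})) i) (1::complex))"
  have "(\<lambda>i. if i = j then conformal heisenberg else vacuum heisenberg) = v(j := cscale (1/2) (v j))"
    by (auto simp: heisenberg_def cscale_single v_def)
  moreover have "pure_tensor (v(j := cscale (1/2) (v j))) = cscale (1/2) (pure_tensor v)"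
    by (simp only: clinear_cscale[OF pure_tensor_linear] fun_upd_triv)
  ultimately show "pure_tensor (\<lambda>i. if i = j then conformal heisenberg else vacuum heisenberg) =
      cscale (1/2) (Poly_Mapping.single ((\<lambda>_. {#})(j := {#0, 0#})) 1)"
    by (simp only: v_def pure_tensor_single)
qed

lemma weight_complex: "(of_nat (weight b) :: complex) = (\<Sum>i\<in>UNIV. \<Sum>k\<in>#b i. of_nat (k + 1))"
  unfolding weight_def of_nat_sum of_nat_sum_mset image_mset.compositionality o_def ..

lemma vertex_omega_single:
  "vertex l omega 1 (Poly_Mapping.single b 1) = cscale (of_nat (weight b) + L0_shift l) (Poly_Mapping.single b 1)"
proof -
  have "vertex l omega 1 (Poly_Mapping.single b 1) =
      (\<Sum>i\<in>UNIV. cscale (1/2) (cscale ((l i)\<^sup>2 + 2 * (\<Sum>k\<in>#b i. of_nat (k + 1))) (Poly_Mapping.single b 1)))"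
    by (simp only: omega_eq clinear_sum[OF vertex_linear_left] clinear_cscale[OF vertex_linear_left]
        vertex_single fld_omega cvec.scale_one)
  also have "\<dots> = cscale (\<Sum>i\<in>UNIV. (\<Sum>k\<in>#b i. of_nat (k + 1)) + (l i)\<^sup>2 / 2) (Poly_Mapping.single b 1)"
    by (simp only: cvec.scale_scale cvec.scale_sum_left) (simp add: algebra_simps)
  finally show ?thesis by (simp only: sum.distrib weight_complex L0_shift_def)
qed

lemma lookup_vertex_omega:
  "Poly_Mapping.lookup (vertex l omega 1 w) b = (of_nat (weight b) + L0_shift l) * Poly_Mapping.lookup w b"
proof -
  have w: "w = (\<Sum>b\<in>Poly_Mapping.keys w. cscale (Poly_Mapping.lookup w b) (Poly_Mapping.single b 1))"
    by (rule poly_mapping_eqI) (simp add: lookup_sum cscale_single lookup_single when_def in_keys_iff del: lookup_cscale)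
  have "vertex l omega 1 w = (\<Sum>b\<in>Poly_Mapping.keys w. cscale (Poly_Mapping.lookup w b)
      (cscale (of_nat (weight b) + L0_shift l) (Poly_Mapping.single b 1)))"
    by (subst w) (simp only: clinear_sum[OF vertex_linear_right] clinear_cscale[OF vertex_linear_right] vertex_omega_single)
  then show ?thesis
    by (simp add: lookup_sum cscale_single lookup_single when_def in_keys_iff del: lookup_cscale)
qed

lemma vertex_omega_eigen:
  "vertex l omega 1 w = cscale h w \<longleftrightarrow> (\<forall>b\<in>Poly_Mapping.keys w. of_nat (weight b) + L0_shift l = h)"
proof
  assume eq: "vertex l omega 1 w = cscale h w"
  show "\<forall>b\<in>Poly_Mapping.keys w. of_nat (weight b) + L0_shift l = h"
  proof
    fix b assume b: "b \<in> Poly_Mapping.keys w"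
    have "(of_nat (weight b) + L0_shift l) * Poly_Mapping.lookup w b = h * Poly_Mapping.lookup w b"
      using arg_cong[OF eq, of "\<lambda>w. Poly_Mapping.lookup w b"] by (simp add: lookup_vertex_omega)
    then show "of_nat (weight b) + L0_shift l = h" using b by (simp add: in_keys_iff)
  qed
next
  assume *: "\<forall>b\<in>Poly_Mapping.keys w. of_nat (weight b) + L0_shift l = h"
  show "vertex l omega 1 w = cscale h w"
  proof (rule poly_mapping_eqI)
    fix b show "Poly_Mapping.lookup (vertex l omega 1 w) b = Poly_Mapping.lookup (cscale h w) b"
      using * by (cases "b \<in> Poly_Mapping.keys w") (auto simp: lookup_vertex_omega in_keys_iff)
  qed
qed

subsection \<open>Fock modules\<close>

lemma lin_ext_inverse:
  assumes "\<And>b. g (f b) = b"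
  shows "lin_ext (\<lambda>b. Poly_Mapping.single (g b) 1) (lin_ext (\<lambda>b. Poly_Mapping.single (f b) 1) w) = w"
  by (rule linear_eq_on_basis[OF clinear_comp[OF lin_ext_linear lin_ext_linear] clinear_id]) (simp add: assms)

text \<open>The carrier type is prescribed, so the countable basis of Fock space is numbered, the
  multisets passing through their sorted lists. The complex label is fixed at 0 and not tied to the
  weight.\<close>

definition enc :: "('n::finite \<Rightarrow> nat multiset) \<Rightarrow> complex \<times> nat" where
  "enc b = (0, to_nat (\<lambda>i. sorted_list_of_multiset (b i)))"

definition dec :: "complex \<times> nat \<Rightarrow> ('n::finite \<Rightarrow> nat multiset)" where
  "dec c = (\<lambda>i. mset (from_nat (snd c) i))"

lemma dec_enc [simp]: "dec (enc b) = b"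
  by (simp add: dec_def enc_def)

definition emb :: "'n::finite fock \<Rightarrow> (complex \<times> nat \<Rightarrow>\<^sub>0 complex)" where
  "emb = lin_ext (\<lambda>b. Poly_Mapping.single (enc b) 1)"

definition proj :: "(complex \<times> nat \<Rightarrow>\<^sub>0 complex) \<Rightarrow> 'n::finite fock" where
  "proj = lin_ext (\<lambda>c. Poly_Mapping.single (dec c) 1)"

lemma emb_linear: "clinear emb" unfolding emb_def by (rule lin_ext_linear)

lemma proj_emb [simp]: "proj (emb w) = w"
  unfolding proj_def emb_def by (rule lin_ext_inverse) simp

lemma emb_inj: "emb v = emb w \<longleftrightarrow> v = w"
  by (metis proj_emb)

definition fock_module :: "('n \<Rightarrow> complex) \<Rightarrow> ('n::finite \<Rightarrow> nat multiset) weight_mod" where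
  "fock_module l = \<lparr>mcarrier = range (emb :: 'n fock \<Rightarrow> _), act = (\<lambda>v n w. emb (vertex l v n (proj w)))\<rparr>"

lemma act_fock: "act (fock_module l) v n (emb w) = emb (vertex l v n w)"
  by (simp add: fock_module_def)

lemma mcarrier_fock: "mcarrier (fock_module (l :: 'n::finite \<Rightarrow> complex)) = range (emb :: 'n fock \<Rightarrow> _)"
  by (simp add: fock_module_def)

lemma vertex_vacuum: "vertex l (Poly_Mapping.single (\<lambda>_. {#}) 1) n w = (if n = -1 then w else 0)"
  by (simp add: vertex_single fld_empty)

lemma vertex_eventually_0: "\<exists>N. \<forall>n\<ge>N. vertex l v n w = 0"
proof -
  obtain h where h: "\<And>n. shifts (h - n) (vertex l v n)" using is_field_vertex[of l v] by (auto simp: is_field_def weight_field_def)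
  obtain d where d: "deg_le d w" using deg_le_ex by blast
  have "vertex l v n w = 0" if "n \<ge> d + h + 1" for n
    by (rule shifts_eq_0[OF h d]) (use that in auto)
  then show ?thesis by blast
qed

lemma eventually_0_shift: "\<exists>N::int. \<forall>n\<ge>N. g n = 0 \<Longrightarrow> \<exists>N. \<forall>i\<ge>N. g (n + int i) = 0"
proof -
  assume "\<exists>N::int. \<forall>n\<ge>N. g n = 0"
  then obtain N where N: "\<And>n. n \<ge> N \<Longrightarrow> g n = 0" by blast
  show ?thesis by (rule exI[of _ "nat (N - n)"]) (auto intro: N)
qed

text \<open>Passes from cut-offs to sums of finite support: every large \<open>K\<close> beyond the
  three truncation points computes both sides.\<close>

lemma vertex_borcherds:
  "Sum_any (\<lambda>i::nat. cscale (of_int m gchoose i) (vertex l (vertex (\<lambda>_. 0) u (k + int i) v) (m + n - int i) w)) =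
   Sum_any (\<lambda>i::nat. cscale ((-1) ^ i * (of_int k gchoose i))
     (vertex l u (k + m - int i) (vertex l v (n + int i) w) -
      cscale ((-1) powi k) (vertex l v (k + n - int i) (vertex l u (m + int i) w))))"
proof -
  let ?f = "\<lambda>i::nat. cscale (of_int m gchoose i) (vertex l (vertex (\<lambda>_. 0) u (k + int i) v) (m + n - int i) w)"
  let ?g = "\<lambda>i::nat. cscale ((-1) ^ i * (of_int k gchoose i))
     (vertex l u (k + m - int i) (vertex l v (n + int i) w) -
      cscale ((-1) powi k) (vertex l v (k + n - int i) (vertex l u (m + int i) w)))"
  obtain N1 where N1: "\<And>i. i \<ge> N1 \<Longrightarrow> vertex (\<lambda>_. 0) u (k + int i) v = 0"
    using eventually_0_shift[OF vertex_eventually_0] by metis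
  obtain N2 where N2: "\<And>i. i \<ge> N2 \<Longrightarrow> vertex l v (n + int i) w = 0"
    using eventually_0_shift[OF vertex_eventually_0] by metis
  obtain N3 where N3: "\<And>i. i \<ge> N3 \<Longrightarrow> vertex l u (m + int i) w = 0"
    using eventually_0_shift[OF vertex_eventually_0] by metis
  have B: "\<forall>\<^sub>F K in sequentially. borcherds_at K (\<lambda>r s w. vertex l u r (vertex l v s w)) (\<lambda>r s w. vertex l v s (vertex l u r w))
    (\<lambda>m n w. vertex l (vertex (\<lambda>_. 0) u m v) n w) k m n w"
    using borcherds_vertex[of l u v] by (auto simp: is_borcherds_def borcherds_def)
  have "\<forall>\<^sub>F K in sequentially. Sum_any ?f = Sum_any ?g"
    using B eventually_ge_at_top[of N1] eventually_ge_at_top[of N2] eventually_ge_at_top[of N3]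
  proof eventually_elim
    case (elim K)
    have "Sum_any ?f = sum ?f {..<K}"
      by (rule Sum_any_eq_sum_nat) (use elim in \<open>simp add: N1 clinear_0[OF vertex_linear_left]\<close>)
    also have "\<dots> = sum ?g {..<K}"
      using elim(1) unfolding borcherds_at_def
      by (simp only: cvec.scale_right_diff_distrib sum_subtractf cvec.scale_sum_right cvec.scale_scale mult_ac)
    also have "\<dots> = Sum_any ?g"
      by (rule Sum_any_eq_sum_nat [symmetric]) (use elim in \<open>simp add: N2 N3 clinear_0[OF vertex_linear_right]\<close>)
    finally show ?case .
  qed
  then show ?thesis by simp
qed

lemma vacuum_tensor: "vacuum heisenberg_tensor = Poly_Mapping.single (\<lambda>_. {#}) 1"
  using pure_tensor_single[of "\<lambda>_. {#}"] by (simp add: heisenberg_tensor_def heisenberg_def)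

lemma H3S3_simps:
  "mode H3S3 = vertex (\<lambda>_. 0)" "vacuum H3S3 = Poly_Mapping.single (\<lambda>_. {#}) 1"
  "conformal H3S3 = omega" "central_charge H3S3 = 3"
  "vcarrier H3S3 = {v. \<forall>\<sigma>. bij \<sigma> \<longrightarrow> tensor_perm \<sigma> v = v}"
proof -
  show "mode H3S3 = vertex (\<lambda>_. 0)"
    by (intro ext) (simp add: H3S3_def fixed_subalgebra_def heisenberg_tensor_def heis_tensor_mode_eq_vertex)
  show "vacuum H3S3 = Poly_Mapping.single (\<lambda>_. {#}) 1"
    using vacuum_tensor by (simp add: H3S3_def fixed_subalgebra_def)
  show "conformal H3S3 = omega"
    by (simp add: H3S3_def fixed_subalgebra_def heisenberg_tensor_def omega_def)
  show "central_charge H3S3 = 3"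
    by (simp add: H3S3_def fixed_subalgebra_def heisenberg_tensor_def heisenberg_def)
  show "vcarrier H3S3 = {v. \<forall>\<sigma>. bij \<sigma> \<longrightarrow> tensor_perm \<sigma> v = v}"
    by (auto simp: H3S3_def fixed_subalgebra_def heisenberg_tensor_def)
qed

text \<open>The axioms hold for all of H(3) acting on Fock space and hence for the fixed vectors;
  what remains is to carry them through the linear injection \<open>emb\<close>.\<close>

lemma fock_weak_module: "weak_module H3S3 (fock_module l)"
  unfolding weak_module_def mcarrier_fock
proof (intro conjI ballI allI)
  show "cvec.subspace (range (emb :: 3 fock \<Rightarrow> _))"
  proof (rule cvec.subspaceI)
    show "0 \<in> range (emb :: 3 fock \<Rightarrow> _)" using clinear_0[OF emb_linear] by (metis rangeI)
    show "v + w \<in> range (emb :: 3 fock \<Rightarrow> _)" if "v \<in> range (emb :: 3 fock \<Rightarrow> _)" "w \<in> range (emb :: 3 fock \<Rightarrow> _)" for v w :: "complex \<times> nat \<Rightarrow>\<^sub>0 complex"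
      using that clinear_add[OF emb_linear] by (metis (no_types, lifting) image_iff rangeI)
    show "cscale c v \<in> range (emb :: 3 fock \<Rightarrow> _)" if "v \<in> range (emb :: 3 fock \<Rightarrow> _)" for c and v :: "complex \<times> nat \<Rightarrow>\<^sub>0 complex"
      using that clinear_cscale[OF emb_linear] by (metis (no_types, lifting) image_iff rangeI)
  qed
next
  fix v n w assume "w \<in> range (emb :: 3 fock \<Rightarrow> _)"
  then show "act (fock_module l) v n w \<in> range (emb :: 3 fock \<Rightarrow> _)" by (auto simp: act_fock)
next
  fix u v n w assume "w \<in> range (emb :: 3 fock \<Rightarrow> _)"
  then show "act (fock_module l) (u + v) n w = act (fock_module l) u n w + act (fock_module l) v n w"
    by (auto simp: act_fock clinear_add[OF vertex_linear_left] clinear_add[OF emb_linear])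
next
  fix c v n w assume "w \<in> range (emb :: 3 fock \<Rightarrow> _)"
  then show "act (fock_module l) (cscale c v) n w = cscale c (act (fock_module l) v n w)"
    by (auto simp: act_fock clinear_cscale[OF vertex_linear_left] clinear_cscale[OF emb_linear])
next
  fix v n w x assume "w \<in> range (emb :: 3 fock \<Rightarrow> _)" "x \<in> range (emb :: 3 fock \<Rightarrow> _)"
  then show "act (fock_module l) v n (w + x) = act (fock_module l) v n w + act (fock_module l) v n x"
    by (auto simp: act_fock clinear_add[OF vertex_linear_right] simp flip: clinear_add[OF emb_linear])
next
  fix c v n w assume "w \<in> range (emb :: 3 fock \<Rightarrow> _)"
  then show "act (fock_module l) v n (cscale c w) = cscale c (act (fock_module l) v n w)"
    by (auto simp: act_fock clinear_cscale[OF vertex_linear_right] simp flip: clinear_cscale[OF emb_linear])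
next
  fix v w assume "w \<in> range (emb :: 3 fock \<Rightarrow> _)"
  then obtain x :: "3 fock" where x: "w = emb x" by blast
  obtain N where "\<And>n. n \<ge> N \<Longrightarrow> vertex l v n x = 0" using vertex_eventually_0 by blast
  then show "\<exists>N. \<forall>n\<ge>N. act (fock_module l) v n w = 0"
    by (intro exI[of _ N]) (simp add: x act_fock clinear_0[OF emb_linear])
next
  fix n w assume "w \<in> range (emb :: 3 fock \<Rightarrow> _)"
  then show "act (fock_module l) (vacuum H3S3) n w = (if n = - 1 then w else 0)"
    by (auto simp: act_fock H3S3_simps vertex_vacuum clinear_0[OF emb_linear])
next
  fix u v w and k m n :: int assume "w \<in> range (emb :: 3 fock \<Rightarrow> _)"
  then obtain x :: "3 fock" where x: "w = emb x" by blast
  have f: "finite {i. g i \<noteq> 0}" if ex: "\<exists>N. \<forall>i\<ge>N. g i = 0" for g :: "nat \<Rightarrow> 3 fock"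
  proof -
    obtain N where N: "\<And>i. i \<ge> N \<Longrightarrow> g i = 0" using ex by blast
    have "{i. g i \<noteq> 0} \<subseteq> {..<N}" using N by (auto simp: not_le [symmetric])
    then show ?thesis by (rule finite_subset) simp
  qed
  let ?f = "\<lambda>i::nat. cscale (of_int m gchoose i) (vertex l (vertex (\<lambda>_. 0) u (k + int i) v) (m + n - int i) x)"
  let ?g = "\<lambda>i::nat. cscale ((-1) ^ i * (of_int k gchoose i))
     (vertex l u (k + m - int i) (vertex l v (n + int i) x) -
      cscale ((-1) powi k) (vertex l v (k + n - int i) (vertex l u (m + int i) x)))"
  obtain N1 where N1: "\<And>i. i \<ge> N1 \<Longrightarrow> vertex (\<lambda>_. 0) u (k + int i) v = 0"
    using eventually_0_shift[OF vertex_eventually_0] by metis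
  obtain N2 where N2: "\<And>i. i \<ge> N2 \<Longrightarrow> vertex l v (n + int i) x = 0"
    using eventually_0_shift[OF vertex_eventually_0] by metis
  obtain N3 where N3: "\<And>i. i \<ge> N3 \<Longrightarrow> vertex l u (m + int i) x = 0"
    using eventually_0_shift[OF vertex_eventually_0] by metis
  have F: "finite {i. ?f i \<noteq> 0}"
    by (rule f, rule exI[of _ N1]) (simp add: N1 clinear_0[OF vertex_linear_left])
  have G: "finite {i. ?g i \<noteq> 0}"
    by (rule f, rule exI[of _ "max N2 N3"]) (simp add: N2 N3 clinear_0[OF vertex_linear_right])
  show "Sum_any (\<lambda>i::nat. cscale (of_int m gchoose i)
          (act (fock_module l) (mode H3S3 u (k + int i) v) (m + n - int i) w)) =
        Sum_any (\<lambda>i::nat. cscale ((-1) ^ i * (of_int k gchoose i))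
          (act (fock_module l) u (k + m - int i) (act (fock_module l) v (n + int i) w) -
           cscale ((-1) powi k) (act (fock_module l) v (k + n - int i) (act (fock_module l) u (m + int i) w))))"
    unfolding x act_fock H3S3_simps clinear_cscale[OF emb_linear, symmetric] clinear_diff[OF emb_linear, symmetric]
      clinear_Sum_any[OF emb_linear F, symmetric] clinear_Sum_any[OF emb_linear G, symmetric]
    by (simp only: vertex_borcherds)
qed

section \<open>The generating function of partitions\<close>

abbreviation abssum_on :: "('a \<Rightarrow> complex) \<Rightarrow> 'a set \<Rightarrow> bool" (infix "abssum'_on" 50) where
  "f abssum_on A \<equiv> (\<lambda>x. norm (f x)) summable_on A"

lemma has_sum_Times_mult:
  fixes f :: "'a \<Rightarrow> complex" and g :: "'b \<Rightarrow> complex"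
  assumes f: "f abssum_on A" "(f has_sum a) A" and g: "g abssum_on B" "(g has_sum b) B"
  shows "(\<lambda>(x, y). f x * g y) abssum_on (A \<times> B)" "((\<lambda>(x, y). f x * g y) has_sum (a * b)) (A \<times> B)"
proof -
  show *: "(\<lambda>(x, y). f x * g y) abssum_on (A \<times> B)"
  proof (rule Infinite_Sum.abs_summable_on_Sigma_iff[where f = "\<lambda>(x, y). f x * g y", THEN iffD2], intro conjI ballI)
    show "(\<lambda>y. (\<lambda>(x, y). f x * g y) (x, y)) abssum_on B" for x
      using g(1) by (simp add: norm_mult summable_on_cmult_right)
    have "(\<lambda>x. norm (f x) * infsum (\<lambda>y. norm (g y)) B) summable_on A"
      using f(1) by (rule summable_on_cmult_left)
    moreover have "0 \<le> infsum (\<lambda>y. norm (g y)) B" by (simp add: infsum_nonneg)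
    ultimately show "(\<lambda>x. norm (infsum (\<lambda>y. norm ((\<lambda>(x, y). f x * g y) (x, y))) B)) summable_on A"
      by (simp add: norm_mult infsum_cmult_right' abs_mult)
  qed
  show "((\<lambda>(x, y). f x * g y) has_sum (a * b)) (A \<times> B)"
  proof (rule has_sum_SigmaI)
    show "((\<lambda>y. (\<lambda>(x, y). f x * g y) (x, y)) has_sum f x * b) B" for x
      using g(2) by (simp add: has_sum_cmult_right)
    show "((\<lambda>x. f x * b) has_sum (a * b)) A" using f(2) by (rule has_sum_cmult_left)
    show "(\<lambda>(x, y). f x * g y) summable_on A \<times> B" using * by (rule Infinite_Sum.abs_summable_summable)
  qed
qed

definition msize :: "nat multiset \<Rightarrow> nat" where
  "msize \<mu> = (\<Sum>k\<in>#\<mu>. k + 1)"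

text \<open>Euler's product of 1 / (1 - x^n) over n >= 1, written as a sum over partitions. An index
  k stands for a part of size k + 1.\<close>

definition pgf :: "complex \<Rightarrow> complex" where
  "pgf x = (\<Sum>\<^sub>\<infinity>\<mu>. x ^ msize \<mu>)"

lemma geometric_has_sum:
  fixes x :: complex assumes "norm x < 1"
  shows "(\<lambda>j::nat. x ^ j) abssum_on UNIV" "((\<lambda>j::nat. x ^ j) has_sum (1 / (1 - x))) UNIV"
proof -
  have "summable (\<lambda>j. norm (x ^ j))" using assms by (simp add: norm_power summable_geometric)
  then show "(\<lambda>j::nat. x ^ j) abssum_on UNIV"
    by (intro summable_nonneg_imp_summable_on) auto
  show "((\<lambda>j::nat. x ^ j) has_sum (1 / (1 - x))) UNIV"
    by (rule norm_summable_imp_has_sum[OF \<open>summable _\<close>]) (rule geometric_sums[OF assms])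
qed

lemma norm_power_less_1: "norm (x::complex) < 1 \<Longrightarrow> norm (x ^ Suc n) < 1"
  using power_decreasing[of 1 "Suc n" "norm x"] by (simp add: norm_power norm_mult)

text \<open>Admitting the index \<open>K\<close> means choosing its multiplicity freely, which
  contributes the geometric series in x^(K+1).\<close>

lemma multisets_below_has_sum:
  fixes x :: complex assumes x: "norm x < 1"
  shows "(\<lambda>\<mu>. x ^ msize \<mu>) abssum_on {\<mu>. set_mset \<mu> \<subseteq> {..<K}} \<and>
    ((\<lambda>\<mu>. x ^ msize \<mu>) has_sum (\<Prod>k<K. 1 / (1 - x ^ Suc k))) {\<mu>. set_mset \<mu> \<subseteq> {..<K}}"
proof (induction K)
  case 0
  have "{\<mu>. set_mset \<mu> \<subseteq> {..<0::nat}} = {{#}}" by auto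
  then show ?case by (simp add: msize_def has_sum_finiteI)
next
  case (Suc K)
  let ?A = "{\<mu>. set_mset \<mu> \<subseteq> {..<K}}" and ?B = "{\<mu>. set_mset \<mu> \<subseteq> {..<Suc K}}"
  let ?h = "\<lambda>(\<mu>, j). \<mu> + replicate_mset j K"
  note P = has_sum_Times_mult[OF conjunct1[OF Suc] conjunct2[OF Suc] geometric_has_sum[OF norm_power_less_1[OF x, of K]]]
  have bij: "bij_betw ?h (?A \<times> UNIV) ?B"
  proof (rule bij_betw_byWitness[where f' = "\<lambda>\<mu>. (filter_mset (\<lambda>k. k \<noteq> K) \<mu>, count \<mu> K)"])
    show "\<forall>p\<in>?A \<times> UNIV. (filter_mset (\<lambda>k. k \<noteq> K) (?h p), count (?h p) K) = p"
    proof (rule ballI)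
      fix p assume p: "p \<in> ?A \<times> (UNIV :: nat set)"
      obtain \<mu> j where pj: "p = (\<mu>, j)" by fastforce
      have \<mu>: "set_mset \<mu> \<subseteq> {..<K}" using p pj by auto
      then have "K \<notin># \<mu>" by auto
      then have "filter_mset (\<lambda>k. k \<noteq> K) \<mu> = \<mu>" "count \<mu> K = 0"
        by (fastforce simp: filter_mset_eq_conv, simp add: not_in_iff)
      then show "(filter_mset (\<lambda>k. k \<noteq> K) (?h p), count (?h p) K) = p"
        by (simp add: pj)
    qed
    show "\<forall>\<mu>\<in>?B. ?h (filter_mset (\<lambda>k. k \<noteq> K) \<mu>, count \<mu> K) = \<mu>"
      by (auto intro!: multiset_eqI)
    show "?h ` (?A \<times> UNIV) \<subseteq> ?B" by (auto split: if_splits)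
    show "(\<lambda>\<mu>. (filter_mset (\<lambda>k. k \<noteq> K) \<mu>, count \<mu> K)) ` ?B \<subseteq> ?A \<times> UNIV"
      by auto
  qed
  have eq: "(\<lambda>(\<mu>, j). x ^ msize \<mu> * (x ^ Suc K) ^ j) = (\<lambda>p. x ^ msize (?h p))"
  proof (rule ext)
    fix p :: "nat multiset \<times> nat"
    obtain \<mu> j where p: "p = (\<mu>, j)" by fastforce
    have "msize (\<mu> + replicate_mset j K) = msize \<mu> + Suc K * j" by (simp add: msize_def)
    then show "(\<lambda>(\<mu>, j). x ^ msize \<mu> * (x ^ Suc K) ^ j) p = x ^ msize (?h p)"
      by (simp only: p split_conv power_add power_mult)
  qed
  have "(\<lambda>p. x ^ msize (?h p)) abssum_on ?A \<times> UNIV" using P(1) unfolding eq .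
  then have "(\<lambda>\<mu>. norm (x ^ msize \<mu>)) summable_on ?B"
    using summable_on_reindex_bij_betw[OF bij, of "\<lambda>\<mu>. norm (x ^ msize \<mu>)"] by simp
  moreover have "((\<lambda>\<mu>. x ^ msize \<mu>) has_sum (\<Prod>k<Suc K. 1 / (1 - x ^ Suc k))) ?B"
    using P(2) has_sum_reindex_bij_betw[OF bij, of "\<lambda>\<mu>. x ^ msize \<mu>"] unfolding eq by simp
  ultimately show ?case by blast
qed

text \<open>The point is independence of \<open>K\<close>, so that one bound dominates all finite
  sums over partitions. With u = r^(k+1) one has 1/(1-u) <= exp(u/(1-r)), and the exponents form a
  geometric series.\<close>

lemma prod_euler_bound:
  fixes r :: real assumes r: "0 \<le> r" "r < 1"
  shows "(\<Prod>k<K. 1 / (1 - r ^ Suc k)) \<le> exp (1 / (1 - r)\<^sup>2)"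
proof -
  have rk: "r ^ Suc k \<le> r" "r ^ Suc k < 1" for k
  proof -
    show "r ^ Suc k \<le> r" using power_decreasing[of 1 "Suc k" r] r by simp
    then show "r ^ Suc k < 1" using r(2) by linarith
  qed
  have "1 / (1 - r ^ Suc k) \<le> exp (r ^ Suc k / (1 - r))" for k
  proof -
    have "1 / (1 - r ^ Suc k) = 1 + r ^ Suc k / (1 - r ^ Suc k)" using rk[of k] by (simp add: field_simps)
    also have "\<dots> \<le> 1 + r ^ Suc k / (1 - r)"
      using rk[of k] r by (intro add_left_mono divide_left_mono mult_pos_pos) auto
    also have "\<dots> \<le> exp (r ^ Suc k / (1 - r))" by (rule exp_ge_add_one_self)
    finally show ?thesis .
  qed
  then have "(\<Prod>k<K. 1 / (1 - r ^ Suc k)) \<le> (\<Prod>k<K. exp (r ^ Suc k / (1 - r)))"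
    by (intro prod_mono) (use rk in \<open>auto simp: less_imp_le\<close>)
  also have "\<dots> = exp ((\<Sum>k<K. r ^ Suc k) / (1 - r))"
    by (simp only: exp_sum[symmetric, OF finite_lessThan] sum_divide_distrib)
  also have "(\<Sum>k<K. r ^ Suc k) \<le> 1 / (1 - r)"
  proof -
    have "(\<Sum>k<K. r ^ Suc k) \<le> (\<Sum>k<K. r ^ k)" using r by (intro sum_mono) (auto intro: mult_left_le_one_le)
    also have "\<dots> \<le> suminf (\<lambda>k. r ^ k)" using r by (intro sum_le_suminf summable_geometric) auto
    finally show ?thesis using r by (simp add: suminf_geometric)
  qed
  finally show ?thesis using r by (simp add: divide_right_mono power2_eq_square)
qed

lemma abs_summable_msize:
  fixes x :: complex assumes x: "norm x < 1"
  shows "(\<lambda>\<mu>. x ^ msize \<mu>) abssum_on UNIV"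
proof (rule nonneg_bdd_above_summable_on)
  show "bdd_above (sum (\<lambda>\<mu>. norm (x ^ msize \<mu>)) ` {F. F \<subseteq> UNIV \<and> finite F})"
  proof (rule bdd_aboveI2)
    fix F :: "nat multiset set" assume "F \<in> {F. F \<subseteq> UNIV \<and> finite F}"
    then have F: "finite F" by auto
    define K where "K = Suc (Max (insert 0 (\<Union>\<mu>\<in>F. set_mset \<mu>)))"
    have sub: "F \<subseteq> {\<mu>. set_mset \<mu> \<subseteq> {..<K}}"
      using F by (auto simp: K_def less_Suc_eq_le intro!: Max_ge)
    let ?r = "of_real (norm x) :: complex"
    have r: "norm ?r < 1" using x by simp
    have hs: "((\<lambda>\<mu>. ?r ^ msize \<mu>) has_sum (\<Prod>k<K. 1 / (1 - ?r ^ Suc k))) {\<mu>. set_mset \<mu> \<subseteq> {..<K}}"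
      using multisets_below_has_sum[OF r] by blast
    have "(\<Prod>k<K. 1 / (1 - ?r ^ Suc k)) = of_real (\<Prod>k<K. 1 / (1 - norm x ^ Suc k))" by simp
    with hs have "((\<lambda>\<mu>. of_real (norm x ^ msize \<mu>) :: complex) has_sum of_real (\<Prod>k<K. 1 / (1 - norm x ^ Suc k))) {\<mu>. set_mset \<mu> \<subseteq> {..<K}}"
      by (simp only: of_real_power)
    then have "((\<lambda>\<mu>. norm x ^ msize \<mu>) has_sum (\<Prod>k<K. 1 / (1 - norm x ^ Suc k))) {\<mu>. set_mset \<mu> \<subseteq> {..<K}}"
      by (simp only: has_sum_of_real_iff)
    then have "(\<Sum>\<mu>\<in>F. norm x ^ msize \<mu>) \<le> (\<Prod>k<K. 1 / (1 - norm x ^ Suc k))"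
      using F sub by (intro finite_sum_le_has_sum) auto
    also have "\<dots> \<le> exp (1 / (1 - norm x)\<^sup>2)" using x by (intro prod_euler_bound) auto
    finally show "(\<Sum>\<mu>\<in>F. norm (x ^ msize \<mu>)) \<le> exp (1 / (1 - norm x)\<^sup>2)" by (simp add: norm_power)
  qed
qed auto

lemma pgf_has_sum: "norm x < 1 \<Longrightarrow> ((\<lambda>\<mu>. x ^ msize \<mu>) has_sum pgf x) UNIV"
  unfolding pgf_def using Infinite_Sum.abs_summable_summable[OF abs_summable_msize] by (rule has_sum_infsum)

text \<open>Absolute summability makes everything outside some finite set small, and the sets
  \<open>A K\<close> eventually contain that finite set.\<close>

lemma infsum_exhaustion:
  fixes f :: "'a \<Rightarrow> complex"
  assumes f: "f abssum_on UNIV" and A: "\<And>F. finite F \<Longrightarrow> \<forall>\<^sub>F K in sequentially. F \<subseteq> A K"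
  shows "(\<lambda>K. infsum f (A K)) \<longlonglongrightarrow> infsum f UNIV"
proof (rule tendstoI)
  fix e :: real assume e: "e > 0"
  let ?n = "\<lambda>x. norm (f x)"
  have "((\<lambda>F. sum ?n F) \<longlongrightarrow> infsum ?n UNIV) (finite_subsets_at_top UNIV)"
    using f infsum_tendsto by blast
  then have "\<forall>\<^sub>F F in finite_subsets_at_top UNIV. dist (sum ?n F) (infsum ?n UNIV) < e"
    using e by (rule tendstoD)
  then obtain F where F: "finite F" "dist (sum ?n F) (infsum ?n UNIV) < e"
    by (auto simp: eventually_finite_subsets_at_top)
  show "\<forall>\<^sub>F K in sequentially. dist (infsum f (A K)) (infsum f UNIV) < e"
    using A[OF F(1)]
  proof eventually_elim
    case (elim K)
    have sub: "f summable_on B" "?n summable_on B" for B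
      using summable_on_subset_banach[OF f, of B] summable_on_subset_banach[OF Infinite_Sum.abs_summable_summable[OF f], of B] by auto
    have "infsum f UNIV - infsum f (A K) = infsum f (UNIV - A K)"
      by (rule infsum_Diff[symmetric]) (use sub in auto)
    then have "dist (infsum f (A K)) (infsum f UNIV) = norm (infsum f (UNIV - A K))"
      by (simp add: dist_norm norm_minus_commute)
    also have "\<dots> \<le> infsum ?n (UNIV - A K)" by (rule norm_infsum_bound) (rule sub)
    also have "\<dots> \<le> infsum ?n (UNIV - F)"
      by (rule infsum_mono_neutral) (use sub elim in auto)
    also have "\<dots> = infsum ?n UNIV - infsum ?n F"
      by (rule infsum_Diff) (use sub in auto)
    also have "\<dots> < e" using F by (simp add: dist_real_def)
    finally show ?case .
  qed
qed

lemma pgf_LIMSEQ: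
  fixes x :: complex assumes x: "norm x < 1"
  shows "(\<lambda>K. \<Prod>k<K. 1 / (1 - x ^ Suc k)) \<longlonglongrightarrow> pgf x"
proof -
  have "(\<lambda>K. infsum (\<lambda>\<mu>. x ^ msize \<mu>) {\<mu>. set_mset \<mu> \<subseteq> {..<K}}) \<longlonglongrightarrow> pgf x"
    unfolding pgf_def
  proof (rule infsum_exhaustion[OF abs_summable_msize[OF x]])
    fix F :: "nat multiset set" assume F: "finite F"
    show "\<forall>\<^sub>F K in sequentially. F \<subseteq> {\<mu>. set_mset \<mu> \<subseteq> {..<K}}"
      using eventually_gt_at_top[of "Max (insert 0 (\<Union>\<mu>\<in>F. set_mset \<mu>))"]
    proof eventually_elim
      case (elim K)
      have "k < K" if "\<mu> \<in> F" "k \<in># \<mu>" for k \<mu>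
        by (rule le_less_trans[OF Max_ge elim]) (use F that in auto)
      then show ?case by auto
    qed
  qed
  then show ?thesis by (simp only: infsumI[OF conjunct2[OF multisets_below_has_sum[OF x]]])
qed

lemma log_series_sums:
  fixes z :: complex assumes "norm z < 1"
  shows "(\<lambda>j. z ^ Suc j / of_nat (Suc j)) sums (- Ln (1 - z))"
proof -
  have "(\<lambda>n. (-1) ^ Suc n / of_nat n * (- z) ^ n) sums ln (1 + - z)"
    by (rule Ln_series) (use assms in simp)
  then have "(\<lambda>n. - ((-1) ^ Suc n / of_nat n * (- z) ^ n)) sums - ln (1 - z)"
    using sums_minus[of "\<lambda>n. (-1) ^ Suc n / of_nat n * (- z) ^ n"] by (simp only: diff_conv_add_uminus)
  moreover have "- ((-1) ^ Suc n / of_nat n * (- z) ^ n) = z ^ n / of_nat n" for n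
    by (cases "even n") simp_all
  ultimately have "(\<lambda>n. z ^ n / of_nat n) sums - ln (1 - z)" by (simp only:)
  then show ?thesis by (subst sums_Suc_iff) simp
qed

text \<open>The logarithm of Euler's product, expanded and summed in the other order. It shows that
  \<open>pgf\<close> has no zeros, and it is the form in which the inversion is proved.\<close>

lemma pgf_eq_exp:
  fixes x :: complex assumes x: "norm x < 1"
  shows "summable (\<lambda>j. x ^ Suc j / (of_nat (Suc j) * (1 - x ^ Suc j)))"
    "pgf x = exp (suminf (\<lambda>j. x ^ Suc j / (of_nat (Suc j) * (1 - x ^ Suc j))))"
proof -
  define f :: "nat \<times> nat \<Rightarrow> complex" where "f = (\<lambda>(n, j). (x ^ Suc n) ^ Suc j / of_nat (Suc j))"
  let ?r = "of_real (norm x) :: complex"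
  have r: "norm ?r < 1" using x by simp
  \<comment> \<open>A product of geometric series dominates, since (n+1)(j+1) >= n + j and the
    denominators are at least 1.\<close>
  have "(\<lambda>(n, j). ?r ^ n * ?r ^ j) abssum_on UNIV \<times> UNIV"
    by (rule has_sum_Times_mult(1)[OF geometric_has_sum[OF r] geometric_has_sum[OF r]])
  then have abs: "f abssum_on UNIV \<times> UNIV"
  proof (rule Infinite_Sum.abs_summable_on_comparison_test)
    fix p :: "nat \<times> nat"
    obtain n j where p: "p = (n, j)" by fastforce
    have "norm (f p) = norm x ^ (Suc n * Suc j) / real (Suc j)"
      by (simp add: f_def p norm_divide norm_power norm_mult power_mult power_mult_distrib del: of_nat_Suc) (simp add: power_add mult.commute flip: power_mult)
    also have "\<dots> \<le> norm x ^ (Suc n * Suc j) / 1" by (intro divide_left_mono) auto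
    also have "\<dots> = norm x ^ (Suc n * Suc j)" by simp
    also have "\<dots> \<le> norm x ^ (n + j)" by (rule power_decreasing) (use x in auto)
    finally show "norm (f p) \<le> norm ((\<lambda>(n, j). ?r ^ n * ?r ^ j) p)"
      by (simp add: p norm_mult norm_power power_add)
  qed
  then obtain T where T: "(f has_sum T) (UNIV \<times> UNIV)"
    using Infinite_Sum.abs_summable_summable summable_on_def by blast
  have row: "((\<lambda>j. f (n, j)) has_sum (- Ln (1 - x ^ Suc n))) UNIV" for n
  proof (rule norm_summable_imp_has_sum)
    have z: "norm (x ^ Suc n) < 1" by (rule norm_power_less_1[OF x])
    show "(\<lambda>j. f (n, j)) sums (- Ln (1 - x ^ Suc n))"
      using log_series_sums[OF z] by (simp add: f_def)
    have "(\<lambda>j. f (n, j)) abssum_on UNIV"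
      using abs by (subst (asm) Infinite_Sum.abs_summable_on_Sigma_iff) auto
    then show "summable (\<lambda>j. norm (f (n, j)))" by (rule summable_on_UNIV_nonneg_real_iff[THEN iffD1, rotated]) auto
  qed
  have T1: "((\<lambda>n. - Ln (1 - x ^ Suc n)) has_sum T) UNIV"
    by (rule has_sum_SigmaD[OF T row])
  have T': "((\<lambda>(j, n). f (n, j)) has_sum T) (UNIV \<times> UNIV)"
    using T by (subst (asm) has_sum_swap) simp
  have col: "((\<lambda>n. (\<lambda>(j, n). f (n, j)) (j, n)) has_sum (x ^ Suc j / (of_nat (Suc j) * (1 - x ^ Suc j)))) UNIV" for j
  proof -
    have z: "norm (x ^ Suc j) < 1" by (rule norm_power_less_1[OF x])
    have "((\<lambda>n. (x ^ Suc j) ^ n * (x ^ Suc j / of_nat (Suc j))) has_sum (1 / (1 - x ^ Suc j) * (x ^ Suc j / of_nat (Suc j)))) UNIV"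
      by (rule has_sum_cmult_left[OF geometric_has_sum(2)[OF z]])
    moreover have "(x ^ Suc j) ^ n * (x ^ Suc j / of_nat (Suc j)) = (\<lambda>(j, n). f (n, j)) (j, n)" for n
      by (simp add: f_def algebra_simps flip: power_mult power_add power_Suc)
    ultimately show ?thesis by (simp add: mult.commute)
  qed
  have T2: "((\<lambda>j. x ^ Suc j / (of_nat (Suc j) * (1 - x ^ Suc j))) has_sum T) UNIV"
    by (rule has_sum_SigmaD[OF T' col])
  then have s2: "(\<lambda>j. x ^ Suc j / (of_nat (Suc j) * (1 - x ^ Suc j))) sums T" by (rule has_sum_imp_sums)
  then show "summable (\<lambda>j. x ^ Suc j / (of_nat (Suc j) * (1 - x ^ Suc j)))" by (rule sums_summable)
  have "(\<lambda>K. \<Sum>k<K. - Ln (1 - x ^ Suc k)) \<longlonglongrightarrow> T"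
    using has_sum_imp_sums[OF T1] by (simp add: sums_def)
  then have "(\<lambda>K. exp (\<Sum>k<K. - Ln (1 - x ^ Suc k))) \<longlonglongrightarrow> exp T" by (rule tendsto_exp)
  moreover have "exp (\<Sum>k<K. - Ln (1 - x ^ Suc k)) = (\<Prod>k<K. 1 / (1 - x ^ Suc k))" for K
    unfolding exp_sum[OF finite_lessThan]
  proof (rule prod.cong[OF refl])
    fix k
    have "1 - x ^ Suc k \<noteq> 0" using norm_power_less_1[OF x, of k] by (metis norm_one order_less_irrefl right_minus_eq)
    then show "exp (- Ln (1 - x ^ Suc k)) = 1 / (1 - x ^ Suc k)"
      by (simp add: exp_minus inverse_eq_divide)
  qed
  ultimately have "(\<lambda>K. \<Prod>k<K. 1 / (1 - x ^ Suc k)) \<longlonglongrightarrow> exp T" by simp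
  then have "pgf x = exp T" using pgf_LIMSEQ[OF x] LIMSEQ_unique by blast
  then show "pgf x = exp (suminf (\<lambda>j. x ^ Suc j / (of_nat (Suc j) * (1 - x ^ Suc j))))"
    using s2 by (simp add: sums_iff)
qed

lemma pgf_nonzero: "norm x < 1 \<Longrightarrow> pgf x \<noteq> 0"
  by (simp add: pgf_eq_exp)

text \<open>Finiteness is read off from convergence at 1/2: an infinite level set would repeat one
  positive term infinitely often.\<close>

lemma finite_msize: "finite {\<mu>. msize \<mu> = n}"
proof (rule ccontr)
  assume inf: "infinite {\<mu>. msize \<mu> = n}"
  have "(\<lambda>\<mu>. norm ((1/2::complex) ^ msize \<mu>)) summable_on {\<mu>. msize \<mu> = n}"
    by (rule summable_on_subset_banach[OF abs_summable_msize]) (auto simp: norm_divide)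
  then have "(\<lambda>\<mu>. (1/2::real) ^ n) summable_on {\<mu>. msize \<mu> = n}"
    by (rule summable_on_cong[THEN iffD1, rotated]) (auto simp: norm_power norm_divide)
  then show False using infsum_diverge_constant[OF inf, of "(1/2::real) ^ n"] by simp
qed

lemma pgf_holomorphic: "pgf holomorphic_on ball 0 1"
proof (rule power_series_holomorphic)
  fix x :: complex assume "x \<in> ball 0 1"
  then have x: "norm x < 1" by simp
  let ?p = "\<lambda>n. of_nat (card {\<mu>. msize \<mu> = n}) :: complex"
  have bij: "bij_betw (\<lambda>\<mu>. (msize \<mu>, \<mu>)) UNIV (SIGMA n:UNIV. {\<mu>. msize \<mu> = n})"
    by (rule bij_betwI[where g = snd]) auto
  have "((\<lambda>(n, \<mu>). x ^ n) has_sum pgf x) (SIGMA n:UNIV. {\<mu>. msize \<mu> = n})"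
    using pgf_has_sum[OF x] has_sum_reindex_bij_betw[OF bij, of "\<lambda>(n, \<mu>). x ^ n"] by simp
  then have "((\<lambda>n. ?p n * x ^ n) has_sum pgf x) UNIV"
  proof (rule has_sum_SigmaD)
    fix n :: nat
    have "((\<lambda>\<mu>. x ^ n) has_sum (\<Sum>\<mu>\<in>{\<mu>. msize \<mu> = n}. x ^ n)) {\<mu>. msize \<mu> = n}"
      by (rule has_sum_finite) (rule finite_msize)
    then show "((\<lambda>\<mu>. (\<lambda>(n, \<mu>). x ^ n) (n, \<mu>)) has_sum ?p n * x ^ n) {\<mu>. msize \<mu> = n}" by simp
  qed
  then show "(\<lambda>n. ?p n * (x - 0) ^ n) sums pgf x"
    using has_sum_imp_sums by fastforce
qed

section \<open>Dimensions and characters from bases\<close>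

text \<open>The coordinates \<open>p j\<close> form a dual family, which yields injectivity and
  linear independence at once.\<close>

lemma dim_eq_card_probe:
  fixes f :: "'i \<Rightarrow> ('b \<Rightarrow>\<^sub>0 complex)"
  assumes I: "finite I" and p: "\<And>i j. i \<in> I \<Longrightarrow> j \<in> I \<Longrightarrow> Poly_Mapping.lookup (f i) (p j) = (if i = j then 1 else 0)"
    and W: "W = cvec.span (f ` I)"
  shows "cvec.dim W = card I"
proof -
  have inj: "inj_on f I"
    by (rule inj_onI) (metis p zero_neq_one)
  have ind: "cvec.independent (f ` I)"
    unfolding cvec.independent_explicit_finite_subsets
  proof (intro allI impI ballI)
    fix S u v assume S: "S \<subseteq> f ` I" "finite S" and 0: "(\<Sum>v\<in>S. cscale (u v) v) = 0" and v: "v \<in> S"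
    obtain i where i: "i \<in> I" "v = f i" using v S by blast
    have "0 = (\<Sum>w\<in>S. u w * Poly_Mapping.lookup w (p i))"
      using arg_cong[OF 0, of "\<lambda>x. Poly_Mapping.lookup x (p i)"] by (simp add: lookup_sum)
    also have "\<dots> = (\<Sum>w\<in>S. if w = v then u v else 0)"
    proof (rule sum.cong[OF refl])
      fix w assume "w \<in> S"
      then obtain j where j: "j \<in> I" "w = f j" using S by blast
      show "u w * Poly_Mapping.lookup w (p i) = (if w = v then u v else 0)"
        using p[OF j(1) i(1)] inj_onD[OF inj, of j i] i j by auto
    qed
    also have "\<dots> = u v" using S v by simp
    finally show "u v = 0" by simp
  qed
  show ?thesis
    using cvec.dim_span_eq_card_independent[OF ind] card_image[OF inj] by (simp only: W)
qed

text \<open>Reduces a character to a weight generating function: the sum over a basis of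
  L(0)-eigenvectors is regrouped by eigenvalue.\<close>

lemma char_has_sum:
  fixes g :: "'i \<Rightarrow> complex"
  assumes dim: "\<And>h. cvec.dim (eigenspace V M h) = card {i\<in>I. g i = h}"
    and fin: "\<And>h. finite {i\<in>I. g i = h}"
    and hs: "((\<lambda>i. exp (2 * of_real pi * \<i> * \<tau> * (g i - central_charge V / 24))) has_sum X) I"
  shows "char_converges V M \<tau>" "ch V M \<tau> = X"
proof -
  let ?e = "\<lambda>h. exp (2 * of_real pi * \<i> * \<tau> * (h - central_charge V / 24))"
  have bij: "bij_betw (\<lambda>i. (g i, i)) I (SIGMA h:UNIV. {i\<in>I. g i = h})"
    by (rule bij_betwI[where g = snd]) auto
  have "((\<lambda>(h, i). ?e h) has_sum X) (SIGMA h:UNIV. {i\<in>I. g i = h})"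
    using hs has_sum_reindex_bij_betw[OF bij, of "\<lambda>(h, i). ?e h"] by simp
  then have "(char_term V M \<tau> has_sum X) UNIV"
  proof (rule has_sum_SigmaD)
    fix h
    have "((\<lambda>i. ?e h) has_sum (\<Sum>i\<in>{i\<in>I. g i = h}. ?e h)) {i\<in>I. g i = h}"
      by (rule has_sum_finite) (rule fin)
    then show "((\<lambda>i. (\<lambda>(h, i). ?e h) (h, i)) has_sum char_term V M \<tau> h) {i\<in>I. g i = h}"
      by (simp add: char_term_def dim)
  qed
  then show "char_converges V M \<tau>" "ch V M \<tau> = X"
    by (auto simp: char_converges_def ch_def summable_on_def infsumI)
qed

subsection \<open>Triples of partitions\<close>

definition tri :: "'a \<times> 'a \<times> 'a \<Rightarrow> 3 \<Rightarrow> 'a" where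
  "tri t i = (if i = 1 then fst t else if i = 2 then fst (snd t) else snd (snd t))"

lemma tri_simps: "tri (x, y, z) 1 = x" "tri (x, y, z) 2 = y" "tri (x, y, z) 3 = z"
  by (simp_all add: tri_def)

lemma tri_eta: "tri (b 1, b 2, b 3) = b"
proof
  fix i :: 3
  show "tri (b 1, b 2, b 3) i = b i"
    using exhaust_3[of i] by (auto simp: tri_simps)
qed

lemma tri_eq_iff: "tri (x, y, z) = tri (x', y', z') \<longleftrightarrow> x = x' \<and> y = y' \<and> z = z'"
  by (metis tri_simps)

lemma bij_tri: "bij_betw tri (UNIV \<times> UNIV \<times> UNIV) UNIV"
  by (rule bij_betwI[where g = "\<lambda>b. (b 1, b 2, b 3)"]) (auto simp: tri_eta tri_simps)

lemma weight_tri: "weight (tri (x, y, z)) = msize x + msize y + msize z"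
  by (simp add: weight_def sum_3 tri_simps msize_def)

lemma weight_has_sum:
  assumes q: "norm q < 1"
  shows "(\<lambda>b :: 3 \<Rightarrow> nat multiset. q ^ weight b) abssum_on UNIV"
    "((\<lambda>b :: 3 \<Rightarrow> nat multiset. q ^ weight b) has_sum pgf q ^ 3) UNIV"
proof -
  note a = abs_summable_msize[OF q] pgf_has_sum[OF q]
  note * = has_sum_Times_mult[OF a has_sum_Times_mult[OF a a]]
  have eq: "(\<lambda>(x, y). q ^ msize x * (case y of (x, y) \<Rightarrow> q ^ msize x * q ^ msize y)) = (\<lambda>t. q ^ weight (tri t))"
    by (auto simp: fun_eq_iff weight_tri power_add)
  show "((\<lambda>b :: 3 \<Rightarrow> nat multiset. q ^ weight b) has_sum pgf q ^ 3) UNIV"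
    using *(2) unfolding eq using has_sum_reindex_bij_betw[OF bij_tri, of "\<lambda>b. q ^ weight b"]
    by (simp add: power3_eq_cube mult.assoc)
  show "(\<lambda>b :: 3 \<Rightarrow> nat multiset. q ^ weight b) abssum_on UNIV"
    using *(1) unfolding eq using summable_on_reindex_bij_betw[OF bij_tri, of "\<lambda>b. norm (q ^ weight b)"]
    by simp
qed

lemma finite_weight: "finite {b :: 3 \<Rightarrow> nat multiset. weight b = n}"
proof (rule ccontr)
  let ?S = "{b :: 3 \<Rightarrow> nat multiset. weight b = n}"
  assume inf: "infinite ?S"
  have "(\<lambda>b. norm ((1/2::complex) ^ weight b)) summable_on ?S"
    by (rule summable_on_subset_banach[OF weight_has_sum(1)]) (auto simp: norm_divide)
  then have "(\<lambda>b. (1/2::real) ^ n) summable_on ?S"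
    by (rule summable_on_cong[THEN iffD1, rotated]) (auto simp: norm_power norm_divide)
  then show False using infsum_diverge_constant[OF inf, of "(1/2::real) ^ n"] by simp
qed

lemma finite_weight_complex: "finite {b :: 3 \<Rightarrow> nat multiset. of_nat (weight b) + c = (h :: complex)}"
proof (cases "\<exists>n. of_nat n + c = h")
  case True
  then obtain n where n: "of_nat n + c = h" by blast
  have "{b :: 3 \<Rightarrow> nat multiset. of_nat (weight b) + c = h} = {b. weight b = n}"
    using n by (auto simp flip: n)
  then show ?thesis by (simp add: finite_weight)
next
  case False
  then have "{b :: 3 \<Rightarrow> nat multiset. of_nat (weight b) + c = h} = {}" by auto
  then show ?thesis by (simp only: finite.emptyI)
qed

lemma poly_mapping_expansion: "w = (\<Sum>b\<in>Poly_Mapping.keys w. cscale (Poly_Mapping.lookup w b) (Poly_Mapping.single b 1))"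
  by (rule poly_mapping_eqI) (simp add: lookup_sum cscale_single lookup_single when_def in_keys_iff del: lookup_cscale)

subsection \<open>Fock modules as ordinary modules\<close>

lemma emb_single: "emb (Poly_Mapping.single b 1) = Poly_Mapping.single (enc b) 1"
  by (simp add: emb_def)

lemma enc_eq_iff: "enc b = enc c \<longleftrightarrow> b = c"
  by (metis dec_enc)

lemma eigenspace_fock:
  "eigenspace H3S3 (fock_module l) h = emb ` {w :: 3 fock. \<forall>b\<in>Poly_Mapping.keys w. of_nat (weight b) + L0_shift l = h}"
proof -
  have "emb (vertex l omega 1 x) = cscale h (emb x) \<longleftrightarrow> (\<forall>b\<in>Poly_Mapping.keys x. of_nat (weight b) + L0_shift l = h)" for x :: "3 fock"
    by (simp only: clinear_cscale[OF emb_linear, symmetric] emb_inj vertex_omega_eigen)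
  then show ?thesis
    by (auto simp: eigenspace_def L0_def mcarrier_fock act_fock H3S3_simps)
qed

lemma eigenspace_fock_span:
  "eigenspace H3S3 (fock_module l) h =
    cvec.span ((\<lambda>b. emb (Poly_Mapping.single b 1)) ` {b :: 3 \<Rightarrow> nat multiset. of_nat (weight b) + L0_shift l = h})" (is "_ = cvec.span (?f ` ?S)")
proof
  show "eigenspace H3S3 (fock_module l) h \<subseteq> cvec.span (?f ` ?S)"
  proof
    fix v assume "v \<in> eigenspace H3S3 (fock_module l) h"
    then obtain w :: "3 fock" where w: "v = emb w" "\<forall>b\<in>Poly_Mapping.keys w. of_nat (weight b) + L0_shift l = h"
      unfolding eigenspace_fock by blast
    have "v = (\<Sum>b\<in>Poly_Mapping.keys w. cscale (Poly_Mapping.lookup w b) (?f b))"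
      unfolding w(1) by (subst poly_mapping_expansion) (simp only: clinear_sum[OF emb_linear] clinear_cscale[OF emb_linear])
    also have "\<dots> \<in> cvec.span (?f ` ?S)"
      by (intro cvec.span_sum cvec.span_scale cvec.span_base imageI) (use w in auto)
    finally show "v \<in> cvec.span (?f ` ?S)" .
  qed
  have "cvec.subspace (eigenspace H3S3 (fock_module l) h)"
    unfolding eigenspace_fock
  proof (rule cvec.subspaceI)
    let ?K = "{w :: 3 fock. \<forall>b\<in>Poly_Mapping.keys w. of_nat (weight b) + L0_shift l = h}"
    show "0 \<in> emb ` ?K" by (rule image_eqI[of _ _ 0]) (simp_all add: clinear_0[OF emb_linear])
    fix v assume v: "v \<in> emb ` ?K"
    then obtain x where x: "v = emb x" "x \<in> ?K" by blast
    show "cscale c v \<in> emb ` ?K" for c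
      by (rule image_eqI[of _ _ "cscale c x"]) (use x in \<open>auto simp: clinear_cscale[OF emb_linear] in_keys_iff\<close>)
    fix w assume "w \<in> emb ` ?K"
    then obtain y where y: "w = emb y" "y \<in> ?K" by blast
    show "v + w \<in> emb ` ?K"
      by (rule image_eqI[of _ _ "x + y"]) (use x y keys_add[of x y] in \<open>auto simp: clinear_add[OF emb_linear]\<close>)
  qed
  moreover have "?f ` ?S \<subseteq> eigenspace H3S3 (fock_module l) h"
    unfolding eigenspace_fock by auto
  ultimately show "cvec.span (?f ` ?S) \<subseteq> eigenspace H3S3 (fock_module l) h"
    by (rule cvec.span_minimal[rotated])
qed

lemma fock_voa_module: "voa_module H3S3 (fock_module l)"
  unfolding voa_module_def
proof (intro conjI allI)
  show "weak_module H3S3 (fock_module l)" by (rule fock_weak_module)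
  show "mcarrier (fock_module l) \<subseteq> cvec.span (\<Union>h. eigenspace H3S3 (fock_module l) h)"
    unfolding mcarrier_fock
  proof
    fix v assume "v \<in> range (emb :: 3 fock \<Rightarrow> _)"
    then obtain w :: "3 fock" where w: "v = emb w" by blast
    have "v = (\<Sum>b\<in>Poly_Mapping.keys w. cscale (Poly_Mapping.lookup w b) (emb (Poly_Mapping.single b 1)))"
      unfolding w by (subst poly_mapping_expansion) (simp only: clinear_sum[OF emb_linear] clinear_cscale[OF emb_linear])
    also have "\<dots> \<in> cvec.span (\<Union>h. eigenspace H3S3 (fock_module l) h)"
    proof (intro cvec.span_sum cvec.span_scale cvec.span_base UN_I[OF UNIV_I])
      fix b :: "3 \<Rightarrow> nat multiset" show "emb (Poly_Mapping.single b 1) \<in> eigenspace H3S3 (fock_module l) (of_nat (weight b) + L0_shift l)"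
        unfolding eigenspace_fock by auto
    qed
    finally show "v \<in> cvec.span (\<Union>h. eigenspace H3S3 (fock_module l) h)" .
  qed
  fix h
  show "\<exists>B. finite B \<and> eigenspace H3S3 (fock_module l) h \<subseteq> cvec.span B"
    unfolding eigenspace_fock_span using finite_weight_complex by blast
  have "\<exists>N. \<forall>n\<ge>N. {b :: 3 \<Rightarrow> nat multiset. of_nat (weight b) + L0_shift l = h - of_nat n} = {}"
  \<comment> \<open>Either h lies on the ladder of weights above \<open>L0_shift l\<close>, at
    height m, and n > m leads below it, or no h - n lies on the ladder at all.\<close>
  proof (cases "\<exists>m. h = of_nat m + L0_shift l")
    case True
    then obtain m where m: "h = of_nat m + L0_shift l" by blast
    show ?thesis
    proof (intro exI[of _ "Suc m"] allI impI)
      fix n assume n: "Suc m \<le> n"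
      have "of_nat (weight b) + L0_shift l \<noteq> h - of_nat n" for b :: "3 \<Rightarrow> nat multiset"
      proof
        assume "of_nat (weight b) + L0_shift l = h - of_nat n"
        then have "(of_nat (weight b + n) :: complex) = of_nat m" unfolding m by (simp add: algebra_simps)
        then have "weight b + n = m" by (simp only: of_nat_eq_iff)
        then show False using n by simp
      qed
      then show "{b :: 3 \<Rightarrow> nat multiset. of_nat (weight b) + L0_shift l = h - of_nat n} = {}" by blast
    qed
  next
    case False
    have "of_nat (weight b) + L0_shift l \<noteq> h - of_nat n" for n and b :: "3 \<Rightarrow> nat multiset"
    proof
      assume "of_nat (weight b) + L0_shift l = h - of_nat n"
      then have "h = of_nat (weight b + n) + L0_shift l" by (simp add: algebra_simps)
      then show False using False by blast
    qed
    then show ?thesis by blast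
  qed
  then show "\<exists>N. \<forall>n\<ge>N. eigenspace H3S3 (fock_module l) (h - of_nat n) = {0}"
    unfolding eigenspace_fock_span by (metis cvec.span_empty image_empty)
qed

lemma nome_less_1: "Im \<tau> > 0 \<Longrightarrow> norm (exp (2 * of_real pi * \<i> * \<tau>)) < 1"
  by simp

lemma fock_character:
  assumes \<tau>: "Im \<tau> > 0"
  defines "q \<equiv> exp (2 * of_real pi * \<i> * \<tau>)"
  shows "char_converges H3S3 (fock_module l) \<tau>"
    "ch H3S3 (fock_module l) \<tau> = exp (2 * of_real pi * \<i> * \<tau> * (L0_shift l - 1/8)) * pgf q ^ 3"
proof -
  let ?S = "\<lambda>h. {b :: 3 \<Rightarrow> nat multiset. of_nat (weight b) + L0_shift l = h}"
  have q: "norm q < 1" unfolding q_def using \<tau> by (rule nome_less_1)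
  have d: "cvec.dim (eigenspace H3S3 (fock_module l) h) = card (?S h)" for h
    by (rule dim_eq_card_probe[OF finite_weight_complex _ eigenspace_fock_span, where p = enc])
      (simp add: emb_single lookup_single when_def enc_eq_iff)
  have e: "exp (2 * of_real pi * \<i> * \<tau> * ((of_nat (weight b) + L0_shift l) - central_charge H3S3 / 24)) =
      exp (2 * of_real pi * \<i> * \<tau> * (L0_shift l - 1/8)) * q ^ weight b" for b :: "3 \<Rightarrow> nat multiset"
    unfolding q_def exp_of_nat_mult[symmetric] exp_add[symmetric]
    by (simp add: H3S3_simps algebra_simps)
  have hs: "((\<lambda>b :: 3 \<Rightarrow> nat multiset. exp (2 * of_real pi * \<i> * \<tau> * ((of_nat (weight b) + L0_shift l) - central_charge H3S3 / 24)))
      has_sum exp (2 * of_real pi * \<i> * \<tau> * (L0_shift l - 1/8)) * pgf q ^ 3) UNIV"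
    unfolding e by (rule has_sum_cmult_right[OF weight_has_sum(2)[OF q]])
  show "char_converges H3S3 (fock_module l) \<tau>"
    by (rule char_has_sum(1)[OF _ _ hs]) (simp_all add: d finite_weight_complex)
  show "ch H3S3 (fock_module l) \<tau> = exp (2 * of_real pi * \<i> * \<tau> * (L0_shift l - 1/8)) * pgf q ^ 3"
    by (rule char_has_sum(2)[OF _ _ hs]) (simp_all add: d finite_weight_complex)
qed

definition zero_module :: "('b, 'm) voa_mod" where
  "zero_module = \<lparr>mcarrier = {0}, act = (\<lambda>v n w. 0)\<rparr>"

lemma zero_module:
  fixes V :: "'b voa"
  shows "voa_module V (zero_module :: ('b, 'm) voa_mod)"
  "char_converges V (zero_module :: ('b, 'm) voa_mod) \<tau>" "ch V (zero_module :: ('b, 'm) voa_mod) \<tau> = 0"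
proof -
  let ?Z = "zero_module :: ('b, 'm) voa_mod"
  have e: "eigenspace V ?Z h = {0}" for h
    by (auto simp: eigenspace_def L0_def zero_module_def)
  have "weak_module V ?Z"
    by (simp add: weak_module_def zero_module_def)
  then show "voa_module V ?Z"
    unfolding voa_module_def e by (auto simp: zero_module_def cvec.span_zero intro!: exI[of _ "{}"])
  have "cvec.dim {0 :: 'm \<Rightarrow>\<^sub>0 complex} = card ({} :: nat set)"
    by (rule dim_eq_card_probe[where f = "\<lambda>_. 0" and p = "\<lambda>_. undefined"]) simp_all
  then have "char_term V ?Z \<tau> h = 0" for h by (simp add: char_term_def e)
  then have "char_term V ?Z \<tau> = (\<lambda>_. 0)" by (rule ext)
  then show "char_converges V ?Z \<tau>" "ch V ?Z \<tau> = 0"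
    by (simp_all add: char_converges_def ch_def)
qed

subsection \<open>The character of the orbifold\<close>

definition orbit :: "(3 \<Rightarrow> 'a) \<Rightarrow> (3 \<Rightarrow> 'a) set" where
  "orbit b = {b \<circ> \<sigma> | \<sigma>. bij \<sigma>}"

lemma orbit_refl: "b \<in> orbit b"
  unfolding orbit_def by (rule CollectI, rule exI[of _ id]) simp

lemma orbit_eq: "c \<in> orbit b \<Longrightarrow> orbit c = orbit b"
proof -
  assume "c \<in> orbit b"
  then obtain \<sigma> where s: "c = b \<circ> \<sigma>" "bij \<sigma>" by (auto simp: orbit_def)
  show ?thesis
  proof
    show "orbit c \<subseteq> orbit b"
      unfolding orbit_def s(1) using bij_comp[OF _ s(2)] by (auto simp: comp_assoc)
    show "orbit b \<subseteq> orbit c"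
    proof
      fix d assume "d \<in> orbit b"
      then obtain \<rho> where r: "d = b \<circ> \<rho>" "bij \<rho>" by (auto simp: orbit_def)
      have "d = c \<circ> (inv \<sigma> \<circ> \<rho>)"
        using s by (simp add: r s fun_eq_iff bij_is_surj surj_f_inv_f)
      moreover have "bij (inv \<sigma> \<circ> \<rho>)" by (rule bij_comp[OF r(2) bij_imp_bij_inv[OF s(2)]])
      ultimately show "d \<in> orbit c" unfolding orbit_def by blast
    qed
  qed
qed

lemma orbit_tri:
  "orbit (tri (x, y, z)) = {tri (x, y, z), tri (y, x, z), tri (z, y, x), tri (x, z, y), tri (y, z, x), tri (z, x, y)}"
    (is "?L = ?R")
proof
  show "?L \<subseteq> ?R"
  proof
    fix c assume "c \<in> ?L"
    then obtain \<sigma> where s: "c = tri (x, y, z) \<circ> \<sigma>" "bij \<sigma>" by (auto simp: orbit_def)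
    have c: "c = tri (tri (x, y, z) (\<sigma> 1), tri (x, y, z) (\<sigma> 2), tri (x, y, z) (\<sigma> 3))"
      unfolding s(1) by (subst tri_eta [symmetric]) simp
    have "\<sigma> 1 \<noteq> \<sigma> 2" "\<sigma> 2 \<noteq> \<sigma> 3" "\<sigma> 1 \<noteq> \<sigma> 3"
      using bij_is_inj[OF s(2)] by (auto simp: inj_eq)
    then show "c \<in> ?R"
      unfolding c using exhaust_3[of "\<sigma> 1"] exhaust_3[of "\<sigma> 2"] exhaust_3[of "\<sigma> 3"]
      by (elim disjE) (simp_all add: tri_simps)
  qed
  have "tri (x, y, z) \<circ> tri t \<in> ?L" if "bij (tri t)" for t
    using that unfolding orbit_def by blast
  moreover have "tri (x, y, z) \<circ> tri (i, j, k) = tri (tri (x, y, z) i, tri (x, y, z) j, tri (x, y, z) k)" for i j k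
    by (subst tri_eta [symmetric]) (simp add: tri_simps)
  moreover have "bij (tri (i, j, k))" if "i \<noteq> j" "j \<noteq> k" "i \<noteq> k" for i j k :: 3
  proof -
    have "inj (tri (i, j, k))"
    proof (rule injI)
      fix m n :: 3 assume "tri (i, j, k) m = tri (i, j, k) n"
      then show "m = n" using that exhaust_3[of m] exhaust_3[of n] by (auto simp: tri_simps)
    qed
    then show ?thesis by (simp add: bij_def finite_UNIV_inj_surj)
  qed
  ultimately have "tri (tri (x, y, z) i, tri (x, y, z) j, tri (x, y, z) k) \<in> ?L"
    if "i \<noteq> j" "j \<noteq> k" "i \<noteq> k" for i j k using that by metis
  from this[of 1 2 3] this[of 2 1 3] this[of 3 2 1] this[of 1 3 2] this[of 2 3 1] this[of 3 1 2]
  show "?R \<subseteq> ?L" by (simp add: tri_simps)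
qed

text \<open>The order of the stabiliser, counted by the permutations that fix b: the identity, three
  transpositions and two 3-cycles. In this form Burnside's sum splits into five summable
  pieces.\<close>

definition stab :: "(3 \<Rightarrow> 'a) \<Rightarrow> nat" where
  "stab b = 1 + of_bool (b 1 = b 2) + of_bool (b 2 = b 3) + of_bool (b 1 = b 3) + 2 * of_bool (b 1 = b 2 \<and> b 2 = b 3)"

lemma stab_orbit: "c \<in> orbit b \<Longrightarrow> stab c = stab b"
proof -
  assume c: "c \<in> orbit b"
  obtain x y z where b: "b = tri (x, y, z)" by (metis tri_eta)
  show ?thesis using c unfolding b orbit_tri by (auto simp: stab_def tri_simps)
qed

lemma finite_orbit: "finite (orbit b)"
  using orbit_tri[of "b 1" "b 2" "b 3"] by (simp add: tri_eta)

lemma card_orbit: "card (orbit b) * stab b = 6"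
proof -
  obtain x y z where b: "b = tri (x, y, z)" by (metis tri_eta)
  show ?thesis unfolding b orbit_tri
    by (cases "x = y"; cases "y = z"; cases "x = z") (auto simp: stab_def tri_simps tri_eq_iff card_insert_if)
qed

lemma weight_orbit: "c \<in> orbit b \<Longrightarrow> weight c = weight b"
proof -
  assume "c \<in> orbit b"
  then obtain \<sigma> where "c = b \<circ> \<sigma>" "bij \<sigma>" by (auto simp: orbit_def)
  then show ?thesis
    unfolding weight_def using sum.reindex_bij_betw[of \<sigma> UNIV UNIV "\<lambda>i. \<Sum>k\<in>#b i. k + 1"] by simp
qed

lemma lookup_tensor_perm:
  assumes "bij \<sigma>"
  shows "Poly_Mapping.lookup (tensor_perm \<sigma> v) b = Poly_Mapping.lookup v (b \<circ> \<sigma>)"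
proof -
  have "c \<circ> inv \<sigma> = b \<longleftrightarrow> c = b \<circ> \<sigma>" for c
    using assms by (auto simp: fun_eq_iff) (metis bij_inv_eq_iff, metis bij_inv_eq_iff)
  then have "Poly_Mapping.lookup (tensor_perm \<sigma> v) b =
      (\<Sum>c\<in>Poly_Mapping.keys v. if c = b \<circ> \<sigma> then Poly_Mapping.lookup v c else 0)"
    unfolding tensor_perm_def lin_ext_def
    by (simp add: lookup_sum cscale_single lookup_single when_def del: lookup_cscale)
  then show ?thesis by (simp add: in_keys_iff)
qed

text \<open>Since permutations act on the basis, invariance concerns only how coefficients vary
  along orbits. Orbit sums therefore span the fixed space, and its character counts orbits.\<close>

lemma fixed_iff:
  fixes v :: "(3 \<Rightarrow> 'a) \<Rightarrow>\<^sub>0 complex"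
  shows "(\<forall>\<sigma>. bij \<sigma> \<longrightarrow> tensor_perm \<sigma> v = v) \<longleftrightarrow> (\<forall>b. \<forall>c\<in>orbit b. Poly_Mapping.lookup v c = Poly_Mapping.lookup v b)"
proof
  assume *: "\<forall>\<sigma>. bij \<sigma> \<longrightarrow> tensor_perm \<sigma> v = v"
  show "\<forall>b. \<forall>c\<in>orbit b. Poly_Mapping.lookup v c = Poly_Mapping.lookup v b"
    using * by (auto simp: orbit_def) (metis lookup_tensor_perm)
next
  assume *: "\<forall>b. \<forall>c\<in>orbit b. Poly_Mapping.lookup v c = Poly_Mapping.lookup v b"
  show "\<forall>\<sigma>. bij \<sigma> \<longrightarrow> tensor_perm \<sigma> v = v"
  proof (intro allI impI poly_mapping_eqI)
    fix \<sigma> :: "3 \<Rightarrow> 3" and b :: "3 \<Rightarrow> 'a" assume s: "bij \<sigma>"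
    then have "b \<circ> \<sigma> \<in> orbit b" by (auto simp: orbit_def)
    then show "Poly_Mapping.lookup (tensor_perm \<sigma> v) b = Poly_Mapping.lookup v b"
      using * by (simp add: lookup_tensor_perm[OF s])
  qed
qed

definition rep :: "(3 \<Rightarrow> 'a) set \<Rightarrow> 3 \<Rightarrow> 'a" where
  "rep X = (SOME b. b \<in> X)"

lemma rep_in: "X \<in> range orbit \<Longrightarrow> rep X \<in> X"
  unfolding rep_def using orbit_refl by (metis imageE someI)

lemma orbit_rep: "X \<in> range orbit \<Longrightarrow> orbit (rep X) = X"
  using rep_in orbit_eq by (metis imageE)

definition osum :: "(3 \<Rightarrow> nat multiset) set \<Rightarrow> 3 fock" where
  "osum X = (\<Sum>c\<in>X. Poly_Mapping.single c 1)"

lemma lookup_osum: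
  assumes "X \<in> range orbit"
  shows "Poly_Mapping.lookup (osum X) b = (if b \<in> X then 1 else 0)"
proof -
  have "finite X" using assms finite_orbit by blast
  then show ?thesis by (simp add: osum_def lookup_sum lookup_single when_def)
qed

lemma eigenspace_orbifold:
  "eigenspace H3S3 (adjoint_module H3S3) h =
    {v. (\<forall>b. \<forall>c\<in>orbit b. Poly_Mapping.lookup v c = Poly_Mapping.lookup v b) \<and> (\<forall>b\<in>Poly_Mapping.keys v. of_nat (weight b) = h)}"
  by (auto simp: eigenspace_def adjoint_module_def L0_def H3S3_simps vertex_omega_eigen fixed_iff L0_shift_def)

lemma eigenspace_orbifold_span:
  "eigenspace H3S3 (adjoint_module H3S3) h = cvec.span (osum ` {X \<in> range orbit. of_nat (weight (rep X)) = h})"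
    (is "?E = cvec.span (osum ` ?I)")
proof
  have fin: "finite ?I"
  proof (rule finite_subset)
    show "?I \<subseteq> orbit ` {b. of_nat (weight b) + 0 = h}"
    proof
      fix X assume X: "X \<in> ?I"
      then show "X \<in> orbit ` {b. of_nat (weight b) + 0 = h}"
        by (intro image_eqI[of _ _ "rep X"]) (auto simp: orbit_rep)
    qed
    show "finite (orbit ` {b :: 3 \<Rightarrow> nat multiset. of_nat (weight b) + 0 = h})"
      by (intro finite_imageI finite_weight_complex)
  qed
  show "?E \<subseteq> cvec.span (osum ` ?I)"
  proof
    fix v assume "v \<in> ?E"
    then have v: "\<And>b c. c \<in> orbit b \<Longrightarrow> Poly_Mapping.lookup v c = Poly_Mapping.lookup v b"
      "\<And>b. b \<in> Poly_Mapping.keys v \<Longrightarrow> of_nat (weight b) = h"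
      unfolding eigenspace_orbifold by auto
    have "v = (\<Sum>X\<in>?I. cscale (Poly_Mapping.lookup v (rep X)) (osum X))"
    proof (rule poly_mapping_eqI)
      fix b
      have "(\<Sum>X\<in>?I. Poly_Mapping.lookup v (rep X) * Poly_Mapping.lookup (osum X) b) =
          (\<Sum>X\<in>?I. if X = orbit b then Poly_Mapping.lookup v b else 0)"
      proof (rule sum.cong[OF refl])
        fix X assume X: "X \<in> ?I"
        then have X': "X \<in> range orbit" by auto
        show "Poly_Mapping.lookup v (rep X) * Poly_Mapping.lookup (osum X) b = (if X = orbit b then Poly_Mapping.lookup v b else 0)"
        proof (cases "b \<in> X")
          case True
          then have bO: "b \<in> orbit (rep X)" using orbit_rep[OF X'] by simp
          have "Poly_Mapping.lookup v b = Poly_Mapping.lookup v (rep X)" by (rule v(1)[OF bO])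
          moreover have "X = orbit b" using orbit_eq[OF bO] orbit_rep[OF X'] by simp
          ultimately show ?thesis using True lookup_osum[OF X', of b] by simp
        next
          case False
          then have "X \<noteq> orbit b" using orbit_refl by blast
          then show ?thesis using False by (simp add: lookup_osum[OF X'])
        qed
      qed
      also have "\<dots> = (if orbit b \<in> ?I then Poly_Mapping.lookup v b else 0)"
        using fin by (rule sum.delta)
      also have "\<dots> = Poly_Mapping.lookup v b"
      proof (cases "b \<in> Poly_Mapping.keys v")
        case True
        have "weight (rep (orbit b)) = weight b" by (rule weight_orbit) (rule rep_in, simp)
        then show ?thesis using v(2)[OF True] by simp
      qed (simp add: in_keys_iff)
      finally show "Poly_Mapping.lookup v b = Poly_Mapping.lookup (\<Sum>X\<in>?I. cscale (Poly_Mapping.lookup v (rep X)) (osum X)) b"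
        by (simp only: lookup_sum lookup_cscale)
    qed
    also have "\<dots> \<in> cvec.span (osum ` ?I)"
      by (intro cvec.span_sum cvec.span_scale cvec.span_base imageI)
    finally show "v \<in> cvec.span (osum ` ?I)" .
  qed
  have "cvec.subspace ?E"
    unfolding eigenspace_orbifold
  proof (rule cvec.subspaceI)
    let ?A = "{v :: 3 fock. (\<forall>b. \<forall>c\<in>orbit b. Poly_Mapping.lookup v c = Poly_Mapping.lookup v b) \<and> (\<forall>b\<in>Poly_Mapping.keys v. of_nat (weight b) = h)}"
    show "0 \<in> ?A" by simp
    fix x assume x: "x \<in> ?A"
    show "cscale c x \<in> ?A" for c using x by (auto simp: in_keys_iff)
    fix y assume y: "y \<in> ?A"
    have K: "b \<in> Poly_Mapping.keys x \<or> b \<in> Poly_Mapping.keys y" if "b \<in> Poly_Mapping.keys (x + y)" for b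
      using that by (auto simp: in_keys_iff lookup_add)
    show "x + y \<in> ?A"
    proof (intro CollectI conjI allI ballI)
      fix b c :: "3 \<Rightarrow> nat multiset" assume "c \<in> orbit b"
      then show "Poly_Mapping.lookup (x + y) c = Poly_Mapping.lookup (x + y) b" using x y by (simp add: lookup_add)
    next
      fix b assume "b \<in> Poly_Mapping.keys (x + y)"
      then show "of_nat (weight b) = h" using K[of b] x y by blast
    qed
  qed
  moreover have "osum ` ?I \<subseteq> ?E"
  proof (rule image_subsetI)
    fix X assume X: "X \<in> ?I"
    then have X': "X \<in> range orbit" by auto
    show "osum X \<in> ?E"
      unfolding eigenspace_orbifold
    proof (intro CollectI conjI allI ballI)
      fix b c :: "3 \<Rightarrow> nat multiset" assume "c \<in> orbit b"
      then have "c \<in> X \<longleftrightarrow> b \<in> X" using orbit_eq orbit_rep[OF X'] orbit_refl by metis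
      then show "Poly_Mapping.lookup (osum X) c = Poly_Mapping.lookup (osum X) b" by (simp add: lookup_osum[OF X'])
    next
      fix b assume "b \<in> Poly_Mapping.keys (osum X)"
      then have "b \<in> orbit (rep X)" by (simp add: in_keys_iff lookup_osum[OF X'] orbit_rep[OF X'] split: if_splits)
      then have "weight b = weight (rep X)" by (rule weight_orbit)
      then show "of_nat (weight b) = h" using X by simp
    qed
  qed
  ultimately show "cvec.span (osum ` ?I) \<subseteq> ?E" by (rule cvec.span_minimal[rotated])
qed

text \<open>These are the graded traces of the nontrivial permutations: a basis vector fixed by a
  transposition is a pair of partitions, one of them counted twice, and one fixed by a 3-cycle is a
  single partition counted three times.\<close>

lemma diagonal_has_sum:
  assumes q: "norm q < 1"
  shows "((\<lambda>b :: 3 \<Rightarrow> nat multiset. of_bool (b 1 = b 2) * q ^ weight b) has_sum (pgf (q\<^sup>2) * pgf q)) UNIV"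
    "((\<lambda>b :: 3 \<Rightarrow> nat multiset. of_bool (b 2 = b 3) * q ^ weight b) has_sum (pgf (q\<^sup>2) * pgf q)) UNIV"
    "((\<lambda>b :: 3 \<Rightarrow> nat multiset. of_bool (b 1 = b 3) * q ^ weight b) has_sum (pgf (q\<^sup>2) * pgf q)) UNIV"
    "((\<lambda>b :: 3 \<Rightarrow> nat multiset. of_bool (b 1 = b 2 \<and> b 2 = b 3) * q ^ weight b) has_sum pgf (q ^ 3)) UNIV"
proof -
  have q2: "norm (q\<^sup>2) < 1" using norm_power_less_1[OF q, of 1] by (simp add: power2_eq_square)
  have q3: "norm (q ^ 3) < 1" using norm_power_less_1[OF q, of 2] by (simp add: eval_nat_numeral)
  note P = has_sum_Times_mult(2)[OF abs_summable_msize[OF q2] pgf_has_sum[OF q2] abs_summable_msize[OF q] pgf_has_sum[OF q]]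
  have A: "((\<lambda>b. of_bool (C b) * q ^ weight b) has_sum (pgf (q\<^sup>2) * pgf q)) UNIV"
    if bij: "bij_betw f (UNIV \<times> UNIV) {b. C b}" and w: "\<And>x z. weight (f (x, z)) = 2 * msize x + msize z"
    for C and f :: "nat multiset \<times> nat multiset \<Rightarrow> 3 \<Rightarrow> nat multiset"
  proof -
    have "(\<lambda>(x, y). (q\<^sup>2) ^ msize x * q ^ msize y) = (\<lambda>p. q ^ weight (f p))"
      by (auto simp: fun_eq_iff w power_add power_mult)
    then have "((\<lambda>p. q ^ weight (f p)) has_sum (pgf (q\<^sup>2) * pgf q)) (UNIV \<times> UNIV)" using P by simp
    then have "((\<lambda>b. q ^ weight b) has_sum (pgf (q\<^sup>2) * pgf q)) {b. C b}"
      using has_sum_reindex_bij_betw[OF bij, of "\<lambda>b. q ^ weight b"] by simp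
    then show ?thesis
      by (rule has_sum_cong_neutral[THEN iffD1, rotated -1]) auto
  qed
  show "((\<lambda>b :: 3 \<Rightarrow> nat multiset. of_bool (b 1 = b 2) * q ^ weight b) has_sum (pgf (q\<^sup>2) * pgf q)) UNIV"
  proof (rule A)
    show "bij_betw (\<lambda>(x, z). tri (x, x, z)) (UNIV \<times> UNIV) {b :: 3 \<Rightarrow> nat multiset. b 1 = b 2}"
      by (rule bij_betwI[where g = "\<lambda>b. (b 1, b 3)"]) (auto simp: tri_simps, metis tri_eta)
  qed (simp add: weight_tri)
  show "((\<lambda>b :: 3 \<Rightarrow> nat multiset. of_bool (b 2 = b 3) * q ^ weight b) has_sum (pgf (q\<^sup>2) * pgf q)) UNIV"
  proof (rule A)
    show "bij_betw (\<lambda>(x, z). tri (z, x, x)) (UNIV \<times> UNIV) {b :: 3 \<Rightarrow> nat multiset. b 2 = b 3}"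
      by (rule bij_betwI[where g = "\<lambda>b. (b 2, b 1)"]) (auto simp: tri_simps, metis tri_eta)
  qed (simp add: weight_tri)
  show "((\<lambda>b :: 3 \<Rightarrow> nat multiset. of_bool (b 1 = b 3) * q ^ weight b) has_sum (pgf (q\<^sup>2) * pgf q)) UNIV"
  proof (rule A)
    show "bij_betw (\<lambda>(x, z). tri (x, z, x)) (UNIV \<times> UNIV) {b :: 3 \<Rightarrow> nat multiset. b 1 = b 3}"
      by (rule bij_betwI[where g = "\<lambda>b. (b 1, b 2)"]) (auto simp: tri_simps, metis tri_eta)
  qed (simp add: weight_tri)
  have bij: "bij_betw (\<lambda>x. tri (x, x, x)) UNIV {b :: 3 \<Rightarrow> nat multiset. b 1 = b 2 \<and> b 2 = b 3}"
    by (rule bij_betwI[where g = "\<lambda>b. b 1"]) (auto simp: tri_simps, metis tri_eta)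
  have "(q ^ 3) ^ msize x = q ^ weight (tri (x, x, x))" for x
  proof -
    have "weight (tri (x, x, x)) = 3 * msize x" by (simp add: weight_tri)
    then show ?thesis by (simp only: power_mult)
  qed
  then have "((\<lambda>x. q ^ weight (tri (x, x, x))) has_sum pgf (q ^ 3)) UNIV" using pgf_has_sum[OF q3] by simp
  then have "((\<lambda>b. q ^ weight b) has_sum pgf (q ^ 3)) {b :: 3 \<Rightarrow> nat multiset. b 1 = b 2 \<and> b 2 = b 3}"
    using has_sum_reindex_bij_betw[OF bij, of "\<lambda>b. q ^ weight b"] by simp
  then show "((\<lambda>b :: 3 \<Rightarrow> nat multiset. of_bool (b 1 = b 2 \<and> b 2 = b 3) * q ^ weight b) has_sum pgf (q ^ 3)) UNIV"
    by (rule has_sum_cong_neutral[THEN iffD1, rotated -1]) auto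
qed

text \<open>Burnside's lemma, weighted by \<open>q ^ weight\<close>.\<close>

lemma orbit_has_sum:
  assumes q: "norm q < 1"
  shows "((\<lambda>X. q ^ weight (rep X)) has_sum ((pgf q ^ 3 + 3 * (pgf (q\<^sup>2) * pgf q) + 2 * pgf (q ^ 3)) / 6))
    (range (orbit :: _ \<Rightarrow> (3 \<Rightarrow> nat multiset) set))"
proof -
  let ?S = "(pgf q ^ 3 + 3 * (pgf (q\<^sup>2) * pgf q) + 2 * pgf (q ^ 3)) / 6"
  \<comment> \<open>\<open>stab b / 6\<close> is the reciprocal of the orbit length, so the terms of
    one orbit add up to a single power of q.\<close>
  let ?F = "\<lambda>b :: 3 \<Rightarrow> nat multiset. of_nat (stab b) / 6 * q ^ weight b"
  note h = weight_has_sum(2)[OF q] diagonal_has_sum[OF q]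
  have e: "1/6 * ((((A + D) + D) + D) + 2 * T) = (A + 3 * D + 2 * T) / 6" for A D T :: complex
    by (simp add: field_simps)
  have fe: "1/6 * (((q ^ weight b + of_bool (b 1 = b 2) * q ^ weight b) + of_bool (b 2 = b 3) * q ^ weight b) +
      of_bool (b 1 = b 3) * q ^ weight b + 2 * (of_bool (b 1 = b 2 \<and> b 2 = b 3) * q ^ weight b)) = ?F b" for b
  proof -
    have "1/6 * (((u + A * u) + B * u) + C * u + 2 * (D * u)) = (1 + A + B + C + 2 * D) / 6 * u" for A B C D u :: complex
      by (simp add: field_simps)
    moreover have "(of_nat (stab b) :: complex) = 1 + of_bool (b 1 = b 2) + of_bool (b 2 = b 3) + of_bool (b 1 = b 3) + 2 * of_bool (b 1 = b 2 \<and> b 2 = b 3)"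
      unfolding stab_def by (simp only: of_nat_add of_nat_mult of_nat_1 of_nat_numeral of_nat_of_bool)
    ultimately show ?thesis by (simp only:)
  qed
  have F: "(?F has_sum ?S) UNIV"
    using has_sum_cmult_right[OF has_sum_add[OF has_sum_add[OF has_sum_add[OF has_sum_add[OF h(1) h(2)] h(3)] h(4)]
        has_sum_cmult_right[OF h(5), of 2]], of "1/6"]
    by (simp only: e fe)
  have bij: "bij_betw (\<lambda>b. (orbit b, b)) UNIV (SIGMA X:range (orbit :: (3 \<Rightarrow> nat multiset) \<Rightarrow> _). X)"
  proof (rule bij_betwI[where g = snd])
    show "(\<lambda>b. (orbit b, b)) \<in> UNIV \<rightarrow> (SIGMA X:range orbit. X)" by (auto simp: orbit_refl)
    show "(orbit (snd p), snd p) = p" if "p \<in> (SIGMA X:range orbit. X)" for p :: "(3 \<Rightarrow> nat multiset) set \<times> (3 \<Rightarrow> nat multiset)"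
    proof -
      obtain b0 b where "p = (orbit b0, b)" "b \<in> orbit b0" using \<open>p \<in> _\<close> by blast
      then show ?thesis using orbit_eq[of b b0] by simp
    qed
  qed auto
  have "((\<lambda>(X, b). ?F b) has_sum ?S) (SIGMA X:range orbit. X)"
    using F has_sum_reindex_bij_betw[OF bij, of "\<lambda>(X, b). ?F b"] by simp
  then show ?thesis
  proof (rule has_sum_SigmaD[where f = "\<lambda>(X, b). ?F b" and B = "\<lambda>X. X" and g = "\<lambda>X. q ^ weight (rep X)"])
    fix X :: "(3 \<Rightarrow> nat multiset) set" assume X: "X \<in> range orbit"
    let ?b = "rep X"
    obtain b0 where b0: "?b = b0" "X = orbit b0" using orbit_rep[OF X] by blast
    have fin: "finite X" unfolding b0(2) by (rule finite_orbit)
    have "(\<Sum>b\<in>X. ?F b) = (\<Sum>b\<in>X. ?F b0)"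
    proof (rule sum.cong[OF refl])
      fix b assume "b \<in> X"
      then have b: "b \<in> orbit b0" by (simp only: b0(2))
      show "?F b = ?F b0" by (simp only: stab_orbit[OF b] weight_orbit[OF b])
    qed
    also have "\<dots> = of_nat (card X * stab b0) / 6 * q ^ weight b0" by simp
    also have "card X * stab b0 = 6" unfolding b0(2) by (rule card_orbit)
    finally have "(\<Sum>b\<in>X. ?F b) = q ^ weight (rep X)" unfolding b0(1) by simp
    then show "((\<lambda>b. (\<lambda>(X, b). ?F b) (X, b)) has_sum q ^ weight (rep X)) X"
      using has_sum_finite[OF fin, of ?F] by (simp only: split_conv)
  qed
qed

lemma orbifold_character:
  assumes \<tau>: "Im \<tau> > 0"
  defines "q \<equiv> exp (2 * of_real pi * \<i> * \<tau>)"
  shows "char_converges H3S3 (adjoint_module H3S3) \<tau>"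
    "ch H3S3 (adjoint_module H3S3) \<tau> =
      exp (- 2 * of_real pi * \<i> * \<tau> / 8) * ((pgf q ^ 3 + 3 * (pgf (q\<^sup>2) * pgf q) + 2 * pgf (q ^ 3)) / 6)"
proof -
  let ?S = "(pgf q ^ 3 + 3 * (pgf (q\<^sup>2) * pgf q) + 2 * pgf (q ^ 3)) / 6"
  let ?I = "\<lambda>h. {X \<in> range (orbit :: _ \<Rightarrow> (3 \<Rightarrow> nat multiset) set). of_nat (weight (rep X)) = (h :: complex)}"
  have q: "norm q < 1" unfolding q_def using \<tau> by (rule nome_less_1)
  have fin: "finite (?I h)" for h
  proof (rule finite_subset)
    show "?I h \<subseteq> orbit ` {b. of_nat (weight b) + 0 = h}"
    proof
      fix X assume X: "X \<in> ?I h"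
      then show "X \<in> orbit ` {b. of_nat (weight b) + 0 = h}"
        by (intro image_eqI[of _ _ "rep X"]) (auto simp: orbit_rep)
    qed
    show "finite (orbit ` {b :: 3 \<Rightarrow> nat multiset. of_nat (weight b) + 0 = h})"
      by (intro finite_imageI finite_weight_complex)
  qed
  have d: "cvec.dim (eigenspace H3S3 (adjoint_module H3S3) h) = card (?I h)" for h
  proof (rule dim_eq_card_probe[OF fin _ eigenspace_orbifold_span, where p = rep])
    fix X Y assume X: "X \<in> ?I h" and Y: "Y \<in> ?I h"
    then have X': "X \<in> range orbit" and Y': "Y \<in> range orbit" by auto
    have "rep Y \<in> X \<longleftrightarrow> X = Y"
      using orbit_eq orbit_rep[OF X'] orbit_rep[OF Y'] rep_in[OF Y'] by metis
    then show "Poly_Mapping.lookup (osum X) (rep Y) = (if X = Y then 1 else 0)" by (simp add: lookup_osum[OF X'])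
  qed
  have e: "exp (2 * of_real pi * \<i> * \<tau> * (of_nat (weight (rep X)) - central_charge H3S3 / 24)) =
      exp (- 2 * of_real pi * \<i> * \<tau> / 8) * q ^ weight (rep X)" for X :: "(3 \<Rightarrow> nat multiset) set"
    unfolding q_def exp_of_nat_mult[symmetric] exp_add[symmetric]
    by (simp add: H3S3_simps algebra_simps)
  have hs: "((\<lambda>X. exp (2 * of_real pi * \<i> * \<tau> * (of_nat (weight (rep X)) - central_charge H3S3 / 24)))
      has_sum exp (- 2 * of_real pi * \<i> * \<tau> / 8) * ?S) (range (orbit :: _ \<Rightarrow> (3 \<Rightarrow> nat multiset) set))"
    unfolding e by (rule has_sum_cmult_right[OF orbit_has_sum[OF q]])
  show "char_converges H3S3 (adjoint_module H3S3) \<tau>"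
    by (rule char_has_sum(1)[OF d fin hs])
  show "ch H3S3 (adjoint_module H3S3) \<tau> = exp (- 2 * of_real pi * \<i> * \<tau> / 8) * ?S"
    by (rule char_has_sum(2)[OF d fin hs])
qed

section \<open>Partial fractions of the hyperbolic cotangent\<close>

text \<open>Euler's sine product at an imaginary argument, in logarithmic form.\<close>

lemma sinh_log_product:
  fixes x :: real assumes x: "x > 0"
  shows "(\<lambda>k. ln (1 + x\<^sup>2 / (real (Suc k))\<^sup>2)) sums ln (sinh (pi * x) / (pi * x))"
proof -
  define z where "z = \<i> * of_real x"
  have z0: "z \<noteq> 0" using x by (simp add: z_def)
  have z2: "z\<^sup>2 = - (of_real x)\<^sup>2" by (simp add: z_def power_mult_distrib)
  have sin: "sin (of_real pi * z) = \<i> * of_real (sinh (pi * x))"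
  proof -
    have "sin (\<i> * of_real (pi * x)) = \<i> * sinh (of_real (pi * x))" by (simp add: sinh_conv_sin del: of_real_mult)
    moreover have "sinh (of_real (pi * x) :: complex) = of_real (sinh (pi * x))"
      by (simp add: sinh_def exp_of_real scaleR_conv_of_real del: of_real_mult flip: of_real_minus)
    ultimately show ?thesis by (simp add: z_def mult_ac)
  qed
  have "(\<lambda>n. of_real pi * z * (\<Prod>k=1..n. 1 - z^2 / of_nat k^2)) \<longlonglongrightarrow> sin (of_real pi * z)"
    by (rule sin_product_formula_complex)
  then have "(\<lambda>n. (of_real pi * z * (\<Prod>k=1..n. 1 - z^2 / of_nat k^2)) / (of_real pi * z)) \<longlonglongrightarrow> sin (of_real pi * z) / (of_real pi * z)"
    by (intro tendsto_divide tendsto_const) (use z0 in auto)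
  moreover have "(of_real pi * z * (\<Prod>k=1..n. 1 - z^2 / of_nat k^2)) / (of_real pi * z) =
      of_real (\<Prod>k<n. 1 + x\<^sup>2 / (real (Suc k))\<^sup>2)" for n
  proof -
    have "(\<Prod>k=1..n. 1 - z^2 / of_nat k^2) = (\<Prod>k<n. 1 - z^2 / of_nat (Suc k)^2)"
      by (rule prod.reindex_bij_witness[of _ Suc "\<lambda>k. k - 1"]) auto
    also have "\<dots> = (\<Prod>k<n. of_real (1 + x\<^sup>2 / (real (Suc k))\<^sup>2))"
      by (intro prod.cong refl) (simp add: z2)
    finally show ?thesis using z0 by simp
  qed
  moreover have "sin (of_real pi * z) / (of_real pi * z) = of_real (sinh (pi * x) / (pi * x))"
    unfolding sin by (simp add: z_def)
  ultimately have "(\<lambda>n. of_real (\<Prod>k<n. 1 + x\<^sup>2 / (real (Suc k))\<^sup>2) :: complex) \<longlonglongrightarrow> of_real (sinh (pi * x) / (pi * x))"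
    by (simp only:)
  then have "(\<lambda>n. \<Prod>k<n. 1 + x\<^sup>2 / (real (Suc k))\<^sup>2) \<longlonglongrightarrow> sinh (pi * x) / (pi * x)"
    by (simp only: tendsto_of_real_iff)
  then have "(\<lambda>n. ln (\<Prod>k<n. 1 + x\<^sup>2 / (real (Suc k))\<^sup>2)) \<longlonglongrightarrow> ln (sinh (pi * x) / (pi * x))"
    by (rule tendsto_ln) (use x in auto)
  moreover have "ln (\<Prod>k<n. 1 + x\<^sup>2 / (real (Suc k))\<^sup>2) = (\<Sum>k<n. ln (1 + x\<^sup>2 / (real (Suc k))\<^sup>2))" for n
  proof (rule ln_prod)
    have "1 + x\<^sup>2 / (real (Suc k))\<^sup>2 > 0" for k by (intro add_pos_nonneg) auto
    then show "1 + x\<^sup>2 / (real (Suc k))\<^sup>2 \<noteq> 0" for k by (metis less_irrefl)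
  qed simp
  ultimately show ?thesis by (simp only: sums_def)
qed

text \<open>The logarithmic derivative of the product for sinh; the differentiated series converges
  uniformly by comparison with the inverse squares.\<close>

lemma coth_pfd:
  fixes x :: real assumes x: "x > 0"
  shows "(\<lambda>k. 2 * x / ((real (Suc k))\<^sup>2 + x\<^sup>2)) sums (pi * cosh (pi * x) / sinh (pi * x) - 1 / x)"
proof -
  let ?f = "\<lambda>k x. ln (1 + x\<^sup>2 / (real (Suc k))\<^sup>2)"
  let ?f' = "\<lambda>k x. 2 * x / ((real (Suc k))\<^sup>2 + x\<^sup>2)"
  \<comment> \<open>A compact interval that contains 0, where the series of logarithms converges
    trivially, and has x in its interior.\<close>
  let ?S = "{0..2 * x}"
  have ps: "(real (Suc k))\<^sup>2 + t\<^sup>2 > 0" "1 + t\<^sup>2 / (real (Suc k))\<^sup>2 > 0" for k t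
    by (auto intro!: add_pos_nonneg)
  have d: "(?f k has_field_derivative ?f' k t) (at t within ?S)" for k t
  proof -
    have "((\<lambda>t. 1 + A * t\<^sup>2) has_field_derivative A * (2 * t)) (at t within ?S)" for A
      by (auto intro!: derivative_eq_intros)
    from this[of "1 / (real (Suc k))\<^sup>2"]
    have "((\<lambda>t. 1 + t\<^sup>2 / (real (Suc k))\<^sup>2) has_field_derivative 2 * t / (real (Suc k))\<^sup>2) (at t within ?S)"
      by (simp del: of_nat_Suc)
    from DERIV_chain2[OF DERIV_ln_divide[OF ps(2)] this]
    have "(?f k has_field_derivative 1 / (1 + t\<^sup>2 / (real (Suc k))\<^sup>2) * (2 * t / (real (Suc k))\<^sup>2)) (at t within ?S)" .
    moreover have "1 / (1 + t\<^sup>2 / (real (Suc k))\<^sup>2) * (2 * t / (real (Suc k))\<^sup>2) = ?f' k t"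
    proof -
      have "(real (Suc k))\<^sup>2 \<noteq> 0" by simp
      then show ?thesis using ps[where t = t and k = k] by (simp add: divide_simps del: of_nat_Suc)
    qed
    ultimately show ?thesis by (simp only:)
  qed
  have u: "uniformly_convergent_on ?S (\<lambda>n t. \<Sum>k<n. ?f' k t)"
  proof (rule Weierstrass_m_test')
    fix k t assume "t \<in> ?S"
    then have t: "0 \<le> t" "t \<le> 2 * x" by auto
    have "norm (?f' k t) = 2 * t / ((real (Suc k))\<^sup>2 + t\<^sup>2)" using t ps(1)[of k t] by simp
    also have "\<dots> \<le> 2 * (2 * x) / (real (Suc k))\<^sup>2"
      by (rule frac_le) (use t in auto)
    finally show "norm (?f' k t) \<le> 2 * (2 * x) * (1 / (real (Suc k))\<^sup>2)" by simp
  next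
    have "summable (\<lambda>k. 1 / (real (Suc k))\<^sup>2)"
      using sums_summable[OF inverse_squares_sums] by (simp add: add.commute)
    then show "summable (\<lambda>k. 2 * (2 * x) * (1 / (real (Suc k))\<^sup>2))" by (rule summable_mult)
  qed
  have x0: "0 \<in> ?S" "summable (\<lambda>k. ?f k 0)" "x \<in> interior ?S" using x by auto
  have "((\<lambda>t. suminf (\<lambda>k. ?f k t)) has_field_derivative suminf (\<lambda>k. ?f' k x)) (at x)"
    using has_field_derivative_series'(2)[OF convex_real_interval(5) d u x0] .
  moreover have "((\<lambda>t. ln (sinh (pi * t) / (pi * t))) has_field_derivative (pi * cosh (pi * x) / sinh (pi * x) - 1 / x)) (at x)"
  proof -
    have s: "sinh (pi * x) > 0" using x by simp
    have "((\<lambda>t. ln (sinh (pi * t)) - ln (pi * t)) has_field_derivative (pi * cosh (pi * x) / sinh (pi * x) - 1 / x)) (at x)"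
      using s x by (auto intro!: derivative_eq_intros simp: field_simps)
    moreover have "\<forall>\<^sub>F t in nhds x. ln (sinh (pi * t)) - ln (pi * t) = ln (sinh (pi * t) / (pi * t))"
      using eventually_nhds_in_open[of "{0<..}" x] x
      by (auto elim!: eventually_mono simp: ln_div)
    ultimately show ?thesis by (subst (asm) DERIV_cong_ev[OF refl _ refl]) auto
  qed
  moreover have "\<forall>\<^sub>F t in nhds x. ln (sinh (pi * t) / (pi * t)) = suminf (\<lambda>k. ?f k t)"
    using eventually_nhds_in_open[of "{0<..}" x] x
    by (auto elim!: eventually_mono dest!: sinh_log_product simp: sums_iff)
  ultimately have "suminf (\<lambda>k. ?f' k x) = pi * cosh (pi * x) / sinh (pi * x) - 1 / x"
    using DERIV_cong_ev[OF refl _ refl, of "\<lambda>t. ln (sinh (pi * t) / (pi * t))" "\<lambda>t. suminf (\<lambda>k. ?f k t)" x]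
      DERIV_unique by blast
  moreover have "summable (\<lambda>k. ?f' k x)"
  proof -
    have "convergent (\<lambda>n. \<Sum>k<n. ?f' k x)"
      using u by (rule uniformly_convergent_imp_convergent) (use x in auto)
    then show ?thesis by (simp add: summable_iff_convergent)
  qed
  ultimately show ?thesis by (simp add: sums_iff)
qed

text \<open>Follows from coth(pi x) = 2 / (exp(2 pi x) - 1) + 1. The Bose factor on the right is the
  one occurring in the logarithm of \<open>pgf\<close>.\<close>

lemma bose_pfd:
  fixes x :: real assumes x: "x > 0"
  shows "(\<lambda>n. (x / pi) / (x\<^sup>2 + (real (Suc n))\<^sup>2)) sums (1 / (exp (2 * pi * x) - 1) + 1 / 2 - 1 / (2 * pi * x))"
proof -
  have "(\<lambda>k. (1 / (2 * pi)) * (2 * x / ((real (Suc k))\<^sup>2 + x\<^sup>2))) sums ((1 / (2 * pi)) * (pi * cosh (pi * x) / sinh (pi * x) - 1 / x))"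
    by (rule sums_mult[OF coth_pfd[OF x]])
  moreover have "(1 / (2 * pi)) * (pi * cosh (pi * x) / sinh (pi * x) - 1 / x) = 1 / (exp (2 * pi * x) - 1) + 1 / 2 - 1 / (2 * pi * x)"
  proof -
    define E where "E = exp (pi * x)"
    have E: "E > 1" using x by (simp add: E_def)
    have e2: "exp (2 * pi * x) = E * E" by (simp add: E_def flip: exp_add)
    have ch: "cosh (pi * x) = (E + 1 / E) / 2" "sinh (pi * x) = (E - 1 / E) / 2"
      by (simp_all add: cosh_def sinh_def E_def exp_minus inverse_eq_divide)
    have EE: "E * E > 1" using E by (metis less_1_mult)
    have "cosh (pi * x) / sinh (pi * x) = (E * E + 1) / (E * E - 1)"
      unfolding ch using E EE by (simp add: field_simps)
    also have "\<dots> = 2 / (E * E - 1) + 1" using EE by (simp add: field_simps)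
    finally have c: "cosh (pi * x) / sinh (pi * x) = 2 / (E * E - 1) + 1" .
    have "(1 / (2 * pi)) * (pi * cosh (pi * x) / sinh (pi * x) - 1 / x) = (1/2) * (cosh (pi * x) / sinh (pi * x)) - 1 / (2 * pi * x)"
      using x by (simp add: field_simps)
    then show ?thesis unfolding c e2 by simp
  qed
  moreover have "(1 / (2 * pi)) * (2 * x / ((real (Suc k))\<^sup>2 + x\<^sup>2)) = (x / pi) / (x\<^sup>2 + (real (Suc k))\<^sup>2)" for k
    by (simp add: add.commute)
  ultimately show ?thesis by (simp only:)
qed

section \<open>The lattice sum behind the logarithm of eta\<close>

text \<open>Chosen so that summation over n gives the k-th term of ln \<open>pgf\<close> at exp(-2
  pi y), up to elementary corrections, while exchanging k and n amounts to replacing y by 1/y. As a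
  double series it diverges like the harmonic series, so only truncated squares and their tails can
  be compared.\<close>

definition latt :: "real \<Rightarrow> nat \<Rightarrow> nat \<Rightarrow> real" where
  "latt y k n = (y / pi) / ((real (Suc k))\<^sup>2 * y\<^sup>2 + (real (Suc n))\<^sup>2)"

lemma latt_swap: "y > 0 \<Longrightarrow> latt (1 / y) n k = latt y k n"
proof -
  assume y: "y > 0"
  have "(real (Suc n))\<^sup>2 * (1 / y)\<^sup>2 + (real (Suc k))\<^sup>2 = ((real (Suc k))\<^sup>2 * y\<^sup>2 + (real (Suc n))\<^sup>2) / y\<^sup>2"
    using y by (simp add: field_simps power2_eq_square del: of_nat_Suc)
  then show ?thesis using y unfolding latt_def by (simp add: power2_eq_square del: of_nat_Suc)
qed

lemma latt_row_sums:
  assumes y: "y > 0"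
  shows "latt y k sums (1 / (real (Suc k) * (exp (2 * pi * y * real (Suc k)) - 1)) + 1 / (2 * real (Suc k)) - 1 / (2 * pi * y * (real (Suc k))\<^sup>2))"
proof -
  have p: "real (Suc k) > 0" by simp
  then have x: "real (Suc k) * y > 0" using y by (rule mult_pos_pos)
  have "(\<lambda>n. (1 / real (Suc k)) * ((real (Suc k) * y / pi) / ((real (Suc k) * y)\<^sup>2 + (real (Suc n))\<^sup>2))) sums
     ((1 / real (Suc k)) * (1 / (exp (2 * pi * (real (Suc k) * y)) - 1) + 1 / 2 - 1 / (2 * pi * (real (Suc k) * y))))"
    by (rule sums_mult[OF bose_pfd[OF x]])
  moreover have "(1 / real (Suc k)) * ((real (Suc k) * y / pi) / ((real (Suc k) * y)\<^sup>2 + (real (Suc n))\<^sup>2)) = latt y k n" for n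
    using p by (simp add: latt_def power_mult_distrib del: of_nat_Suc)
  moreover have "(1 / c) * (1 / E + 1 / 2 - 1 / (2 * pi * y * c)) = 1 / (c * E) + 1 / (2 * c) - 1 / (2 * pi * y * c\<^sup>2)" for c E
    by (simp add: algebra_simps power2_eq_square)
  moreover have "2 * pi * (real (Suc k) * y) = 2 * pi * y * real (Suc k)" by simp
  ultimately show ?thesis by (simp only:)
qed

text \<open>A decreasing summand is compared with its integral, whose primitive is an arctangent.
  The two bounds differ by the replacement of K by K + 1.\<close>

lemma latt_tail_bounds:
  assumes y: "y > 0" and K: "K > 0"
  shows "suminf (\<lambda>n. latt y k (n + K)) \<le> arctan (real (Suc k) * y / real K) / (pi * real (Suc k))"
    "suminf (\<lambda>n. latt y k (n + K)) \<ge> arctan (real (Suc k) * y / real (Suc K)) / (pi * real (Suc k))"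
proof -
  define c where "c = real (Suc k) * y"
  have c: "c > 0" unfolding c_def by (rule mult_pos_pos) (use y in auto)
  define F where "F = (\<lambda>t. arctan (t / c) / (pi * real (Suc k)))"
  define F' where "F' = (\<lambda>t. (y / pi) / (c\<^sup>2 + t\<^sup>2))"
  have d: "(F has_real_derivative F' t) (at t)" for t
  proof -
    have s: "c\<^sup>2 + t\<^sup>2 > 0" using c by (simp add: add_pos_nonneg)
    have "(F has_real_derivative inverse (1 + (t / c)\<^sup>2) * (1 / c) / (pi * real (Suc k))) (at t)"
      unfolding F_def using c by (auto intro!: derivative_eq_intros)
    moreover have "inverse (1 + (t / c)\<^sup>2) * (1 / c) / (pi * real (Suc k)) = F' t"
    proof -
      have "1 + (t / c)\<^sup>2 = (c\<^sup>2 + t\<^sup>2) / c\<^sup>2" using c by (simp add: power_divide add_divide_distrib)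
      moreover have "inverse (X / c\<^sup>2) * (1 / c) = c / X" for X
        using c by (simp add: power2_eq_square)
      ultimately have "inverse (1 + (t / c)\<^sup>2) * (1 / c) = c / (c\<^sup>2 + t\<^sup>2)" by simp
      then show ?thesis unfolding F'_def c_def by (simp del: of_nat_Suc)
    qed
    ultimately show ?thesis by simp
  qed
  have anti: "F' t \<le> F' s" if "0 \<le> s" "s \<le> t" for s t
    unfolding F'_def using that c y
    by (intro divide_left_mono add_left_mono power_mono mult_pos_pos) (auto intro: add_pos_nonneg)
  have latt: "latt y k n = F' (real (Suc n))" for n
    by (simp add: latt_def F'_def c_def power_mult_distrib)
  have up: "latt y k n \<le> F (real (Suc n)) - F (real n)" and lo: "latt y k n \<ge> F (real (Suc (Suc n))) - F (real (Suc n))" for n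
  proof -
    obtain z where z: "real n < z" "z < real (Suc n)" "F (real (Suc n)) - F (real n) = (real (Suc n) - real n) * F' z"
      using MVT2[of "real n" "real (Suc n)" F F'] d by auto
    then show "latt y k n \<le> F (real (Suc n)) - F (real n)" unfolding latt using anti[of z "real (Suc n)"] by simp
    obtain w where w: "real (Suc n) < w" "w < real (Suc (Suc n))" "F (real (Suc (Suc n))) - F (real (Suc n)) = (real (Suc (Suc n)) - real (Suc n)) * F' w"
      using MVT2[of "real (Suc n)" "real (Suc (Suc n))" F F'] d by auto
    then show "latt y k n \<ge> F (real (Suc (Suc n))) - F (real (Suc n))" unfolding latt using anti[of "real (Suc n)" w] by simp
  qed
  have lim: "(\<lambda>n. F (real n)) \<longlonglongrightarrow> (pi / 2) / (pi * real (Suc k))"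
  proof -
    have "filterlim (\<lambda>n. real n / c) at_top sequentially"
      using c by (intro filterlim_tendsto_pos_mult_at_top[of "\<lambda>_. 1 / c" "1 / c", simplified] filterlim_real_sequentially) auto
    then have "(\<lambda>n. arctan (real n / c)) \<longlonglongrightarrow> pi / 2"
      using filterlim_compose[OF tendsto_arctan_at_top] by blast
    then show ?thesis unfolding F_def by (intro tendsto_divide tendsto_const) auto
  qed
  \<comment> \<open>The integral from t to infinity, rewritten by the reflection of the
    arctangent.\<close>
  have at: "(pi / 2) / (pi * real (Suc k)) - F t = arctan (c / t) / (pi * real (Suc k))" if "t > 0" for t
  proof -
    have "arctan (t / c) = pi / 2 - arctan (c / t)"
      using arctan_inverse[of "c / t"] c that by simp
    then show ?thesis unfolding F_def by (simp add: diff_divide_distrib)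
  qed
  have sm: "summable (\<lambda>n. latt y k (n + K))"
    using sums_summable[OF latt_row_sums[OF y, of k]] by (simp only: summable_iff_shift)
  have "(\<lambda>n. F (real (Suc n + K)) - F (real (n + K))) sums ((pi / 2) / (pi * real (Suc k)) - F (real (0 + K)))"
    by (rule telescope_sums[where f = "\<lambda>n. F (real (n + K))"]) (rule LIMSEQ_ignore_initial_segment[OF lim])
  then have s1: "(\<lambda>n. F (real (Suc (n + K))) - F (real (n + K))) sums (arctan (c / real K) / (pi * real (Suc k)))"
    using at[of "real K"] K by simp
  show "suminf (\<lambda>n. latt y k (n + K)) \<le> arctan (real (Suc k) * y / real K) / (pi * real (Suc k))"
    using suminf_le[OF up sm sums_summable[OF s1]] sums_unique[OF s1] by (simp only: c_def)
  have "(\<lambda>n. F (real (Suc n + Suc K)) - F (real (n + Suc K))) sums ((pi / 2) / (pi * real (Suc k)) - F (real (0 + Suc K)))"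
    by (rule telescope_sums[where f = "\<lambda>n. F (real (n + Suc K))"]) (rule LIMSEQ_ignore_initial_segment[OF lim])
  then have s2: "(\<lambda>n. F (real (Suc (Suc (n + K)))) - F (real (Suc (n + K)))) sums (arctan (c / real (Suc K)) / (pi * real (Suc k)))"
    using at[of "real (Suc K)"] by simp
  show "suminf (\<lambda>n. latt y k (n + K)) \<ge> arctan (real (Suc k) * y / real (Suc K)) / (pi * real (Suc k))"
    using suminf_le[OF lo sums_summable[OF s2] sm] sums_unique[OF s2] by (simp only: c_def)
qed

subsection \<open>Riemann sums of \<open>arctan u / u\<close>\<close>

definition arc :: "real \<Rightarrow> real" where
  "arc u = (if u = 0 then 1 else arctan u / u)"

text \<open>Exactly the inequality that makes the derivative of arctan u / u nonpositive.\<close>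

lemma arctan_ge: "u \<ge> 0 \<Longrightarrow> u / (1 + u\<^sup>2) \<le> arctan u"
proof (cases "u = 0")
  case False
  assume "u \<ge> 0"
  then have u: "u > 0" using False by simp
  obtain z where z: "0 < z" "z < u" "arctan u - arctan 0 = (u - 0) * inverse (1 + z\<^sup>2)"
    using MVT2[OF u, of arctan "\<lambda>z. inverse (1 + z\<^sup>2)"] DERIV_arctan by blast
  have "1 + z\<^sup>2 \<le> 1 + u\<^sup>2" using z by (intro add_left_mono power_mono) auto
  then have "inverse (1 + u\<^sup>2) \<le> inverse (1 + z\<^sup>2)" by (intro le_imp_inverse_le) (auto intro: add_pos_nonneg)
  then have "u * inverse (1 + u\<^sup>2) \<le> u * inverse (1 + z\<^sup>2)" using u by (intro mult_left_mono) auto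
  then show ?thesis using z by (simp add: divide_inverse)
qed simp

lemma arc_antimono:
  assumes "0 \<le> u" "u \<le> v" shows "arc v \<le> arc u"
proof -
  have le1: "arctan v \<le> v" if "v > 0" for v
    using that by (simp add: arctan_le_self)
  show ?thesis
  proof (cases "u = 0")
    case True
    then show ?thesis using assms le1[of v] by (auto simp: arc_def)
  next
    case False
    then have u: "u > 0" using assms by simp
    show ?thesis
    proof (cases "u = v")
      case ne: False
      have "\<exists>D. ((\<lambda>u. arctan u / u) has_real_derivative D) (at t) \<and> D \<le> 0" if t: "u \<le> t" "t \<le> v" for t
      proof (intro exI conjI)
        have t0: "t > 0" using t u by simp
        have p: "1 + t\<^sup>2 > 0" by (auto intro: add_pos_nonneg)
        show "((\<lambda>u. arctan u / u) has_real_derivative (inverse (1 + t\<^sup>2) * t - arctan t * 1) / (t * t)) (at t)"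
          by (rule derivative_eq_intros refl)+ (use t0 in auto)
        have "inverse (1 + t\<^sup>2) * t \<le> arctan t" using arctan_ge[of t] t0 by (simp add: divide_inverse mult.commute)
        then show "(inverse (1 + t\<^sup>2) * t - arctan t * 1) / (t * t) \<le> 0" using t0 by (simp add: divide_le_0_iff)
      qed
      then have "arctan v / v \<le> arctan u / u"
        using DERIV_nonpos_imp_nonincreasing[of u v "\<lambda>u. arctan u / u"] assms by blast
      then show ?thesis using u assms by (auto simp: arc_def)
    qed simp
  qed
qed

lemma arc_continuous: "continuous_on A arc"
proof -
  have "isCont arc x" for x
  proof (cases "x = 0")
    case True
    have "((\<lambda>h. (arctan (0 + h) - arctan 0) / h) \<longlongrightarrow> inverse (1 + 0\<^sup>2)) (at 0)"
      using DERIV_arctan[of 0] unfolding DERIV_def .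
    then have "((\<lambda>h. arctan h / h) \<longlongrightarrow> 1) (at 0)" by simp
    then have "(arc \<longlongrightarrow> 1) (at 0)"
      by (rule Lim_transform_eventually) (auto simp: arc_def eventually_at_filter)
    then show ?thesis using True by (simp add: isCont_def arc_def)
  next
    case False
    have "isCont (\<lambda>x. arctan x / x) x" using False by (intro continuous_intros) auto
    moreover have "\<forall>\<^sub>F t in nhds x. arc t = arctan t / t"
      using False t1_space_nhds[of x 0] by (auto elim!: eventually_mono simp: arc_def)
    ultimately show ?thesis by (simp add: isCont_cong)
  qed
  then show ?thesis by (simp add: continuous_at_imp_continuous_on)
qed

text \<open>The inverse tangent integral Ti_2. Only its behaviour under y -> 1/y will matter, not
  its values.\<close>

definition arcint :: "real \<Rightarrow> real" where
  "arcint y = integral {0..y} arc"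

lemma arcint_deriv: "y > 0 \<Longrightarrow> (arcint has_real_derivative arc y) (at y)"
proof -
  assume y: "y > 0"
  have "((\<lambda>x. integral {0..x} arc) has_real_derivative arc y) (at y within {0..y + 1})"
    by (rule integral_has_real_derivative[OF arc_continuous]) (use y in auto)
  moreover have "at y within {0..y + 1} = at y"
    by (rule at_within_interior) (use y in auto)
  ultimately show ?thesis by (simp add: arcint_def [abs_def])
qed

lemma arcint_increment:
  assumes "0 \<le> u" "u \<le> v"
  shows "arc v * (v - u) \<le> arcint v - arcint u" "arcint v - arcint u \<le> arc u * (v - u)"
proof -
  have int: "arc integrable_on {a..b}" for a b by (rule integrable_continuous_real[OF arc_continuous])
  have "integral {0..u} arc + integral {u..v} arc = integral {0..v} arc"
    by (rule Henstock_Kurzweil_Integration.integral_combine[OF assms int])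
  then have e: "arcint v - arcint u = integral {u..v} arc" by (simp add: arcint_def)
  have "integral {u..v} (\<lambda>_. arc v) \<le> integral {u..v} arc"
    by (rule integral_le) (use int arc_antimono assms in auto)
  then show "arc v * (v - u) \<le> arcint v - arcint u" using assms by (simp add: e mult.commute)
  have "integral {u..v} arc \<le> integral {u..v} (\<lambda>_. arc u)"
    by (rule integral_le) (use int arc_antimono assms in auto)
  then show "arcint v - arcint u \<le> arc u * (v - u)" using assms by (simp add: e mult.commute)
qed

text \<open>The right-endpoint Riemann sum of \<open>arc\<close> over [0, y] with mesh y / K; the
  mesh cancels against the denominator of \<open>arc\<close>.\<close>

definition riem :: "real \<Rightarrow> nat \<Rightarrow> real" where
  "riem y K = (\<Sum>k<K. arctan (real (Suc k) * y / real K) / real (Suc k))"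

text \<open>As \<open>arc\<close> decreases from 1 and stays nonnegative, the left and right sums
  enclose the integral and differ by at most the mesh.\<close>

lemma riem_LIMSEQ:
  assumes y: "y > 0" shows "riem y \<longlonglongrightarrow> arcint y"
proof -
  have b: "arcint y - y / real K \<le> riem y K \<and> riem y K \<le> arcint y" if K: "K > 0" for K
  proof -
    define \<delta> where "\<delta> = y / real K"
    have \<delta>: "\<delta> > 0" using y K by (simp add: \<delta>_def)
    define u where "u = (\<lambda>k. real k * \<delta>)"
    have r: "riem y K = (\<Sum>k<K. arc (u (Suc k)) * \<delta>)"
      unfolding riem_def
    proof (rule sum.cong[OF refl])
      fix k
      have "u (Suc k) \<noteq> 0" using \<delta> by (simp add: u_def)
      then have "arc (u (Suc k)) * \<delta> = arctan (u (Suc k)) / (real (Suc k) * \<delta>) * \<delta>" by (simp add: arc_def u_def)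
      also have "\<dots> = arctan (u (Suc k)) / real (Suc k)" using \<delta> by simp
      finally have "arctan (u (Suc k)) / real (Suc k) = arc (u (Suc k)) * \<delta>" by (rule sym)
      moreover have "u (Suc k) = real (Suc k) * y / real K" by (simp add: u_def \<delta>_def)
      ultimately show "arctan (real (Suc k) * y / real K) / real (Suc k) = arc (u (Suc k)) * \<delta>" by (simp only:)
    qed
    have tel: "(\<Sum>k<K. arcint (u (Suc k)) - arcint (u k)) = arcint y"
    proof -
      have "(\<Sum>k<K. arcint (u (Suc k)) - arcint (u k)) = arcint (u K) - arcint (u 0)" by (rule sum_lessThan_telescope)
      then show ?thesis using K by (simp add: u_def \<delta>_def arcint_def)
    qed
    have st: "u (Suc k) - u k = \<delta>" "0 \<le> u k" "u k \<le> u (Suc k)" for k using \<delta> by (auto simp: u_def algebra_simps)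
    have "riem y K \<le> (\<Sum>k<K. arcint (u (Suc k)) - arcint (u k))"
      unfolding r by (intro sum_mono) (use arcint_increment(1)[OF st(2,3)] st(1) in simp)
    moreover have "(\<Sum>k<K. arcint (u (Suc k)) - arcint (u k)) \<le> (\<Sum>k<K. arc (u k) * \<delta>)"
      by (intro sum_mono) (use arcint_increment(2)[OF st(2,3)] st(1) in simp)
    moreover have "(\<Sum>k<K. arc (u k) * \<delta>) = riem y K + (arc (u 0) - arc (u K)) * \<delta>"
    proof -
      have "(\<Sum>k<K. arc (u (Suc k)) - arc (u k)) = arc (u K) - arc (u 0)" by (rule sum_lessThan_telescope)
      then have "(\<Sum>k<K. arc (u (Suc k)) * \<delta> - arc (u k) * \<delta>) = (arc (u K) - arc (u 0)) * \<delta>"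
        by (simp flip: left_diff_distrib sum_distrib_right)
      then show ?thesis unfolding r by (simp add: sum_subtractf algebra_simps)
    qed
    moreover have "(arc (u 0) - arc (u K)) * \<delta> \<le> 1 * \<delta>"
    proof (rule mult_right_mono)
      have "arc (u K) \<ge> 0" using \<delta> K by (simp add: u_def arc_def zero_le_arctan_iff)
      then show "arc (u 0) - arc (u K) \<le> 1" by (simp add: u_def arc_def)
    qed (use \<delta> in simp)
    ultimately show ?thesis unfolding tel by (simp add: \<delta>_def)
  qed
  show ?thesis
  proof (rule tendsto_sandwich)
    have "(\<lambda>K. y / real K) \<longlonglongrightarrow> 0" by (rule lim_const_over_n)
    then show "(\<lambda>K. arcint y - y / real K) \<longlonglongrightarrow> arcint y"
      using tendsto_diff[OF tendsto_const] by fastforce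
    show "(\<lambda>K. arcint y) \<longlonglongrightarrow> arcint y" by simp
    show "\<forall>\<^sub>F K in sequentially. arcint y - y / real K \<le> riem y K" "\<forall>\<^sub>F K in sequentially. riem y K \<le> arcint y"
      using eventually_gt_at_top[of 0] by (eventually_elim, use b in blast)+
  qed
qed

text \<open>The difference of the two sides has derivative 0 because arctan t + arctan(1/t) = pi/2,
  and it vanishes at y = 1. This logarithm is the source of the square root in the inversion
  formula.\<close>

lemma arcint_reflect:
  assumes y: "y > 0" shows "arcint y - arcint (1 / y) = pi / 2 * ln y"
proof -
  define D where "D = (\<lambda>y. arcint y - arcint (1 / y) - pi / 2 * ln y)"
  have d: "(D has_real_derivative 0) (at t within {0<..})" if t: "t \<in> {0<..}" for t
  proof -
    have t0: "t > 0" using t by simp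
    have "((\<lambda>t. arcint (1 / t)) has_real_derivative arc (1 / t) * (- 1 / t\<^sup>2)) (at t)"
    proof (rule DERIV_chain2[OF arcint_deriv])
      show "((\<lambda>t. 1 / t) has_real_derivative - 1 / t\<^sup>2) (at t)"
        using t0 by (auto intro!: derivative_eq_intros simp: power2_eq_square)
    qed (use t0 in simp)
    then have "(D has_real_derivative arc t - arc (1 / t) * (- 1 / t\<^sup>2) - pi / 2 * (1 / t)) (at t)"
      unfolding D_def by (rule DERIV_diff[OF DERIV_diff[OF arcint_deriv[OF t0]] DERIV_cmult[OF DERIV_ln_divide[OF t0]]])
    moreover have "arc t - arc (1 / t) * (- 1 / t\<^sup>2) - pi / 2 * (1 / t) = 0"
    proof -
      have "arctan (inverse t) = pi / 2 - arctan t" using arctan_inverse[of t] t0 by simp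
      then have "arctan (1 / t) = pi / 2 - arctan t" by (simp only: inverse_eq_divide)
      then have "arc (1 / t) * (- 1 / t\<^sup>2) = (arctan t - pi / 2) / t"
        using t0 by (simp add: arc_def power2_eq_square diff_divide_distrib)
      moreover have "arc t = arctan t / t" using t0 by (simp add: arc_def)
      ultimately show ?thesis by (simp add: diff_divide_distrib)
    qed
    ultimately have "(D has_real_derivative 0) (at t)" by (simp only:)
    then show ?thesis by (rule has_field_derivative_at_within)
  qed
  have "\<exists>c. \<forall>t\<in>{0<..}. D t = c"
  proof (rule has_field_derivative_zero_constant)
    show "convex {(0::real)<..}" by simp
  qed (rule d)
  then obtain c where "\<And>t. t > 0 \<Longrightarrow> D t = c" by auto
  then have "D y = D 1" using y by simp
  then show ?thesis by (simp add: D_def)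
qed

subsection \<open>The inversion formula for the reciprocal of the eta function\<close>

text \<open>The logarithm of \<open>pgf\<close> at exp(-2 pi y), the nome of the point \<tau> = \<i>
  y on the imaginary axis.\<close>

definition logp :: "real \<Rightarrow> real" where
  "logp y = suminf (\<lambda>k. 1 / (real (Suc k) * (exp (2 * pi * y * real (Suc k)) - 1)))"

lemma pgf_real:
  assumes y: "y > 0"
  shows "summable (\<lambda>k. 1 / (real (Suc k) * (exp (2 * pi * y * real (Suc k)) - 1)))"
    "pgf (of_real (exp (- (2 * pi * y)))) = of_real (exp (logp y))"
proof -
  define r where "r = exp (- (2 * pi * y))"
  have r: "norm (of_real r :: complex) < 1" using y by (simp add: r_def)
  let ?t = "\<lambda>k. 1 / (real (Suc k) * (exp (2 * pi * y * real (Suc k)) - 1))"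
  have t: "of_real r ^ Suc k / (of_nat (Suc k) * (1 - of_real r ^ Suc k)) = (of_real (?t k) :: complex)" for k
  proof -
    define E where "E = exp (2 * pi * y * real (Suc k))"
    have E: "E > 1" using y by (simp add: E_def)
    have "r ^ Suc k = exp (- (2 * pi * y * real (Suc k)))"
      unfolding r_def exp_of_nat_mult [symmetric] by (simp add: algebra_simps)
    then have rE: "r ^ Suc k = 1 / E" by (simp add: E_def exp_minus inverse_eq_divide)
    have "r ^ Suc k / (real (Suc k) * (1 - r ^ Suc k)) = 1 / (real (Suc k) * (E - 1))"
    proof -
      have "E * (1 - 1 / E) = E - 1" using E by (simp add: right_diff_distrib)
      moreover have "(1 / E) / (c * (1 - 1 / E)) = 1 / (c * (E * (1 - 1 / E)))" for c
        by (simp add: mult.assoc mult.left_commute)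
      ultimately show ?thesis unfolding rE by (simp only:)
    qed
    then have "of_real (r ^ Suc k / (real (Suc k) * (1 - r ^ Suc k))) = (of_real (?t k) :: complex)" by (simp only: E_def)
    then show ?thesis by (simp only: of_real_divide of_real_mult of_real_diff of_real_power of_real_of_nat_eq of_real_1)
  qed
  have s: "summable (\<lambda>k. of_real (?t k) :: complex)" using pgf_eq_exp(1)[OF r] by (simp only: t)
  then show s': "summable ?t" by (simp only: summable_of_real_iff)
  have "pgf (of_real r) = exp (suminf (\<lambda>k. of_real (?t k)))" using pgf_eq_exp(2)[OF r] by (simp only: t)
  also have "suminf (\<lambda>k. of_real (?t k) :: complex) = of_real (logp y)"
    unfolding logp_def by (rule suminf_of_real [OF s', symmetric])
  finally show "pgf (of_real (exp (- (2 * pi * y)))) = of_real (exp (logp y))" by (simp add: r_def exp_of_real)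
qed

text \<open>The region k < K <= n keeps a nonzero share in the limit. Its bounds are Riemann sums
  with meshes y / K and y / (K+1), the latter lacking its last term arctan y / (K+1).\<close>

lemma tail_LIMSEQ:
  assumes y: "y > 0"
  shows "(\<lambda>K. \<Sum>k<K. suminf (\<lambda>n. latt y k (n + K))) \<longlonglongrightarrow> arcint y / pi"
proof (rule tendsto_sandwich[where f = "\<lambda>K. (riem y (Suc K) - arctan y / real (Suc K)) / pi" and h = "\<lambda>K. riem y K / pi"])
  have R: "riem y \<longlonglongrightarrow> arcint y" by (rule riem_LIMSEQ[OF y])
  show "(\<lambda>K. riem y K / pi) \<longlonglongrightarrow> arcint y / pi" by (intro tendsto_divide R tendsto_const) simp
  have Z: "(\<lambda>K. arctan y / real (Suc K)) \<longlonglongrightarrow> 0" by (rule LIMSEQ_Suc[OF lim_const_over_n])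
  have "(\<lambda>K. (riem y (Suc K) - arctan y / real (Suc K)) / pi) \<longlonglongrightarrow> (arcint y - 0) / pi"
    by (rule tendsto_divide[OF tendsto_diff[OF LIMSEQ_Suc[OF R] Z] tendsto_const pi_neq_zero])
  then show "(\<lambda>K. (riem y (Suc K) - arctan y / real (Suc K)) / pi) \<longlonglongrightarrow> arcint y / pi" by simp
  show "\<forall>\<^sub>F K in sequentially. (\<Sum>k<K. suminf (\<lambda>n. latt y k (n + K))) \<le> riem y K / pi"
    using eventually_gt_at_top[of 0]
  proof eventually_elim
    case (elim K)
    have "(\<Sum>k<K. suminf (\<lambda>n. latt y k (n + K))) \<le> (\<Sum>k<K. arctan (real (Suc k) * y / real K) / (pi * real (Suc k)))"
      by (intro sum_mono latt_tail_bounds(1)[OF y elim])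
    also have "\<dots> = riem y K / pi" unfolding riem_def sum_divide_distrib by (intro sum.cong refl) (simp add: mult.commute)
    finally show ?case .
  qed
  show "\<forall>\<^sub>F K in sequentially. (riem y (Suc K) - arctan y / real (Suc K)) / pi \<le> (\<Sum>k<K. suminf (\<lambda>n. latt y k (n + K)))"
    using eventually_gt_at_top[of 0]
  proof eventually_elim
    case (elim K)
    have "real (Suc K) * y / real (Suc K) = y" by simp
    then have "riem y (Suc K) - arctan y / real (Suc K) = (\<Sum>k<K. arctan (real (Suc k) * y / real (Suc K)) / real (Suc k))"
      unfolding riem_def by (simp only: sum.lessThan_Suc add_diff_cancel_right')
    then have "(riem y (Suc K) - arctan y / real (Suc K)) / pi = (\<Sum>k<K. arctan (real (Suc k) * y / real (Suc K)) / (pi * real (Suc k)))"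
      by (simp only: sum_divide_distrib divide_divide_eq_left mult.commute)
    also have "\<dots> \<le> (\<Sum>k<K. suminf (\<lambda>n. latt y k (n + K)))"
      by (intro sum_mono latt_tail_bounds(2)[OF y elim])
    finally show ?case .
  qed
qed

text \<open>Both double sums are cut at the square k, n < K. The squares agree after exchanging k
  and n, the harmonic corrections do not depend on y, and the inverse squares produce the terms with
  pi/12; only the difference of the tails is left.\<close>

lemma logp_reflect:
  assumes y: "y > 0"
  shows "(logp y - pi / (12 * y)) - (logp (1 / y) - pi * y / 12) = ln y / 2"
proof -
  \<comment> \<open>Row sums decay only like 1/(2 (k+1)); subtracting this makes them summable over
    k.\<close>
  define A where "A = (\<lambda>y K. \<Sum>k<K. suminf (latt y k) - 1 / (2 * real (Suc k)))"
  define U where "U = (\<lambda>y K. \<Sum>k<K. suminf (\<lambda>n. latt y k (n + K)))"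
  have Alim: "A y \<longlonglongrightarrow> logp y - pi / (12 * y)" if y: "y > 0" for y
  proof -
    have "(\<lambda>k. 1 / (real k + 1)\<^sup>2) sums (pi\<^sup>2 / 6)"
      using inverse_squares_sums by (simp add: add.commute)
    then have "(\<lambda>k. 1 / (2 * pi * y) * (1 / (real k + 1)\<^sup>2)) sums (1 / (2 * pi * y) * (pi\<^sup>2 / 6))"
      by (rule sums_mult)
    from sums_diff[OF summable_sums[OF pgf_real(1)[OF y]] this]
    have "(\<lambda>k. 1 / (real (Suc k) * (exp (2 * pi * y * real (Suc k)) - 1)) - 1 / (2 * pi * y) * (1 / (real k + 1)\<^sup>2)) sums
        (logp y - 1 / (2 * pi * y) * (pi\<^sup>2 / 6))" by (simp only: logp_def)
    moreover have "1 / (real (Suc k) * (exp (2 * pi * y * real (Suc k)) - 1)) - 1 / (2 * pi * y) * (1 / (real k + 1)\<^sup>2) =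
        suminf (latt y k) - 1 / (2 * real (Suc k))" for k
      unfolding sums_unique[OF latt_row_sums[OF y], symmetric] by (simp add: add.commute)
    moreover have "1 / (2 * pi * y) * (pi\<^sup>2 / 6) = pi / (12 * y)"
      using y by (simp add: field_simps power2_eq_square)
    ultimately show ?thesis unfolding A_def by (simp only: sums_def)
  qed
  have split: "suminf (latt y k) = suminf (\<lambda>n. latt y k (n + K)) + (\<Sum>n<K. latt y k n)" if "y > 0" for y k K
    by (rule suminf_split_initial_segment[OF sums_summable[OF latt_row_sums[OF that]]])
  have AU: "A y K - A (1 / y) K = U y K - U (1 / y) K" for K
  proof -
    have "(\<Sum>k<K. \<Sum>n<K. latt y k n) = (\<Sum>n<K. \<Sum>k<K. latt (1 / y) n k)"
      by (subst sum.swap) (simp only: latt_swap[OF y])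
    moreover have "1 / y > 0" using y by simp
    ultimately show ?thesis
      unfolding A_def U_def sum_subtractf using y by (simp only: split[of _ _ K] sum.distrib)
  qed
  have y1: "1 / y > 0" using y by simp
  have "(\<lambda>K. A y K - A (1 / y) K) \<longlonglongrightarrow> (logp y - pi / (12 * y)) - (logp (1 / y) - pi / (12 * (1 / y)))"
    by (intro tendsto_diff Alim y y1)
  moreover have "(\<lambda>K. A y K - A (1 / y) K) \<longlonglongrightarrow> arcint y / pi - arcint (1 / y) / pi"
    unfolding AU unfolding U_def by (intro tendsto_diff tail_LIMSEQ y y1)
  ultimately have "(logp y - pi / (12 * y)) - (logp (1 / y) - pi / (12 * (1 / y))) = arcint y / pi - arcint (1 / y) / pi"
    by (rule LIMSEQ_unique)
  also have "\<dots> = ln y / 2" using arcint_reflect[OF y] by (simp flip: diff_divide_distrib)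
  finally show ?thesis by simp
qed

text \<open>The reciprocal of Dedekind's eta function. In terms of the reciprocal all characters are
  polynomial expressions in its values, up to powers of q.\<close>

definition einv :: "complex \<Rightarrow> complex" where
  "einv \<tau> = exp (- (2 * of_real pi * \<i> * \<tau> / 24)) * pgf (exp (2 * of_real pi * \<i> * \<tau>))"

lemma einv_imaginary:
  assumes y: "y > 0"
  shows "einv (\<i> * of_real y) = of_real (exp (pi * y / 12 + logp y))"
proof -
  have "2 * of_real pi * \<i> * (\<i> * of_real y) = (of_real (- (2 * pi * y)) :: complex)" by simp
  then have "einv (\<i> * of_real y) = exp (- (of_real (- (2 * pi * y)) / 24)) * pgf (exp (of_real (- (2 * pi * y))))"
    by (simp only: einv_def)
  also have "exp (of_real (- (2 * pi * y)) :: complex) = of_real (exp (- (2 * pi * y)))" by (rule exp_of_real)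
  also have "- (of_real (- (2 * pi * y)) / 24) = (of_real (pi * y / 12) :: complex)" by simp
  finally show ?thesis by (simp only: pgf_real(2)[OF y] exp_of_real exp_add of_real_mult)
qed

lemma einv_holomorphic: "einv holomorphic_on {\<tau>. Im \<tau> > 0}"
proof -
  have "(pgf \<circ> (\<lambda>\<tau>. exp (2 * of_real pi * \<i> * \<tau>))) holomorphic_on {\<tau>. Im \<tau> > 0}"
  proof (rule holomorphic_on_compose_gen[OF _ pgf_holomorphic])
    show "(\<lambda>\<tau>. exp (2 * of_real pi * \<i> * \<tau>)) ` {\<tau>. Im \<tau> > 0} \<subseteq> ball 0 1" by auto
    show "(\<lambda>\<tau>. exp (2 * of_real pi * \<i> * \<tau>)) holomorphic_on {\<tau>. Im \<tau> > 0}" by (intro holomorphic_intros)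
  qed
  then show ?thesis unfolding einv_def o_def by (intro holomorphic_intros) auto
qed

lemma Im_neg_inverse: "Im \<tau> > 0 \<Longrightarrow> Im (- 1 / \<tau>) > 0"
  by (cases "\<tau> = 0") (auto simp: Im_divide divide_simps sum_power2_gt_zero_iff complex_eq_iff power2_eq_square[symmetric])

text \<open>Both sides are holomorphic on the upper half-plane and agree on the imaginary axis by
  \<open>logp_reflect\<close>; the axis accumulates at \<i>. The principal root is holomorphic
  because -\<i> \<tau> has positive real part.\<close>

theorem einv_inversion:
  assumes \<tau>: "Im \<tau> > 0"
  shows "einv (- 1 / \<tau>) * csqrt (- \<i> * \<tau>) = einv \<tau>"
proof -
  let ?H = "{\<tau>. Im \<tau> > 0}"
  have "(\<lambda>\<tau>. einv (- 1 / \<tau>) * csqrt (- \<i> * \<tau>) - einv \<tau>) \<tau> = 0"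
  proof (rule analytic_continuation[where f = "\<lambda>\<tau>. einv (- 1 / \<tau>) * csqrt (- \<i> * \<tau>) - einv \<tau>" and w = \<tau> and S = ?H and U = "(\<lambda>y. \<i> * of_real y) ` {0<..}" and \<xi> = \<i>])
    have "(einv \<circ> (\<lambda>\<tau>. - 1 / \<tau>)) holomorphic_on ?H"
    proof (rule holomorphic_on_compose_gen[OF _ einv_holomorphic])
      show "(\<lambda>\<tau>. - 1 / \<tau>) ` ?H \<subseteq> ?H" using Im_neg_inverse by blast
      show "(\<lambda>\<tau>. - 1 / \<tau>) holomorphic_on ?H" by (intro holomorphic_intros) auto
    qed
    moreover have "- \<i> * \<tau> \<notin> \<real>\<^sub>\<le>\<^sub>0" if "Im \<tau> > 0" for \<tau>
      using that by (auto simp: complex_nonpos_Reals_iff)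
    ultimately show "(\<lambda>\<tau>. einv (- 1 / \<tau>) * csqrt (- \<i> * \<tau>) - einv \<tau>) holomorphic_on ?H"
      unfolding o_def by (intro holomorphic_intros einv_holomorphic) auto
    show "open ?H" by (rule open_halfspace_Im_gt)
    show "connected ?H" by (rule convex_connected[OF convex_halfspace_Im_gt])
    show "(\<lambda>y. \<i> * of_real y) ` {0<..} \<subseteq> ?H" by auto
    show "\<i> \<in> ?H" "\<tau> \<in> ?H" using \<tau> by auto
    show "\<i> islimpt (\<lambda>y. \<i> * of_real y) ` {0<..}"
      unfolding islimpt_approachable
    proof (intro allI impI)
      fix e :: real assume e: "e > 0"
      show "\<exists>x'\<in>(\<lambda>y. \<i> * of_real y) ` {0<..}. x' \<noteq> \<i> \<and> dist x' \<i> < e"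
      proof (rule bexI[of _ "\<i> * of_real (1 + e / 2)"])
        have eq: "\<i> * of_real (1 + e / 2) - \<i> = \<i> * of_real (e / 2)" by (simp add: algebra_simps)
        have "dist (\<i> * of_real (1 + e / 2)) \<i> = norm (\<i> * of_real (e / 2) :: complex)"
          by (simp only: dist_norm eq)
        also have "\<dots> = e / 2" using e by (simp add: norm_mult)
        finally have "dist (\<i> * of_real (1 + e / 2)) \<i> = e / 2" .
        then show "\<i> * of_real (1 + e / 2) \<noteq> \<i> \<and> dist (\<i> * of_real (1 + e / 2)) \<i> < e"
          using e dist_nz by fastforce
      qed (rule imageI, use e in simp)
    qed
    fix z assume "z \<in> (\<lambda>y. \<i> * of_real y) ` {0<..}"
    then obtain y where z: "z = \<i> * of_real y" and y: "y > 0" by auto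
    have y1: "1 / y > 0" using y by simp
    have "- 1 / z = \<i> * of_real (1 / y)" using y by (simp add: z field_simps)
    moreover have "csqrt (- \<i> * z) = of_real (exp (ln y / 2))"
    proof -
      have "- \<i> * z = of_real y" by (simp add: z)
      moreover have "sqrt y = exp (ln y / 2)" using y by (simp add: ln_sqrt flip: ln_sqrt)
      ultimately show ?thesis using y by (simp add: csqrt_of_real_nonneg)
    qed
    moreover have "pi * (1 / y) / 12 + logp (1 / y) + ln y / 2 = pi * y / 12 + logp y"
      using logp_reflect[OF y] by simp
    ultimately show "einv (- 1 / z) * csqrt (- \<i> * z) - einv z = 0"
      by (simp only: einv_imaginary[OF y1] einv_imaginary[OF y] z of_real_mult [symmetric] exp_add [symmetric] diff_self)
  qed
  then show ?thesis by simp
qed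

subsection \<open>Laplace transforms\<close>

text \<open>The indicator makes shifted copies vanish to the left of the shift, which keeps the
  later superpositions locally finite.\<close>

definition kern :: "real \<Rightarrow> real \<Rightarrow> real" where
  "kern p t = indicator {0..} t * t powr (p - 1)"

lemma kern_measurable [measurable]: "kern p \<in> borel_measurable borel"
  unfolding kern_def by measurable

lemma kern_nonneg: "kern p t \<ge> 0"
  by (simp add: kern_def indicator_def)

text \<open>Euler's integral for Gamma under the substitution t -> a t. Computing with nonnegative
  integrals yields integrability together with the value.\<close>

lemma laplace_real:
  assumes p: "p > 0" and a: "a > 0"
  shows "integrable lborel (\<lambda>t. kern p t * exp (- (a * t)))"
    "(LINT t|lborel. kern p t * exp (- (a * t))) = Gamma p * a powr (- p)"
proof -
  let ?f = "\<lambda>t. kern p t * exp (- (a * t))"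
  have "ennreal (Gamma p) = (\<integral>\<^sup>+t. ennreal (indicator {0..} t * t powr (p - 1) / exp t) \<partial>lborel)"
    by (rule Gamma_conv_nn_integral_real[OF p])
  also have "\<dots> = (\<integral>\<^sup>+t. ennreal (kern p t * exp (- t)) \<partial>lborel)"
    by (intro nn_integral_cong) (simp add: kern_def exp_minus divide_inverse)
  also have "\<dots> = ennreal \<bar>a\<bar> * (\<integral>\<^sup>+x. ennreal (kern p (0 + a * x) * exp (- (0 + a * x))) \<partial>lborel)"
    by (rule nn_integral_real_affine) (use a in auto)
  also have "(\<integral>\<^sup>+x. ennreal (kern p (0 + a * x) * exp (- (0 + a * x))) \<partial>lborel) = (\<integral>\<^sup>+x. ennreal (a powr (p - 1)) * ennreal (?f x) \<partial>lborel)"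
  proof (intro nn_integral_cong)
    fix x
    have "kern p (a * x) = a powr (p - 1) * kern p x"
      using a by (auto simp: kern_def indicator_def powr_mult zero_le_mult_iff)
    then show "ennreal (kern p (0 + a * x) * exp (- (0 + a * x))) = ennreal (a powr (p - 1)) * ennreal (?f x)"
      by (simp add: ennreal_mult' [symmetric] mult.assoc)
  qed
  also have "\<dots> = ennreal (a powr (p - 1)) * (\<integral>\<^sup>+x. ennreal (?f x) \<partial>lborel)"
    by (rule nn_integral_cmult) measurable
  finally have "ennreal (Gamma p) = ennreal (a powr p) * (\<integral>\<^sup>+x. ennreal (?f x) \<partial>lborel)"
    using a by (simp add: mult.assoc [symmetric] ennreal_mult' [symmetric] powr_diff)
  then have "ennreal (a powr (- p)) * ennreal (Gamma p) = (ennreal (a powr (- p)) * ennreal (a powr p)) * (\<integral>\<^sup>+x. ennreal (?f x) \<partial>lborel)"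
    by (simp add: mult.assoc)
  also have "ennreal (a powr (- p)) * ennreal (a powr p) = 1"
    using a by (simp add: ennreal_mult' [symmetric] powr_add [symmetric])
  finally have "ennreal (a powr (- p)) * ennreal (Gamma p) = (\<integral>\<^sup>+x. ennreal (?f x) \<partial>lborel)"
    by (simp only: mult_1)
  moreover have "ennreal (Gamma p * a powr (- p)) = ennreal (a powr (- p)) * ennreal (Gamma p)"
    unfolding mult.commute[of "Gamma p"] using Gamma_real_pos[OF p] by (intro ennreal_mult) auto
  ultimately have nn: "(\<integral>\<^sup>+x. ennreal (?f x) \<partial>lborel) = ennreal (Gamma p * a powr (- p))"
    by (simp only:)
  have "has_bochner_integral lborel ?f (Gamma p * a powr (- p))"
  proof (rule has_bochner_integral_nn_integral[OF _ _ _ nn])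
    show "?f \<in> borel_measurable lborel" by measurable
    show "AE t in lborel. 0 \<le> ?f t" using kern_nonneg by simp
    show "0 \<le> Gamma p * a powr (- p)" using Gamma_real_pos[OF p] by simp
  qed
  then show "integrable lborel ?f" "(LINT t|lborel. ?f t) = Gamma p * a powr (- p)"
    by (auto simp: has_bochner_integral_iff)
qed

text \<open>Lets each term of an expanded exponential count as a kernel with larger parameter. At t
  = 0 both sides are 0, because 0 \<open>powr\<close> x is 0.\<close>

lemma kern_power: "kern p t * t ^ n = kern (p + real n) t" if "p > 0"
proof (cases "t > 0")
  case True
  then show ?thesis by (simp add: kern_def powr_add powr_realpow [symmetric] powr_diff)
next
  case False
  then show ?thesis by (cases "t = 0") (auto simp: kern_def)
qed

text \<open>Expanding \<open>exp (- s t)\<close> around a large real exponent \<open>a\<close> reduces the complex case to the binomial series.\<close>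

lemma laplace_complex:
  assumes p: "p > 0" and s: "Re s > 0"
  shows "integrable lborel (\<lambda>t. of_real (kern p t) * exp (- (s * of_real t)))"
    "(LINT t|lborel. of_real (kern p t) * exp (- (s * of_real t))) = of_real (Gamma p) * s powr (- of_real p)"
proof -
  \<comment> \<open>From |a - s|^2 = a^2 - 2 a Re s + |s|^2 it follows that |a - s| < a for every a
    > |s|^2 / (2 Re s).\<close>
  define a where "a = (norm s)\<^sup>2 / (2 * Re s) + 1"
  have a: "a > 0" using s by (simp add: a_def add_nonneg_pos)
  have lt: "norm (a - s) < a"
  proof (rule power2_less_imp_less)
    have "(norm (a - s))\<^sup>2 = a\<^sup>2 - 2 * a * Re s + (norm s)\<^sup>2"
      unfolding cmod_power2 by (simp add: power2_eq_square algebra_simps)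
    moreover have "2 * a * Re s = (norm s)\<^sup>2 + 2 * Re s" using s by (simp add: a_def field_simps)
    ultimately show "(norm (a - s))\<^sup>2 < a\<^sup>2" using s by simp
  qed (use a in simp)
  define c where "c = (\<lambda>n. (a - s) ^ n / fact n)"
  define F where "F = (\<lambda>n t. c n * of_real (kern (p + real n) t * exp (- (a * t))))"
  have pn: "p + real n > 0" for n using p by simp
  have Fi: "integrable lborel (F n)" for n
    unfolding F_def by (intro integrable_mult_right integrable_of_real laplace_real(1) pn a)
  have FI: "(LINT t|lborel. F n t) = c n * of_real (Gamma (p + real n) * a powr (- (p + real n)))" for n
    unfolding F_def by (simp add: laplace_real(2)[OF pn a] del: of_real_mult)
  have FN: "(LINT t|lborel. norm (F n t)) = norm (c n) * (Gamma (p + real n) * a powr (- (p + real n)))" for n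
  proof -
    have "norm (F n t) = norm (c n) * (kern (p + real n) t * exp (- (a * t)))" for t
      using kern_nonneg[of "p + real n" t] by (simp add: F_def norm_mult)
    then show ?thesis by (simp add: laplace_real(2)[OF pn a])
  qed
  \<comment> \<open>This turns the n-th integral into a term of the binomial series for (1 + (s -
    a)/a)^(-p).\<close>
  have G: "Gamma (p + real n) = Gamma p * pochhammer p n" for n
  proof -
    have "p \<notin> \<int>\<^sub>\<le>\<^sub>0" using p by (auto elim!: nonpos_Ints_cases)
    moreover have "Gamma p \<noteq> 0" using Gamma_real_pos[OF p] by simp
    ultimately show ?thesis using pochhammer_Gamma[of p n] by simp
  qed
  have ap: "a powr (- (p + real n)) = a powr (- p) / a ^ n" for n
    using a by (simp add: powr_minus powr_diff powr_realpow divide_inverse)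
  have bin: "(- of_real p gchoose n) = ((-1) ^ n / fact n * of_real (pochhammer p n) :: complex)" for n
    by (simp add: gbinomial_pochhammer pochhammer_of_real)
  have sgn2: "(-1) ^ n * ((-1) ^ n * x) = x" for n and x :: complex
    unfolding mult.assoc [symmetric] power_mult_distrib [symmetric] by simp
  have tm: "c n * of_real (Gamma (p + real n) * a powr (- (p + real n))) =
      of_real (Gamma p * a powr (- p)) * ((- of_real p gchoose n) * ((s - a) / a) ^ n)" for n
  proof -
    have "((s - a) / a) ^ n = (-1) ^ n * (a - s) ^ n / of_real a ^ n"
      by (simp add: power_divide flip: power_mult_distrib)
    then have "(-1) ^ n / fact n * P * ((s - a) / a) ^ n = (-1) ^ n * ((-1) ^ n * (P * (a - s) ^ n / (fact n * of_real a ^ n)))" for P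
      by simp
    then have "(- of_real p gchoose n) * ((s - a) / a) ^ n = of_real (pochhammer p n) * (a - s) ^ n / (fact n * of_real a ^ n)"
      unfolding bin sgn2 .
    then show ?thesis unfolding G ap c_def by simp
  qed
  have z: "norm ((s - a) / a) < 1" using lt a by (simp add: norm_divide norm_minus_commute)
  \<comment> \<open>The integrals of the norms form the same binomial series at the point -|a -
    s|/a, where all its terms are nonnegative; so its convergence is again given by
    \<open>gen_binomial_complex\<close>.\<close>
  have summ: "summable (\<lambda>n. LINT t|lborel. norm (F n t))"
  proof -
    define r where "r = norm (a - s) / a"
    have r: "0 \<le> r" "r < 1" using lt a by (auto simp: r_def)
    have "summable (\<lambda>n. (- of_real p gchoose n) * (- of_real r :: complex) ^ n)"
      by (rule sums_summable[OF gen_binomial_complex]) (use r in simp)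
    moreover have "(- of_real p gchoose n) * (- of_real r :: complex) ^ n = of_real (pochhammer p n / fact n * r ^ n)" for n
    proof -
      have "(-1) ^ n / fact n * P * ((-1) ^ n * R) = (-1) ^ n * ((-1) ^ n * (P / fact n * R))" for P R :: complex
        by (simp only: divide_inverse mult_ac)
      then show ?thesis unfolding bin power_minus[of "of_real r"] sgn2 by simp
    qed
    ultimately have "summable (\<lambda>n. of_real (pochhammer p n / fact n * r ^ n) :: complex)" by (simp only:)
    then have "summable (\<lambda>n. pochhammer p n / fact n * r ^ n)" by (simp only: summable_of_real_iff)
    then have "summable (\<lambda>n. (Gamma p * a powr (- p)) * (pochhammer p n / fact n * r ^ n))" by (rule summable_mult)
    moreover have "(Gamma p * a powr (- p)) * (pochhammer p n / fact n * r ^ n) = norm (c n) * (Gamma (p + real n) * a powr (- (p + real n)))" for n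
      unfolding G ap by (simp add: c_def r_def norm_divide norm_power power_divide)
    ultimately show ?thesis unfolding FN by (simp only:)
  qed
  have ptw: "(\<lambda>n. F n t) sums (of_real (kern p t) * exp (- (s * of_real t)))" for t
  proof -
    have "(\<lambda>n. ((a - s) * t) ^ n /\<^sub>R fact n) sums exp ((a - s) * t)" by (rule exp_converges)
    then have "(\<lambda>n. of_real (kern p t * exp (- (a * t))) * (((a - s) * t) ^ n /\<^sub>R fact n)) sums (of_real (kern p t * exp (- (a * t))) * exp ((a - s) * t))"
      by (rule sums_mult)
    moreover have "of_real (kern p t * exp (- (a * t))) * (((a - s) * t) ^ n /\<^sub>R fact n) = F n t" for n
      by (simp add: F_def c_def kern_power[OF p, symmetric] power_mult_distrib scaleR_conv_of_real divide_inverse mult_ac)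
    moreover have "of_real (kern p t * exp (- (a * t))) * exp ((a - s) * t) = of_real (kern p t) * exp (- (s * of_real t))"
    proof -
      have "exp (- (a * t)) * exp ((a - s) * t) = exp (- (s * of_real t))"
        by (simp add: exp_of_real [symmetric] exp_add [symmetric] algebra_simps)
      then show ?thesis by (simp add: mult.assoc)
    qed
    ultimately show ?thesis by (simp only:)
  qed
  have ae: "AE t in lborel. summable (\<lambda>n. norm (F n t))"
  proof (rule AE_I2)
    fix t :: real
    have "summable (\<lambda>n. norm (((a - s) * t) ^ n /\<^sub>R fact n))" by (rule summable_norm_exp)
    then have "summable (\<lambda>n. (kern p t * exp (- (a * t))) * norm (((a - s) * t) ^ n /\<^sub>R fact n))" by (rule summable_mult)
    moreover have "(kern p t * exp (- (a * t))) * norm (((a - s) * t) ^ n /\<^sub>R fact n) = norm (F n t)" for n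
      using kern_nonneg[of p t]
      by (simp add: F_def c_def kern_power[OF p, symmetric] power_mult_distrib norm_mult norm_inverse norm_fact norm_power divide_inverse abs_mult power_abs mult_ac)
    ultimately show "summable (\<lambda>n. norm (F n t))" by (simp only:)
  qed
  have eq: "(\<lambda>t. suminf (\<lambda>n. F n t)) = (\<lambda>t. of_real (kern p t) * exp (- (s * of_real t)))"
    by (rule ext) (rule sums_unique[OF ptw, symmetric])
  show "integrable lborel (\<lambda>t. of_real (kern p t) * exp (- (s * of_real t)))"
    using integrable_suminf[OF Fi ae summ] by (simp only: eq)
  have "(\<lambda>n. LINT t|lborel. F n t) sums (LINT t|lborel. of_real (kern p t) * exp (- (s * of_real t)))"
    using sums_integral[OF Fi ae summ] by (simp only: eq)
  moreover have "(\<lambda>n. LINT t|lborel. F n t) sums (of_real (Gamma p * a powr (- p)) * (1 + (s - a) / a) powr (- of_real p))"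
    unfolding FI tm by (rule sums_mult[OF gen_binomial_complex[OF z]])
  ultimately have "(LINT t|lborel. of_real (kern p t) * exp (- (s * of_real t))) = of_real (Gamma p * a powr (- p)) * (1 + (s - a) / a) powr (- of_real p)"
    by (rule sums_unique2)
  also have "1 + (s - a) / a = s / of_real a" using a by (simp add: field_simps)
  also have "of_real (Gamma p * a powr (- p)) * (s / of_real a) powr (- of_real p) = of_real (Gamma p) * s powr (- of_real p)"
  proof -
    have s0: "s \<noteq> 0" using s by auto
    have nz: "s / of_real a \<noteq> 0" using s0 a by simp
    \<comment> \<open>Division by a positive real leaves the argument unchanged, so no branch jump
      separates the two powers.\<close>
    have ln: "Ln (s / of_real a) = Ln s - of_real (ln a)" by (rule Ln_divide_of_real[OF a s0])
    have "(s / of_real a) powr (- of_real p) = exp (- of_real p * (Ln s - of_real (ln a)))"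
      unfolding powr_def ln using nz by (simp only: if_False)
    moreover have "s powr (- of_real p) = exp (- of_real p * Ln s)"
      unfolding powr_def using s0 by (simp only: if_False)
    moreover have "of_real (a powr (- p)) = (exp (- of_real p * of_real (ln a)) :: complex)"
    proof -
      have "a powr (- p) = exp (- p * ln a)" using a unfolding powr_def by simp
      then show ?thesis by (simp only: exp_of_real [symmetric] of_real_mult of_real_minus)
    qed
    moreover have "exp (- of_real p * of_real (ln a)) * exp (- of_real p * (Ln s - of_real (ln a))) = exp (- of_real p * Ln s)"
      unfolding exp_add [symmetric] by (rule arg_cong[of _ _ exp]) (simp add: algebra_simps)
    ultimately show ?thesis by (simp only: of_real_mult mult.assoc)
  qed
  finally show "(LINT t|lborel. of_real (kern p t) * exp (- (s * of_real t))) = of_real (Gamma p) * s powr (- of_real p)" .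
qed

text \<open>A power series in \<open>exp (2 \<pi> \<i> \<tau> \<delta>)\<close> times a power of \<open>\<tau>\<close> is a Laplace transform: each term
  shifts the kernel, and only finitely many shifted kernels are nonzero at a given point.\<close>

lemma laplace_power_series:
  fixes b :: "nat \<Rightarrow> complex" and f :: "complex \<Rightarrow> complex"
  assumes p: "p > 0" and \<delta>: "\<delta> > 0" and b: "\<And>x. norm x < 1 \<Longrightarrow> (\<lambda>n. b n * x ^ n) sums f x"
  shows "\<exists>S :: real \<Rightarrow> complex. \<forall>\<tau>. Im \<tau> > 0 \<longrightarrow>
    integrable lborel (\<lambda>t. S t * exp (2 * of_real pi * \<i> * \<tau> * of_real t)) \<and>
    (LINT t|lborel. S t * exp (2 * of_real pi * \<i> * \<tau> * of_real t)) =
      of_real (Gamma p) * (- (2 * of_real pi * \<i> * \<tau>)) powr (- of_real p) *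
      (exp (2 * of_real pi * \<i> * \<tau> * of_real T) * f (exp (2 * of_real pi * \<i> * \<tau> * of_real \<delta>)))"
proof -
  define S where "S = (\<lambda>t. suminf (\<lambda>n. b n * of_real (kern p (t - (T + real n * \<delta>)))))"
  show ?thesis
  proof (intro exI[of _ S] allI impI)
    fix \<tau> :: complex assume \<tau>: "Im \<tau> > 0"
    define s where "s = - (2 * of_real pi * \<i> * \<tau>)"
    have s: "Re s > 0" using \<tau> by (simp add: s_def)
    have es: "2 * of_real pi * \<i> * \<tau> * u = - (s * u)" for u by (simp add: s_def)
    define x where "x = exp (- (s * of_real \<delta>))"
    have x: "norm x < 1" using s \<delta> by (simp add: x_def)
    let ?T = "\<lambda>n. T + real n * \<delta>"
    define F where "F = (\<lambda>n t. b n * of_real (kern p (t - ?T n)) * exp (- (s * of_real t)))"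
    let ?k = "\<lambda>t. of_real (kern p t) * exp (- (s * of_real t))"
    \<comment> \<open>Every term is a translate of one fixed integrand, so that all terms share one
      integral and one integral of norms; the translation produces the factor x^n.\<close>
    have F_eq: "F n t = (b n * exp (- (s * of_real (?T n)))) * ?k (- ?T n + 1 * t)" for n t
    proof -
      have "exp (- (s * of_real t)) = exp (- (s * of_real (?T n))) * exp (- (s * of_real (- ?T n + 1 * t)))"
        by (simp add: exp_add [symmetric] algebra_simps)
      moreover have "t - ?T n = - ?T n + 1 * t" by simp
      ultimately show ?thesis unfolding F_def by (simp only: mult_ac)
    qed
    have k: "integrable lborel (\<lambda>t. ?k (- ?T n + 1 * t))" for n
      using lborel_integrable_real_affine[OF laplace_complex(1)[OF p s], of 1 "- ?T n"] by simp
    have kI: "(LINT t|lborel. ?k (- ?T n + 1 * t)) = of_real (Gamma p) * s powr (- of_real p)" for n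
      using lborel_integral_real_affine[of 1 ?k "- ?T n"] laplace_complex(2)[OF p s] by simp
    define N where "N = (LINT t|lborel. norm (?k t))"
    have kN: "(LINT t|lborel. norm (?k (- ?T n + 1 * t))) = N" for n
      using lborel_integral_real_affine[of 1 "\<lambda>t. norm (?k t)" "- ?T n"] by (simp add: N_def)
    have Fi: "integrable lborel (F n)" for n
      unfolding F_eq [abs_def] by (intro integrable_mult_right k)
    have xn: "exp (- (s * of_real (?T n))) = exp (- (s * of_real T)) * x ^ n" for n
      by (simp add: x_def exp_of_nat_mult [symmetric] exp_add [symmetric] algebra_simps)
    have FI: "(LINT t|lborel. F n t) = (of_real (Gamma p) * s powr (- of_real p) * exp (- (s * of_real T))) * (b n * x ^ n)" for n
      unfolding F_eq integral_mult_right_zero kI xn by (simp add: mult_ac)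
    have FN: "(LINT t|lborel. norm (F n t)) = (norm (exp (- (s * of_real T))) * N) * norm (b n * x ^ n)" for n
      unfolding F_eq norm_mult[of "b n * _"] integral_mult_right_zero kN xn by (simp add: norm_mult mult_ac)
    have summ: "summable (\<lambda>n. LINT t|lborel. norm (F n t))"
    proof -
      \<comment> \<open>Convergence at a radius strictly between |x| and 1 gives absolute
        convergence at x.\<close>
      have n: "norm (of_real ((1 + norm x) / 2) :: complex) = (1 + norm x) / 2"
        unfolding norm_of_real by simp
      have "norm (of_real ((1 + norm x) / 2) :: complex) < 1" unfolding n using x by simp
      moreover have "norm x < norm (of_real ((1 + norm x) / 2) :: complex)" unfolding n using x by simp
      ultimately have "norm (of_real ((1 + norm x) / 2) :: complex) < 1 \<and> norm x < norm (of_real ((1 + norm x) / 2) :: complex)"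
        by (rule conjI)
      then have "summable (\<lambda>n. norm (b n * x ^ n))"
        using powser_insidea[OF sums_summable[OF b]] by blast
      then show ?thesis unfolding FN by (rule summable_mult)
    qed
    have fin: "finite {n. kern p (t - ?T n) \<noteq> 0}" for t
    proof (rule finite_subset)
      show "{n. kern p (t - ?T n) \<noteq> 0} \<subseteq> {..nat \<lceil>(t - T) / \<delta>\<rceil>}"
      proof
        fix n assume "n \<in> {n. kern p (t - ?T n) \<noteq> 0}"
        then have "?T n \<le> t" by (auto simp: kern_def indicator_def split: if_splits)
        then have "real n \<le> (t - T) / \<delta>" using \<delta> by (simp add: pos_le_divide_eq algebra_simps)
        then have "real n \<le> real_of_int \<lceil>(t - T) / \<delta>\<rceil>" by (meson le_of_int_ceiling order_trans)
        then show "n \<in> {..nat \<lceil>(t - T) / \<delta>\<rceil>}" by simp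
      qed
    qed simp
    have ae: "AE t in lborel. summable (\<lambda>n. norm (F n t))"
    proof (rule AE_I2)
      show "summable (\<lambda>n. norm (F n t))" for t
        by (rule summable_finite[OF fin[of t]]) (simp add: F_def)
    qed
    have eq: "(\<lambda>t. suminf (\<lambda>n. F n t)) = (\<lambda>t. S t * exp (2 * of_real pi * \<i> * \<tau> * of_real t))"
    proof
      fix t
      have "suminf (\<lambda>n. F n t) = suminf (\<lambda>n. b n * of_real (kern p (t - ?T n))) * exp (- (s * of_real t))"
        unfolding F_def by (rule suminf_mult2 [symmetric], rule summable_finite[OF fin[of t]]) simp
      then show "suminf (\<lambda>n. F n t) = S t * exp (2 * of_real pi * \<i> * \<tau> * of_real t)" by (simp only: S_def es)
    qed
    have "(\<lambda>n. LINT t|lborel. F n t) sums (LINT t|lborel. S t * exp (2 * of_real pi * \<i> * \<tau> * of_real t))"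
      using sums_integral[OF Fi ae summ] by (simp only: eq)
    moreover have "(\<lambda>n. LINT t|lborel. F n t) sums ((of_real (Gamma p) * s powr (- of_real p) * exp (- (s * of_real T))) * f x)"
      unfolding FI by (rule sums_mult[OF b[OF x]])
    ultimately have "(LINT t|lborel. S t * exp (2 * of_real pi * \<i> * \<tau> * of_real t)) = (of_real (Gamma p) * s powr (- of_real p) * exp (- (s * of_real T))) * f x"
      by (rule sums_unique2)
    moreover have "of_real (Gamma p) * (- (2 * of_real pi * \<i> * \<tau>)) powr (- of_real p) *
      (exp (2 * of_real pi * \<i> * \<tau> * of_real T) * f (exp (2 * of_real pi * \<i> * \<tau> * of_real \<delta>))) =
      (of_real (Gamma p) * s powr (- of_real p) * exp (- (s * of_real T))) * f x"
      unfolding es x_def s_def [symmetric] by (rule mult.assoc [symmetric])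
    moreover have "integrable lborel (\<lambda>t. S t * exp (2 * of_real pi * \<i> * \<tau> * of_real t))"
      using integrable_suminf[OF Fi ae summ] unfolding eq .
    ultimately show "integrable lborel (\<lambda>t. S t * exp (2 * of_real pi * \<i> * \<tau> * of_real t)) \<and>
      (LINT t|lborel. S t * exp (2 * of_real pi * \<i> * \<tau> * of_real t)) =
      of_real (Gamma p) * (- (2 * of_real pi * \<i> * \<tau>)) powr (- of_real p) *
      (exp (2 * of_real pi * \<i> * \<tau> * of_real T) * f (exp (2 * of_real pi * \<i> * \<tau> * of_real \<delta>)))"
      by metis
  qed
qed

section \<open>Lebesgue measure on one-dimensional space\<close>

lemma lborel_vec1: "lborel = distr lborel borel (vec :: real \<Rightarrow> real^1)"
proof (rule lborel_eqI)
  have B: "Basis = {axis 1 1 :: real^1}" by (auto simp: Basis_vec_def)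
  fix l u :: "real^1" assume "\<And>b. b \<in> Basis \<Longrightarrow> l \<bullet> b \<le> u \<bullet> b"
  then have lu: "l $ 1 \<le> u $ 1" by (simp add: B inner_axis)
  have [measurable]: "(vec :: real \<Rightarrow> real^1) \<in> borel_measurable borel"
    by (rule borel_measurable_continuous_onI) (auto intro!: continuous_intros simp: vec_def)
  have "vec -` box l u = {l $ 1<..<u $ 1}"
    by (auto simp: mem_box B inner_axis)
  then have "emeasure (distr lborel borel (vec :: real \<Rightarrow> real^1)) (box l u) = ennreal (u $ 1 - l $ 1)"
    using lu by (simp add: emeasure_distr)
  then show "emeasure (distr lborel borel (vec :: real \<Rightarrow> real^1)) (box l u) = (\<Prod>b\<in>Basis. (u - l) \<bullet> b)"
    by (simp add: B inner_axis)
qed simp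

lemma integral_vec1:
  fixes f :: "real \<Rightarrow> complex"
  assumes f: "integrable lborel f"
  shows "integrable lborel (\<lambda>x :: real^1. f (x $ 1))" "(LINT x|lborel. f ((x :: real^1) $ 1)) = (LINT t|lborel. f t)"
proof -
  have [measurable]: "(vec :: real \<Rightarrow> real^1) \<in> borel_measurable borel"
    by (rule borel_measurable_continuous_onI) (auto intro!: continuous_intros simp: vec_def)
  have [measurable]: "(\<lambda>x :: real^1. x $ 1) \<in> borel_measurable borel"
    by (rule borel_measurable_continuous_onI) (auto intro!: continuous_intros)
  have [measurable]: "f \<in> borel_measurable borel" using borel_measurable_integrable[OF f] by simp
  have m: "(\<lambda>x :: real^1. f (x $ 1)) \<in> borel_measurable borel" "vec \<in> measurable lborel (borel :: (real^1) measure)" by measurable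
  show "integrable lborel (\<lambda>x :: real^1. f (x $ 1))"
    unfolding lborel_vec1 using f by (subst integrable_distr_eq[OF m(2,1)]) simp
  show "(LINT x|lborel. f ((x :: real^1) $ 1)) = (LINT t|lborel. f t)"
    unfolding lborel_vec1 by (subst integral_distr[OF m(2,1)]) simp
qed

subsection \<open>Decomposition of the transformed character\<close>

text \<open>The prefactors agree: 3, 2 + 1 and 3 times the exponent 1/24 all give the 1/8 coming
  from central charge 3.\<close>

lemma orbifold_character_einv:
  assumes \<tau>: "Im \<tau> > 0"
  shows "ch H3S3 (adjoint_module H3S3) \<tau> = (einv \<tau> ^ 3 + 3 * (einv (2 * \<tau>) * einv \<tau>) + 2 * einv (3 * \<tau>)) / 6"
proof -
  let ?q = "exp (2 * of_real pi * \<i> * \<tau>)" and ?e = "\<lambda>u. exp (- (2 * of_real pi * \<i> * \<tau> * u))"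
  have 1: "einv \<tau> = ?e (1/24) * pgf ?q" by (simp add: einv_def)
  have 2: "einv (2 * \<tau>) = ?e (2/24) * pgf (?q\<^sup>2)"
    by (simp add: einv_def exp_double [symmetric] mult_ac)
  have q3: "?q ^ 3 = exp (2 * of_real pi * \<i> * (3 * \<tau>))"
    by (simp add: exp_of_nat_mult [symmetric] mult_ac)
  have 3: "einv (3 * \<tau>) = ?e (3/24) * pgf (?q ^ 3)"
    unfolding q3 by (simp add: einv_def mult_ac)
  have e3: "?e (1/24) ^ 3 = ?e (1/8)" "?e (2/24) * ?e (1/24) = ?e (1/8)" "?e (3/24) = ?e (1/8)"
    by (simp_all add: exp_of_nat_mult [symmetric] exp_add [symmetric] algebra_simps)
  have "einv \<tau> ^ 3 = ?e (1/8) * pgf ?q ^ 3" by (simp only: 1 power_mult_distrib e3)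
  moreover have "einv (2 * \<tau>) * einv \<tau> = ?e (1/8) * (pgf (?q\<^sup>2) * pgf ?q)"
  proof -
    have "einv (2 * \<tau>) * einv \<tau> = (?e (2/24) * ?e (1/24)) * (pgf (?q\<^sup>2) * pgf ?q)" unfolding 1 2 by (simp only: mult_ac)
    then show ?thesis by (simp only: e3)
  qed
  moreover have "einv (3 * \<tau>) = ?e (1/8) * pgf (?q ^ 3)" by (simp only: 3 e3)
  moreover have "exp (- 2 * of_real pi * \<i> * \<tau> / 8) = ?e (1/8)" by simp
  ultimately show ?thesis by (simp only: orbifold_character(2)[OF \<tau>]) (simp add: algebra_simps add_divide_distrib)
qed

lemma fock_character_einv:
  assumes \<tau>: "Im \<tau> > 0"
  shows "ch H3S3 (fock_module l) \<tau> = exp (2 * of_real pi * \<i> * \<tau> * L0_shift l) * einv \<tau> ^ 3"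
proof -
  have "exp (2 * of_real pi * \<i> * \<tau> * (L0_shift l - 1/8)) =
      exp (2 * of_real pi * \<i> * \<tau> * L0_shift l) * exp (- (2 * of_real pi * \<i> * \<tau> / 24)) ^ 3"
    by (simp add: exp_of_nat_mult [symmetric] exp_add [symmetric] algebra_simps)
  then show ?thesis by (simp add: fock_character(2)[OF \<tau>] einv_def power_mult_distrib mult.assoc)
qed

lemma csqrt_eq_exp: "w \<noteq> 0 \<Longrightarrow> csqrt w = exp (Ln w / 2)"
  by (simp add: csqrt_exp_Ln)

text \<open>At x = exp(2 pi \<i> \<tau> / m) this is \<eta>(\<tau>)^m / \<eta>(\<tau>/m) up to a
  power of exp(2 pi \<i> \<tau>). It isolates a power series once \<eta>(\<tau>)^(-m) is taken out
  as a factor.\<close>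

definition quot :: "nat \<Rightarrow> complex \<Rightarrow> complex" where
  "quot m x = pgf x / pgf (x ^ m) ^ m"

lemma quot_power_series:
  assumes m: "m > 0"
  shows "\<exists>b. \<forall>x. norm x < 1 \<longrightarrow> (\<lambda>n. b n * x ^ n) sums quot m x"
proof -
  have lt: "norm (x ^ m) < 1" if "norm x < 1" for x :: complex
    using norm_power_less_1[OF that, of "m - 1"] m by simp
  have "(pgf \<circ> (\<lambda>x. x ^ m)) holomorphic_on ball 0 1"
  proof (rule holomorphic_on_compose_gen[OF _ pgf_holomorphic])
    show "(\<lambda>x. x ^ m) holomorphic_on ball 0 1" by (intro holomorphic_intros)
    show "(\<lambda>x. x ^ m) ` ball 0 1 \<subseteq> ball (0 :: complex) 1" using lt by auto
  qed
  then have "quot m holomorphic_on ball 0 1"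
    unfolding quot_def [abs_def] o_def
    by (intro holomorphic_intros pgf_holomorphic) (use lt pgf_nonzero in auto)
  then have "(\<lambda>n. (deriv ^^ n) (quot m) 0 / fact n * (x - 0) ^ n) sums quot m x" if "norm x < 1" for x
    by (rule holomorphic_power_series) (use that in simp)
  then show ?thesis by (intro exI[of _ "\<lambda>n. (deriv ^^ n) (quot m) 0 / fact n"]) simp
qed

lemma einv_quot:
  assumes \<tau>: "Im \<tau> > 0" and m: "m > 0"
  shows "einv (\<tau> / of_nat m) = einv \<tau> ^ m *
    (exp (2 * of_real pi * \<i> * \<tau> * of_real (real m / 24 - 1 / (24 * real m))) * quot m (exp (2 * of_real pi * \<i> * \<tau> * of_real (1 / real m))))"
proof -
  let ?x = "exp (2 * of_real pi * \<i> * \<tau> * of_real (1 / real m))"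
  have mc: "of_nat m \<noteq> (0 :: complex)" using m by simp
  have xm: "?x ^ m = exp (2 * of_real pi * \<i> * \<tau>)"
    unfolding exp_of_nat_mult [symmetric] using mc by (simp add: field_simps)
  have P: "pgf (exp (2 * of_real pi * \<i> * \<tau>)) \<noteq> 0" by (rule pgf_nonzero[OF nome_less_1[OF \<tau>]])
  have a: "exp (- (2 * of_real pi * \<i> * \<tau> / 24)) ^ m * exp (2 * of_real pi * \<i> * \<tau> * of_real (real m / 24 - 1 / (24 * real m))) =
      exp (- (2 * of_real pi * \<i> * (\<tau> / of_nat m) / 24))"
    unfolding exp_of_nat_mult [symmetric] exp_add [symmetric]
    by (rule arg_cong[of _ _ exp]) (use mc in \<open>simp add: field_simps\<close>)
  have x: "exp (2 * of_real pi * \<i> * (\<tau> / of_nat m)) = ?x" by simp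
  have "einv \<tau> ^ m * (exp (2 * of_real pi * \<i> * \<tau> * of_real (real m / 24 - 1 / (24 * real m))) * quot m ?x) =
      (exp (- (2 * of_real pi * \<i> * \<tau> / 24)) ^ m * exp (2 * of_real pi * \<i> * \<tau> * of_real (real m / 24 - 1 / (24 * real m)))) *
      (pgf (exp (2 * of_real pi * \<i> * \<tau>)) ^ m * quot m ?x)"
    by (simp only: einv_def power_mult_distrib mult_ac)
  also have "pgf (exp (2 * of_real pi * \<i> * \<tau>)) ^ m * quot m ?x = pgf ?x"
    unfolding quot_def xm using P by simp
  finally show ?thesis unfolding a by (simp only: einv_def x)
qed

text \<open>Inversion at \<tau>/m, because -1/(\<tau>/m) = m (-1/\<tau>). The square root is written
  through the logarithm of -2 pi \<i> \<tau> in order to match the powers in the Laplace transforms;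
  the ratio 2 pi m of the arguments is a positive real.\<close>

lemma einv_inversion_scaled:
  assumes \<tau>: "Im \<tau> > 0" and m: "m > 0"
  defines "L \<equiv> Ln (- (2 * of_real pi * \<i> * \<tau>))"
  shows "einv (of_nat m * (- 1 / \<tau>)) = einv (\<tau> / of_nat m) * of_real (sqrt (2 * pi * real m)) * exp (- (L / 2))"
proof -
  have m0: "real m > 0" using m by simp
  have \<tau>0: "\<tau> \<noteq> 0" using \<tau> by auto
  have I: "Im (\<tau> / of_nat m) > 0" using \<tau> m0 by (simp add: Im_divide_of_nat)
  define r where "r = 2 * pi * real m"
  have r: "r > 0" using m0 by (simp add: r_def)
  let ?s = "- (2 * of_real pi * \<i> * \<tau>)"
  have s0: "?s \<noteq> 0" using \<tau>0 by simp
  have w: "- \<i> * (\<tau> / of_nat m) = ?s / of_real r"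
    using m by (simp add: r_def field_simps)
  have "csqrt (- \<i> * (\<tau> / of_nat m)) = exp ((L - of_real (ln r)) / 2)"
  proof -
    have ln: "Ln (?s / of_real r) = L - of_real (ln r)" unfolding L_def by (rule Ln_divide_of_real[OF r s0])
    have nz: "?s / of_real r \<noteq> 0" unfolding divide_eq_0_iff using s0 r by auto
    show ?thesis unfolding w csqrt_eq_exp[OF nz] ln ..
  qed
  moreover have "- 1 / (\<tau> / of_nat m) = of_nat m * (- 1 / \<tau>)" by simp
  ultimately have *: "einv (of_nat m * (- 1 / \<tau>)) * exp ((L - of_real (ln r)) / 2) = einv (\<tau> / of_nat m)"
    using einv_inversion[OF I] by simp
  have "sqrt r = exp (ln r / 2)" using r by (simp add: powr_half_sqrt [symmetric] powr_def)
  then have sq: "of_real (sqrt r) = (exp (of_real (ln r) / 2) :: complex)"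
    by (simp only: exp_of_real [symmetric] of_real_divide of_real_numeral)
  have "exp ((L - of_real (ln r)) / 2) * (of_real (sqrt r) * exp (- (L / 2))) = 1"
    unfolding sq exp_add [symmetric] by (simp add: diff_divide_distrib)
  then have "einv (of_nat m * (- 1 / \<tau>)) = einv (\<tau> / of_nat m) * (of_real (sqrt r) * exp (- (L / 2)))"
    unfolding * [symmetric] by (simp add: mult.assoc)
  then show ?thesis by (simp add: r_def mult.assoc)
qed

lemma transformed_character:
  "\<exists>S :: real \<Rightarrow> complex. \<forall>\<tau>. Im \<tau> > 0 \<longrightarrow>
    integrable lborel (\<lambda>t. S t * exp (2 * of_real pi * \<i> * \<tau> * of_real t)) \<and>
    ch H3S3 (adjoint_module H3S3) (- 1 / \<tau>) =
      einv \<tau> ^ 3 * (LINT t|lborel. S t * exp (2 * of_real pi * \<i> * \<tau> * of_real t))"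
proof -
  have one: "(\<lambda>n. (if n = 0 then 1 else 0) * x ^ n) sums 1" for x :: complex
  proof -
    have "(\<lambda>n. (if n = 0 then 1 else 0) * x ^ n) = (\<lambda>n. if n = 0 then 1 else 0)" by auto
    then show ?thesis using sums_single[of 0 "\<lambda>_. 1 :: complex"] by simp
  qed
  obtain b2 where b2: "\<And>x. norm x < 1 \<Longrightarrow> (\<lambda>n. b2 n * x ^ n) sums quot 2 x"
    using quot_power_series[of 2] by auto
  obtain b3 where b3: "\<And>x. norm x < 1 \<Longrightarrow> (\<lambda>n. b3 n * x ^ n) sums quot 3 x"
    using quot_power_series[of 3] by auto
  have pos: "3 / 2 > (0 :: real)" "1 > (0 :: real)" "1 / real 2 > 0" "1 / real 3 > 0" "1 / 2 > (0 :: real)" by simp_all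
  let ?w = "\<lambda>\<tau>. 2 * of_real pi * \<i> * \<tau>"
  let ?I = "\<lambda>S \<tau>. LINT t|lborel. S t * exp (?w \<tau> * of_real t)"
  let ?G = "\<lambda>m \<tau>. exp (?w \<tau> * of_real (real m / 24 - 1 / (24 * real m))) * quot m (exp (?w \<tau> * of_real (1 / real m)))"
  \<comment> \<open>The term of the identity permutation: its power series is the constant 1, so its
    density is a single unshifted kernel.\<close>
  obtain A :: "real \<Rightarrow> complex" where A: "\<And>\<tau>. Im \<tau> > 0 \<Longrightarrow> integrable lborel (\<lambda>t. A t * exp (?w \<tau> * of_real t)) \<and>
      ?I A \<tau> = of_real (Gamma (3/2)) * (- ?w \<tau>) powr (- of_real (3/2)) * (exp (?w \<tau> * of_real 0) * 1)"
    using laplace_power_series[of "3/2" 1 _ "\<lambda>_. 1" 0, OF pos(1) pos(2) one] by blast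
  obtain B :: "real \<Rightarrow> complex" where B: "\<And>\<tau>. Im \<tau> > 0 \<Longrightarrow> integrable lborel (\<lambda>t. B t * exp (?w \<tau> * of_real t)) \<and>
      ?I B \<tau> = of_real (Gamma 1) * (- ?w \<tau>) powr (- of_real 1) * ?G 2 \<tau>"
    using laplace_power_series[of 1 "1 / real 2" b2 "quot 2" "real 2 / 24 - 1 / (24 * real 2)", OF pos(2) pos(3) b2] by blast
  obtain C :: "real \<Rightarrow> complex" where C: "\<And>\<tau>. Im \<tau> > 0 \<Longrightarrow> integrable lborel (\<lambda>t. C t * exp (?w \<tau> * of_real t)) \<and>
      ?I C \<tau> = of_real (Gamma (1/2)) * (- ?w \<tau>) powr (- of_real (1/2)) * ?G 3 \<tau>"
    using laplace_power_series[of "1/2" "1 / real 3" b3 "quot 3" "real 3 / 24 - 1 / (24 * real 3)", OF pos(5) pos(4) b3] by blast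
  let ?r = "\<lambda>m :: nat. of_real (sqrt (2 * pi * real m)) :: complex"
  \<comment> \<open>The constants undo Gamma(p) and combine the roots of 2 pi m from the inversion
    with the Burnside weights 1/6, 3/6 and 2/6.\<close>
  define a where "a = ?r 1 ^ 3 / (6 * of_real (Gamma (3/2)))"
  define b where "b = ?r 2 * ?r 1 / (2 * of_real (Gamma 1))"
  define c where "c = ?r 3 / (3 * of_real (Gamma (1/2)))"
  define S where "S = (\<lambda>t. a * A t + b * B t + c * C t)"
  show ?thesis
  proof (intro exI[of _ S] allI impI)
    fix \<tau> :: complex assume \<tau>: "Im \<tau> > 0"
    let ?e = "\<lambda>t :: real. exp (?w \<tau> * of_real t)"
    define L where "L = Ln (- ?w \<tau>)"
    \<comment> \<open>The principal value of (-2 pi \<i> \<tau>)^(-1/2); the power with exponent -p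
      is then E^(2p) for p = 3/2, 1, 1/2.\<close>
    define E where "E = exp (- (L / 2))"
    have "\<tau> \<noteq> 0" using \<tau> by auto
    then have w0: "- ?w \<tau> \<noteq> 0" by simp
    have pw: "(- ?w \<tau>) powr (- of_real p) = exp (- (of_real p * L))" for p
      unfolding powr_def L_def using w0 by (simp only: if_False mult_minus_left)
    have p3: "(- ?w \<tau>) powr (- of_real (3/2)) = E ^ 3"
      unfolding pw E_def exp_of_nat_mult [symmetric] by (rule arg_cong[of _ _ exp]) simp
    have p2: "(- ?w \<tau>) powr (- of_real 1) = E ^ 2"
      unfolding pw E_def exp_of_nat_mult [symmetric] by (rule arg_cong[of _ _ exp]) simp
    have p1: "(- ?w \<tau>) powr (- of_real (1/2)) = E"
      unfolding pw E_def by (rule arg_cong[of _ _ exp]) simp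
    have cancel: "y / (k * g) * (g * z) = y / k * z" if "g \<noteq> 0" for g k y z :: complex
      using that by simp
    note A' = A[OF \<tau>, unfolded p3] and B' = B[OF \<tau>, unfolded p2] and C' = C[OF \<tau>, unfolded p1]
    note Ai = A'[THEN conjunct1] and Bi = B'[THEN conjunct1] and Ci = C'[THEN conjunct1]
    have Se: "S t * ?e t = a * (A t * ?e t) + b * (B t * ?e t) + c * (C t * ?e t)" for t
      by (simp only: S_def distrib_right mult.assoc)
    have int: "integrable lborel (\<lambda>t. S t * ?e t)"
      unfolding Se by (intro Bochner_Integration.integrable_add integrable_mult_right Ai Bi Ci)
    have "?I S \<tau> = a * ?I A \<tau> + b * ?I B \<tau> + c * ?I C \<tau>"
    proof -
      have "?I S \<tau> = (LINT t|lborel. a * (A t * ?e t) + b * (B t * ?e t) + c * (C t * ?e t))" by (simp only: Se)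
      also have "\<dots> = (LINT t|lborel. a * (A t * ?e t) + b * (B t * ?e t)) + (LINT t|lborel. c * (C t * ?e t))"
        by (intro Bochner_Integration.integral_add Bochner_Integration.integrable_add integrable_mult_right Ai Bi Ci)
      also have "(LINT t|lborel. a * (A t * ?e t) + b * (B t * ?e t)) = (LINT t|lborel. a * (A t * ?e t)) + (LINT t|lborel. b * (B t * ?e t))"
        by (intro Bochner_Integration.integral_add integrable_mult_right Ai Bi)
      finally show ?thesis by (simp only: integral_mult_right_zero)
    qed
    also have "a * ?I A \<tau> = ?r 1 ^ 3 / 6 * E ^ 3"
    proof -
      have nz: "of_real (Gamma (3/2)) \<noteq> (0 :: complex)"
        using less_imp_neq[OF Gamma_real_pos[of "3/2"]] by (simp only: of_real_eq_0_iff) simp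
      have "?I A \<tau> = of_real (Gamma (3/2)) * E ^ 3" using A'[THEN conjunct2] by (simp only: mult_1_right of_real_0 mult_zero_right exp_zero)
      then show ?thesis unfolding a_def by (simp only: cancel[OF nz])
    qed
    also have "b * ?I B \<tau> = ?r 2 * ?r 1 / 2 * (E ^ 2 * ?G 2 \<tau>)"
    proof -
      have "?I B \<tau> = of_real (Gamma 1) * E ^ 2 * ?G 2 \<tau>" by (rule B'[THEN conjunct2])
      then show ?thesis by (simp only: b_def Gamma_1 of_real_1 mult_1 mult_1_right)
    qed
    also have "c * ?I C \<tau> = ?r 3 / 3 * (E * ?G 3 \<tau>)"
    proof -
      have nz: "of_real (Gamma (1/2)) \<noteq> (0 :: complex)"
        using less_imp_neq[OF Gamma_real_pos[of "1/2"]] by (simp only: of_real_eq_0_iff) simp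
      have "?I C \<tau> = of_real (Gamma (1/2)) * (E * ?G 3 \<tau>)" using C'[THEN conjunct2] by (simp only: mult.assoc)
      then show ?thesis unfolding c_def by (simp only: cancel[OF nz])
    qed
    finally have SI: "?I S \<tau> = ?r 1 ^ 3 / 6 * E ^ 3 + ?r 2 * ?r 1 / 2 * (E ^ 2 * ?G 2 \<tau>) + ?r 3 / 3 * (E * ?G 3 \<tau>)" .
    note inv = einv_inversion_scaled[OF \<tau>, folded L_def, folded E_def]
    have e1: "einv (- 1 / \<tau>) = einv \<tau> * ?r 1 * E" using inv[of 1] by (simp only: of_nat_1 div_by_1 mult_1)
    have e2: "einv (2 * (- 1 / \<tau>)) = einv \<tau> ^ 2 * ?G 2 \<tau> * ?r 2 * E"
      using inv[of 2, unfolded einv_quot[OF \<tau>, of 2]] by (simp only: of_nat_numeral zero_less_numeral einv_quot[OF \<tau>, of 2, unfolded of_nat_numeral])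
    have e3: "einv (3 * (- 1 / \<tau>)) = einv \<tau> ^ 3 * ?G 3 \<tau> * ?r 3 * E"
      using inv[of 3] by (simp only: of_nat_numeral zero_less_numeral einv_quot[OF \<tau>, of 3, unfolded of_nat_numeral])
    have alg: "((x * r * E) ^ 3 + 3 * ((x ^ 2 * G * r' * E) * (x * r * E)) + 2 * (x ^ 3 * H * r'' * E)) / 6 =
        x ^ 3 * (r ^ 3 / 6 * E ^ 3 + r' * r / 2 * (E ^ 2 * G) + r'' / 3 * (E * H))" for x r r' r'' G H :: complex
    proof -
      have d: "u / 6 + v / 2 + w / 3 = (u + 3 * v + 2 * w) / 6" for u v w :: complex
        by (simp add: field_simps)
      have "(x * r * E) ^ 3 + 3 * ((x ^ 2 * G * r' * E) * (x * r * E)) + 2 * (x ^ 3 * H * r'' * E) =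
          x ^ 3 * (r ^ 3 * E ^ 3 + 3 * (r' * r * (E ^ 2 * G)) + 2 * (r'' * (E * H)))"
        by algebra
      then show ?thesis by (simp only: times_divide_eq_left d) (simp only: times_divide_eq_right)
    qed
    have "ch H3S3 (adjoint_module H3S3) (- 1 / \<tau>) = einv \<tau> ^ 3 * ?I S \<tau>"
      unfolding orbifold_character_einv[OF Im_neg_inverse[OF \<tau>]] e1 e2 e3 SI by (rule alg)
    then show "integrable lborel (\<lambda>t. S t * ?e t) \<and>
        ch H3S3 (adjoint_module H3S3) (- 1 / \<tau>) = einv \<tau> ^ 3 * ?I S \<tau>"
      using int by blast
  qed
qed

text \<open>With the whole momentum in the first factor and its square equal to 2t, any real t is
  reached as the lowest weight.\<close>

lemma L0_shift_csqrt:
  "L0_shift (\<lambda>i :: 3. if i = 1 then csqrt (2 * of_real t) else 0) = of_real t"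
proof -
  have "(\<lambda>i :: 3. (if i = 1 then csqrt (2 * of_real t) else 0)\<^sup>2 / 2) = (\<lambda>i. if i = 1 then of_real t else 0)"
    by auto
  then show ?thesis unfolding L0_shift_def by (simp only:) simp
qed

section \<open>The transformed character as an integral over Fock modules\<close>

lemma modular_invariance:
  "\<exists>(M1 :: real^1 \<Rightarrow> (3 \<Rightarrow> nat multiset) weight_mod) (S1 :: real^1 \<Rightarrow> complex).
     (\<forall>x. voa_module H3S3 (M1 x)) \<and>
     (\<forall>\<tau>. Im \<tau> > 0 \<longrightarrow>
        (\<forall>x. char_converges H3S3 (M1 x) \<tau>) \<and>
        integrable lborel (\<lambda>x. S1 x * ch H3S3 (M1 x) \<tau>) \<and>
        ch H3S3 (adjoint_module H3S3) (- 1 / \<tau>) = (LINT x|lborel. S1 x * ch H3S3 (M1 x) \<tau>))"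
proof -
  obtain S :: "real \<Rightarrow> complex" where S: "\<And>\<tau>. Im \<tau> > 0 \<Longrightarrow>
      integrable lborel (\<lambda>t. S t * exp (2 * of_real pi * \<i> * \<tau> * of_real t)) \<and>
      ch H3S3 (adjoint_module H3S3) (- 1 / \<tau>) =
        einv \<tau> ^ 3 * (LINT t|lborel. S t * exp (2 * of_real pi * \<i> * \<tau> * of_real t))"
    using transformed_character by blast
  \<comment> \<open>For \<open>x $ 1 < 0\<close> the momentum is imaginary; the lowest weight is \<open>x $ 1\<close> in either case.\<close>
  define M1 :: "real^1 \<Rightarrow> (3 \<Rightarrow> nat multiset) weight_mod" where "M1 = (\<lambda>x :: real^1. fock_module (\<lambda>i. if i = 1 then csqrt (2 * of_real (x $ 1)) else 0))"
  have eq: "S (x $ 1) * ch H3S3 (M1 x) \<tau> = einv \<tau> ^ 3 * (S (x $ 1) * exp (2 * of_real pi * \<i> * \<tau> * of_real (x $ 1)))"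
    if "Im \<tau> > 0" for x :: "real^1" and \<tau>
    unfolding M1_def fock_character_einv[OF that] L0_shift_csqrt by (simp only: mult_ac)
  show ?thesis
  proof (intro exI[of _ M1] exI[of _ "\<lambda>x :: real^1. S (x $ 1)"] conjI allI impI)
    show "voa_module H3S3 (M1 x)" for x unfolding M1_def by (rule fock_voa_module)
    fix \<tau> :: complex assume \<tau>: "Im \<tau> > 0"
    show "char_converges H3S3 (M1 x) \<tau>" for x unfolding M1_def by (rule fock_character(1)[OF \<tau>])
    note I = integral_vec1[OF S[OF \<tau>, THEN conjunct1]]
    show "integrable lborel (\<lambda>x :: real^1. S (x $ 1) * ch H3S3 (M1 x) \<tau>)"
      unfolding eq[OF \<tau>] by (rule integrable_mult_right[OF I(1)])
    show "ch H3S3 (adjoint_module H3S3) (- 1 / \<tau>) = (LINT x|lborel. S ((x :: real^1) $ 1) * ch H3S3 (M1 x) \<tau>)"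
      unfolding eq[OF \<tau>] integral_mult_right_zero I(2) by (rule S[OF \<tau>, THEN conjunct2])
  qed
qed

theorem theorem7p1:
  shows "\<exists>(M1 :: real^1 \<Rightarrow> (3 \<Rightarrow> nat multiset) weight_mod)
          (M2 :: real^2 \<Rightarrow> (3 \<Rightarrow> nat multiset) weight_mod)
          (M3 :: real^3 \<Rightarrow> (3 \<Rightarrow> nat multiset) weight_mod)
          (S1 :: real^1 \<Rightarrow> complex) (S2 :: real^2 \<Rightarrow> complex) (S3 :: real^3 \<Rightarrow> complex).
     (\<forall>x. voa_module H3S3 (M1 x)) \<and>
     (\<forall>x. voa_module H3S3 (M2 x)) \<and>
     (\<forall>x. voa_module H3S3 (M3 x)) \<and>
     (\<forall>\<tau>. Im \<tau> > 0 \<longrightarrow>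
        char_converges H3S3 (adjoint_module H3S3) \<tau> \<and>
        (\<forall>x. char_converges H3S3 (M1 x) \<tau>) \<and>
        (\<forall>x. char_converges H3S3 (M2 x) \<tau>) \<and>
        (\<forall>x. char_converges H3S3 (M3 x) \<tau>) \<and>
        integrable lborel (\<lambda>x. S1 x * ch H3S3 (M1 x) \<tau>) \<and>
        integrable lborel (\<lambda>x. S2 x * ch H3S3 (M2 x) \<tau>) \<and>
        integrable lborel (\<lambda>x. S3 x * ch H3S3 (M3 x) \<tau>) \<and>
        ch H3S3 (adjoint_module H3S3) (- 1 / \<tau>) =
          (LINT x|lborel. S1 x * ch H3S3 (M1 x) \<tau>) +
          (LINT x|lborel. S2 x * ch H3S3 (M2 x) \<tau>) +
          (LINT x|lborel. S3 x * ch H3S3 (M3 x) \<tau>))"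
proof -
  obtain M1 :: "real^1 \<Rightarrow> (3 \<Rightarrow> nat multiset) weight_mod" and S1 :: "real^1 \<Rightarrow> complex" where
    M1: "\<And>x. voa_module H3S3 (M1 x)" and
    S1: "\<And>\<tau>. Im \<tau> > 0 \<Longrightarrow> (\<forall>x. char_converges H3S3 (M1 x) \<tau>) \<and>
        integrable lborel (\<lambda>x. S1 x * ch H3S3 (M1 x) \<tau>) \<and>
        ch H3S3 (adjoint_module H3S3) (- 1 / \<tau>) = (LINT x|lborel. S1 x * ch H3S3 (M1 x) \<tau>)"
    using modular_invariance by blast
  show ?thesis
    by (rule exI[of _ M1], rule exI[of _ "\<lambda>_. zero_module"], rule exI[of _ "\<lambda>_. zero_module"],
      rule exI[of _ S1], rule exI[of _ "\<lambda>_. 0"], rule exI[of _ "\<lambda>_. 0"])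
      (use M1 S1 orbifold_character(1) in \<open>simp add: zero_module del: divide_minus_left\<close>)
qed

end
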